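(* Assume that one-way functions exist. Then for every $\gamma>1$ there exists a rate-1 efficient $\mu$-conditionally secure entropy-preserving pseudorandom generator $G_\gamma:\{0,1\}^n\to\{0,1\}^{n+\gamma\log n}$, where $\mu(n)=1/n^2$.
   Context: A one-way function is a polynomial-time computable $f:\{0,1\}^*\to\{0,1\}^*$ such that every probabilistic polynomial-time algorithm inverts it (outputs some preimage of $f(x)$ for uniform $x\in\{0,1\}^n$) with at most negligible probability. Ensembles $\{A_n\}$, $\{B_n\}$ are $\mu(\cdot)$-indistinguishable if for every probabilistic distinguisher $D$ running in time polynomial in its first input there is $n_0$ with $|\Pr[D(1^n,A_n)=1]-\Pr[D(1^n,B_n)=1]|<\mu(n)$ for all $n\geq n_0$. $\mathcal{U}_n$ is uniform on $\{0,1\}^n$; $H$ is Shannon entropy. An efficiently computable $G:\{0,1\}^n\to\{0,1\}^{n+\gamma\log n}$ is a $\mu$-conditionally secure entropy-preserving pseudorandom generator if there exist events $E_n\subseteq\{0,1\}^n$ and a constant $\alpha$ such that (i) $\{G(\mathcal{U}_n\mid E_n)\}_n$ and $\{\mathcal{U}_{n+\gamma\log n}\}_n$ are $\mu(n)$-indistinguishable, and (ii) for all sufficiently large $n$, $H(G(\mathcal{U}_n\mid E_n))\geq n-\alpha\log n$. $G$ is rate-1 efficient if its running time on inputs of length $n$ is at most $n+O(n^{\varepsilon})$ for some constant $\varepsilon<1$.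
   Formalization: Claimed for those γ>1 for which some rate-1 efficient map, with no security asked, sends n bits to n+⌊γ log n⌋ bits; this is necessary for the conclusion, and it fails for uncomputable γ. The inverter is also given 1^n. *)

theory Defs
  imports "HOL-Probability.Probability" "HOL-Computational_Algebra.Polynomial"
begin

section \<open>Probabilistic multi-tape Turing machines\<close>

text \<open>
  Machines have a fixed number of tapes, infinite in both directions, whose cells hold a bit or
  the blank \<open>None\<close>. A larger alphabet adds nothing, not even a constant factor in running time,
  since one of its tapes can be replaced by several tapes with synchronous heads.
  Tape 0 initially carries the input and tape 1 finally carries the output. A fresh uniform coin is
  supplied as the first argument of the transition function in every step.
\<close>

datatype move = MoveLeft | Stay | MoveRight

type_synonym symbol = "bool option"
type_synonym tape = "(int \<Rightarrow> symbol) \<times> int"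
type_synonym config = "nat \<times> tape list"

record machine =
  num_tapes :: nat
  num_states :: nat
  transition :: "bool \<Rightarrow> nat \<Rightarrow> symbol list \<Rightarrow> nat \<times> (symbol \<times> move) list"

definition start_state :: nat where "start_state = 0"

definition halt_state :: nat where "halt_state = 1"

text \<open>Only the finitely many values of the transition function on the states below
  \<open>num_states\<close> and on symbol lists of length \<open>num_tapes\<close> matter.\<close>

definition turing_machine :: "machine \<Rightarrow> bool" where
  "turing_machine M \<longleftrightarrow>
     num_tapes M \<ge> 2 \<and> start_state < num_states M \<and> halt_state < num_states M \<and>
     (\<forall>b q ss. q < num_states M \<longrightarrow> length ss = num_tapes M \<longrightarrow>
        fst (transition M b q ss) < num_states M \<and>
        length (snd (transition M b q ss)) = num_tapes M)"

definition deterministic :: "machine \<Rightarrow> bool" where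
  "deterministic M \<longleftrightarrow> transition M True = transition M False"

fun offset :: "move \<Rightarrow> int" where
  "offset MoveLeft = - 1"
| "offset Stay = 0"
| "offset MoveRight = 1"

fun read_tape :: "tape \<Rightarrow> symbol" where
  "read_tape (t, i) = t i"

fun act :: "symbol \<times> move \<Rightarrow> tape \<Rightarrow> tape" where
  "act (s, m) (t, i) = (t(i := s), i + offset m)"

definition halted :: "config \<Rightarrow> bool" where
  "halted c \<longleftrightarrow> fst c = halt_state"

definition step :: "machine \<Rightarrow> bool \<Rightarrow> config \<Rightarrow> config" where
  "step M b c =
     (if halted c then c
      else let (q, as) = transition M b (fst c) (map read_tape (snd c))
           in (q, map2 act as (snd c)))"

definition blank_tape :: tape where
  "blank_tape = ((\<lambda>_. None), 0)"

definition input_tape :: "bool list \<Rightarrow> tape" where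
  "input_tape x =
     ((\<lambda>i. if 0 \<le> i \<and> i < int (length x) then Some (x ! nat i) else None), 0)"

definition initial_config :: "machine \<Rightarrow> bool list \<Rightarrow> config" where
  "initial_config M x = (start_state, input_tape x # replicate (num_tapes M - 1) blank_tape)"

text \<open>The run of \<open>length r\<close> steps with coins \<open>r\<close>; a halted configuration no longer changes.\<close>

definition run :: "machine \<Rightarrow> bool list \<Rightarrow> bool list \<Rightarrow> config" where
  "run M r x = fold (step M) r (initial_config M x)"

text \<open>The output stands on tape 1, from cell 0 up to the first blank, wherever the head is.\<close>

definition tape_content :: "tape \<Rightarrow> bool list" where
  "tape_content t = map (\<lambda>i. the (fst t (int i))) [0..<(LEAST i. fst t (int i) = None)]"

definition output_of :: "config \<Rightarrow> bool list" where
  "output_of c = tape_content (snd c ! 1)"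

definition halts_within :: "machine \<Rightarrow> nat \<Rightarrow> bool list \<Rightarrow> bool" where
  "halts_within M t x \<longleftrightarrow> (\<forall>r. length r = t \<longrightarrow> halted (run M r x))"

definition running_time :: "machine \<Rightarrow> bool list \<Rightarrow> nat" where
  "running_time M x = (LEAST t. halts_within M t x)"

section \<open>Efficient computation\<close>

definition uniform_bits :: "nat \<Rightarrow> bool list pmf" where
  "uniform_bits n = pmf_of_set {x. length x = n}"

text \<open>The distribution of the output over the coins; meaningful if \<open>M\<close> halts on \<open>x\<close> within
  some time that does not depend on the coins.\<close>

definition result :: "machine \<Rightarrow> bool list \<Rightarrow> bool list pmf" where
  "result M x = map_pmf (\<lambda>r. output_of (run M r x)) (uniform_bits (running_time M x))"

definition computes_in_time ::
    "machine \<Rightarrow> (bool list \<Rightarrow> bool list) \<Rightarrow> (nat \<Rightarrow> nat) \<Rightarrow> bool" where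
  "computes_in_time M f T \<longleftrightarrow> turing_machine M \<and> deterministic M \<and>
     (\<forall>x r. length r = T (length x) \<longrightarrow> halted (run M r x) \<and> output_of (run M r x) = f x)"

definition poly_time_computable :: "(bool list \<Rightarrow> bool list) \<Rightarrow> bool" where
  "poly_time_computable f \<longleftrightarrow> (\<exists>M. \<exists>p :: nat poly. computes_in_time M f (poly p))"

definition ppt :: "machine \<Rightarrow> bool" where
  "ppt M \<longleftrightarrow> turing_machine M \<and>
     (\<exists>p :: nat poly. \<forall>x. halts_within M (poly p (length x)) x)"

text \<open>The pair \<open>(1\<^sup>n, y)\<close> as a bit string.\<close>

definition with_unary :: "nat \<Rightarrow> bool list \<Rightarrow> bool list" where
  "with_unary n y = replicate n True @ False # y"

definition ppt_in_first_input :: "machine \<Rightarrow> bool" where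
  "ppt_in_first_input D \<longleftrightarrow> turing_machine D \<and>
     (\<exists>p :: nat poly. \<forall>n y. halts_within D (poly p n) (with_unary n y))"

section \<open>One-way functions\<close>

definition negligible :: "(nat \<Rightarrow> real) \<Rightarrow> bool" where
  "negligible \<mu> \<longleftrightarrow> (\<forall>c :: nat. \<forall>\<^sub>F n in sequentially. \<bar>\<mu> n\<bar> < 1 / real n ^ c)"

text \<open>The inverter also receives \<open>1\<^sup>n\<close>: otherwise any function that shrinks its argument too
  much, such as the binary length, would count as one-way.\<close>

definition inversion_prob :: "(bool list \<Rightarrow> bool list) \<Rightarrow> machine \<Rightarrow> nat \<Rightarrow> real" where
  "inversion_prob f A n =
     pmf (do { x \<leftarrow> uniform_bits n;
               x' \<leftarrow> result A (with_unary n (f x));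
               return_pmf (f x' = f x) }) True"

definition one_way_function :: "(bool list \<Rightarrow> bool list) \<Rightarrow> bool" where
  "one_way_function f \<longleftrightarrow>
     poly_time_computable f \<and> (\<forall>A. ppt A \<longrightarrow> negligible (inversion_prob f A))"

section \<open>Conditionally secure entropy-preserving generators\<close>

definition accept_prob :: "machine \<Rightarrow> nat \<Rightarrow> bool list pmf \<Rightarrow> real" where
  "accept_prob D n P = pmf (do { y \<leftarrow> P; result D (with_unary n y) }) [True]"

definition indistinguishable ::
    "(nat \<Rightarrow> real) \<Rightarrow> (nat \<Rightarrow> bool list pmf) \<Rightarrow> (nat \<Rightarrow> bool list pmf) \<Rightarrow> bool" where
  "indistinguishable \<mu> A B \<longleftrightarrow>
     (\<forall>D. ppt_in_first_input D \<longrightarrow>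
        (\<exists>n0. \<forall>n\<ge>n0. \<bar>accept_prob D n (A n) - accept_prob D n (B n)\<bar> < \<mu> n))"

definition shannon_entropy :: "'a::countable pmf \<Rightarrow> real" where
  "shannon_entropy P = prob_space.entropy (measure_pmf P) 2 (count_space UNIV) (\<lambda>x. x)"

lemma shannon_entropy_eq_sum:
  fixes P :: "'a::countable pmf"
  assumes "finite (set_pmf P)"
  shows "shannon_entropy P = - (\<Sum>x\<in>set_pmf P. pmf P x * log 2 (pmf P x))"
proof -
  have info: "information_space (measure_pmf P) 2"
    by (simp add: information_space_def information_space_axioms_def
        measure_pmf.prob_space_axioms)
  have "distributed (measure_pmf P) (count_space UNIV) (\<lambda>x. x) (\<lambda>x. ennreal (pmf P x))"
    unfolding distributed_def by (auto simp: measure_pmf_eq_density[symmetric] distr_id2)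
  from information_space.entropy_distr[OF info this]
  have "shannon_entropy P = - (LINT x|count_space UNIV. pmf P x * log 2 (pmf P x))"
    by (simp add: shannon_entropy_def)
  also have "(LINT x|count_space UNIV. pmf P x * log 2 (pmf P x))
           = (\<Sum>x | pmf P x * log 2 (pmf P x) \<noteq> 0. pmf P x * log 2 (pmf P x))"
    by (subst lebesgue_integral_count_space_finite_support)
       (auto intro!: finite_subset[OF _ assms] simp: set_pmf_iff)
  also have "\<dots> = (\<Sum>x\<in>set_pmf P. pmf P x * log 2 (pmf P x))"
    by (rule sum.mono_neutral_left) (use assms in \<open>auto simp: set_pmf_iff\<close>)
  finally show ?thesis .
qed

text \<open>The output length \<open>n + \<gamma> log n\<close>, rounded down.\<close>

definition stretched_length :: "real \<Rightarrow> nat \<Rightarrow> nat" where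
  "stretched_length \<gamma> n = n + nat \<lfloor>\<gamma> * log 2 (real n)\<rfloor>"

definition cond_output ::
    "(bool list \<Rightarrow> bool list) \<Rightarrow> (nat \<Rightarrow> bool list set) \<Rightarrow> nat \<Rightarrow> bool list pmf" where
  "cond_output G E n = map_pmf G (cond_pmf (uniform_bits n) (E n))"

definition cond_secure_ep_prg ::
    "(nat \<Rightarrow> real) \<Rightarrow> real \<Rightarrow> (bool list \<Rightarrow> bool list) \<Rightarrow> bool" where
  "cond_secure_ep_prg \<mu> \<gamma> G \<longleftrightarrow>
     poly_time_computable G \<and>
     (\<forall>x. length (G x) = stretched_length \<gamma> (length x)) \<and>
     (\<exists>(E :: nat \<Rightarrow> bool list set) (\<alpha> :: real).
        (\<forall>n. E n \<subseteq> {x. length x = n} \<and> E n \<noteq> {}) \<and>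
        indistinguishable \<mu> (cond_output G E) (\<lambda>n. uniform_bits (stretched_length \<gamma> n)) \<and>
        (\<forall>\<^sub>F n in sequentially.
           shannon_entropy (cond_output G E n) \<ge> real n - \<alpha> * log 2 (real n)))"

definition rate1_efficient :: "(bool list \<Rightarrow> bool list) \<Rightarrow> bool" where
  "rate1_efficient G \<longleftrightarrow>
     (\<exists>M (\<epsilon> :: real) (T :: nat \<Rightarrow> nat). \<epsilon> < 1 \<and>
        (\<lambda>n. real (T n)) \<in> O(\<lambda>n. real n powr \<epsilon>) \<and>
        computes_in_time M G (\<lambda>n. n + T n))"

text \<open>
  Without any security requirement, not every real \<open>\<gamma>\<close> admits an efficient map from \<open>n\<close> bits to
  \<open>n + \<gamma> log n\<close> bits: the output lengths determine \<open>\<gamma>\<close>, so \<open>\<gamma>\<close> must be a computable real,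
  whatever the rounding. The following condition says that there is a rate-1 efficient map of this
  shape at all. It is necessary for a rate-1 efficient generator with stretch \<open>\<gamma> log n\<close>, the
  generator itself being such a map, and it holds for instance for every positive rational \<open>\<gamma>\<close>.
\<close>

definition admissible_stretch :: "real \<Rightarrow> bool" where
  "admissible_stretch \<gamma> \<longleftrightarrow>
     (\<exists>L. rate1_efficient L \<and> (\<forall>x. length (L x) = stretched_length \<gamma> (length x)))"

lemma admissible_stretch_necessary:
  assumes "rate1_efficient G" and "cond_secure_ep_prg \<mu> \<gamma> G"
  shows "admissible_stretch \<gamma>"
  using assms unfolding admissible_stretch_def cond_secure_ep_prg_def by blast

end

theory Submission imports Defs begin

text \<open>A seed ends with hash functions \<open>R\<close>, with \<open>O(log n)\<close> bits \<open>w\<close> and with a string \<open>a\<close> of length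
  \<open>m\<close>. The generator keeps everything else and \<open>R\<close>, and replaces \<open>w\<close> and \<open>a\<close> by \<open>m - i - O(log n)\<close>
  hash bits of \<open>f a\<close> followed by \<open>i + O(log n)\<close> hash bits of \<open>a\<close>, where \<open>i\<close> is the number written
  in \<open>w\<close>. The event requires that \<open>f a\<close> has about \<open>2\<^sup>i\<close> preimages for the most frequent \<open>i\<close>; it
  costs only \<open>O(log n)\<close> bits of entropy, and so does the generator, because \<open>R\<close> and the hash bits
  almost determine \<open>a\<close>. The bits of \<open>f a\<close> are close to uniform by the leftover hash lemma. If a
  later bit is predictable from \<open>f a\<close> and \<open>j\<close> hash bits of \<open>a\<close>, then the decoder of Goldreich
  and Levin inverts \<open>f\<close> after guessing those \<open>j\<close> bits, which succeeds with probability
  \<open>2\<^sup>-\<^sup>j\<close> for each of the \<open>2\<^sup>i\<close> preimages, hence with polynomial probability in total.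

  As \<open>m\<close> is a small power of \<open>n\<close>, the hash bits take time \<open>O(n\<^sup>\<epsilon>)\<close>. The number of output bits is
  known only through the machine that witnesses that the stretch is admissible. This machine needs
  \<open>n\<close> steps on its own; it runs while the input is copied, whenever it visits a new input cell.\<close>

section \<open>A loop language on stacks\<close>

text \<open>The time bound leaves only a sublinear number of steps besides reading, so
  \<open>f\<close> is applied to strings of length \<open>m = 2 ^ (s div K)\<close>, where
  \<open>s\<close> is the number of extra output bits. This \<open>m\<close> depends on
  \<open>s\<close> and \<open>K\<close> only and equals \<open>n\<close> to the power \<gamma> / K
  up to a constant factor. For fixed \<open>K\<close> it is thus polynomially related to
  \<open>n\<close>, so that a distinguisher that is polynomial in \<open>n\<close> yields an
  inverter that is polynomial in \<open>m\<close>. The degree of the running time in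
  \<open>m\<close> has to be known before \<open>K\<close> is chosen; therefore several statements
  first fix a polynomial and only then quantify over \<open>K\<close>. The inverter knows
  \<open>m\<close>, but none of \<open>n\<close>, \<open>i\<close>, the hybrid position or the sign
  of the advantage, and many \<open>n\<close> share one \<open>m\<close>. It runs through all small
  values of these parameters and checks every candidate with \<open>f\<close>, so that wrong values
  do no harm. One-wayness speaks about machines, so the inverter has to become one, while the
  distinguisher and \<open>f\<close> are arbitrary machines inside it. Hence programs are compiled
  to machines with exact step counts, and machines are simulated by programs.\<close>

type_synonym env = "nat \<Rightarrow> bool list"

datatype com =
    Skip
  | Push nat bool
  | Pop nat
  | Seq com com (infixr \<open>;;\<close> 60)
  | Case nat com com com
  | For nat com

definition pop :: "nat \<Rightarrow> env \<Rightarrow> env" where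
  "pop v e = e(v := tl (e v))"

text \<open>\<open>For v c\<close> runs \<open>c\<close> once per element of register \<open>v\<close> and pops that element only afterwards,
  so that \<open>c\<close> sees the current element on top of \<open>v\<close>.\<close>

primrec exec :: "com \<Rightarrow> env \<Rightarrow> env" where
  "exec Skip e = e"
| "exec (Push v b) e = e(v := b # e v)"
| "exec (Pop v) e = pop v e"
| "exec (c ;; d) e = exec d (exec c e)"
| "exec (Case v c0 c1 c2) e =
     (case e v of [] \<Rightarrow> exec c0 e | x # xs \<Rightarrow> if x then exec c1 e else exec c2 e)"
| "exec (For v c) e = ((\<lambda>e. pop v (exec c e)) ^^ length (e v)) e"

primrec loop_cost :: "('s \<Rightarrow> 's) \<Rightarrow> ('s \<Rightarrow> nat) \<Rightarrow> nat \<Rightarrow> 's \<Rightarrow> nat" where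
  "loop_cost f t 0 s = 1"
| "loop_cost f t (Suc n) s = t s + 2 + loop_cost f t n (f s)"

text \<open>The exact step counts of the compiled code: a push moves the head and then writes; the
  first two branches of a \<open>Case\<close> end with a jump, the third falls through; each round
  of a loop adds a test and a pop.\<close>

primrec cost :: "com \<Rightarrow> env \<Rightarrow> nat" where
  "cost Skip e = 0"
| "cost (Push v b) e = 2"
| "cost (Pop v) e = 1"
| "cost (c ;; d) e = cost c e + cost d (exec c e)"
| "cost (Case v c0 c1 c2) e =
     (case e v of [] \<Rightarrow> 2 + cost c0 e | x # xs \<Rightarrow> if x then 2 + cost c1 e else 1 + cost c2 e)"
| "cost (For v c) e = loop_cost (\<lambda>e. pop v (exec c e)) (cost c) (length (e v)) e"

primrec writes :: "com \<Rightarrow> nat set" where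
  "writes Skip = {}"
| "writes (Push v b) = {v}"
| "writes (Pop v) = {v}"
| "writes (c ;; d) = writes c \<union> writes d"
| "writes (Case v c0 c1 c2) = writes c0 \<union> writes c1 \<union> writes c2"
| "writes (For v c) = insert v (writes c)"

primrec regs :: "com \<Rightarrow> nat set" where
  "regs Skip = {}"
| "regs (Push v b) = {v}"
| "regs (Pop v) = {v}"
| "regs (c ;; d) = regs c \<union> regs d"
| "regs (Case v c0 c1 c2) = insert v (regs c0 \<union> regs c1 \<union> regs c2)"
| "regs (For v c) = insert v (regs c)"

text \<open>As the body may not write the loop register, the number of rounds is fixed on entry. So
  the iteration in \<open>exec\<close> agrees with compiled code that tests for emptiness in every
  round, and every program terminates.\<close>

primrec wf_com :: "com \<Rightarrow> bool" where
  "wf_com Skip = True"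
| "wf_com (Push v b) = True"
| "wf_com (Pop v) = True"
| "wf_com (c ;; d) = (wf_com c \<and> wf_com d)"
| "wf_com (Case v c0 c1 c2) = (wf_com c0 \<and> wf_com c1 \<and> wf_com c2)"
| "wf_com (For v c) = (wf_com c \<and> v \<notin> writes c)"

lemma finite_regs [simp]: "finite (regs c)"
  by (induction c) auto

lemma exec_unwritten: "v \<notin> writes c \<Longrightarrow> exec c e v = e v"
proof (induction c arbitrary: e)
  case (For w c)
  have "((\<lambda>e. pop w (exec c e)) ^^ n) e v = e v" for n
    by (induction n) (use For in \<open>auto simp: pop_def\<close>)
  then show ?case by simp
qed (auto simp: pop_def split: list.splits)

text \<open>Unfolds a loop at its first round, which is the form that the compiled code follows and
  that inductions over the content of the loop register need.\<close>

lemma exec_For_Cons: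
  assumes "v \<notin> writes c" and "e v = b # xs"
  shows "exec (For v c) e = exec (For v c) (pop v (exec c e))"
    and "cost (For v c) e = cost c e + 2 + cost (For v c) (pop v (exec c e))"
proof -
  have "pop v (exec c e) v = xs"
    using assms exec_unwritten[of v c e] by (simp add: pop_def)
  then show "exec (For v c) e = exec (For v c) (pop v (exec c e))"
    and "cost (For v c) e = cost c e + 2 + cost (For v c) (pop v (exec c e))"
    using assms(2) by (simp_all del: funpow.simps add: funpow_Suc_right)
qed

section \<open>Compilation to Turing machines\<close>

text \<open>Tape 1 holds its stack growing to the right, so that its final content, read from the
  bottom, is the output; all other tapes grow to the left, like an input tape seen as a stack.\<close>

definition sgn_tape :: "nat \<Rightarrow> int" where
  "sgn_tape v = (if v = 1 then - 1 else 1)"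

definition cell :: "bool list \<Rightarrow> int \<Rightarrow> symbol" where
  "cell xs z = (if 0 \<le> z \<and> z < int (length xs) then Some (xs ! nat z) else None)"

text \<open>The anchor \<open>A v\<close> is the blank cell next to the bottom of the stack. Push
  and pop leave it fixed, so the head, which scans the top element, has a position determined by the
  height.\<close>

definition stack_tape :: "nat \<Rightarrow> (nat \<Rightarrow> int) \<Rightarrow> bool list \<Rightarrow> tape" where
  "stack_tape v A xs =
     (let p = A v - sgn_tape v * int (length xs) in ((\<lambda>i. cell xs (sgn_tape v * (i - p))), p))"

definition push_move :: "nat \<Rightarrow> move" where
  "push_move v = (if v = 1 then MoveRight else MoveLeft)"

definition pop_move :: "nat \<Rightarrow> move" where
  "pop_move v = (if v = 1 then MoveLeft else MoveRight)"

text \<open>Tapes outside \<open>V\<close> carry whatever \<open>J\<close> says. Compiled code does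
  not touch them, so it can later share a machine with a foreign one that lives on these
  tapes.\<close>

definition tapes :: "nat \<Rightarrow> nat set \<Rightarrow> (nat \<Rightarrow> int) \<Rightarrow> (nat \<Rightarrow> tape) \<Rightarrow> env \<Rightarrow> tape list" where
  "tapes k V A J e = map (\<lambda>v. if v \<in> V then stack_tape v A (e v) else J v) [0..<k]"

type_synonym instr = "bool \<Rightarrow> symbol list \<Rightarrow> nat \<times> (symbol \<times> move) list"

definition keep :: "symbol list \<Rightarrow> (symbol \<times> move) list" where
  "keep ss = map (\<lambda>s. (s, Stay)) ss"

definition goto :: "nat \<Rightarrow> instr" where
  "goto a = (\<lambda>_ ss. (a, keep ss))"

definition pop_to :: "nat \<Rightarrow> nat \<Rightarrow> instr" where
  "pop_to v a = (\<lambda>_ ss. (a, if ss ! v = None then keep ss else (keep ss)[v := (None, pop_move v)]))"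

primrec csize :: "com \<Rightarrow> nat" where
  "csize Skip = 0"
| "csize (Push v b) = 2"
| "csize (Pop v) = 1"
| "csize (c ;; d) = csize c + csize d"
| "csize (Case v c0 c1 c2) = 3 + csize c0 + csize c1 + csize c2"
| "csize (For v c) = 2 + csize c"

primrec code :: "com \<Rightarrow> nat \<Rightarrow> instr list" where
  "code Skip a = []"
| "code (Push v b) a =
    [\<lambda>_ ss. (a + 1, (keep ss)[v := (ss ! v, push_move v)]),
     \<lambda>_ ss. (a + 2, (keep ss)[v := (Some b, Stay)])]"
| "code (Pop v) a = [pop_to v (a + 1)]"
| "code (c ;; d) a = code c a @ code d (a + csize c)"
| "code (Case v c0 c1 c2) a =
    (let a1 = a + 2 + csize c0; a2 = a1 + 1 + csize c1; a' = a2 + csize c2 in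
     (\<lambda>_ ss. (case ss ! v of None \<Rightarrow> a + 1 | Some b \<Rightarrow> if b then a1 else a2, keep ss)) #
     code c0 (a + 1) @ goto a' # code c1 a1 @ goto a' # code c2 a2)"
| "code (For v c) a =
    (\<lambda>_ ss. (if ss ! v = None then a + 2 + csize c else a + 1, keep ss)) #
    code c (a + 1) @ [pop_to v a]"

lemma length_code [simp]: "length (code c a) = csize c"
  by (induction c arbitrary: a) (auto simp: Let_def)

definition instrs_ok :: "nat \<Rightarrow> instr list \<Rightarrow> bool" where
  "instrs_ok n is \<longleftrightarrow>
     (\<forall>i\<in>set is. \<forall>b ss. fst (i b ss) < n \<and> length (snd (i b ss)) = length ss)"

lemma length_keep [simp]: "length (keep ss) = length ss"
  by (simp add: keep_def)

lemma instrs_ok_simps [simp]: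
  "instrs_ok n []"
  "instrs_ok n (i # is) \<longleftrightarrow>
     (\<forall>b ss. fst (i b ss) < n \<and> length (snd (i b ss)) = length ss) \<and> instrs_ok n is"
  "instrs_ok n (is @ js) \<longleftrightarrow> instrs_ok n is \<and> instrs_ok n js"
  by (auto simp: instrs_ok_def)

lemma instrs_ok_goto [simp]: "fst (goto a b ss) = a" "length (snd (goto a b ss)) = length ss"
  by (auto simp: goto_def)

lemma instrs_ok_pop_to [simp]:
  "fst (pop_to v a b ss) = a" "length (snd (pop_to v a b ss)) = length ss"
  by (auto simp: pop_to_def)

lemma instrs_ok_code: "a + csize c < n \<Longrightarrow> instrs_ok n (code c a)"
  by (induction c arbitrary: a) (auto simp: Let_def split: option.splits)

definition loaded :: "machine \<Rightarrow> nat \<Rightarrow> instr list \<Rightarrow> bool" where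
  "loaded M a is \<longleftrightarrow> (\<forall>i<length is. \<forall>b. transition M b (a + i) = (is ! i) b)"

lemma loaded_Cons:
  "loaded M a (i # is) \<longleftrightarrow> (\<forall>b. transition M b a = i b) \<and> loaded M (Suc a) is"
  unfolding loaded_def
proof safe
  fix j b assume "\<forall>ia<length (i # is). \<forall>b. transition M b (a + ia) = ((i # is) ! ia) b"
    and "j < length is"
  then show "transition M b (Suc a + j) = (is ! j) b"
    by (auto dest: spec[of _ "Suc j"])
next
  fix j b assume "\<forall>b. transition M b a = i b"
    and "\<forall>ia<length is. \<forall>b. transition M b (Suc a + ia) = (is ! ia) b" and "j < length (i # is)"
  then show "transition M b (a + j) = ((i # is) ! j) b"
    by (cases j) auto
qed auto

lemma loaded_append:
  "loaded M a (is @ js) \<longleftrightarrow> loaded M a is \<and> loaded M (a + length is) js"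
  by (induction "is" arbitrary: a) (auto simp: loaded_Cons loaded_def[of _ _ "[]"])

text \<open>Quantifying over all coins of the given number expresses that this part of the run does
  not depend on them.\<close>

definition reaches :: "machine \<Rightarrow> nat \<Rightarrow> config \<Rightarrow> config \<Rightarrow> bool" where
  "reaches M t s s' \<longleftrightarrow> (\<forall>r. length r = t \<longrightarrow> fold (step M) r s = s')"

lemma reaches_0 [simp]: "reaches M 0 s s' \<longleftrightarrow> s = s'"
  by (auto simp: reaches_def)

lemma reaches_trans:
  assumes "reaches M t s s'" and "reaches M t' s' s''"
  shows "reaches M (t + t') s s''"
  unfolding reaches_def
proof (intro allI impI)
  fix r :: "bool list" assume "length r = t + t'"
  then have "length (take t r) = t" "length (drop t r) = t'" by auto
  then have "fold (step M) (take t r @ drop t r) s = s''"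
    using assms unfolding reaches_def by (metis comp_apply fold_append)
  then show "fold (step M) r s = s''" by simp
qed

lemma reaches_1: "(\<And>b. step M b s = s') \<Longrightarrow> reaches M 1 s s'"
  by (auto simp: reaches_def length_Suc_conv)

lemma length_tapes [simp]: "length (tapes k V A J e) = k"
  by (simp add: tapes_def)

lemma tapes_nth [simp]:
  "v < k \<Longrightarrow> tapes k V A J e ! v = (if v \<in> V then stack_tape v A (e v) else J v)"
  by (simp add: tapes_def)

lemma read_stack: "read_tape (stack_tape v A xs) = (case xs of [] \<Rightarrow> None | b # _ \<Rightarrow> Some b)"
  by (auto simp: stack_tape_def Let_def cell_def split: list.splits)

lemma act_keep: "map2 act (keep (map read_tape ts)) ts = ts"
  by (induction ts) (auto simp: keep_def)

lemma act_keep_update: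
  assumes "v < length ts"
  shows "map2 act ((keep (map read_tape ts))[v := x]) ts = ts[v := act x (ts ! v)]"
proof (rule nth_equalityI)
  fix i assume "i < length (map2 act ((keep (map read_tape ts))[v := x]) ts)"
  then have i: "i < length ts" by simp
  have "act (read_tape (ts ! i), Stay) (ts ! i) = ts ! i"
    by (cases "ts ! i") simp
  then show "map2 act ((keep (map read_tape ts))[v := x]) ts ! i = ts[v := act x (ts ! v)] ! i"
    using i assms by (simp add: nth_list_update keep_def)
qed simp

lemma tapes_update:
  assumes "v \<in> V" "v < k"
  shows "(tapes k V A J e)[v := stack_tape v A xs] = tapes k V A J (e(v := xs))"
  by (rule nth_equalityI) (use assms in \<open>auto simp: nth_list_update\<close>)

lemma sgn_tape_cases: "sgn_tape v = 1 \<or> sgn_tape v = - 1"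
  by (simp add: sgn_tape_def)

lemma cell_Cons: "cell (b # xs) z = (if z = 0 then Some b else cell xs (z - 1))"
  by (cases "z > 0") (auto simp: cell_def nth_Cons' nat_diff_distrib)

lemma act_push:
  "act (Some b, Stay) (act (read_tape (stack_tape v A xs), push_move v) (stack_tape v A xs)) =
     stack_tape v A (b # xs)"
  using sgn_tape_cases[of v]
  by (auto simp: stack_tape_def Let_def push_move_def sgn_tape_def fun_eq_iff cell_Cons
      algebra_simps)

lemma cell_negative: "z < 0 \<Longrightarrow> cell xs z = None"
  by (simp add: cell_def)

lemma act_pop:
  assumes "xs \<noteq> []"
  shows "act (None, pop_move v) (stack_tape v A xs) = stack_tape v A (tl xs)"
proof -
  obtain b ys where xs: "xs = b # ys" using assms by (cases xs) auto
  show ?thesis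
    by (auto simp: xs stack_tape_def Let_def pop_move_def sgn_tape_def fun_eq_iff cell_Cons
        cell_negative algebra_simps)
qed

lemma step_instr:
  assumes "transition M b q = i" "q \<noteq> halt_state"
  shows "step M b (q, ts) = (let (q', as) = i (map read_tape ts) in (q', map2 act as ts))"
  using assms by (simp add: step_def halted_def)

lemma read_tapes:
  assumes "v \<in> V" "v < k"
  shows "map read_tape (tapes k V A J e) ! v = (case e v of [] \<Rightarrow> None | b # _ \<Rightarrow> Some b)"
  using assms by (simp add: read_stack)

lemma step_keep:
  assumes "loaded M a [i]" "a \<ge> 2" "\<And>b. i b (map read_tape ts) = (a', keep (map read_tape ts))"
  shows "reaches M 1 (a, ts) (a', ts)"
proof (rule reaches_1)
  fix b
  have "step M b (a, ts) = (let (q', as) = i b (map read_tape ts) in (q', map2 act as ts))"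
    using assms(1,2) by (intro step_instr) (auto simp: loaded_Cons halt_state_def)
  then show "step M b (a, ts) = (a', ts)"
    using assms(3)[of b] by (simp add: act_keep)
qed

lemma step_goto: "loaded M a [goto a'] \<Longrightarrow> a \<ge> 2 \<Longrightarrow> reaches M 1 (a, ts) (a', ts)"
  by (rule step_keep) (auto simp: goto_def)

lemma reaches_pop_to:
  assumes "loaded M a [pop_to v a']" "a \<ge> 2" "v \<in> V" "v < k"
  shows "reaches M 1 (a, tapes k V A J e) (a', tapes k V A J (pop v e))"
proof (cases "e v")
  case Nil
  then have "pop v e = e" by (auto simp: pop_def)
  moreover have "reaches M 1 (a, tapes k V A J e) (a', tapes k V A J e)"
    using Nil read_tapes[OF assms(3,4), of A J e]
    by (intro step_keep[OF assms(1,2)]) (auto simp: pop_to_def)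
  ultimately show ?thesis by simp
next
  case (Cons x xs)
  show ?thesis
  proof (rule reaches_1)
    fix b
    let ?ts = "tapes k V A J e"
    have "step M b (a, ?ts) =
        (let (q', as) = pop_to v a' b (map read_tape ?ts) in (q', map2 act as ?ts))"
      using assms(1,2) by (intro step_instr) (auto simp: loaded_Cons halt_state_def)
    also have "\<dots> = (a', map2 act ((keep (map read_tape ?ts))[v := (None, pop_move v)]) ?ts)"
      using Cons read_tapes[OF assms(3,4), of A J e] by (simp add: pop_to_def)
    also have "\<dots> = (a', tapes k V A J (pop v e))"
      using Cons assms(3,4)
      by (simp add: act_keep_update act_pop tapes_update pop_def)
    finally show "step M b (a, ?ts) = (a', tapes k V A J (pop v e))" .
  qed
qed

lemma reaches_push:
  assumes "loaded M a (code (Push v x) a)" "a \<ge> 2" "v \<in> V" "v < k"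
  shows "reaches M 2 (a, tapes k V A J e) (a + 2, tapes k V A J (e(v := x # e v)))"
proof -
  let ?ts = "tapes k V A J e"
  let ?us = "?ts[v := act (read_tape (?ts ! v), push_move v) (?ts ! v)]"
  have 1: "reaches M 1 (a, ?ts) (a + 1, ?us)"
  proof (rule reaches_1)
    fix b
    show "step M b (a, ?ts) = (a + 1, ?us)"
      using assms by (subst step_instr[of M b a])
        (auto simp: loaded_Cons halt_state_def act_keep_update)
  qed
  have 2: "reaches M 1 (a + 1, ?us) (a + 2, tapes k V A J (e(v := x # e v)))"
  proof (rule reaches_1)
    fix b
    have "step M b (a + 1, ?us) =
        (a + 2, map2 act ((keep (map read_tape ?us))[v := (Some x, Stay)]) ?us)"
      using assms by (subst step_instr[of M b "a + 1"])
        (auto simp: loaded_Cons halt_state_def)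
    also have "\<dots> = (a + 2, tapes k V A J (e(v := x # e v)))"
      using assms(3,4) by (subst act_keep_update) (simp_all add: act_push tapes_update)
    finally show "step M b (a + 1, ?us) = (a + 2, tapes k V A J (e(v := x # e v)))" .
  qed
  from reaches_trans[OF 1 2] show ?thesis by (simp add: numeral_2_eq_2)
qed

text \<open>The time is exact, not only bounded, so that consecutive pieces of code chain by
  \<open>reaches_trans\<close>.\<close>

lemma reaches_code:
  assumes "loaded M a (code c a)" "wf_com c" "regs c \<subseteq> V" "V \<subseteq> {..<k}" "a \<ge> 2"
  shows "reaches M (cost c e) (a, tapes k V A J e) (a + csize c, tapes k V A J (exec c e))"
  using assms
proof (induction c arbitrary: a e)
  case (Push v b)
  then have "v \<in> V" "v < k" by auto
  from reaches_push[OF Push(1) Push(5) this] show ?case by (simp add: fun_upd_def)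
next
  case (Pop v)
  then show ?case using reaches_pop_to[of M a v "a + 1" V k A J e] by auto
next
  case (Seq c d)
  have 1: "reaches M (cost c e) (a, tapes k V A J e) (a + csize c, tapes k V A J (exec c e))"
    by (rule Seq.IH) (use Seq.prems in \<open>auto simp: loaded_append\<close>)
  have 2: "reaches M (cost d (exec c e)) (a + csize c, tapes k V A J (exec c e))
     (a + csize c + csize d, tapes k V A J (exec d (exec c e)))"
    by (rule Seq.IH) (use Seq.prems in \<open>auto simp: loaded_append\<close>)
  show ?case using reaches_trans[OF 1 2] by (simp add: add.assoc)
next
  case (Case v c0 c1 c2)
  let ?a1 = "a + 2 + csize c0" let ?a2 = "?a1 + 1 + csize c1"
  let ?a' = "?a2 + csize c2"
  let ?s = "\<lambda>q e. (q, tapes k V A J e)"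
  let ?i = "\<lambda>(b::bool) ss. (case ss ! v of None \<Rightarrow> a + 1 | Some b \<Rightarrow> if b then ?a1 else ?a2, keep ss)"
  have l: "loaded M a [?i]"
     "loaded M (a + 1) (code c0 (a + 1))" "loaded M (a + 1 + csize c0) [goto ?a']"
     "loaded M ?a1 (code c1 ?a1)" "loaded M (?a1 + csize c1) [goto ?a']"
     "loaded M ?a2 (code c2 ?a2)"
    using Case.prems(1) by (auto simp: Let_def loaded_Cons loaded_append loaded_def[of _ _ "[]"] ac_simps
        fun_eq_iff split: option.splits)
  have v: "v \<in> V" "v < k" using Case.prems by auto
  let ?q = "case e v of [] \<Rightarrow> a + 1 | x # _ \<Rightarrow> if x then ?a1 else ?a2"
  have 1: "reaches M 1 (?s a e) (?s ?q e)"
    by (rule step_keep[OF l(1) \<open>a \<ge> 2\<close>])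
      (use read_tapes[OF v, of A J e] in \<open>auto split: list.splits\<close>)
  show ?case
  proof (cases "e v")
    case Nil
    have 2: "reaches M (cost c0 e) (?s (a + 1) e) (?s (a + 1 + csize c0) (exec c0 e))"
      by (rule Case.IH) (use Case.prems l in auto)
    have 3: "reaches M 1 (?s (a + 1 + csize c0) (exec c0 e)) (?s ?a' (exec c0 e))"
      by (rule step_goto) (use Case.prems l in auto)
    show ?thesis
      using reaches_trans[OF 1 reaches_trans[OF _ 3], of "cost c0 e"] 2 Nil
      by (simp add: Let_def ac_simps numeral_3_eq_3)
  next
    case (Cons x xs)
    show ?thesis
    proof (cases x)
      case True
      have 2: "reaches M (cost c1 e) (?s ?a1 e) (?s (?a1 + csize c1) (exec c1 e))"
        by (rule Case.IH) (use Case.prems l in auto)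
      have 3: "reaches M 1 (?s (?a1 + csize c1) (exec c1 e)) (?s ?a' (exec c1 e))"
        by (rule step_goto) (use Case.prems l in auto)
      show ?thesis
        using reaches_trans[OF 1 reaches_trans[OF _ 3], of "cost c1 e"] 2 Cons True
        by (simp add: Let_def ac_simps numeral_3_eq_3)
    next
      case False
      have 2: "reaches M (cost c2 e) (?s ?a2 e) (?s ?a' (exec c2 e))"
        by (rule Case.IH) (use Case.prems l in auto)
      show ?thesis
        using reaches_trans[OF 1, of "cost c2 e"] 2 Cons False
        by (simp add: Let_def ac_simps numeral_3_eq_3)
    qed
  qed
next
  case (For v c)
  let ?s = "\<lambda>q e. (q, tapes k V A J e)"
  let ?i = "\<lambda>(b::bool) ss. (if ss ! v = None then a + 2 + csize c else a + 1, keep ss)"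
  have l: "loaded M a [?i]" "loaded M (a + 1) (code c (a + 1))"
      "loaded M (a + 1 + csize c) [pop_to v a]"
    using For.prems(1) by (auto simp: loaded_Cons loaded_append loaded_def[of _ _ "[]"])
  have v: "v \<in> V" "v < k" "v \<notin> writes c" using For.prems by auto
  have 1: "reaches M 1 (?s a e) (?s (if e v = [] then a + 2 + csize c else a + 1) e)" for e
    by (rule step_keep[OF l(1) \<open>a \<ge> 2\<close>])
      (use read_tapes[OF v(1,2), of A J e] in \<open>auto split: list.splits\<close>)
  \<comment> \<open>The structural induction covers one execution of the body; the rounds are
    handled by an induction over the content of \<open>v\<close>, which the body leaves
    alone.\<close>
  have "reaches M (cost (For v c) e) (?s a e) (?s (a + csize (For v c)) (exec (For v c) e))"
  proof (induction "e v" arbitrary: e)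
    case Nil
    then show ?case using 1[of e] by (simp add: Nil[symmetric])
  next
    case (Cons x xs)
    let ?e = "exec c e"
    have "reaches M (cost c e) (?s (a + 1) e) (?s (a + 1 + csize c) ?e)"
      by (rule For.IH) (use For.prems l in auto)
    moreover have "reaches M 1 (?s (a + 1 + csize c) ?e) (?s a (pop v ?e))"
      by (rule reaches_pop_to) (use For.prems l v in auto)
    moreover have "reaches M 1 (?s a e) (?s (a + 1) e)"
      using 1[of e] by (simp add: Cons.hyps(2)[symmetric])
    ultimately have body: "reaches M (1 + (cost c e + 1)) (?s a e) (?s a (pop v ?e))"
      by (blast intro: reaches_trans)
    have "xs = pop v ?e v"
      using Cons.hyps(2)[symmetric] exec_unwritten[OF v(3), of e] by (simp add: pop_def)
    note rest = Cons.hyps(1)[of "pop v ?e", OF this]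
    have "1 + (cost c e + 1) + cost (For v c) (pop v ?e) = cost (For v c) e"
      "exec (For v c) (pop v ?e) = exec (For v c) e"
      using exec_For_Cons[of v c e x xs] v(3) Cons.hyps(2)[symmetric]
      by (simp_all del: exec.simps cost.simps)
    with reaches_trans[OF body rest] show ?case by metis
  qed
  then show ?case .
qed auto

section \<open>Polynomial-time functions\<close>

lemma poly_nat_mono: "m \<le> n \<Longrightarrow> poly p m \<le> poly (p :: nat poly) n"
  by (induction p) (auto intro!: add_mono mult_mono)

text \<open>An instance of a class for lists can restrict the element type only by a sort. With this
  class, whose single instance is \<open>bool\<close>, bit strings become contexts.\<close>

class bit_type = fixes to_bool :: "'a \<Rightarrow> bool"

instantiation bool :: bit_type begin
definition to_bool_bool :: "bool \<Rightarrow> bool" where "to_bool_bool b = b"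
instance ..
end

text \<open>A context is a finite tuple of bit strings, laid out in the registers; the components of a
  pair occupy the even and the odd registers.\<close>

class ctx =
  fixes enc :: "'a \<Rightarrow> env" and blen :: "'a \<Rightarrow> nat"
  assumes enc_le: "length (enc x v) \<le> blen x"
    and enc_dim: "\<exists>d. \<forall>x v. d \<le> v \<longrightarrow> enc x v = []"

instantiation list :: (bit_type) ctx begin
definition enc_list :: "'a list \<Rightarrow> env" where
  "enc_list xs = (\<lambda>v. if v = 0 then map to_bool xs else [])"
definition blen_list :: "'a list \<Rightarrow> nat" where "blen_list xs = length xs"
instance by standard (auto simp: enc_list_def blen_list_def intro!: exI[of _ 1])
end

definition merge :: "env \<Rightarrow> env \<Rightarrow> env" where
  "merge e e' v = (if even v then e (v div 2) else e' (v div 2))"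

instantiation prod :: (ctx, ctx) ctx begin
definition enc_prod :: "'a \<times> 'b \<Rightarrow> env" where "enc_prod p = merge (enc (fst p)) (enc (snd p))"
definition blen_prod :: "'a \<times> 'b \<Rightarrow> nat" where "blen_prod p = blen (fst p) + blen (snd p)"
instance
proof
  fix p :: "'a \<times> 'b" and v
  show "length (enc p v) \<le> blen p"
    using enc_le[of "fst p" "v div 2"] enc_le[of "snd p" "v div 2"]
    by (auto simp: enc_prod_def blen_prod_def merge_def)
next
  obtain d where d: "\<forall>x v. d \<le> v \<longrightarrow> enc (x :: 'a) v = []" using enc_dim by blast
  obtain d' where d': "\<forall>x v. d' \<le> v \<longrightarrow> enc (x :: 'b) v = []" using enc_dim by blast
  have "enc (p :: 'a \<times> 'b) v = []" if "2 * max d d' \<le> v" for p v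
  proof -
    have "d \<le> v div 2" "d' \<le> v div 2" using that by auto
    then show ?thesis using d d' by (auto simp: enc_prod_def merge_def)
  qed
  then show "\<exists>d. \<forall>(x :: 'a \<times> 'b) v. d \<le> v \<longrightarrow> enc x v = []" by blast
qed
end

lemma map_to_bool [simp]: "map to_bool (xs :: bool list) = xs"
  by (induction xs) (auto simp: to_bool_bool_def)

lemma enc_bits: "enc (xs :: bool list) = (\<lambda>v. if v = 0 then xs else [])"
  by (auto simp: enc_list_def)

lemma blen_bits [simp]: "blen (xs :: bool list) = length xs"
  by (simp add: blen_list_def)

lemma enc_Pair: "enc (x, y) = merge (enc x) (enc y)"
  by (simp add: enc_prod_def)

lemma blen_Pair [simp]: "blen (x, y) = blen x + blen y"
  by (simp add: blen_prod_def)

section \<open>Renaming of registers\<close>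

primrec rename :: "(nat \<Rightarrow> nat) \<Rightarrow> com \<Rightarrow> com" where
  "rename \<pi> Skip = Skip"
| "rename \<pi> (Push v b) = Push (\<pi> v) b"
| "rename \<pi> (Pop v) = Pop (\<pi> v)"
| "rename \<pi> (c ;; d) = rename \<pi> c ;; rename \<pi> d"
| "rename \<pi> (Case v c0 c1 c2) = Case (\<pi> v) (rename \<pi> c0) (rename \<pi> c1) (rename \<pi> c2)"
| "rename \<pi> (For v c) = For (\<pi> v) (rename \<pi> c)"

lemma writes_rename [simp]: "writes (rename \<pi> c) = \<pi> ` writes c"
  by (induction c) auto

lemma regs_rename [simp]: "regs (rename \<pi> c) = \<pi> ` regs c"
  by (induction c) auto

lemma wf_rename [simp]: "inj \<pi> \<Longrightarrow> wf_com (rename \<pi> c) = wf_com c"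
  by (induction c) (auto simp: inj_def)

lemma pop_comp: "inj \<pi> \<Longrightarrow> (\<lambda>w. pop (\<pi> v) e (\<pi> w)) = pop v (\<lambda>w. e (\<pi> w))"
  by (auto simp: pop_def fun_eq_iff inj_def)

lemma exec_rename:
  assumes "inj \<pi>"
  shows "(\<lambda>w. exec (rename \<pi> c) e (\<pi> w)) = exec c (\<lambda>w. e (\<pi> w))"
proof (induction c arbitrary: e)
  case (Push v b)
  then show ?case using assms by (auto simp: fun_eq_iff inj_def)
next
  case (Pop v)
  then show ?case using pop_comp[OF assms] by simp
next
  case (Case v c0 c1 c2)
  then show ?case by (cases "e (\<pi> v)") auto
next
  case (For v c)
  have "(\<lambda>w. ((\<lambda>e. pop (\<pi> v) (exec (rename \<pi> c) e)) ^^ n) e (\<pi> w)) =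
      ((\<lambda>e. pop v (exec c e)) ^^ n) (\<lambda>w. e (\<pi> w))" for n
  proof (induction n)
    case (Suc n)
    then show ?case using For by (simp add: pop_comp[OF assms])
  qed simp
  then show ?case by simp
qed auto

lemma exec_rename_other: "v \<notin> range \<pi> \<Longrightarrow> exec (rename \<pi> c) e v = e v"
  by (rule exec_unwritten) auto

lemma cost_rename:
  assumes "inj \<pi>"
  shows "cost (rename \<pi> c) e = cost c (\<lambda>w. e (\<pi> w))"
proof (induction c arbitrary: e)
  case (Seq c d)
  then show ?case by (simp add: exec_rename[OF assms])
next
  case (For v c)
  have "loop_cost (\<lambda>e. pop (\<pi> v) (exec (rename \<pi> c) e)) (cost (rename \<pi> c)) n e =
      loop_cost (\<lambda>e. pop v (exec c e)) (cost c) n (\<lambda>w. e (\<pi> w))" for n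
    by (induction n arbitrary: e)
      (simp_all add: For pop_comp[OF assms] exec_rename[OF assms])
  then show ?case by simp
qed (auto split: list.splits)

definition evn :: "nat \<Rightarrow> nat" where "evn v = 2 * v"
definition odd' :: "nat \<Rightarrow> nat" where "odd' v = 2 * v + 1"

lemma inj_evn: "inj evn" and inj_odd': "inj odd'"
  by (auto simp: inj_def evn_def odd'_def)

lemma merge_at [simp]: "merge e e' (evn v) = e v" "merge e e' (odd' v) = e' v"
  by (auto simp: merge_def evn_def odd'_def)

lemma merge_eqI:
  assumes "\<And>w. e (evn w) = e1 w" "\<And>w. e (odd' w) = e2 w"
  shows "e = merge e1 e2"
proof
  fix v
  show "e v = merge e1 e2 v"
    using assms(1)[of "v div 2"] assms(2)[of "v div 2"]
    by (auto simp: merge_def evn_def odd'_def)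
qed

lemma evn_not_odd': "evn v \<notin> range odd'" "odd' v \<notin> range evn"
  unfolding evn_def odd'_def by (auto, presburger+)

lemma exec_evn: "exec (rename evn c) (merge e e') = merge (exec c e) e'"
  using fun_cong[OF exec_rename[OF inj_evn, of c "merge e e'"]]
  by (intro merge_eqI) (auto simp: exec_rename_other evn_not_odd')

lemma exec_odd': "exec (rename odd' c) (merge e e') = merge e (exec c e')"
  using fun_cong[OF exec_rename[OF inj_odd', of c "merge e e'"]]
  by (intro merge_eqI) (auto simp: exec_rename_other evn_not_odd')

text \<open>The final environment is exactly the encoding of the result, so all scratch registers
  are empty again and programs can be composed. The bound on the output length is what makes costs
  compose to polynomials.\<close>

definition implements :: "com \<Rightarrow> nat poly \<Rightarrow> ('a::ctx \<Rightarrow> 'b::ctx) \<Rightarrow> bool" where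
  "implements c p F \<longleftrightarrow> wf_com c \<and> (\<forall>x. exec c (enc x) = enc (F x) \<and>
     cost c (enc x) \<le> poly p (blen x) \<and> blen (F x) \<le> poly p (blen x))"

definition FP :: "('a::ctx \<Rightarrow> 'b::ctx) \<Rightarrow> bool" where
  "FP F \<longleftrightarrow> (\<exists>c p. implements c p F)"

lemma implementsD:
  assumes "implements c p F"
  shows "wf_com c" "exec c (enc x) = enc (F x)" "cost c (enc x) \<le> poly p (blen x)"
    "blen (F x) \<le> poly p (blen x)"
  using assms by (auto simp: implements_def)

lemma FPI:
  fixes F :: "'a::ctx \<Rightarrow> 'b::ctx"
  assumes "wf_com c" "\<And>x. exec c (enc x) = enc (F x)"
    "\<And>x :: 'a. cost c (enc x) \<le> poly p (blen x)" "\<And>x. blen (F x) \<le> poly q (blen x)"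
  shows "FP F"
  unfolding FP_def implements_def
proof (intro exI[of _ c] exI[of _ "p + q"] conjI allI)
  fix x :: 'a
  show "cost c (enc x) \<le> poly (p + q) (blen x)" "blen (F x) \<le> poly (p + q) (blen x)"
    using assms(3)[of x] assms(4)[of x] by simp_all
qed (use assms in auto)

lemma FP_comp:
  fixes f :: "'a::ctx \<Rightarrow> 'b::ctx" and g :: "'b \<Rightarrow> 'c::ctx"
  assumes "FP f" "FP g"
  shows "FP (\<lambda>x. g (f x))"
proof -
  obtain c p d q where "implements c p f" "implements d q g"
    using assms by (auto simp: FP_def)
  note c = implementsD[OF this(1)] and d = implementsD[OF this(2)]
  have le: "poly q (blen (f x)) \<le> poly (pcompose q p) (blen x)" for x
    using poly_nat_mono[OF c(4)] by (simp add: poly_pcompose)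
  show ?thesis
  proof (rule FPI[of "c ;; d" _ "p + pcompose q p" "pcompose q p"])
    fix x :: 'a
    show "cost (c ;; d) (enc x) \<le> poly (p + pcompose q p) (blen x)"
      using c(3)[of x] d(3)[of "f x"] le[of x] by (simp add: c(2))
    show "blen (g (f x)) \<le> poly (pcompose q p) (blen x)"
      using d(4)[of "f x"] le[of x] by simp
  qed (use c d in auto)
qed

lemma FP_id: "FP (\<lambda>x. x)"
  by (rule FPI[of Skip _ 0 "[:0, 1:]"]) auto

lemma FP_on_fst:
  fixes f :: "'a::ctx \<Rightarrow> 'b::ctx"
  assumes "FP f"
  shows "FP (\<lambda>p :: 'a \<times> 'c::ctx. (f (fst p), snd p))"
proof -
  obtain c p where "implements c p f" using assms by (auto simp: FP_def)
  note c = implementsD[OF this]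
  show ?thesis
  proof (rule FPI[of "rename evn c" _ p "p + [:0, 1:]"])
    fix x :: "'a \<times> 'c"
    have le: "poly p (blen (fst x)) \<le> poly p (blen x)"
      by (intro poly_nat_mono) (simp add: blen_prod_def)
    show "exec (rename evn c) (enc x) = enc (f (fst x), snd x)"
      by (simp add: enc_prod_def exec_evn c)
    show "cost (rename evn c) (enc x) \<le> poly p (blen x)"
      using c(3)[of "fst x"] le by (simp add: cost_rename[OF inj_evn] enc_prod_def)
    show "blen (f (fst x), snd x) \<le> poly (p + [:0, 1:]) (blen x)"
      using c(4)[of "fst x"] le by (simp add: blen_prod_def)
  qed (simp add: c inj_evn)
qed

lemma FP_on_snd:
  fixes f :: "'a::ctx \<Rightarrow> 'b::ctx"
  assumes "FP f"
  shows "FP (\<lambda>p :: 'c::ctx \<times> 'a. (fst p, f (snd p)))"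
proof -
  obtain c p where "implements c p f" using assms by (auto simp: FP_def)
  note c = implementsD[OF this]
  show ?thesis
  proof (rule FPI[of "rename odd' c" _ p "p + [:0, 1:]"])
    fix x :: "'c \<times> 'a"
    have le: "poly p (blen (snd x)) \<le> poly p (blen x)"
      by (intro poly_nat_mono) (simp add: blen_prod_def)
    show "exec (rename odd' c) (enc x) = enc (fst x, f (snd x))"
      by (simp add: enc_prod_def exec_odd' c)
    show "cost (rename odd' c) (enc x) \<le> poly p (blen x)"
      using c(3)[of "snd x"] le by (simp add: cost_rename[OF inj_odd'] enc_prod_def)
    show "blen (fst x, f (snd x)) \<le> poly (p + [:0, 1:]) (blen x)"
      using c(4)[of "snd x"] le by (simp add: blen_prod_def)
  qed (simp add: c inj_odd')
qed

definition shift_to :: "nat \<Rightarrow> nat \<Rightarrow> com" where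
  "shift_to v t = For v (Case v Skip (Push t True) (Push t False))"

lemma shift_to:
  assumes "v \<noteq> t"
  shows "exec (shift_to v t) e = e(v := [], t := rev (e v) @ e t)"
    and "cost (shift_to v t) e \<le> 6 * length (e v) + 1"
proof -
  have "exec (shift_to v t) e = e(v := [], t := rev (e v) @ e t) \<and>
      cost (shift_to v t) e \<le> 6 * length (e v) + 1"
  proof (induction "e v" arbitrary: e)
    case Nil
    then show ?case by (auto simp: shift_to_def fun_upd_idem simp flip: Nil)
  next
    case (Cons x xs)
    let ?c = "Case v Skip (Push t True) (Push t False)"
    let ?e = "pop v (exec ?c e)"
    have e: "?e = e(v := xs, t := x # e t)"
      using assms by (auto simp: pop_def fun_eq_iff simp flip: Cons(2))
    have "xs = ?e v" unfolding e using assms by simp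
    note IH = Cons(1)[of ?e, OF this]
    have "v \<notin> writes ?c" using assms by auto
    note * = exec_For_Cons[of _ _ e x xs, OF this Cons(2)[symmetric]]
    have "cost ?c e \<le> 4" by (simp flip: Cons(2))
    then show ?case
      using IH assms *[folded shift_to_def] unfolding e
      by (auto simp: fun_eq_iff simp flip: Cons(2))
  qed
  then show "exec (shift_to v t) e = e(v := [], t := rev (e v) @ e t)"
    and "cost (shift_to v t) e \<le> 6 * length (e v) + 1" by auto
qed

text \<open>A single pass reverses the stack; the second pass, from the scratch register
  \<open>t\<close>, restores the order and produces both copies.\<close>

definition copy_to :: "nat \<Rightarrow> nat \<Rightarrow> nat \<Rightarrow> com" where
  "copy_to u w t =
     shift_to u t ;; For t (Case t Skip (Push u True ;; Push w True) (Push u False ;; Push w False))"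

lemma copy_to:
  assumes "u \<noteq> w" "u \<noteq> t" "w \<noteq> t" "e t = []"
  shows "exec (copy_to u w t) e = e(w := e u @ e w)"
    and "cost (copy_to u w t) e \<le> 14 * length (e u) + 2"
proof -
  let ?c = "Case t Skip (Push u True ;; Push w True) (Push u False ;; Push w False)"
  have *: "exec (For t ?c) e = e(t := [], u := rev (e t) @ e u, w := rev (e t) @ e w) \<and>
      cost (For t ?c) e \<le> 8 * length (e t) + 1" for e
  proof (induction "e t" arbitrary: e)
    case Nil
    then show ?case by (auto simp: fun_upd_idem simp flip: Nil)
  next
    case (Cons x xs)
    let ?e = "pop t (exec ?c e)"
    have e: "?e = e(t := xs, u := x # e u, w := x # e w)"
      using assms(1-3) by (auto simp: pop_def fun_eq_iff simp flip: Cons(2))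
    have "xs = ?e t" using assms(1-3) fun_cong[OF e, of t] by (simp del: exec.simps)
    note IH = Cons(1)[of ?e, OF this]
    have "t \<notin> writes ?c" using assms(1-3) by auto
    note * = exec_For_Cons[of _ _ e x xs, OF this Cons(2)[symmetric]]
    have "cost ?c e \<le> 6" by (simp flip: Cons(2))
    then show ?case
      using IH assms(1-3) * unfolding e
      by (auto simp del: exec.simps cost.simps simp: fun_eq_iff simp flip: Cons(2))
  qed
  show "exec (copy_to u w t) e = e(w := e u @ e w)"
    using assms *[of "e(u := [], t := rev (e u))"]
    by (auto simp: copy_to_def shift_to fun_eq_iff simp del: exec.simps(6))
  show "cost (copy_to u w t) e \<le> 14 * length (e u) + 2"
    using assms *[of "e(u := [], t := rev (e u))"] shift_to(2)[of u t e]
    by (auto simp: copy_to_def shift_to(1) simp del: exec.simps(6) cost.simps(6))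
qed

primrec copies :: "(nat \<Rightarrow> nat option) \<Rightarrow> nat \<Rightarrow> nat \<Rightarrow> com" where
  "copies h d 0 = Skip"
| "copies h d (Suc n) =
     copies h d n ;; (case h n of None \<Rightarrow> Skip | Some u \<Rightarrow> copy_to u (d + 1 + n) d)"

primrec clears :: "nat \<Rightarrow> com" where
  "clears 0 = Skip"
| "clears (Suc n) = clears n ;; For n Skip"

primrec moves :: "nat \<Rightarrow> nat \<Rightarrow> com" where
  "moves d 0 = Skip"
| "moves d (Suc n) = moves d n ;; shift_to (d + 1 + n) d ;; shift_to d n"

lemma exec_clear:
  "exec (For v Skip) e = e(v := [])" "cost (For v Skip) e = 2 * length (e v) + 1"
proof -
  have "exec (For v Skip) e = e(v := []) \<and> cost (For v Skip) e = 2 * length (e v) + 1"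
  proof (induction "e v" arbitrary: e)
    case Nil
    then show ?case by (auto simp: fun_upd_idem simp flip: Nil)
  next
    case (Cons x xs)
    have "xs = pop v (exec Skip e) v" by (simp add: pop_def flip: Cons(2))
    note IH = Cons(1)[of "pop v (exec Skip e)", OF this]
    show ?case
      using IH exec_For_Cons[of v Skip e x xs] Cons(2)[symmetric]
      by (simp del: exec.simps(6) cost.simps(6) add: pop_def)
  qed
  then show "exec (For v Skip) e = e(v := [])" "cost (For v Skip) e = 2 * length (e v) + 1"
    by auto
qed

lemma copies:
  assumes "\<And>v. v \<ge> d \<Longrightarrow> e v = []" "n \<le> d" "\<And>v u. h v = Some u \<Longrightarrow> u < d" "\<And>v. length (e v) \<le> B"
  shows "exec (copies h d n) e = (\<lambda>v. if d + 1 \<le> v \<and> v < d + 1 + n then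
      (case h (v - (d + 1)) of None \<Rightarrow> [] | Some u \<Rightarrow> e u) else e v)" (is "_ = ?f n")
    and "cost (copies h d n) e \<le> n * (14 * B + 2)"
proof -
  have "exec (copies h d n) e = ?f n \<and> cost (copies h d n) e \<le> n * (14 * B + 2)"
    using assms(2)
  proof (induction n)
    case (Suc n)
    then have IH: "exec (copies h d n) e = ?f n" "cost (copies h d n) e \<le> n * (14 * B + 2)"
      by auto
    show ?case
    proof (cases "h n")
      case None
      then show ?thesis using IH assms(1) Suc.prems
        by (auto simp: fun_eq_iff less_Suc_eq split: option.splits)
    next
      case (Some u)
      have u: "u < d" using assms(3) Some .
      have fu: "?f n u = e u" using u by simp
      have c: "exec (copy_to u (d + 1 + n) d) (?f n) = (?f n)(d + 1 + n := e u)"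
        "cost (copy_to u (d + 1 + n) d) (?f n) \<le> 14 * length (e u) + 2"
        using copy_to[of u "d + 1 + n" d "?f n"] u assms(1) by simp_all
      have "14 * length (e u) + 2 \<le> 14 * B + 2" using assms(4)[of u] by simp
      moreover have "(?f n)(d + 1 + n := e u) = ?f (Suc n)"
        using Some by (auto simp: fun_eq_iff less_Suc_eq split: option.splits)
      ultimately show ?thesis
        using IH Some c by simp
    qed
  qed (auto simp: fun_eq_iff)
  then show "exec (copies h d n) e = ?f n" "cost (copies h d n) e \<le> n * (14 * B + 2)" by auto
qed

lemma clears:
  assumes "\<And>v. length (e v) \<le> B"
  shows "exec (clears n) e = (\<lambda>v. if v < n then [] else e v)"
    and "cost (clears n) e \<le> n * (2 * B + 1)"
proof -
  have "exec (clears n) e = (\<lambda>v. if v < n then [] else e v) \<and> cost (clears n) e \<le> n * (2 * B + 1)"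
  proof (induction n)
    case (Suc n)
    have "2 * length (e n) + 1 \<le> 2 * B + 1" using assms[of n] by simp
    with Suc show ?case
      by (auto simp del: exec.simps(6) cost.simps(6) simp: exec_clear fun_eq_iff)
  qed simp
  then show "exec (clears n) e = (\<lambda>v. if v < n then [] else e v)"
    and "cost (clears n) e \<le> n * (2 * B + 1)" by auto
qed

lemma moves:
  assumes "\<And>v. v \<le> d \<Longrightarrow> e v = []" "n \<le> d" "\<And>v. length (e v) \<le> B"
  shows "exec (moves d n) e = (\<lambda>v. if v < n then e (d + 1 + v)
      else if d + 1 \<le> v \<and> v < d + 1 + n then [] else e v)" (is "_ = ?f n")
    and "cost (moves d n) e \<le> n * (12 * B + 2)"
proof -
  have "exec (moves d n) e = ?f n \<and> cost (moves d n) e \<le> n * (12 * B + 2)"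
    using assms(2)
  proof (induction n)
    case (Suc n)
    then have IH: "exec (moves d n) e = ?f n" "cost (moves d n) e \<le> n * (12 * B + 2)"
      by auto
    let ?e1 = "(?f n)(d + 1 + n := [], d := rev (e (d + 1 + n)))"
    have nd: "n < d" using Suc.prems by simp
    have 1: "exec (shift_to (d + 1 + n) d) (?f n) = ?e1"
      using shift_to(1)[of "d + 1 + n" d "?f n"] assms(1)[of d] nd by (simp add: fun_eq_iff)
    have n1: "cost (shift_to (d + 1 + n) d) (?f n) \<le> 6 * length (e (d + 1 + n)) + 1"
      using shift_to(2)[of "d + 1 + n" d "?f n"] by simp
    have "exec (shift_to d n) ?e1 = ?f (Suc n)"
      using nd assms(1)[of d] assms(1)[of n] by (subst shift_to(1)) (auto simp: fun_eq_iff)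
    moreover have "cost (shift_to d n) ?e1 \<le> 6 * length (e (d + 1 + n)) + 1"
      using shift_to(2)[of d n ?e1] nd by simp
    ultimately show ?case
      using IH 1 n1 assms(3)[of "d + 1 + n"] by simp
  qed (auto simp: fun_eq_iff)
  then show "exec (moves d n) e = ?f n" "cost (moves d n) e \<le> n * (12 * B + 2)" by auto
qed

lemma wf_copies: "(\<And>v u. h v = Some u \<Longrightarrow> u < d) \<Longrightarrow> n \<le> d \<Longrightarrow> wf_com (copies h d n)"
  and wf_clears: "wf_com (clears n)"
  and wf_moves: "n \<le> d \<Longrightarrow> wf_com (moves d n)"
  by (induction n) (auto simp: copy_to_def shift_to_def split: option.splits)

text \<open>Projections, duplication and the empty string only select registers, as described by
  \<open>h\<close>. The selected contents are first copied to a block above register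
  \<open>d\<close>, since a source may be needed again; then the old registers are cleared and the
  block is moved down.\<close>

lemma FP_rearrange:
  fixes F :: "'a::ctx \<Rightarrow> 'b::ctx"
  assumes h: "\<And>x v. enc (F x) v = (case h v of None \<Rightarrow> [] | Some u \<Rightarrow> enc x u)"
    and len: "\<And>x. blen (F x) \<le> poly p (blen x)"
  shows "FP F"
proof -
  obtain d1 where d1: "\<And>x v. d1 \<le> v \<Longrightarrow> enc (x :: 'a) v = []" using enc_dim by blast
  obtain d2 where d2: "\<And>x v. d2 \<le> v \<Longrightarrow> enc (x :: 'b) v = []" using enc_dim by blast
  define d where "d = max d1 d2"
  \<comment> \<open>A source register beyond \<open>d\<close> is always empty, so it may be replaced
    by no source at all; this leaves finitely many registers.\<close>
  define h' where "h' v = (case h v of Some u \<Rightarrow> if u < d then Some u else None | None \<Rightarrow> None)" for v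
  have h'd: "u < d" if "h' v = Some u" for u v
    using that by (auto simp: h'_def split: option.splits if_splits)
  have h': "enc (F x) v = (case h' v of None \<Rightarrow> [] | Some u \<Rightarrow> enc x u)" for x v
    using h[of x v] d1[of _ x] by (auto simp: h'_def d_def split: option.splits)
  define c where "c = copies h' d d ;; clears d ;; moves d d"
  have main: "exec c (enc x) = enc (F x) \<and> cost c (enc x) \<le> d * (28 * blen x + 5)" for x
  proof -
    let ?B = "blen x"
    let ?e0 = "enc x"
    let ?e1 = "\<lambda>v. if d + 1 \<le> v \<and> v < d + 1 + d then
      (case h' (v - (d + 1)) of None \<Rightarrow> [] | Some u \<Rightarrow> enc x u) else enc x v"
    let ?e2 = "\<lambda>v. if v < d then [] else ?e1 v"
    have 0: "\<And>v. v \<ge> d \<Longrightarrow> ?e0 v = []" using d1 by (simp add: d_def)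
    have B: "length (?e1 v) \<le> ?B" "length (?e2 v) \<le> ?B" for v
      by (auto simp: enc_le split: option.splits)
    have 1: "exec (copies h' d d) ?e0 = ?e1"
      by (rule copies(1)[where B = ?B]) (use 0 h'd enc_le in auto)
    have k1: "cost (copies h' d d) ?e0 \<le> d * (14 * ?B + 2)"
      by (rule copies(2)) (use 0 h'd enc_le in auto)
    have 2: "exec (clears d) ?e1 = ?e2"
      by (rule clears(1)[where B = ?B]) (rule B)
    have k2: "cost (clears d) ?e1 \<le> d * (2 * ?B + 1)"
      by (rule clears(2)) (rule B)
    have 3: "exec (moves d d) ?e2 = (\<lambda>v. if v < d then ?e2 (d + 1 + v)
      else if d + 1 \<le> v \<and> v < d + 1 + d then [] else ?e2 v)"
      by (rule moves(1)[where B = ?B]) (use B 0 in auto)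
    have k3: "cost (moves d d) ?e2 \<le> d * (12 * ?B + 2)"
      by (rule moves(2)) (use B 0 in auto)
    have "enc (F x) v = []" if "v \<ge> d" for v
      using d2 that by (simp add: d_def)
    then have "exec c ?e0 = enc (F x)"
      unfolding c_def exec.simps 1 2 3 using 0 by (auto simp: fun_eq_iff) (auto simp: h')
    moreover have "cost c ?e0 \<le> d * (14 * ?B + 2) + d * (2 * ?B + 1) + d * (12 * ?B + 2)"
      unfolding c_def cost.simps 1 2 using k1 k2 k3 by linarith
    then have "cost c ?e0 \<le> d * (28 * blen x + 5)" by (simp add: algebra_simps)
    ultimately show ?thesis by blast
  qed
  show ?thesis
  proof (rule FPI[of c])
    show "wf_com c" using h'd by (auto simp: c_def intro!: wf_copies wf_clears wf_moves)
    show "cost c (enc x) \<le> poly [:5 * d, 28 * d:] (blen x)" for x :: 'a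
      using main[of x] by (simp add: algebra_simps)
  qed (use main len in auto)
qed

section \<open>Closure properties of polynomial-time functions\<close>

named_theorems fp

lemmas [fp] = FP_id

lemma FP_fst [fp]:
  fixes f :: "'c::ctx \<Rightarrow> 'a::ctx \<times> 'b::ctx"
  assumes "FP f"
  shows "FP (\<lambda>x. fst (f x))"
proof (rule FP_comp[OF assms, of fst])
  show "FP (fst :: 'a \<times> 'b \<Rightarrow> 'a)"
    by (rule FP_rearrange[where h = "\<lambda>v. Some (2 * v)" and p = "[:0, 1:]"])
      (auto simp: enc_prod_def merge_def blen_prod_def)
qed

lemma FP_snd [fp]:
  fixes f :: "'c::ctx \<Rightarrow> 'a::ctx \<times> 'b::ctx"
  assumes "FP f"
  shows "FP (\<lambda>x. snd (f x))"
proof (rule FP_comp[OF assms, of snd])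
  show "FP (snd :: 'a \<times> 'b \<Rightarrow> 'b)"
    by (rule FP_rearrange[where h = "\<lambda>v. Some (2 * v + 1)" and p = "[:0, 1:]"])
      (auto simp: enc_prod_def merge_def blen_prod_def)
qed

lemma FP_Pair [fp]:
  assumes "FP f" "FP g"
  shows "FP (\<lambda>x. (f x, g x))"
proof -
  have "FP (\<lambda>x. (x, x) :: 'a \<times> 'a)"
    by (rule FP_rearrange[where h = "\<lambda>v. Some (v div 2)" and p = "[:0, 2:]"])
      (auto simp: enc_prod_def merge_def blen_prod_def)
  from FP_comp[OF FP_comp[OF this FP_on_fst[OF assms(1)]] FP_on_snd[OF assms(2)]]
  show ?thesis by simp
qed

lemma FP_Nil [fp]: "FP (\<lambda>x. [] :: bool list)"
  by (rule FP_rearrange[where h = "\<lambda>v. None" and p = 0]) (auto simp: enc_bits)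

lemma FP_Cons [fp]:
  fixes f :: "'a::ctx \<Rightarrow> bool list"
  assumes "FP f"
  shows "FP (\<lambda>x. b # f x)"
proof (rule FP_comp[OF assms, of "\<lambda>xs. b # xs"])
  show "FP (\<lambda>xs. b # xs)"
    by (rule FPI[of "Push 0 b" _ "[:2:]" "[:1, 1:]"]) (auto simp: enc_bits)
qed

lemma FP_tl [fp]:
  fixes f :: "'a::ctx \<Rightarrow> bool list"
  assumes "FP f"
  shows "FP (\<lambda>x. tl (f x))"
proof (rule FP_comp[OF assms, of tl])
  show "FP (tl :: bool list \<Rightarrow> bool list)"
    by (rule FPI[of "Pop 0" _ "[:1:]" "[:0, 1:]"]) (auto simp: enc_bits pop_def)
qed

text \<open>The list is held in register 0 and the branches work on the odd registers. The list
  survives the branch and is projected away only afterwards.\<close>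

lemma FP_case_list:
  fixes l :: "'a::ctx \<Rightarrow> bool list" and f g h :: "'a \<Rightarrow> 'b::ctx"
  assumes "FP l" "FP f" "FP g" "FP h"
  shows "FP (\<lambda>x. case l x of [] \<Rightarrow> f x | b # _ \<Rightarrow> if b then g x else h x)"
proof -
  obtain c1 p1 c2 p2 c3 p3 where "implements c1 p1 f" "implements c2 p2 g" "implements c3 p3 h"
    using assms by (auto simp: FP_def)
  note c1 = implementsD[OF this(1)] and c2 = implementsD[OF this(2)] and c3 = implementsD[OF this(3)]
  define F where "F = (\<lambda>(l :: bool list, x :: 'a).
    (l, case l of [] \<Rightarrow> f x | b # _ \<Rightarrow> if b then g x else h x))"
  let ?p = "p1 + p2 + p3"
  have "FP F"
  proof (rule FPI[of "Case 0 (rename odd' c1) (rename odd' c2) (rename odd' c3)" F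
        "?p + 2" "?p + [:0, 1:]"])
    fix x :: "bool list \<times> 'a"
    obtain l y where x: "x = (l, y)" by fastforce
    have m: "poly p (blen y) \<le> poly p (blen x)" for p :: "nat poly"
      by (rule poly_nat_mono) (simp add: x)
    have e0: "enc x 0 = l" by (simp add: x enc_Pair merge_def enc_bits)
    show "exec (Case 0 (rename odd' c1) (rename odd' c2) (rename odd' c3)) (enc x) = enc (F x)"
      by (cases l) (simp_all add: e0, simp_all add: x F_def enc_Pair exec_odd' c1 c2 c3)
    have cr: "cost (rename odd' c) (enc x) = cost c (enc y)" for c
      by (simp add: x enc_Pair cost_rename[OF inj_odd'])
    show "cost (Case 0 (rename odd' c1) (rename odd' c2) (rename odd' c3)) (enc x)
        \<le> poly (?p + 2) (blen x)"
      using m[of p1] m[of p2] m[of p3] c1(3)[of y] c2(3)[of y] c3(3)[of y]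
      by (cases l) (auto simp: e0 cr)
    show "blen (F x) \<le> poly (?p + [:0, 1:]) (blen x)"
      using m[of p1] m[of p2] m[of p3] c1(4)[of y] c2(4)[of y] c3(4)[of y]
      by (cases l) (auto simp: F_def x)
  qed (use c1 c2 c3 in \<open>auto simp: inj_odd'\<close>)
  from FP_snd[OF FP_comp[OF FP_Pair[OF assms(1) FP_id] this]]
  show ?thesis by (simp add: F_def)
qed

text \<open>The counter occupies register 0 and the body only odd registers, so the condition on
  loops holds automatically.\<close>

lemma exec_For_funpow:
  fixes F :: "'a::ctx \<Rightarrow> 'a" and s :: 'a
  assumes "implements c p F"
  shows "exec (For 0 (rename odd' c)) (enc (l :: bool list, s)) = enc ([] :: bool list, (F ^^ length l) s)"
    and "(\<And>k. k < length l \<Longrightarrow> blen ((F ^^ k) s) \<le> B) \<Longrightarrow>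
      cost (For 0 (rename odd' c)) (enc (l, s)) \<le> length l * (poly p B + 2) + 1"
proof -
  note c = implementsD[OF assms]
  let ?c = "rename odd' c"
  have 0: "0 \<notin> writes ?c" by (auto simp: odd'_def)
  have pop: "pop 0 (exec ?c (enc (b # l, s))) = enc (l, F s)" for b and l :: "bool list" and s :: 'a
    by (auto simp: enc_Pair exec_odd' c pop_def enc_bits merge_def fun_eq_iff)
  have e0: "enc (l, s) 0 = l" for l :: "bool list" and s :: 'a
    by (simp add: enc_Pair merge_def enc_bits)
  have cc: "cost ?c (enc (l, s)) \<le> poly p (blen s)" for l :: "bool list" and s :: 'a
    using c(3)[of s] by (simp add: enc_Pair cost_rename[OF inj_odd'])
  have 1: "exec (For 0 ?c) (enc (l, s)) = enc ([] :: bool list, (F ^^ length l) s)" for l :: "bool list"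
  proof (induction l arbitrary: s)
    case Nil
    then show ?case by (simp add: e0)
  next
    case (Cons b l)
    show ?case
      using exec_For_Cons(1)[OF 0, of "enc (b # l, s)" b l] e0[of "b # l" s] Cons[of "F s"]
      by (simp add: pop funpow_swap1 del: exec.simps(6))
  qed
  then show "exec (For 0 ?c) (enc (l, s)) = enc ([] :: bool list, (F ^^ length l) s)" .
  have 2: "cost (For 0 ?c) (enc (l, s)) \<le> length l * (poly p B + 2) + 1"
    if "\<And>k. k < length l \<Longrightarrow> blen ((F ^^ k) s) \<le> B" for l :: "bool list" using that
  proof (induction l arbitrary: s)
    case Nil
    then show ?case by (simp add: e0)
  next
    case (Cons b l)
    have "blen ((F ^^ k) (F s)) \<le> B" if "k < length l" for k
      using Cons.prems[of "Suc k"] that by (simp add: funpow_swap1)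
    then have "cost (For 0 ?c) (enc (l, F s)) \<le> length l * (poly p B + 2) + 1"
      by (rule Cons.IH)
    moreover have "cost ?c (enc (b # l, s)) \<le> poly p B"
      using cc[of "b # l" s] poly_nat_mono[of "blen s" B p] Cons.prems[of 0] by simp
    ultimately show ?case
      using exec_For_Cons(2)[OF 0, of "enc (b # l, s)" b l] e0[of "b # l" s]
      by (simp add: pop del: cost.simps(6))
  qed
  show "cost (For 0 ?c) (enc (l, s)) \<le> length l * (poly p B + 2) + 1"
    if "\<And>k. k < length l \<Longrightarrow> blen ((F ^^ k) s) \<le> B"
    using 2[of l] that by blast
qed

text \<open>Bounded recursion: a polynomial-time step alone is not enough, because iterated doubling
  grows exponentially; hence the polynomial bound on all intermediate states.\<close>

lemma FP_funpow:
  fixes F :: "'b::ctx \<Rightarrow> 'b" and l :: "'a::ctx \<Rightarrow> bool list" and s :: "'a \<Rightarrow> 'b::ctx"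
  assumes "FP F" "FP l" "FP s"
    and bound: "\<And>x k. k \<le> length (l x) \<Longrightarrow> blen ((F ^^ k) (s x)) \<le> poly q (blen x)"
  shows "FP (\<lambda>x. (F ^^ length (l x)) (s x))"
proof -
  obtain c p where c: "implements c p F" using assms by (auto simp: FP_def)
  obtain d p' where "implements d p' (\<lambda>x. (l x, s x))"
    using FP_Pair[OF assms(2,3)] by (auto simp: FP_def)
  note d = implementsD[OF this]
  have "FP (\<lambda>x. ([] :: bool list, (F ^^ length (l x)) (s x)))"
  proof (rule FPI[of "d ;; For 0 (rename odd' c)" _ "p' + p' * (pcompose p q + 2) + 1" q])
    fix x :: 'a
    have "length (l x) \<le> poly p' (blen x)" using d(4)[of x] by simp
    then have "length (l x) * (poly p (poly q (blen x)) + 2)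
        \<le> poly p' (blen x) * (poly p (poly q (blen x)) + 2)"
      by (intro mult_mono) auto
    moreover have "cost (For 0 (rename odd' c)) (enc (l x, s x))
        \<le> length (l x) * (poly p (poly q (blen x)) + 2) + 1"
      by (rule exec_For_funpow(2)[OF c]) (use bound in auto)
    ultimately show "cost (d ;; For 0 (rename odd' c)) (enc x)
        \<le> poly (p' + p' * (pcompose p q + 2) + 1) (blen x)"
      using d(3)[of x] by (simp add: d(2) poly_pcompose del: cost.simps(6))
    show "blen ([] :: bool list, (F ^^ length (l x)) (s x)) \<le> poly q (blen x)"
      using bound[of "length (l x)" x] by simp
  qed (use d implementsD(1)[OF c] exec_For_funpow(1)[OF c] in
      \<open>auto simp del: exec.simps(6) simp: inj_odd', auto simp: odd'_def\<close>)
  from FP_snd[OF this] show ?thesis by simp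
qed

lemma FP_blen: "FP F \<Longrightarrow> \<exists>p :: nat poly. \<forall>x. blen (F x) \<le> poly p (blen x)"
  unfolding FP_def implements_def by blast

text \<open>Numbers are computed in unary, so that each of them can control a loop and is
  polynomially bounded by construction.\<close>

definition FPN :: "('a::ctx \<Rightarrow> nat) \<Rightarrow> bool" where
  "FPN f \<longleftrightarrow> FP (\<lambda>x. replicate (f x) True)"

definition FPP :: "('a::ctx \<Rightarrow> bool) \<Rightarrow> bool" where
  "FPP P \<longleftrightarrow> FP (\<lambda>x. if P x then [True] else [])"

lemma FP_If [fp]:
  assumes "FPP P" "FP f" "FP g"
  shows "FP (\<lambda>x. if P x then f x else g x)"
proof -
  have "(case (if P x then [True] else []) of [] \<Rightarrow> g x | b # _ \<Rightarrow> if b then f x else g x)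
      = (if P x then f x else g x)" for x by simp
  with FP_case_list[OF assms(1)[unfolded FPP_def] assms(3,2,3)] show ?thesis by simp
qed

lemma FPP_not_Nil:
  fixes l :: "'a::ctx \<Rightarrow> bool list"
  assumes "FP l"
  shows "FPP (\<lambda>x. l x \<noteq> [])"
proof -
  have "(case l x of [] \<Rightarrow> [] | b # _ \<Rightarrow> if b then [True] else [True]) =
      (if l x \<noteq> [] then [True] else [])" for x
    by (cases "l x") auto
  with FP_case_list[OF assms FP_Nil FP_Cons[OF FP_Nil] FP_Cons[OF FP_Nil], of True True]
  show ?thesis by (simp only: FPP_def)
qed

lemma FPP_const [fp]: "FPP (\<lambda>x. b)"
  by (cases b) (simp_all add: FPP_def FP_Nil FP_Cons)

lemma FPP_If:
  assumes "FPP P" "FPP Q" "FPP R"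
  shows "FPP (\<lambda>x. if P x then Q x else R x)"
proof -
  have "(if P x then (if Q x then [True] else []) else (if R x then [True] else [])) =
      (if (if P x then Q x else R x) then [True] else [])" for x by simp
  with FP_If[OF assms(1) assms(2,3)[unfolded FPP_def]] show ?thesis by (simp only: FPP_def)
qed

lemma FPP_not [fp]: "FPP P \<Longrightarrow> FPP (\<lambda>x. \<not> P x)"
  using FPP_If[of P "\<lambda>_. False" "\<lambda>_. True", OF _ FPP_const FPP_const]
  by (simp only: if_False if_True if_cancel if_bool_eq_conj simp_thms)

lemma FPP_conj [fp]:
  assumes "FPP P" "FPP Q"
  shows "FPP (\<lambda>x. P x \<and> Q x)"
proof -
  have "(if P x then Q x else False) = (P x \<and> Q x)" for x by auto
  with FPP_If[OF assms FPP_const[of False]] show ?thesis by (simp only:)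
qed

lemma FPP_iff [fp]:
  assumes "FPP P" "FPP Q"
  shows "FPP (\<lambda>x. P x = Q x)"
proof -
  have "(if P x then Q x else \<not> Q x) = (P x = Q x)" for x by auto
  with FPP_If[OF assms FPP_not[OF assms(2)]] show ?thesis by (simp only:)
qed

lemma FPP_hd: "FP l \<Longrightarrow> FPP (\<lambda>x. case l x of [] \<Rightarrow> False | b # _ \<Rightarrow> b)"
proof -
  assume "FP l"
  from FP_case_list[OF this FP_Nil FP_Cons[OF FP_Nil] FP_Nil, of True]
  have "FP (\<lambda>x. case l x of [] \<Rightarrow> [] | b # _ \<Rightarrow> if b then [True] else [])" .
  moreover have "(case l x of [] \<Rightarrow> [] | b # _ \<Rightarrow> if b then [True] else []) =
      (if (case l x of [] \<Rightarrow> False | b # _ \<Rightarrow> b) then [True] else [])" for x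
    by (cases "l x") auto
  ultimately show ?thesis by (simp add: FPP_def)
qed

lemma FP_singleton [fp]: "FPP P \<Longrightarrow> FP (\<lambda>x. [P x])"
proof -
  assume a: "FPP P"
  have "[P x] = (if P x then [True] else [False])" for x by simp
  with FP_If[OF a FP_Cons[OF FP_Nil] FP_Cons[OF FP_Nil], of True False]
  show ?thesis by (simp cong: if_cong)
qed

lemma funpow_tl: "(tl ^^ n) xs = drop n xs"
  by (induction n arbitrary: xs) (simp_all add: drop_Suc funpow_swap1 tl_drop)

lemma FP_drop [fp]:
  fixes l :: "'a::ctx \<Rightarrow> bool list"
  assumes "FPN n" "FP l"
  shows "FP (\<lambda>x. drop (n x) (l x))"
proof -
  obtain q where q: "\<And>x. blen (l x) \<le> poly q (blen x)" using FP_blen[OF assms(2)] by blast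
  have "FP (\<lambda>x. (tl ^^ length (replicate (n x) True)) (l x))"
  proof (rule FP_funpow[OF FP_tl[OF FP_id] assms(1)[unfolded FPN_def] assms(2), where q = q])
    fix x k
    show "blen ((tl ^^ k) (l x)) \<le> poly q (blen x)"
      using q[of x] by (simp add: funpow_tl)
  qed
  then show ?thesis by (simp add: funpow_tl)
qed

lemma FP_rev_append:
  assumes "FP l" "FP m"
  shows "FP (\<lambda>x. rev (l x) @ (m x :: bool list))"
proof -
  define F where "F = (\<lambda>p :: bool list \<times> bool list. (tl (fst p),
    case fst p of [] \<Rightarrow> snd p | b # _ \<Rightarrow> if b then True # snd p else False # snd p))"
  have F: "FP F"
    unfolding F_def by (intro fp FP_case_list)
  have Fk: "(F ^^ k) (xs, ys) = (drop k xs, rev (take k xs) @ ys)" for k xs ys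
  proof (induction k)
    case (Suc k)
    have t: "drop (Suc k) xs = tl (drop k xs)" by (simp add: drop_Suc tl_drop)
    show ?case
    proof (cases "drop k xs")
      case (Cons b l)
      then have "k < length xs" "xs ! k = b" using nth_via_drop[OF Cons] by (auto intro: ccontr)
      with Suc Cons show ?thesis unfolding t by (auto simp: F_def take_Suc_conv_app_nth)
    qed (use Suc t in \<open>auto simp: F_def\<close>)
  qed simp
  obtain q1 where q1: "\<And>x. blen (l x) \<le> poly q1 (blen x)" using FP_blen[OF assms(1)] by blast
  obtain q2 where q2: "\<And>x. blen (m x) \<le> poly q2 (blen x)" using FP_blen[OF assms(2)] by blast
  have "FP (\<lambda>x. (F ^^ length (l x)) (l x, m x))"
  proof (rule FP_funpow[OF F assms(1) FP_Pair[OF assms], where q = "q1 + q2"])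
    fix x k
    show "blen ((F ^^ k) (l x, m x)) \<le> poly (q1 + q2) (blen x)"
      using q1[of x] q2[of x] by (simp add: Fk)
  qed
  from FP_snd[OF this] show ?thesis by (simp add: Fk)
qed

lemma FP_rev [fp]:
  assumes "FP l"
  shows "FP (\<lambda>x. rev (l x :: bool list))"
  using FP_rev_append[OF assms FP_Nil] by simp

lemma FP_append [fp]:
  assumes "FP l" "FP m"
  shows "FP (\<lambda>x. l x @ (m x :: bool list))"
  using FP_rev_append[OF FP_rev[OF assms(1)] assms(2)] by simp

lemma FPN_length [fp]:
  assumes "FP l"
  shows "FPN (\<lambda>x. length (l x :: bool list))"
proof -
  have k: "((#) True ^^ k) [] = replicate k True" for k by (induction k) auto
  obtain q where q: "\<And>x. blen (l x) \<le> poly q (blen x)" using FP_blen[OF assms] by blast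
  have "FP (\<lambda>x. ((#) True ^^ length (l x)) [])"
  proof (rule FP_funpow[OF FP_Cons[OF FP_id] assms FP_Nil, where q = q])
    fix x k assume "k \<le> length (l x)"
    then show "blen (((#) True ^^ k) []) \<le> poly q (blen x)" using q[of x] by (simp add: k)
  qed
  then show ?thesis by (simp add: k FPN_def)
qed

lemma FP_replicate [fp]: "FPN f \<Longrightarrow> FP (\<lambda>x. replicate (f x) True)"
  by (simp add: FPN_def)

lemma FPN_Suc [fp]: "FPN f \<Longrightarrow> FPN (\<lambda>x. Suc (f x))"
  using FP_Cons[of "\<lambda>x. replicate (f x) True" True] by (simp add: FPN_def)

lemma FPN_const [fp]: "FPN (\<lambda>x. n)"
  by (induction n) (use FP_Nil in \<open>auto simp: FPN_def intro: FP_Cons\<close>)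

lemma FPN_add [fp]: "FPN f \<Longrightarrow> FPN g \<Longrightarrow> FPN (\<lambda>x. f x + g x)"
  unfolding FPN_def replicate_add by (rule FP_append)

lemma FPN_diff [fp]: "FPN f \<Longrightarrow> FPN g \<Longrightarrow> FPN (\<lambda>x. f x - g x)"
  using FP_drop[of g "\<lambda>x. replicate (f x) True"] by (simp add: FPN_def)

lemma FPP_less [fp]: "FPN f \<Longrightarrow> FPN g \<Longrightarrow> FPP (\<lambda>x. f x < g x)"
  using FPP_not_Nil[OF FP_drop[of f "\<lambda>x. replicate (g x) True"]] by (simp add: FPN_def not_le)

lemma FPP_le [fp]: "FPN f \<Longrightarrow> FPN g \<Longrightarrow> FPP (\<lambda>x. f x \<le> g x)"
  using FPP_not[OF FPP_less[of g f]] by (simp add: not_less)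

lemma FPP_eq_nat [fp]: "FPN f \<Longrightarrow> FPN g \<Longrightarrow> FPP (\<lambda>x. f x = g x)"
  using FPP_conj[OF FPP_le[of f g] FPP_le[of g f]] by (simp add: antisym_conv eq_iff)

lemma FP_take [fp]:
  fixes l :: "'a::ctx \<Rightarrow> bool list"
  assumes "FPN n" "FP l"
  shows "FP (\<lambda>x. take (n x) (l x))"
proof -
  have "FP (\<lambda>x. rev (drop (length (l x) - n x) (rev (l x))))"
    by (intro fp assms)
  moreover have "rev (drop (length xs - k) (rev xs)) = take k xs" for k and xs :: "bool list"
    by (cases "k \<le> length xs") (simp_all add: drop_rev)
  ultimately show ?thesis by simp
qed

lemma FPN_min [fp]: "FPN f \<Longrightarrow> FPN g \<Longrightarrow> FPN (\<lambda>x. min (f x) (g x))"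
  using FP_take[of f "\<lambda>x. replicate (g x) True"] by (simp add: FPN_def take_replicate)

text \<open>This is the general bounded loop over an index. The index reaches the body in unary, as
  the length of the first component.\<close>

lemma FP_concat [fp]:
  fixes n :: "'a::ctx \<Rightarrow> nat" and g :: "nat \<Rightarrow> 'a \<Rightarrow> bool list"
  assumes g: "FP (\<lambda>p :: bool list \<times> 'a. g (length (fst p)) (snd p))" and n: "FPN n"
  shows "FP (\<lambda>x. concat (map (\<lambda>i. g i x) [0..<n x]))"
proof -
  define F where "F = (\<lambda>p :: (bool list \<times> 'a) \<times> bool list.
    ((True # fst (fst p), snd (fst p)), snd p @ g (length (fst (fst p))) (snd (fst p))))"
  have F: "FP F"
    unfolding F_def
    by (intro fp FP_comp[of fst "\<lambda>p :: bool list \<times> 'a. g (length (fst p)) (snd p)"] g)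
  have Fk: "(F ^^ k) (([], x), []) =
      ((replicate k True, x), concat (map (\<lambda>i. g i x) [0..<k]))" for k x
    by (induction k) (auto simp: F_def)
  obtain q where q: "\<And>i x. length (g i x) \<le> poly q (i + blen x)"
  proof -
    obtain q where "\<forall>p :: bool list \<times> 'a. blen (g (length (fst p)) (snd p)) \<le> poly q (blen p)"
      using FP_blen[OF g] ..
    from this[rule_format, of "(replicate i True, x)" for i x] have "length (g i x) \<le> poly q (i + blen x)" for i x
      by simp
    then show thesis by (rule that)
  qed
  obtain r where r: "\<And>x. n x \<le> poly r (blen x)"
    using FP_blen[OF n[unfolded FPN_def]] by auto
  have len: "length (concat (map (\<lambda>i. g i x) [0..<k])) \<le> k * poly q (k + blen x)" for k x
  proof -
    have "length (concat (map (\<lambda>i. g i x) [0..<k])) = (\<Sum>i<k. length (g i x))"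
      by (simp add: length_concat comp_def interv_sum_list_conv_sum_set_nat atLeast0LessThan)
    also have "\<dots> \<le> (\<Sum>i<k. poly q (k + blen x))"
      by (intro sum_mono order.trans[OF q] poly_nat_mono) auto
    finally show ?thesis by simp
  qed
  define B where "B = r + [:0, 1:] + r * pcompose q (r + [:0, 1:])"
  have "FP (\<lambda>x. (F ^^ length (replicate (n x) True)) (([], x), []))"
  proof (rule FP_funpow[OF F n[unfolded FPN_def], where q = B])
    fix x k assume "k \<le> length (replicate (n x) True)"
    then have k: "k \<le> poly r (blen x)" using r[of x] by simp
    have "length (concat (map (\<lambda>i. g i x) [0..<k])) \<le> k * poly q (k + blen x)" by (rule len)
    also have "\<dots> \<le> poly r (blen x) * poly q (poly r (blen x) + blen x)"
      using k by (intro mult_mono poly_nat_mono) auto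
    finally show "blen ((F ^^ k) (([], x), [])) \<le> poly B (blen x)"
      using k by (simp add: Fk B_def poly_pcompose)
  qed (intro fp)
  from FP_snd[OF this] show ?thesis by (simp add: Fk)
qed

lemma FPN_mult [fp]:
  assumes "FPN f" "FPN g"
  shows "FPN (\<lambda>x. f x * g x)"
proof -
  have "concat (map (\<lambda>i. replicate b True) [0..<a]) = replicate (a * b) True" for a b
    by (induction a) (auto simp: replicate_add[symmetric] add.commute)
  moreover have "FP (\<lambda>x. concat (map (\<lambda>i. replicate (g x) True) [0..<f x]))"
    by (intro FP_concat assms FP_replicate FP_comp[OF FP_snd[OF FP_id], of "\<lambda>x. replicate (g x) True"])
  ultimately show ?thesis by (simp add: FPN_def)
qed

lemma FPN_poly [fp]: "FPN f \<Longrightarrow> FPN (\<lambda>x. poly p (f x))"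
  by (induction p) (auto intro!: fp)

definition bit :: "bool list \<Rightarrow> nat \<Rightarrow> bool" where
  "bit l i \<longleftrightarrow> (case drop i l of [] \<Rightarrow> False | b # _ \<Rightarrow> b)"

lemma bit_nth: "bit l i \<longleftrightarrow> i < length l \<and> l ! i"
  by (cases "i < length l") (auto simp: bit_def Cons_nth_drop_Suc[symmetric])

lemma FPP_bit [fp]: "FP l \<Longrightarrow> FPN i \<Longrightarrow> FPP (\<lambda>x. bit (l x) (i x))"
  unfolding bit_def by (intro FPP_hd fp)

lemma FPP_All:
  fixes n :: "'a::ctx \<Rightarrow> nat"
  assumes "FPP (\<lambda>p :: bool list \<times> 'a. P (length (fst p)) (snd p))" "FPN n"
  shows "FPP (\<lambda>x. \<forall>i<n x. P i x)"
proof -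
  have "FPP (\<lambda>x. \<not> (concat (map (\<lambda>i. if P i x then [] else [True]) [0..<n x]) \<noteq> []))"
    by (intro fp FPP_not_Nil assms)
  moreover have "\<not> (concat (map (\<lambda>i. if P i x then [] else [True]) [0..<n x]) \<noteq> []) \<longleftrightarrow>
      (\<forall>i<n x. P i x)" for x
    by (auto simp del: if_image_distrib split: if_splits)
  ultimately show ?thesis by simp
qed

lemma FPP_list_eq [fp]:
  assumes "FP f" "FP g"
  shows "FPP (\<lambda>x. (f x :: bool list) = g x)"
proof -
  have c: "FP (\<lambda>p :: bool list \<times> 'a. f (snd p))" "FP (\<lambda>p :: bool list \<times> 'a. g (snd p))"
    by (intro FP_comp[of snd f] FP_comp[of snd g] fp assms)+
  have "FPP (\<lambda>x. length (f x) = length (g x) \<and> (\<forall>i<length (f x). bit (f x) i = bit (g x) i))"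
    by (intro fp FPP_All assms c)
  moreover have "length xs = length ys \<and> (\<forall>i<length xs. bit xs i = bit ys i) \<longleftrightarrow> xs = ys"
    for xs ys by (auto simp: bit_nth list_eq_iff_nth_eq)
  ultimately show ?thesis by simp
qed

text \<open>Counting the indices with a property is the common source of division, of inner products
  as parities, and of majority votes.\<close>

lemma FPN_count [fp]:
  fixes n :: "'a::ctx \<Rightarrow> nat"
  assumes "FPP (\<lambda>p :: bool list \<times> 'a. P (length (fst p)) (snd p))" "FPN n"
  shows "FPN (\<lambda>x. card {i. i < n x \<and> P i x})"
proof -
  have "FPN (\<lambda>x. length (concat (map (\<lambda>i. if P i x then [True] else []) [0..<n x])))"
    by (intro fp assms)
  moreover have "length (concat (map (\<lambda>i. if P i x then [True] else []) [0..<k])) =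
      card {i. i < k \<and> P i x}" for x k
  proof (induction k)
    case (Suc k)
    have "{i. i < Suc k \<and> P i x} = {i. i < k \<and> P i x} \<union> (if P k x then {k} else {})"
      by (auto simp: less_Suc_eq)
    with Suc show ?case by auto
  qed simp
  ultimately show ?thesis by simp
qed

lemma FPP_odd [fp]:
  assumes "FPN f"
  shows "FPP (\<lambda>x. odd (f x))"
proof -
  define F where "F = (\<lambda>l :: bool list. if l \<noteq> [] then [] else [True])"
  have "FP F" unfolding F_def by (intro fp FPP_not_Nil)
  moreover have Fk: "(F ^^ k) [] = (if odd k then [True] else [])" for k
    by (induction k) (auto simp: F_def)
  ultimately have "FP (\<lambda>x. (F ^^ length (replicate (f x) True)) [])"
    by (intro FP_funpow[where q = 1] fp assms) auto
  then show ?thesis by (simp add: Fk FPP_def)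
qed

text \<open>The quotient is the number of positive multiples of the divisor up to the dividend. The
  guard \<open>0 < g x\<close> gives the value 0 for division by zero.\<close>

lemma FPN_div [fp]:
  assumes "FPN f" "FPN g"
  shows "FPN (\<lambda>x. f x div g x)"
proof -
  have c: "FPN (\<lambda>p :: bool list \<times> 'a. f (snd p))" "FPN (\<lambda>p :: bool list \<times> 'a. g (snd p))"
    using FP_comp[OF FP_snd[OF FP_id] assms(1)[unfolded FPN_def]]
      FP_comp[OF FP_snd[OF FP_id] assms(2)[unfolded FPN_def]] by (simp_all add: FPN_def)
  have "FPN (\<lambda>x. card {i. i < f x \<and> (0 < g x \<and> Suc i * g x \<le> f x)})"
    by (intro fp assms c)
  moreover have "card {i. i < a \<and> (0 < b \<and> Suc i * b \<le> a)} = a div b" for a b :: nat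
  proof (cases "b = 0")
    case False
    have "{i. i < a \<and> (0 < b \<and> Suc i * b \<le> a)} = {..<a div b}"
    proof safe
      fix i assume "Suc i * b \<le> a"
      then have "Suc i \<le> a div b" using False by (simp add: less_eq_div_iff_mult_less_eq)
      then show "i < a div b" by simp
    next
      fix i assume i: "i < a div b"
      then have "Suc i \<le> a div b" by simp
      then have s: "Suc i * b \<le> a" using False by (simp only: less_eq_div_iff_mult_less_eq)
      then show "Suc i * b \<le> a" .
      have "Suc i * 1 \<le> Suc i * b" using False by (intro mult_mono) auto
      with s show "i < a" by simp
    qed (use False in auto)
    then show ?thesis by simp
  qed simp
  ultimately show ?thesis by simp
qed

text \<open>The inner product over the field with two elements, where the shorter argument counts as
  padded with zeros. Thus rows of one fixed width can hash strings of any smaller length.\<close>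

fun ip :: "bool list \<Rightarrow> bool list \<Rightarrow> bool" where
  "ip (x # xs) (y # ys) = ((x \<and> y) \<noteq> ip xs ys)"
| "ip _ _ = False"

lemma ip_card: "ip xs ys = odd (card {i. i < length xs \<and> (bit xs i \<and> bit ys i)})"
proof (induction xs ys rule: ip.induct)
  case (1 x xs y ys)
  let ?A = "{i. i < length xs \<and> (bit xs i \<and> bit ys i)}"
  have "{i. i < length (x # xs) \<and> (bit (x # xs) i \<and> bit (y # ys) i)} =
      Suc ` ?A \<union> (if x \<and> y then {0} else {})"
  proof (rule set_eqI)
    fix k
    show "k \<in> {i. i < length (x # xs) \<and> (bit (x # xs) i \<and> bit (y # ys) i)} \<longleftrightarrow>
        k \<in> Suc ` ?A \<union> (if x \<and> y then {0} else {})"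
      by (cases k) (auto simp: bit_nth)
  qed
  moreover have "card (Suc ` ?A \<union> (if x \<and> y then {0} else {})) = card ?A + of_bool (x \<and> y)"
    by (subst card_Un_disjoint) (auto simp: card_image)
  ultimately show ?case using 1 by auto
qed (auto simp: bit_nth)

lemma FPP_ip [fp]:
  assumes "FP f" "FP g"
  shows "FPP (\<lambda>x. ip (f x) (g x))"
proof -
  have c: "FP (\<lambda>p :: bool list \<times> 'a. f (snd p))" "FP (\<lambda>p :: bool list \<times> 'a. g (snd p))"
    by (intro FP_comp[of snd f] FP_comp[of snd g] fp assms)+
  show ?thesis unfolding ip_card by (intro fp assms c)
qed

definition xor :: "bool list \<Rightarrow> bool list \<Rightarrow> bool list" where
  "xor xs ys = map2 (\<noteq>) xs ys"

lemma xor_concat: "xor xs ys = concat (map (\<lambda>i. [bit xs i \<noteq> bit ys i]) [0..<min (length xs) (length ys)])"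
proof -
  have "concat (map (\<lambda>i. [h i]) is) = map h is" for h :: "nat \<Rightarrow> bool" and "is"
    by (induction "is") auto
  then show ?thesis
    unfolding xor_def by (auto intro!: nth_equalityI simp: bit_nth)
qed

lemma FP_xor [fp]:
  assumes "FP f" "FP g"
  shows "FP (\<lambda>x. xor (f x) (g x))"
proof -
  have c: "FP (\<lambda>p :: bool list \<times> 'a. f (snd p))" "FP (\<lambda>p :: bool list \<times> 'a. g (snd p))"
    by (intro FP_comp[of snd f] FP_comp[of snd g] fp assms)+
  show ?thesis unfolding xor_concat by (intro fp assms c)
qed

section \<open>Simulation of Turing machines\<close>

text \<open>A tape is split at its head into two stacks of symbols, the second one starting with the
  scanned cell; cells beyond the stacks are blank.\<close>

definition sget :: "symbol list \<Rightarrow> nat \<Rightarrow> symbol" where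
  "sget l i = (if i < length l then l ! i else None)"

definition shd :: "symbol list \<Rightarrow> symbol" where
  "shd l = (case l of [] \<Rightarrow> None | s # _ \<Rightarrow> s)"

definition split_tape :: "symbol list \<Rightarrow> symbol list \<Rightarrow> tape \<Rightarrow> bool" where
  "split_tape l r t \<longleftrightarrow>
     (\<forall>i. fst t (snd t + int i) = sget r i \<and> fst t (snd t - 1 - int i) = sget l i)"

fun split_act :: "symbol \<times> move \<Rightarrow> symbol list \<times> symbol list \<Rightarrow> symbol list \<times> symbol list" where
  "split_act (s, Stay) (l, r) = (l, s # r)"
| "split_act (s, MoveRight) (l, r) = (s # l, r)"
| "split_act (s, MoveLeft) (l, r) = (tl l, shd l # s # r)"

lemma sget_Cons: "sget (s # l) i = (case i of 0 \<Rightarrow> s | Suc j \<Rightarrow> sget l j)"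
  by (auto simp: sget_def split: nat.splits)

lemma sget_tl: "sget (tl l) i = sget l (Suc i)"
  by (cases l) (auto simp: sget_def)

lemma sget_0: "sget l 0 = shd l"
  by (cases l) (auto simp: sget_def shd_def)

lemma split_tape_read: "split_tape l r t \<Longrightarrow> read_tape t = shd r"
  unfolding split_tape_def by (cases t) (metis read_tape.simps sget_0 add_0_right fst_conv of_nat_0 snd_conv)

lemma split_tape_act:
  assumes "split_tape l r t"
  shows "split_tape (fst (split_act (s, m) (l, tl r))) (snd (split_act (s, m) (l, tl r))) (act (s, m) t)"
proof -
  obtain f p where t: "t = (f, p)" by fastforce
  have r: "f (p + int i) = sget r i" and l: "f (p - 1 - int i) = sget l i" for i
    using assms by (auto simp: split_tape_def t)
  have r': "f (p + 1 + int i) = sget (tl r) i" and l': "f (p - 2 - int i) = sget (tl l) i" for i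
    using r[of "Suc i"] l[of "Suc i"] by (simp_all add: sget_tl algebra_simps)
  show ?thesis
  proof (cases m)
    case MoveLeft
    have "f (p - 1) = shd l" using l[of 0] by (simp add: sget_0)
    then show ?thesis
      using r' l' by (auto simp: MoveLeft split_tape_def t sget_Cons algebra_simps split: nat.splits)
  next
    case Stay
    then show ?thesis
      using r' l by (auto simp: split_tape_def t sget_Cons algebra_simps split: nat.splits)
  next
    case MoveRight
    then show ?thesis
      using r' l by (auto simp: split_tape_def t sget_Cons algebra_simps split: nat.splits)
  qed
qed

primrec encs :: "symbol list \<Rightarrow> bool list" where
  "encs [] = []"
| "encs (s # l) = (case s of None \<Rightarrow> [False, False] | Some b \<Rightarrow> [True, b]) @ encs l"

definition pushsym :: "nat \<Rightarrow> symbol \<Rightarrow> com" where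
  "pushsym v s = (case s of None \<Rightarrow> Push v False ;; Push v False | Some b \<Rightarrow> Push v b ;; Push v True)"

text \<open>There are no variables for symbols: the symbol read selects a copy of the continuation
  \<open>F\<close>, that is, it is remembered in the control state. An empty stack acts as an
  unlimited supply of blanks.\<close>

definition popsym :: "nat \<Rightarrow> (symbol \<Rightarrow> com) \<Rightarrow> com" where
  "popsym v F = Case v (F None)
     (Pop v ;; Case v Skip (Pop v ;; F (Some True)) (Pop v ;; F (Some False)))
     (Pop v ;; Pop v ;; F None)"

lemma exec_pushsym: "e v = encs l \<Longrightarrow> exec (pushsym v s) e = e(v := encs (s # l))"
  by (auto simp: pushsym_def fun_eq_iff split: option.splits)

lemma exec_popsym:
  "e v = encs l \<Longrightarrow> exec (popsym v F) e = exec (F (shd l)) (e(v := encs (tl l)))"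
proof (cases l)
  case (Cons s l')
  assume "e v = encs l"
  with Cons show ?thesis by (cases s) (auto simp: popsym_def pop_def shd_def)
qed (auto simp: popsym_def shd_def fun_upd_idem)

text \<open>Registers 0, 1, 3 and 7 are those of the first four components of nested pairs. So the
  coins, the input and the padding of tape 1 are already in place, and both halves of tape 1 can be
  read off as components. Register 2 holds the control state in unary.\<close>

definition Lr :: "nat \<Rightarrow> nat" where "Lr j = (if j = 1 then 3 else 8 + 2 * j)"

definition Rr :: "nat \<Rightarrow> nat" where
  "Rr j = (if j = 0 then 1 else if j = 1 then 7 else 9 + 2 * j)"

lemma Lr_Rr [simp]:
  "Lr i = Lr j \<longleftrightarrow> i = j" "Rr i = Rr j \<longleftrightarrow> i = j" "Lr i \<noteq> Rr j" "Rr j \<noteq> Lr i"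
  "0 < Lr i" "0 < Rr i" "Lr i \<noteq> 0" "Rr i \<noteq> 0" "Lr i \<noteq> 2" "Rr i \<noteq> 2" "Lr i \<noteq> Suc (Suc 0)" "Rr i \<noteq> Suc (Suc 0)"
  by (auto simp: Lr_def Rr_def) presburger+

definition sim_env ::
  "nat \<Rightarrow> env \<Rightarrow> bool list \<Rightarrow> bool list \<Rightarrow> (nat \<Rightarrow> symbol list) \<Rightarrow> (nat \<Rightarrow> symbol list) \<Rightarrow> bool" where
  "sim_env k e r q L R \<longleftrightarrow> e 0 = r \<and> e 2 = q \<and>
     (\<forall>j<k. e (Lr j) = encs (L j) \<and> e (Rr j) = encs (R j)) \<and>
     (\<forall>v. v \<noteq> 0 \<longrightarrow> v \<noteq> 2 \<longrightarrow> (\<forall>j<k. v \<noteq> Lr j \<and> v \<noteq> Rr j) \<longrightarrow> e v = [])"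

lemma sim_env_upd:
  assumes "sim_env k e r q L R"
  shows "sim_env k (e(0 := r')) r' q L R" "sim_env k (e(2 := q')) r q' L R"
    "j < k \<Longrightarrow> sim_env k (e(Lr j := encs l)) r q (L(j := l)) R"
    "j < k \<Longrightarrow> sim_env k (e(Rr j := encs l)) r q L (R(j := l))"
  using assms by (auto simp: sim_env_def)

text \<open>A decision tree over all combinations of scanned symbols, with a copy of
  \<open>F\<close> at every leaf; \<open>acc\<close> is known at compile time.\<close>

primrec disp :: "nat \<Rightarrow> symbol list \<Rightarrow> (symbol list \<Rightarrow> com) \<Rightarrow> com" where
  "disp 0 acc F = F acc"
| "disp (Suc n) acc F = popsym (Rr n) (\<lambda>s. disp n (s # acc) F)"

lemma exec_disp:
  assumes "sim_env k e r q L R" "n \<le> k"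
  shows "\<exists>e'. exec (disp n acc F) e = exec (F (map (\<lambda>j. shd (R j)) [0..<n] @ acc)) e' \<and>
    sim_env k e' r q L (\<lambda>j. if j < n then tl (R j) else R j)"
  using assms
proof (induction n arbitrary: acc e R)
  case (Suc n)
  let ?e = "e(Rr n := encs (tl (R n)))"
  have "sim_env k ?e r q L (R(n := tl (R n)))"
    using Suc.prems by (intro sim_env_upd) auto
  from Suc.IH[OF this Suc_leD[OF Suc.prems(2)], of "shd (R n) # acc"] have
    "\<exists>e'. exec (disp n (shd (R n) # acc) F) ?e =
        exec (F (map (\<lambda>j. shd ((R(n := tl (R n))) j)) [0..<n] @ shd (R n) # acc)) e' \<and>
      sim_env k e' r q L (\<lambda>j. if j < n then tl ((R(n := tl (R n))) j) else (R(n := tl (R n))) j)"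
    .
  then obtain e' where
    e': "exec (disp n (shd (R n) # acc) F) ?e =
        exec (F (map (\<lambda>j. shd ((R(n := tl (R n))) j)) [0..<n] @ shd (R n) # acc)) e'"
      "sim_env k e' r q L (\<lambda>j. if j < n then tl ((R(n := tl (R n))) j) else (R(n := tl (R n))) j)"
    by (elim exE conjE)
  have "map (\<lambda>j. shd ((R(n := tl (R n))) j)) [0..<n] = map (\<lambda>j. shd (R j)) [0..<n]"
    by simp
  moreover have "(\<lambda>j. if j < n then tl ((R(n := tl (R n))) j) else (R(n := tl (R n))) j) =
      (\<lambda>j. if j < Suc n then tl (R j) else R j)"
    by (auto simp: fun_eq_iff less_Suc_eq)
  moreover have "exec (disp (Suc n) acc F) e = exec (disp n (shd (R n) # acc) F) ?e"
    using Suc.prems by (simp add: exec_popsym sim_env_def)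
  ultimately show ?case
    using e' by (intro exI[of _ e']) (simp only: upt_Suc_append[OF zero_le] map_append list.simps append_assoc append.simps)
qed (use assms in auto)

definition act_sym :: "nat \<Rightarrow> symbol \<times> move \<Rightarrow> com" where
  "act_sym j a = (case a of (s, m) \<Rightarrow> (case m of
      Stay \<Rightarrow> pushsym (Rr j) s
    | MoveRight \<Rightarrow> pushsym (Lr j) s
    | MoveLeft \<Rightarrow> pushsym (Rr j) s ;; popsym (Lr j) (pushsym (Rr j))))"

lemma exec_act_sym:
  assumes "sim_env k e r q L R" "j < k"
  shows "sim_env k (exec (act_sym j a) e) r q
    (L(j := fst (split_act a (L j, R j)))) (R(j := snd (split_act a (L j, R j))))"
proof -
  obtain s m where a: "a = (s, m)" by fastforce
  have e: "e (Lr j) = encs (L j)" "e (Rr j) = encs (R j)" using assms by (auto simp: sim_env_def)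
  show ?thesis
  proof (cases m)
    case MoveLeft
    let ?e1 = "e(Rr j := encs (s # R j))"
    have 1: "exec (pushsym (Rr j) s) e = ?e1" by (rule exec_pushsym) (rule e)
    have 2: "exec (popsym (Lr j) (pushsym (Rr j))) ?e1 =
        exec (pushsym (Rr j) (shd (L j))) (?e1(Lr j := encs (tl (L j))))"
      by (rule exec_popsym) (simp add: e)
    have 3: "exec (pushsym (Rr j) (shd (L j))) (?e1(Lr j := encs (tl (L j)))) =
        (?e1(Lr j := encs (tl (L j))))(Rr j := encs (shd (L j) # s # R j))"
      by (rule exec_pushsym) simp
    have "sim_env k ((?e1(Lr j := encs (tl (L j))))(Rr j := encs (shd (L j) # s # R j))) r q
        (L(j := tl (L j))) (R(j := s # R j, j := shd (L j) # s # R j))"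
      by (intro sim_env_upd assms)
    then show ?thesis using 1 2 3 by (simp add: act_sym_def a MoveLeft)
  next
    case Stay
    then show ?thesis
      using sim_env_upd(4)[OF assms, of "s # R j"] exec_pushsym[of e "Rr j" "R j" s] e
      by (simp add: act_sym_def a)
  next
    case MoveRight
    then show ?thesis
      using sim_env_upd(3)[OF assms, of "s # L j"] exec_pushsym[of e "Lr j" "L j" s] e
      by (simp add: act_sym_def a)
  qed
qed

primrec acts :: "nat \<Rightarrow> (symbol \<times> move) list \<Rightarrow> com" where
  "acts 0 as = Skip"
| "acts (Suc n) as = acts n as ;; act_sym n (as ! n)"

lemma exec_acts:
  assumes "sim_env k e r q L R" "n \<le> k"
  shows "sim_env k (exec (acts n as) e) r q
    (\<lambda>j. if j < n then fst (split_act (as ! j) (L j, R j)) else L j)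
    (\<lambda>j. if j < n then snd (split_act (as ! j) (L j, R j)) else R j)"
  using assms(2)
proof (induction n)
  case (Suc n)
  let ?L = "\<lambda>n j. if j < n then fst (split_act (as ! j) (L j, R j)) else L j"
  let ?R = "\<lambda>n j. if j < n then snd (split_act (as ! j) (L j, R j)) else R j"
  have "sim_env k (exec (acts n as) e) r q (?L n) (?R n)" using Suc by simp
  from exec_act_sym[OF this, of n "as ! n"]
  have "sim_env k (exec (acts (Suc n) as) e) r q
      ((?L n)(n := fst (split_act (as ! n) (L n, R n)))) ((?R n)(n := snd (split_act (as ! n) (L n, R n))))"
    using Suc.prems by simp
  moreover have "(?L n)(n := fst (split_act (as ! n) (L n, R n))) = ?L (Suc n)"
    "(?R n)(n := snd (split_act (as ! n) (L n, R n))) = ?R (Suc n)"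
    by (auto simp: fun_eq_iff less_Suc_eq)
  ultimately show ?case by simp
qed (use assms in simp)

primrec getq :: "nat \<Rightarrow> nat \<Rightarrow> (nat \<Rightarrow> com) \<Rightarrow> com" where
  "getq 0 q F = F q"
| "getq (Suc n) q F = Case 2 (F q) (Pop 2 ;; getq n (Suc q) F) Skip"

lemma exec_getq:
  "e 2 = replicate d True \<Longrightarrow> d \<le> n \<Longrightarrow> exec (getq n q F) e = exec (F (q + d)) (e(2 := []))"
proof (induction n arbitrary: d q e)
  case (Suc n)
  show ?case
  proof (cases d)
    case (Suc d')
    have "pop 2 e 2 = replicate d' True" using Suc Suc.prems by (simp add: pop_def)
    from Suc.IH[of "pop 2 e" d' "Suc q", OF this] show ?thesis
      using Suc Suc.prems by (simp add: pop_def fun_upd_def cong: if_cong)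
  qed (use Suc.prems in \<open>simp add: fun_upd_idem\<close>)
qed (simp add: fun_upd_idem)

primrec setq :: "nat \<Rightarrow> com" where
  "setq 0 = Skip"
| "setq (Suc n) = Push 2 True ;; setq n"

lemma exec_setq: "e 2 = replicate d True \<Longrightarrow> exec (setq n) e = e(2 := replicate (n + d) True)"
proof (induction n arbitrary: d e)
  case (Suc n)
  from Suc.IH[of "e(2 := replicate (Suc d) True)" "Suc d"] Suc.prems show ?case
    by (simp add: fun_upd_def cong: if_cong)
qed (simp add: fun_upd_idem)

definition sim_body :: "machine \<Rightarrow> bool \<Rightarrow> com" where
  "sim_body M b = getq (num_states M) 0 (\<lambda>q. if q = halt_state then setq q
     else disp (num_tapes M) [] (\<lambda>ss.
       acts (num_tapes M) (snd (transition M b q ss)) ;; setq (fst (transition M b q ss))))"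

definition sim_step :: "machine \<Rightarrow> com" where
  "sim_step M = Case 0 Skip (sim_body M True) (sim_body M False)"

text \<open>Loop-free code that leaves register 0 alone. Its cost is at most the constant
  \<open>max_cost\<close>, whatever the registers contain, and it may be the body of a loop over
  register 0.\<close>

primrec safe :: "com \<Rightarrow> bool" where
  "safe Skip = True"
| "safe (Push v b) = (v \<noteq> 0)"
| "safe (Pop v) = (v \<noteq> 0)"
| "safe (c ;; d) = (safe c \<and> safe d)"
| "safe (Case v c0 c1 c2) = (safe c0 \<and> safe c1 \<and> safe c2)"
| "safe (For v c) = False"

primrec max_cost :: "com \<Rightarrow> nat" where
  "max_cost Skip = 0"
| "max_cost (Push v b) = 2"
| "max_cost (Pop v) = 1"
| "max_cost (c ;; d) = max_cost c + max_cost d"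
| "max_cost (Case v c0 c1 c2) = 2 + max_cost c0 + max_cost c1 + max_cost c2"
| "max_cost (For v c) = 0"

lemma safeD: "safe c \<Longrightarrow> wf_com c \<and> 0 \<notin> writes c \<and> cost c e \<le> max_cost c"
proof (induction c arbitrary: e)
  case (Seq c d)
  from Seq(1)[of e] Seq(2)[of "exec c e"] Seq(3) show ?case by auto
next
  case (Case v c0 c1 c2)
  from Case(1)[of e] Case(2)[of e] Case(3)[of e] Case(4) show ?case by (auto split: list.splits)
qed auto

lemma safe_pushsym: "v \<noteq> 0 \<Longrightarrow> safe (pushsym v s)"
  by (auto simp: pushsym_def split: option.splits)

lemma safe_popsym: "v \<noteq> 0 \<Longrightarrow> (\<And>s. safe (F s)) \<Longrightarrow> safe (popsym v F)"
  by (auto simp: popsym_def)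

lemma safe_disp: "(\<And>ss. safe (F ss)) \<Longrightarrow> safe (disp n acc F)"
  by (induction n arbitrary: acc) (auto intro: safe_popsym)

lemma safe_acts: "safe (acts n as)"
  by (induction n) (auto simp: act_sym_def intro!: safe_pushsym safe_popsym split: prod.splits move.splits)

lemma safe_getq: "(\<And>q. safe (F q)) \<Longrightarrow> safe (getq n q F)"
  by (induction n arbitrary: q) auto

lemma safe_setq: "safe (setq n)"
  by (induction n) auto

lemma safe_sim_step: "safe (sim_step M)"
  by (auto simp: sim_step_def sim_body_def intro!: safe_getq safe_setq safe_disp safe_acts)

text \<open>The stack left of the head of tape 1 starts with \<open>p\<close> blanks, so that its height shows the
  position of that head.\<close>

definition sim_rel ::
  "machine \<Rightarrow> nat \<Rightarrow> config \<Rightarrow> (nat \<Rightarrow> symbol list) \<Rightarrow> (nat \<Rightarrow> symbol list) \<Rightarrow> bool" where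
  "sim_rel M p c L R \<longleftrightarrow> fst c < num_states M \<and> length (snd c) = num_tapes M \<and>
     (\<forall>j<num_tapes M. split_tape (L j) (R j) (snd c ! j)) \<and>
     int (length (L 1)) = int p + snd (snd c ! 1)"

lemma exec_sim_body:
  assumes M: "turing_machine M" and s: "sim_env (num_tapes M) e r (replicate (fst c) True) L R"
    and c: "sim_rel M p c L R" and p: "snd (snd c ! 1) > - int p"
  shows "\<exists>L' R'. sim_env (num_tapes M) (exec (sim_body M b) e) r
    (replicate (fst (step M b c)) True) L' R' \<and> sim_rel M p (step M b c) L' R'"
proof -
  let ?k = "num_tapes M"
  have k: "?k \<ge> 2" using M by (simp add: turing_machine_def)
  obtain q ts where qts: "c = (q, ts)" by fastforce
  have q: "q < num_states M" "length ts = ?k" "e 2 = replicate q True"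
    using c s by (auto simp: sim_rel_def qts sim_env_def)
  have s': "sim_env ?k (e(2 := [])) r [] L R" by (rule sim_env_upd(2)[OF s])
  let ?F = "\<lambda>q. if q = halt_state then setq q
     else disp ?k [] (\<lambda>ss. acts ?k (snd (transition M b q ss)) ;; setq (fst (transition M b q ss)))"
  have body: "exec (sim_body M b) e = exec (?F q) (e(2 := []))"
    unfolding sim_body_def using exec_getq[where d = q and q = 0] q by simp
  show ?thesis
  proof (cases "q = halt_state")
    case True
    have "exec (setq q) (e(2 := [])) = e"
      using exec_setq[of "e(2 := [])" 0 q] q(3) by (simp add: fun_upd_idem)
    then show ?thesis
      using True s c body by (auto simp: qts step_def halted_def)
  next
    case False
    let ?ss = "map (\<lambda>j. shd (R j)) [0..<?k]"
    obtain q' as where tr: "transition M b q ?ss = (q', as)" by fastforce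
    have "fst (transition M b q ?ss) < num_states M \<and> length (snd (transition M b q ?ss)) = ?k"
      using M q(1) by (simp add: turing_machine_def)
    then have q': "q' < num_states M" "length as = ?k" using tr by simp_all
    have ss: "map read_tape ts = ?ss"
      using c q(2) by (intro nth_equalityI) (auto simp: sim_rel_def qts intro: split_tape_read)
    have step: "step M b c = (q', map2 act as ts)"
      using False by (simp add: step_def halted_def qts ss tr)
    let ?R = "\<lambda>j. if j < ?k then tl (R j) else R j"
    obtain e' where e': "exec (disp ?k [] (\<lambda>ss. acts ?k (snd (transition M b q ss)) ;;
        setq (fst (transition M b q ss)))) (e(2 := [])) = exec (acts ?k as ;; setq q') e'"
      "sim_env ?k e' r [] L ?R"
      using exec_disp[OF s' order_refl, of "[]" "\<lambda>ss. acts ?k (snd (transition M b q ss)) ;;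
        setq (fst (transition M b q ss))"] tr by auto
    let ?L2 = "\<lambda>j. if j < ?k then fst (split_act (as ! j) (L j, ?R j)) else L j"
    let ?R2 = "\<lambda>j. if j < ?k then snd (split_act (as ! j) (L j, ?R j)) else ?R j"
    let ?e2 = "exec (acts ?k as) e'"
    have e2: "sim_env ?k ?e2 r [] ?L2 ?R2" by (rule exec_acts[OF e'(2)]) simp
    have "exec (setq q') ?e2 = ?e2(2 := replicate q' True)"
      using exec_setq[of ?e2 0 q'] e2 by (simp add: sim_env_def)
    then have e3: "exec (sim_body M b) e = ?e2(2 := replicate q' True)"
      using False body e'(1) by simp
    have "sim_env ?k (exec (sim_body M b) e) r (replicate (fst (step M b c)) True) ?L2 ?R2"
      unfolding e3 step fst_conv by (rule sim_env_upd(2)[OF e2])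
    moreover have "sim_rel M p (step M b c) ?L2 ?R2"
    proof -
      have "split_tape (?L2 j) (?R2 j) (map2 act as ts ! j)" if j: "j < ?k" for j
        using j q(2) q'(2) c split_tape_act[of "L j" "R j" "ts ! j" "fst (as ! j)" "snd (as ! j)"]
        by (auto simp: sim_rel_def qts)
      moreover have "int (length (?L2 1)) = int p + snd (map2 act as ts ! 1)"
      proof -
        obtain s m where a: "as ! Suc 0 = (s, m)" by fastforce
        obtain f h where t: "ts ! Suc 0 = (f, h)" by fastforce
        have "int (length (L 1)) = int p + h" using c by (simp add: sim_rel_def qts t)
        \<comment> \<open>A left move pops this stack. If it were empty, \<open>tl\<close> would not
          lower its height, and the height would no longer show the position of the head.\<close>
        moreover have "L 1 \<noteq> []" using calculation p by (auto simp: qts t)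
        ultimately show ?thesis
          using k q(2) q'(2) a t by (cases m) (auto simp: of_nat_diff Suc_le_eq)
      qed
      ultimately show ?thesis
        using q' q(2) by (simp add: sim_rel_def step)
    qed
    ultimately show ?thesis by blast
  qed
qed

lemma head_step:
  assumes "turing_machine M" "fst c < num_states M" "length (snd c) = num_tapes M" "j < num_tapes M"
  shows "\<bar>snd (snd (step M b c) ! j) - snd (snd c ! j)\<bar> \<le> 1"
proof (cases "halted c")
  case False
  obtain q' as where tr: "transition M b (fst c) (map read_tape (snd c)) = (q', as)" by fastforce
  have "length (snd (transition M b (fst c) (map read_tape (snd c)))) = num_tapes M"
    using assms by (simp add: turing_machine_def)
  then have as: "length as = num_tapes M" using tr by simp
  have act: "\<bar>snd (act a t) - snd t\<bar> \<le> 1" for a t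
    by (cases a; cases t; cases "snd a") auto
  have "snd (step M b c) ! j = act (as ! j) (snd c ! j)"
    using False assms as tr by (simp add: step_def)
  then show ?thesis using act[of "as ! j" "snd c ! j"] by simp
qed (simp add: step_def)

text \<open>A head moves by at most one cell per step, so one padding blank per remaining coin
  suffices to keep the left stack of tape 1 nonempty before every step.\<close>

lemma exec_sim:
  assumes M: "turing_machine M"
  shows "sim_env (num_tapes M) e r (replicate (fst c) True) L R \<Longrightarrow> sim_rel M p c L R \<Longrightarrow>
    int (length r) \<le> int p + snd (snd c ! 1) \<Longrightarrow>
    \<exists>L' R'. sim_env (num_tapes M) (exec (For 0 (sim_step M)) e) []
      (replicate (fst (fold (step M) r c)) True) L' R' \<and> sim_rel M p (fold (step M) r c) L' R'"
proof (induction r arbitrary: e c L R)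
  case Nil
  then have "exec (For 0 (sim_step M)) e = e" by (simp add: sim_env_def)
  with Nil show ?case by auto
next
  case (Cons b r)
  have k: "num_tapes M \<ge> 2" using M by (simp add: turing_machine_def)
  have e0: "e 0 = b # r" using Cons.prems(1) by (simp add: sim_env_def)
  obtain L' R' where L': "sim_env (num_tapes M) (exec (sim_body M b) e) (b # r)
    (replicate (fst (step M b c)) True) L' R'" "sim_rel M p (step M b c) L' R'"
    using exec_sim_body[OF M Cons.prems(1,2), of b] Cons.prems(3) by auto
  have "exec (sim_step M) e = exec (sim_body M b) e"
    using e0 by (simp add: sim_step_def)
  then have e: "pop 0 (exec (sim_step M) e) = (exec (sim_body M b) e)(0 := r)"
    using L'(1) by (simp add: pop_def sim_env_def)
  have 1: "sim_env (num_tapes M) (pop 0 (exec (sim_step M) e)) r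
      (replicate (fst (step M b c)) True) L' R'"
    unfolding e by (rule sim_env_upd(1)[OF L'(1)])
  have "\<bar>snd (snd (step M b c) ! 1) - snd (snd c ! 1)\<bar> \<le> 1"
    using M k Cons.prems(2) by (intro head_step) (auto simp: sim_rel_def)
  then have "int (length r) \<le> int p + snd (snd (step M b c) ! 1)"
    using Cons.prems(3) by simp
  from Cons.IH[OF 1 L'(2) this]
  have "\<exists>L' R'. sim_env (num_tapes M) (exec (For 0 (sim_step M)) (pop 0 (exec (sim_step M) e))) []
      (replicate (fst (fold (step M) (b # r) c)) True) L' R' \<and> sim_rel M p (fold (step M) (b # r) c) L' R'"
    by simp
  moreover have "exec (For 0 (sim_step M)) e = exec (For 0 (sim_step M)) (pop 0 (exec (sim_step M) e))"
    using exec_For_Cons(1)[of 0 "sim_step M" e b r] safeD[OF safe_sim_step] e0 by blast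
  ultimately show ?case by simp
qed

lemma cost_sim:
  "cost (For 0 (sim_step M)) e \<le> length (e 0) * (max_cost (sim_step M) + 2) + 1"
proof (induction "e 0" arbitrary: e)
  case Nil
  then show ?case by (simp flip: Nil)
next
  case (Cons b r)
  have w: "0 \<notin> writes (sim_step M)" using safeD[OF safe_sim_step] by blast
  have e0: "e 0 = b # r" using Cons(2) by simp
  have "r = pop 0 (exec (sim_step M) e) 0"
    using exec_unwritten[OF w, of e] e0 by (simp add: pop_def)
  note this and IH = Cons(1)[of "pop 0 (exec (sim_step M) e)", OF this]
  then show ?case
    using safeD[OF safe_sim_step, of M e] exec_For_Cons(2)[of 0 "sim_step M" e b r] w e0
    by (simp del: cost.simps(6))
qed

text \<open>A crude bound, since a push costs more than the one element that it adds; it suffices to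
  pay for clearing the registers after the simulation.\<close>

lemma length_exec: "length (exec c e v) \<le> length (e v) + cost c e"
proof (induction c arbitrary: e)
  case (Seq c d)
  from Seq(1)[of e] Seq(2)[of "exec c e"] show ?case by simp
next
  case (Case w c0 c1 c2)
  from Case(1)[of e] Case(2)[of e] Case(3)[of e] show ?case by (auto split: list.splits)
next
  case (For w c)
  have "length (((\<lambda>e. pop w (exec c e)) ^^ n) e v) \<le>
      length (e v) + loop_cost (\<lambda>e. pop w (exec c e)) (cost c) n e" for n e
  proof (induction n arbitrary: e)
    case (Suc n)
    have "length (pop w (exec c e) v) \<le> length (exec c e v)" by (simp add: pop_def)
    with Suc[of "pop w (exec c e)"] For[of e] show ?case
      by (simp add: funpow_Suc_right del: funpow.simps)
  qed simp
  then show ?case by simp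
qed (auto simp: pop_def)

section \<open>Cleaning up and reading the simulated output\<close>

primrec clear_except :: "nat set \<Rightarrow> nat \<Rightarrow> com" where
  "clear_except S 0 = Skip"
| "clear_except S (Suc n) = clear_except S n ;; (if n \<in> S then Skip else For n Skip)"

lemma clear_except:
  assumes "\<And>v. length (e v) \<le> B"
  shows "exec (clear_except S n) e = (\<lambda>v. if v < n \<and> v \<notin> S then [] else e v)"
    and "cost (clear_except S n) e \<le> n * (2 * B + 1)"
proof -
  have "exec (clear_except S n) e = (\<lambda>v. if v < n \<and> v \<notin> S then [] else e v) \<and>
      cost (clear_except S n) e \<le> n * (2 * B + 1)"
  proof (induction n)
    case (Suc n)
    have "2 * length (e n) + 1 \<le> 2 * B + 1" using assms[of n] by simp
    with Suc show ?case
      by (auto simp del: exec.simps(6) cost.simps(6) simp: exec_clear fun_eq_iff less_Suc_eq)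
  qed simp
  then show "exec (clear_except S n) e = (\<lambda>v. if v < n \<and> v \<notin> S then [] else e v)"
    and "cost (clear_except S n) e \<le> n * (2 * B + 1)" by auto
qed

lemma wf_clear_except: "wf_com (clear_except S n)"
  by (induction n) auto

lemma length_encs [simp]: "length (encs l) = 2 * length l"
  by (induction l) (auto split: option.splits)

lemma encs_nth:
  "i < length l \<Longrightarrow> encs l ! (2 * i) = (l ! i \<noteq> None) \<and> encs l ! (2 * i + 1) = (l ! i = Some True)"
proof (induction l arbitrary: i)
  case (Cons s l)
  show ?case
  proof (cases i)
    case (Suc j)
    with Cons show ?thesis by (auto split: option.splits)
  qed (auto split: option.splits)
qed simp

lemma bit_encs:
  "bit (encs l) (2 * i) \<longleftrightarrow> sget l i \<noteq> None"
  "bit (encs l) (Suc (2 * i)) \<longleftrightarrow> sget l i = Some True"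
proof -
  show "bit (encs l) (2 * i) \<longleftrightarrow> sget l i \<noteq> None"
    using encs_nth[of i l] by (auto simp: bit_nth sget_def)
  show "bit (encs l) (Suc (2 * i)) \<longleftrightarrow> sget l i = Some True"
  proof (cases "i < length l")
    case True
    then show ?thesis using encs_nth[of i l] by (simp add: bit_nth sget_def)
  next
    case False
    then show ?thesis by (simp add: bit_nth sget_def)
  qed
qed

text \<open>Cell \<open>z\<close> of tape 1 is entry \<open>p + z\<close> from the bottom of the
  left stack, and the right stack continues where the left one ends. Each symbol takes two bits, of
  which \<open>h = 0\<close> is the one for being nonblank and \<open>h = 1\<close> the
  value.\<close>

definition cell_bit :: "bool list \<Rightarrow> bool list \<Rightarrow> nat \<Rightarrow> nat \<Rightarrow> nat \<Rightarrow> bool" where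
  "cell_bit l r p h z = (if 2 * (p + z) < length l then bit l (length l - 2 * Suc (p + z) + h)
     else bit r (2 * (p + z) - length l + h))"

text \<open>A cell contributes only if all cells from 0 up to it are nonblank, so that the output
  stops at the first blank. Beyond both stacks everything is blank, which justifies the
  range.\<close>

definition decode_output :: "bool list \<Rightarrow> bool list \<Rightarrow> nat \<Rightarrow> bool list" where
  "decode_output l r p =
     concat (map (\<lambda>z. if \<forall>i<Suc z. cell_bit l r p 0 i then [cell_bit l r p 1 z] else [])
       [0..<length l + length r])"

lemma concat_map_prefix:
  assumes "N \<le> B" "\<And>z. z < N \<Longrightarrow> P z" "\<not> P N"
  shows "concat (map (\<lambda>z. if \<forall>i<Suc z. P i then [f z] else []) [0..<B]) = map f [0..<N]"
  using assms(1)
proof (induction B)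
  case (Suc B)
  show ?case
  proof (cases "N = Suc B")
    case True
    have "concat (map (\<lambda>z. if \<forall>i<Suc z. P i then [f z] else []) [0..<M]) = map f [0..<M]"
      if "M \<le> N" for M
      using that assms(2) by (induction M) (auto simp: less_Suc_eq)
    with True show ?thesis by blast
  next
    case False
    then have "N \<le> B" using Suc.prems by simp
    moreover have "\<not> (\<forall>i<Suc B. P i)" using \<open>N \<le> B\<close> assms(3) by (metis le_imp_less_Suc)
    ultimately show ?thesis using Suc.IH by simp
  qed
qed simp

lemma decode_output:
  assumes "sim_rel M p c L R" "num_tapes M \<ge> 2"
  shows "decode_output (encs (L 1)) (encs (R 1)) p = output_of c"
proof -
  obtain f h where t: "snd c ! Suc 0 = (f, h)" by fastforce
  let ?l = "L 1" and ?r = "R 1"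
  have s: "split_tape ?l ?r (f, h)"
    using assms t by (auto simp: sim_rel_def dest!: spec[of _ "Suc 0"])
  have len: "int (length ?l) = int p + h"
    using assms t by (simp add: sim_rel_def)
  have r: "f (h + int i) = sget ?r i" and l: "f (h - 1 - int i) = sget ?l i" for i
    using s by (auto simp: split_tape_def)
  have f: "f (int z) = (if p + z < length ?l then sget ?l (length ?l - Suc (p + z))
      else sget ?r (p + z - length ?l))" for z
  proof (cases "p + z < length ?l")
    case True
    have "h - 1 - int (length ?l - Suc (p + z)) = int z" using True len by (simp add: of_nat_diff)
    then show ?thesis using l[of "length ?l - Suc (p + z)"] True by (simp only: if_True)
  next
    case False
    have "h + int (p + z - length ?l) = int z" using False len by (simp add: of_nat_diff)
    then show ?thesis using r[of "p + z - length ?l"] False by (simp only: if_False)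
  qed
  have i: "2 * a - 2 * b = 2 * (a - b)" for a b :: nat by simp
  have c0: "cell_bit (encs ?l) (encs ?r) p 0 z \<longleftrightarrow> f (int z) \<noteq> None" for z
    unfolding cell_bit_def length_encs i add_0_right bit_encs f by simp
  have c1: "cell_bit (encs ?l) (encs ?r) p 1 z \<longleftrightarrow> f (int z) = Some True" for z
    unfolding cell_bit_def length_encs i Suc_eq_plus1[symmetric] bit_encs f by simp
  let ?N = "LEAST i. f (int i) = None"
  have ex: "f (int (length ?l + length ?r)) = None" unfolding f by (simp add: sget_def)
  then have N: "f (int ?N) = None" by (rule LeastI)
  have "?N \<le> length ?l + length ?r" using ex by (rule Least_le)
  then have "?N \<le> length (encs ?l) + length (encs ?r)" by simp
  then have "decode_output (encs ?l) (encs ?r) p = map (\<lambda>z. cell_bit (encs ?l) (encs ?r) p 1 z) [0..<?N]"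
    unfolding decode_output_def
    by (rule concat_map_prefix, unfold c0) (use N not_less_Least in auto)
  also have "\<dots> = map (\<lambda>i. the (f (int i))) [0..<?N]"
  proof (rule map_cong)
    fix z assume "z \<in> set [0..<?N]"
    then have "f (int z) \<noteq> None" using not_less_Least by auto
    then show "cell_bit (encs ?l) (encs ?r) p 1 z = the (f (int z))" unfolding c1 by auto
  qed simp
  also have "\<dots> = output_of c" by (simp add: output_of_def tape_content_def t)
  finally show ?thesis .
qed

lemma encs_map_Some: "encs (map Some x) = concat (map (\<lambda>i. True # [bit x i]) [0..<length x])"
proof -
  have "map (\<lambda>i. True # [bit x i]) [0..<length x] = map (\<lambda>b. [True, b]) x"
    by (rule nth_equalityI) (auto simp: bit_nth)
  moreover have "encs (map Some x) = concat (map (\<lambda>b. [True, b]) x)"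
    by (induction x) auto
  ultimately show ?thesis by simp
qed

lemma encs_replicate_None: "encs (replicate n None) = replicate (2 * n) False"
  by (induction n) auto

lemma sim_rel_initial:
  assumes "turing_machine M"
  shows "sim_rel M p (initial_config M x) (\<lambda>j. if j = 1 then replicate p None else [])
    (\<lambda>j. if j = 0 then map Some x else [])"
proof -
  have k: "2 \<le> num_tapes M" using assms by (simp add: turing_machine_def)
  let ?L = "\<lambda>j. if j = 1 then replicate p None else []"
  let ?R = "\<lambda>j. if j = 0 then map Some x else []"
  have "split_tape (?L j) (?R j) (snd (initial_config M x) ! j)" if "j < num_tapes M" for j
  proof (cases "j = 0")
    case True
    then show ?thesis by (auto simp: split_tape_def initial_config_def input_tape_def sget_def)
  next
    case False
    then have "snd (initial_config M x) ! j = blank_tape"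
      using that by (simp add: initial_config_def nth_Cons')
    then show ?thesis using False by (auto simp: split_tape_def blank_tape_def sget_def)
  qed
  moreover have "snd (snd (initial_config M x) ! 1) = 0"
    using k by (simp add: initial_config_def blank_tape_def)
  ultimately show ?thesis
    using assms k by (simp add: sim_rel_def turing_machine_def initial_config_def)
qed

lemma sim_env_initial:
  assumes "2 \<le> k"
  shows "sim_env k (enc (r, (encs l0, (encs l1, [] :: bool list)))) r []
    (\<lambda>j. if j = 1 then l1 else []) (\<lambda>j. if j = 0 then l0 else [])"
proof -
  have e: "enc (r, (x, (y, [] :: bool list))) v =
      (if v = 0 then r else if v = 1 then x else if v = 3 then y else [])" for x y v
    by (auto simp: enc_Pair merge_def enc_bits elim!: evenE oddE)
  show ?thesis
    unfolding sim_env_def e using assms by (auto simp: Lr_def Rr_def split: if_splits)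
qed

text \<open>The coin string is at the same time the loop counter, so the machine is run for as many
  steps as there are coins, each at a cost that depends on the machine only.\<close>

theorem FP_run:
  assumes M: "turing_machine M"
  shows "FP (\<lambda>p. output_of (run M (snd p) (fst p)))"
proof -
  let ?k = "num_tapes M"
  have k: "?k \<ge> 2" using M by (simp add: turing_machine_def)
  define I where "I = (\<lambda>p :: bool list \<times> bool list.
    (snd p, (encs (map Some (fst p)), (encs (replicate (length (snd p)) None), [] :: bool list))))"
  have rep: "replicate (2 * n) False = concat (map (\<lambda>i. [False, False]) [0..<n])" for n
  proof -
    have "replicate (2 * n) False = concat (replicate n [False, False])" by (induction n) auto
    then show ?thesis by (simp add: map_replicate_const)
  qed
  have "FP I"
    unfolding I_def encs_map_Some encs_replicate_None rep
    by (intro fp)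
  then obtain d q where "implements d q I" by (auto simp: FP_def)
  note d = implementsD[OF this]
  define n where "n = 11 + 2 * ?k"
  define c where "c = d ;; For 0 (sim_step M) ;; clear_except {3, 7} n"
  have fin: "\<exists>l r. exec c (enc p) = enc ([] :: bool list, ([] :: bool list, (l, r))) \<and>
      decode_output l r (length (snd p)) = output_of (run M (snd p) (fst p)) \<and>
      length l + length r + cost c (enc p) \<le>
        poly (q + q * [:max_cost (sim_step M) + 2:] + 1 +
          [:n + 1:] * (2 * (q + q + q * [:max_cost (sim_step M) + 2:] + 1) + 1)) (blen p)" for p
  proof -
    obtain x r where p: "p = (x, r)" by fastforce
    let ?e1 = "enc (I p)"
    let ?c0 = "initial_config M x"
    have 1: "sim_env ?k ?e1 r (replicate (fst ?c0) True)
      (\<lambda>j. if j = 1 then replicate (length r) None else []) (\<lambda>j. if j = 0 then map Some x else [])"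
      using sim_env_initial[OF k] by (simp add: I_def p initial_config_def start_state_def)
    have "snd (snd ?c0 ! 1) = 0"
      using k by (simp add: initial_config_def blank_tape_def)
    then obtain L R where LR: "sim_env ?k (exec (For 0 (sim_step M)) ?e1) []
      (replicate (fst (run M r x)) True) L R" "sim_rel M (length r) (run M r x) L R"
      using exec_sim[OF M 1 sim_rel_initial[OF M]] unfolding run_def by auto
    let ?e2 = "exec (For 0 (sim_step M)) ?e1"
    let ?C = "max_cost (sim_step M) + 2"
    let ?Q = "poly q (blen p)"
    have "length (?e1 0) \<le> blen (I p)" by (rule enc_le)
    then have l0: "length (?e1 0) \<le> ?Q" using d(4)[of p] by simp
    have cost2: "cost (For 0 (sim_step M)) ?e1 \<le> ?Q * ?C + 1"
      using cost_sim[of M ?e1] mult_right_mono[OF l0, of ?C] by linarith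
    let ?B = "?Q + ?Q * ?C + 1"
    have B: "length (?e2 v) \<le> ?B" for v
      using length_exec[of "For 0 (sim_step M)" ?e1 v] enc_le[of "I p" v] d(4)[of p] cost2
      by linarith
    note cl = clear_except[of ?e2 ?B "{3, 7}" n, OF B]
    have c: "exec c (enc p) = exec (clear_except {3, 7} n) ?e2"
      by (simp add: c_def d(2) del: exec.simps(6))
    have "exec c (enc p) = enc ([] :: bool list, ([] :: bool list, (encs (L 1), encs (R 1))))"
    proof
      fix v
      have e: "enc ([] :: bool list, ([] :: bool list, (x, y))) v =
          (if v = 3 then x else if v = 7 then y else [])" for x y :: "bool list"
        by (auto simp: enc_Pair merge_def enc_bits elim!: evenE oddE)
      have "v \<noteq> Lr j \<and> v \<noteq> Rr j" if "j < ?k" "v \<ge> n" for j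
        using that by (auto simp: n_def Lr_def Rr_def)
      then have z: "?e2 v = []" if "v \<ge> n"
        using that LR(1) by (auto simp: sim_env_def n_def)
      have "?e2 3 = encs (L 1)" "?e2 7 = encs (R 1)"
        using LR(1) k by (auto simp: sim_env_def Lr_def Rr_def dest!: spec[of _ 1])
      then show "exec c (enc p) v = enc ([] :: bool list, ([] :: bool list, (encs (L 1), encs (R 1)))) v"
        unfolding c cl(1) e using z k by (auto simp: n_def)
    qed
    moreover have "decode_output (encs (L 1)) (encs (R 1)) (length (snd p)) =
        output_of (run M (snd p) (fst p))"
      using decode_output[OF LR(2) k] by (simp add: p)
    moreover have "length (encs (L 1)) \<le> ?B" "length (encs (R 1)) \<le> ?B"
      using B[of 3] B[of 7] LR(1) k by (auto simp: sim_env_def Lr_def Rr_def dest!: spec[of _ 1])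
    moreover have "cost c (enc p) \<le> ?Q + (?Q * ?C + 1) + n * (2 * ?B + 1)"
      using d(3)[of p] cost2 cl(2) by (simp add: c_def d(2) del: exec.simps(6) cost.simps(6))
    ultimately show ?thesis
      by (intro exI[of _ "encs (L 1)"] exI[of _ "encs (R 1)"]) (simp add: algebra_simps)
  qed
  then obtain l r where lr: "\<And>p. exec c (enc p) = enc ([] :: bool list, ([] :: bool list, (l p, r p)))"
    "\<And>p. decode_output (l p) (r p) (length (snd p)) = output_of (run M (snd p) (fst p))"
    "\<And>p. length (l p) + length (r p) + cost c (enc p) \<le>
      poly (q + q * [:max_cost (sim_step M) + 2:] + 1 +
          [:n + 1:] * (2 * (q + q + q * [:max_cost (sim_step M) + 2:] + 1) + 1)) (blen p)"
    by metis
  have "FP (\<lambda>p. ([] :: bool list, ([] :: bool list, (l p, r p))))"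
  proof (rule FPI[of c])
    show "wf_com c"
      using d(1) safeD[OF safe_sim_step] by (auto simp: c_def wf_clear_except)
    show "cost c (enc p) \<le> poly (q + q * [:max_cost (sim_step M) + 2:] + 1 +
          [:n + 1:] * (2 * (q + q + q * [:max_cost (sim_step M) + 2:] + 1) + 1)) (blen p)" for p :: "bool list \<times> bool list"
      using lr(3)[of p] by linarith
    show "blen ([] :: bool list, ([] :: bool list, (l p, r p))) \<le>
       poly (q + q * [:max_cost (sim_step M) + 2:] + 1 +
          [:n + 1:] * (2 * (q + q + q * [:max_cost (sim_step M) + 2:] + 1) + 1)) (blen p)" for p
      using lr(3)[of p] by simp
  qed (rule lr)
  from FP_snd[OF FP_snd[OF this]] have FPlr: "FP (\<lambda>p. (l p, r p))" by simp
  have "FP (\<lambda>s :: (bool list \<times> bool list) \<times> bool list.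
      decode_output (fst (fst s)) (snd (fst s)) (length (snd s)))"
    unfolding decode_output_def cell_bit_def
    by (intro fp FPP_All FPP_If)
  from FP_comp[OF FP_Pair[OF FPlr FP_snd[OF FP_id]] this]
  show ?thesis by (simp add: lr(2))
qed

section \<open>Probabilistic machines from programs\<close>

lemma finite_bits [simp]: "finite {x :: bool list. length x = n}"
  using finite_lists_length_eq[of "UNIV :: bool set" n] by simp

lemma card_bits [simp]: "card {x :: bool list. length x = n} = 2 ^ n"
  using card_lists_length_eq[of "UNIV :: bool set" n] by simp

lemma ex_bits [simp]: "\<exists>x :: bool list. length x = n"
  using length_replicate[of n True] by blast

lemma set_uniform_bits [simp]: "set_pmf (uniform_bits n) = {x. length x = n}"
  by (simp add: uniform_bits_def)

lemma uniform_bits_add: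
  "uniform_bits (m + n) = map_pmf (\<lambda>(x, y). x @ y) (pair_pmf (uniform_bits m) (uniform_bits n))"
proof -
  let ?S = "\<lambda>n. {x :: bool list. length x = n}"
  have "bij_betw (\<lambda>(x, y). x @ y) (?S m \<times> ?S n) (?S (m + n))"
    by (rule bij_betw_byWitness[where f' = "\<lambda>z. (take m z, drop m z)"]) auto
  then have "map_pmf (\<lambda>(x, y). x @ y) (pmf_of_set (?S m \<times> ?S n)) = pmf_of_set (?S (m + n))"
    by (intro map_pmf_of_set_bij_betw) auto
  moreover have "pmf_of_set (?S m \<times> ?S n) = pair_pmf (pmf_of_set (?S m)) (pmf_of_set (?S n))"
    by (rule pmf_eqI) (auto simp: pmf_pair indicator_def)
  ultimately show ?thesis by (simp add: uniform_bits_def)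
qed

lemma map_take_uniform: "map_pmf (take m) (uniform_bits (m + n)) = uniform_bits m"
proof -
  have "map_pmf (take m) (uniform_bits (m + n)) = map_pmf fst (pair_pmf (uniform_bits m) (uniform_bits n))"
    unfolding uniform_bits_add map_pmf_comp by (rule map_pmf_cong) auto
  then show ?thesis by (simp add: map_fst_pair_pmf)
qed

lemma map_drop_uniform: "map_pmf (drop m) (uniform_bits (m + n)) = uniform_bits n"
proof -
  have "map_pmf (drop m) (uniform_bits (m + n)) = map_pmf snd (pair_pmf (uniform_bits m) (uniform_bits n))"
    unfolding uniform_bits_add map_pmf_comp by (rule map_pmf_cong) auto
  then show ?thesis by (simp add: map_snd_pair_pmf)
qed

lemma map_rev_uniform: "map_pmf rev (uniform_bits n) = uniform_bits n"
  unfolding uniform_bits_def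
  by (intro map_pmf_of_set_bij_betw bij_betw_byWitness[where f' = rev]) auto

lemma step_halted: "halted c \<Longrightarrow> fold (step M) r c = c"
  by (induction r) (auto simp: step_def)

lemma run_append: "run M (r @ r') x = fold (step M) r' (run M r x)"
  by (simp add: run_def)

lemma run_halted: "halted (run M r x) \<Longrightarrow> run M (r @ r') x = run M r x"
  by (simp add: run_append step_halted)

lemma halts_within_mono:
  assumes "halts_within M t x" "t \<le> t'"
  shows "halts_within M t' x"
  unfolding halts_within_def
proof (intro allI impI)
  fix r :: "bool list" assume r: "length r = t'"
  then have h: "halted (run M (take t r) x)" using assms by (simp add: halts_within_def)
  have "run M (take t r @ drop t r) x = run M (take t r) x" by (rule run_halted[OF h])
  with h show "halted (run M r x)" by simp
qed

text \<open>Coins after halting are ignored, so any time bound that is valid for all coins gives the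
  same distribution as the least one.\<close>

lemma result_eq:
  assumes "halts_within M t x"
  shows "result M x = map_pmf (\<lambda>r. output_of (run M r x)) (uniform_bits t)"
proof -
  let ?t = "running_time M x"
  have h: "halts_within M ?t x" unfolding running_time_def by (rule LeastI) (rule assms)
  have "?t \<le> t" unfolding running_time_def by (rule Least_le) (rule assms)
  then obtain d where t: "t = ?t + d" using le_Suc_ex by blast
  have "map_pmf (\<lambda>r. output_of (run M r x)) (uniform_bits t) =
      map_pmf (\<lambda>r. output_of (run M (take ?t r) x)) (uniform_bits (?t + d))"
    unfolding t
  proof (rule map_pmf_cong)
    fix r assume "r \<in> set_pmf (uniform_bits (?t + d))"
    then have "halted (run M (take ?t r) x)" using h by (simp add: halts_within_def)
    from run_halted[OF this, of "drop ?t r"]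
    show "output_of (run M r x) = output_of (run M (take ?t r) x)" by simp
  qed simp
  also have "\<dots> = map_pmf (\<lambda>r. output_of (run M r x)) (map_pmf (take ?t) (uniform_bits (?t + d)))"
    by (simp add: map_pmf_comp)
  also have "\<dots> = result M x" by (simp add: map_take_uniform result_def)
  finally show ?thesis by simp
qed

text \<open>States 0 and 1 are the start and the halt state, so code is loaded from state 2 on. The
  start step puts the head of tape 1 on cell -1, where an empty stack with that anchor has its
  head.\<close>

definition prog_machine :: "nat \<Rightarrow> instr list \<Rightarrow> machine" where
  "prog_machine k is = \<lparr>num_tapes = k, num_states = 2 + length is,
     transition = (\<lambda>b q ss. if q = 0 then (2, (keep ss)[1 := (ss ! 1, MoveLeft)])
       else if 2 \<le> q \<and> q < 2 + length is then (is ! (q - 2)) b ss else (1, keep ss))\<rparr>"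

lemma prog_machine_simps [simp]:
  "num_tapes (prog_machine k is) = k" "num_states (prog_machine k is) = 2 + length is"
  by (simp_all add: prog_machine_def)

lemma turing_prog_machine:
  assumes "instrs_ok (2 + length is) is" "2 \<le> k" "is \<noteq> []"
  shows "turing_machine (prog_machine k is)"
  using assms
  by (auto simp: turing_machine_def prog_machine_def start_state_def halt_state_def instrs_ok_def)

lemma loaded_prog_machine: "loaded (prog_machine k is) 2 is"
  by (auto simp: loaded_def prog_machine_def)

definition input_env :: "bool list \<Rightarrow> env" where
  "input_env x = (\<lambda>v. if v = 0 then x else [])"

definition input_anchor :: "bool list \<Rightarrow> nat \<Rightarrow> int" where
  "input_anchor x v = (if v = 0 then int (length x) else if v = 1 then - 1 else 0)"

lemma stack_tape_eq:
  "stack_tape v A xs = ((\<lambda>i. cell xs (sgn_tape v * (i - (A v - sgn_tape v * int (length xs))))),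
     A v - sgn_tape v * int (length xs))"
  by (simp add: stack_tape_def Let_def)

lemma input_stack_tape:
  assumes "v \<noteq> 1"
  shows "stack_tape v (input_anchor x) (input_env x v) = (if v = 0 then input_tape x else blank_tape)"
  using assms by (auto simp: stack_tape_eq input_anchor_def input_env_def input_tape_def
      blank_tape_def sgn_tape_def cell_def fun_eq_iff)

lemma output_stack_tape:
  assumes "A 1 = - 1"
  shows "tape_content (stack_tape 1 A xs) = rev xs"
proof -
  have c: "fst (stack_tape 1 A xs) (int i) = cell xs (int (length xs) - 1 - int i)" for i
    using assms by (simp add: stack_tape_eq sgn_tape_def)
  have t: "fst (stack_tape 1 A xs) (int i) = (if i < length xs then Some (rev xs ! i) else None)" for i
  proof (cases "i < length xs")
    case True
    then have "nat (int (length xs) - 1 - int i) = length xs - Suc i" by arith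
    with True show ?thesis unfolding c by (simp add: cell_def rev_nth)
  next
    case False
    then show ?thesis unfolding c by (simp add: cell_def)
  qed
  have "(LEAST i. fst (stack_tape 1 A xs) (int i) = None) = length xs"
    by (rule Least_equality, unfold t) (auto split: if_splits)
  then show ?thesis
    unfolding tape_content_def t by (auto intro!: nth_equalityI)
qed

lemma reaches_start:
  assumes "2 \<le> k"
  shows "reaches (prog_machine k is) 1 (initial_config (prog_machine k is) x)
    (2, tapes k {..<k} (input_anchor x) J (input_env x))"
proof (rule reaches_1)
  fix b
  let ?ts = "input_tape x # replicate (k - 1) blank_tape"
  have "step (prog_machine k is) b (0, ?ts) =
      (2, map2 act ((keep (map read_tape ?ts))[1 := (map read_tape ?ts ! 1, MoveLeft)]) ?ts)"
    by (subst step_instr[OF _ _, of _ _ _ "\<lambda>ss. (2, (keep ss)[1 := (ss ! 1, MoveLeft)])"])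
      (auto simp: prog_machine_def halt_state_def)
  also have "\<dots> = (2, ?ts[1 := act (map read_tape ?ts ! 1, MoveLeft) (?ts ! 1)])"
    using assms by (subst act_keep_update) auto
  also have "?ts[1 := act (map read_tape ?ts ! 1, MoveLeft) (?ts ! 1)] =
      tapes k {..<k} (input_anchor x) J (input_env x)"
  proof (rule nth_equalityI)
    fix v assume "v < length (?ts[1 := act (map read_tape ?ts ! 1, MoveLeft) (?ts ! 1)])"
    then have v: "v < k" using assms by simp
    have b: "act (map read_tape ?ts ! 1, MoveLeft) (?ts ! 1) = stack_tape 1 (input_anchor x) []"
      using assms by (auto simp: blank_tape_def stack_tape_eq input_anchor_def sgn_tape_def cell_def fun_eq_iff)
    show "?ts[1 := act (map read_tape ?ts ! 1, MoveLeft) (?ts ! 1)] ! v =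
        tapes k {..<k} (input_anchor x) J (input_env x) ! v"
    proof (cases "v = 1")
      case True
      then show ?thesis using v b by (simp add: input_env_def)
    next
      case False
      then show ?thesis using v input_stack_tape[OF False, of x] assms
        by (auto simp: nth_Cons')
    qed
  qed (use assms in simp)
  finally show "step (prog_machine k is) b (initial_config (prog_machine k is) x) =
      (2, tapes k {..<k} (input_anchor x) J (input_env x))"
    by (simp add: initial_config_def start_state_def)
qed

text \<open>The only instruction that uses its coin. One coin is stored for every element of
  \<open>u\<close>; the coin of the step that finds \<open>u\<close> empty is lost, whence
  \<open>butlast\<close> below.\<close>

definition flip_instr :: "nat \<Rightarrow> nat \<Rightarrow> nat \<Rightarrow> instr" where
  "flip_instr a u v = (\<lambda>b ss. if ss ! u = None then (a + 1, (keep ss)[v := (ss ! v, MoveRight)])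
     else (a, (keep ss)[u := (None, pop_move u), v := (Some b, MoveLeft)]))"

lemma act_keep_update2:
  assumes "u < length ts" "v < length ts" "u \<noteq> v"
  shows "map2 act ((keep (map read_tape ts))[u := x, v := y]) ts = ts[u := act x (ts ! u), v := act y (ts ! v)]"
proof (rule nth_equalityI)
  fix i assume "i < length (map2 act ((keep (map read_tape ts))[u := x, v := y]) ts)"
  then have i: "i < length ts" by simp
  have "act (read_tape (ts ! i), Stay) (ts ! i) = ts ! i"
    by (cases "ts ! i") simp
  then show "map2 act ((keep (map read_tape ts))[u := x, v := y]) ts ! i =
      ts[u := act x (ts ! u), v := act y (ts ! v)] ! i"
    using i assms by (simp add: nth_list_update keep_def)
qed simp

text \<open>While coins are collected, the head of tape \<open>v\<close> scans the blank above the stack, so that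
  every coin costs a single step; therefore the anchor moves by one.\<close>

lemma run_flips:
  assumes "loaded M a [flip_instr a u v]" "a \<ge> 2" "u < k" "v < k" "u \<noteq> v" "v \<noteq> 1"
    and "length r = Suc (length (e u))"
  shows "fold (step M) r (a, (tapes k {..<k} A J e)[v :=
      (fst (stack_tape v A (e v)), snd (stack_tape v A (e v)) - 1)]) =
    (a + 1, tapes k {..<k} A J (e(u := [], v := rev (butlast r) @ e v)))"
  using assms(7)
proof (induction "e u" arbitrary: e r)
  case Nil
  then obtain b where r: "r = [b]" by (cases r) auto
  let ?T = "tapes k {..<k} A J e"
  let ?h = "(fst (stack_tape v A (e v)), snd (stack_tape v A (e v)) - 1)"
  let ?ts = "?T[v := ?h]"
  have u: "map read_tape ?ts ! u = None"
    using assms Nil read_stack[of u A "e u"] by (simp flip: Nil)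
  have "step M b (a, ?ts) = (a + 1, map2 act ((keep (map read_tape ?ts))[v := (map read_tape ?ts ! v, MoveRight)]) ?ts)"
    using assms u by (subst step_instr[of M b a]) (auto simp: loaded_Cons halt_state_def flip_instr_def)
  also have "\<dots> = (a + 1, ?ts[v := act (map read_tape ?ts ! v, MoveRight) (?ts ! v)])"
    using assms by (subst act_keep_update) auto
  also have "\<dots> = (a + 1, ?T)"
    using assms by (auto simp: stack_tape_eq sgn_tape_def fun_eq_iff nth_list_update intro!: nth_equalityI)
  finally show ?case using Nil by (simp add: r fun_upd_idem)
next
  case (Cons x xs)
  then obtain b r' where r: "r = b # r'" by (cases r) auto
  let ?T = "\<lambda>e. tapes k {..<k} A J e"
  let ?h = "\<lambda>e. (fst (stack_tape v A (e v)), snd (stack_tape v A (e v)) - 1)"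
  let ?ts = "(?T e)[v := ?h e]"
  let ?e = "e(u := xs, v := b # e v)"
  have eu: "e u = x # xs" using Cons(2) by simp
  have u: "map read_tape ?ts ! u \<noteq> None"
    using assms eu read_stack[of u A "e u"] by simp
  have "step M b (a, ?ts) = (a, map2 act ((keep (map read_tape ?ts))[u := (None, pop_move u), v := (Some b, MoveLeft)]) ?ts)"
    using assms u by (subst step_instr[of M b a]) (auto simp: loaded_Cons halt_state_def flip_instr_def)
  also have "\<dots> = (a, ?ts[u := act (None, pop_move u) (?ts ! u), v := act (Some b, MoveLeft) (?ts ! v)])"
    using assms by (subst act_keep_update2) auto
  also have "?ts[u := act (None, pop_move u) (?ts ! u), v := act (Some b, MoveLeft) (?ts ! v)] =
      (?T ?e)[v := ?h ?e]"
  proof (rule nth_equalityI)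
    fix i assume "i < length (?ts[u := act (None, pop_move u) (?ts ! u), v := act (Some b, MoveLeft) (?ts ! v)])"
    then have i: "i < k" by simp
    have 1: "act (None, pop_move u) (stack_tape u A (e u)) = stack_tape u A xs"
      using act_pop[of "e u" u A] eu by simp
    have 2: "act (Some b, MoveLeft) (?h e) = ?h ?e"
      using assms(5,6) by (auto simp: stack_tape_eq sgn_tape_def fun_eq_iff cell_Cons algebra_simps)
    show "?ts[u := act (None, pop_move u) (?ts ! u), v := act (Some b, MoveLeft) (?ts ! v)] ! i =
      (?T ?e)[v := ?h ?e] ! i"
      using i assms 1 2 by (auto simp: nth_list_update)
  qed simp
  finally have s: "step M b (a, ?ts) = (a, (?T ?e)[v := ?h ?e])" .
  have xs: "xs = ?e u" using assms by simp
  have len: "length r' = Suc (length (?e u))" using Cons(3) r eu assms(5) by simp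
  have "fold (step M) r' (a, (?T ?e)[v := ?h ?e]) =
      (a + 1, ?T (?e(u := [], v := rev (butlast r') @ ?e v)))"
    using Cons(1)[of ?e r'] xs len by blast
  moreover have "?e(u := [], v := rev (butlast r') @ ?e v) = e(u := [], v := rev (butlast r) @ e v)"
    using assms(5) len by (auto simp: r fun_eq_iff)
  ultimately show ?case using s by (simp add: r)
qed

text \<open>Register \<open>i\<close> lives on tape \<open>reg_tape i\<close>, which leaves tape 1 for the output.\<close>

definition reg_tape :: "nat \<Rightarrow> nat" where
  "reg_tape i = (if i = 0 then 0 else Suc i)"

lemma inj_reg_tape: "inj reg_tape"
  by (auto simp: inj_def reg_tape_def)

lemma one_notin_reg_tape: "1 \<notin> range reg_tape"
  by (auto simp: reg_tape_def)

lemma halted_reaches_run: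
  assumes "fold (step M) r (initial_config M x) = c" "halted c" "length r \<le> length r'"
    "r = take (length r) r'"
  shows "run M r' x = c"
proof -
  have "run M (r @ drop (length r) r') x = c"
    using assms(1,2) by (simp add: run_append run_def step_halted)
  then show ?thesis using assms(4) by (metis append_take_drop_id)
qed

text \<open>A deterministic phase computes the required number of coins in unary, then the coins are
  collected, then \<open>F\<close> runs. The number of steps of the first phase depends on
  \<open>x\<close> only, so the coins collected are the reversal of a fixed segment of the coin
  string and hence uniform.\<close>

theorem FP_ppt:
  fixes F :: "bool list \<times> bool list \<Rightarrow> bool list" and q :: "nat poly"
  assumes "FP F"
  obtains A where "ppt A"
    "\<And>x. result A x = map_pmf (\<lambda>\<rho>. F (x, \<rho>)) (uniform_bits (poly q (length x)))"
proof -
  define I where "I = (\<lambda>x :: bool list. (x, ([] :: bool list, replicate (poly q (length x)) True)))"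
  have "FP I" unfolding I_def by (intro fp)
  then obtain c1 p1 where "implements c1 p1 I" by (auto simp: FP_def)
  note c1 = implementsD[OF this]
  define G where "G = (\<lambda>p :: bool list \<times> bool list \<times> bool list. F (fst p, fst (snd p)))"
  have "FP G" unfolding G_def by (intro FP_comp[OF _ assms] fp)
  then obtain c2 p2 where "implements c2 p2 G" by (auto simp: FP_def)
  note c2 = implementsD[OF this]
  define d1 where "d1 = rename reg_tape c1"
  define d2 where "d2 = rename reg_tape c2 ;; shift_to 0 1"
  define k where "k = Suc (Max (insert 4 (regs d1 \<union> regs d2)))"
  have k: "regs d1 \<subseteq> {..<k}" "regs d2 \<subseteq> {..<k}" "4 < k"
    by (auto simp: k_def less_Suc_eq_le)
  define a where "a = 2 + csize d1"
  \<comment> \<open>Tapes 4 and 2 belong to registers 3 and 1, which hold the unary count and the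
    empty component of \<open>I\<close>.\<close>
  define prg where "prg = code d1 2 @ [flip_instr a 4 2] @ code d2 (a + 1) @ [goto 1]"
  define A where "A = prog_machine k prg"
  have len: "length prg = csize d1 + csize d2 + 2" by (simp add: prg_def)
  have "instrs_ok (2 + length prg) prg"
    unfolding prg_def instrs_ok_simps len[unfolded prg_def]
    by (intro conjI instrs_ok_code) (auto simp: a_def flip_instr_def)
  then have TM: "turing_machine A"
    unfolding A_def using k by (intro turing_prog_machine) (auto simp: prg_def)
  have l: "loaded A 2 (code d1 2)" "loaded A a [flip_instr a 4 2]"
    "loaded A (a + 1) (code d2 (a + 1))" "loaded A (a + 1 + csize d2) [goto 1]"
    using loaded_prog_machine[of k prg]
    unfolding A_def[symmetric] by (auto simp: prg_def loaded_append loaded_Cons loaded_def[of _ _ "[]"] a_def ac_simps)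
  have wf: "wf_com d1" "wf_com d2"
    using c1 c2 by (auto simp: d1_def d2_def inj_reg_tape shift_to_def)
  define B where "B x = poly q (length x)" for x :: "bool list"
  define t1 where "t1 x = cost d1 (input_env x)" for x
  define T2 where "T2 x = 7 * poly p2 (length x + B x) + 1" for x
  define \<rho> where "\<rho> x r = rev (take (B x) (drop (1 + t1 x) r))" for x and r :: "bool list"
  define N where "N x = (1 + t1 x) + (B x + (1 + (T2 x + 1)))" for x
  have in_enc: "(\<lambda>w. input_env x (reg_tape w)) = enc x" for x
    by (auto simp: input_env_def reg_tape_def enc_bits)
  have main: "halted (run A r x) \<and> output_of (run A r x) = F (x, \<rho> x r)" if r: "length r = N x" for x r
  proof -
    let ?J = "\<lambda>_. blank_tape"
    let ?V = "{..<k}"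
    let ?e0 = "input_env x"
    let ?e1 = "exec d1 ?e0"
    let ?A0 = "input_anchor x"
    \<comment> \<open>An empty stack whose head scans its anchor is the same tape as one with the
      anchor a cell further, whose head scans the blank above it. This is the position in which
      coins are collected.\<close>
    let ?A1 = "?A0(2 := ?A0 2 + 1)"
    define r0 where "r0 = take (1 + t1 x) r"
    define r1 where "r1 = take (B x + 1) (drop (1 + t1 x) r)"
    define r2 where "r2 = drop (B x + 1) (drop (1 + t1 x) r)"
    have rr: "r = r0 @ r1 @ r2" unfolding r0_def r1_def r2_def by (simp only: append_take_drop_id)
    have lr: "length r0 = 1 + t1 x" "length r1 = B x + 1" "length r2 = T2 x + 1"
      using r by (simp_all add: r0_def r1_def r2_def N_def)
    have "reaches A (1 + t1 x) (initial_config A x) (a, tapes k ?V ?A0 ?J ?e1)"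
      unfolding A_def a_def t1_def
      by (rule reaches_trans[OF reaches_start reaches_code]) (use l k wf in \<open>auto simp: A_def\<close>)
    then have 1: "fold (step A) r0 (initial_config A x) = (a, tapes k ?V ?A0 ?J ?e1)"
      using lr(1) by (simp add: reaches_def)
    have e1: "?e1 (reg_tape w) = enc (I x) w" for w
      using fun_cong[OF exec_rename[OF inj_reg_tape, of c1 ?e0], of w] in_enc[of x] c1(2)[of x]
      by (simp add: d1_def)
    have e1_1: "?e1 1 = []"
      using exec_rename_other[OF one_notin_reg_tape, of c1 ?e0] by (simp add: d1_def input_env_def)
    have enc: "enc (y, (z, u)) w = (if w = 0 then y else if w = 1 then z else if w = 3 then u else [])"
      for y z u :: "bool list" and w
      by (auto simp: enc_Pair merge_def enc_bits elim!: evenE oddE)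
    have e1_2: "?e1 2 = []" and e1_4: "length (?e1 4) = B x"
      using e1[of 1] e1[of 3] by (simp_all add: I_def enc B_def reg_tape_def numeral_2_eq_2)
    let ?h = "(fst (stack_tape 2 ?A1 (?e1 2)), snd (stack_tape 2 ?A1 (?e1 2)) - 1)"
    have "cell [] z = None" for z by (simp add: cell_def)
    then have h: "stack_tape 2 ?A0 (?e1 2) = ?h"
      by (simp add: e1_2 stack_tape_eq sgn_tape_def)
    have "tapes k ?V ?A0 ?J ?e1 = (tapes k ?V ?A1 ?J ?e1)[2 := ?h]"
    proof (rule nth_equalityI)
      fix i assume "i < length (tapes k ?V ?A0 ?J ?e1)"
      then have i: "i < k" by simp
      have "i \<noteq> 2 \<Longrightarrow> stack_tape i ?A1 (?e1 i) = stack_tape i ?A0 (?e1 i)"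
        by (simp add: stack_tape_def)
      with i h show "tapes k ?V ?A0 ?J ?e1 ! i = (tapes k ?V ?A1 ?J ?e1)[2 := ?h] ! i"
        by (cases "i = 2") simp_all
    qed simp
    then have "fold (step A) r1 (a, tapes k ?V ?A0 ?J ?e1) =
        (a + 1, tapes k ?V ?A1 ?J (?e1(4 := [], 2 := rev (butlast r1) @ ?e1 2)))"
      using run_flips[OF l(2), of k r1 ?e1 ?A1 ?J] k lr(2) e1_4 by (simp add: a_def)
    moreover have "rev (butlast r1) = \<rho> x r"
      using lr(2) by (simp add: r1_def \<rho>_def butlast_take)
    ultimately have 2: "fold (step A) r1 (a, tapes k ?V ?A0 ?J ?e1) =
        (a + 1, tapes k ?V ?A1 ?J (?e1(4 := [], 2 := \<rho> x r)))"
      by (simp add: e1_2)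
    let ?e2 = "?e1(4 := [], 2 := \<rho> x r)"
    have "?e2 (reg_tape w) = enc (x, (\<rho> x r, [] :: bool list)) w" for w
    proof -
      have "?e2 (reg_tape w) = (if w = 1 then \<rho> x r else if w = 3 then [] else ?e1 (reg_tape w))"
        by (simp add: reg_tape_def)
      then show ?thesis unfolding e1 by (simp add: I_def enc)
    qed
    then have e2: "(\<lambda>w. ?e2 (reg_tape w)) = enc (x, (\<rho> x r, [] :: bool list))" by blast
    let ?e3 = "exec (rename reg_tape c2) ?e2"
    let ?e4 = "exec d2 ?e2"
    have "?e3 0 = F (x, \<rho> x r)"
      using fun_cong[OF exec_rename[OF inj_reg_tape, of c2 ?e2], of 0] e2 c2(2)
      by (simp add: reg_tape_def enc_bits G_def)
    moreover have "?e3 1 = []"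
      using exec_rename_other[OF one_notin_reg_tape, of c2 ?e2] e1_1 by simp
    ultimately have e4: "?e4 1 = rev (F (x, \<rho> x r))"
      by (simp add: d2_def shift_to)
    have "length (\<rho> x r) = B x" using r by (simp add: \<rho>_def N_def)
    then have bl: "blen (x, (\<rho> x r, [] :: bool list)) = length x + B x" by simp
    have "cost (rename reg_tape c2) ?e2 \<le> poly p2 (length x + B x)"
      using c2(3)[of "(x, (\<rho> x r, []))"] bl by (simp only: cost_rename[OF inj_reg_tape] e2)
    moreover have "length (?e3 0) \<le> poly p2 (length x + B x)"
      using c2(4)[of "(x, (\<rho> x r, []))"] bl \<open>?e3 0 = F (x, \<rho> x r)\<close> by (simp add: G_def)
    ultimately have cost: "cost d2 ?e2 \<le> T2 x"
      using shift_to(2)[of 0 1 ?e3] by (simp add: d2_def T2_def)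
    have "reaches A (cost d2 ?e2 + 1) (a + 1, tapes k ?V ?A1 ?J ?e2) (1, tapes k ?V ?A1 ?J ?e4)"
      by (rule reaches_trans[OF reaches_code step_goto[OF l(4)]]) (use l k wf in \<open>auto simp: a_def\<close>)
    moreover have "length (take (cost d2 ?e2 + 1) r2) = cost d2 ?e2 + 1" using cost lr(3) by simp
    ultimately have 3: "fold (step A) (take (cost d2 ?e2 + 1) r2) (a + 1, tapes k ?V ?A1 ?J ?e2) =
        (1, tapes k ?V ?A1 ?J ?e4)"
      unfolding reaches_def by blast
    have "run A r x = (1, tapes k ?V ?A1 ?J ?e4)"
    proof (rule halted_reaches_run[of A "r0 @ r1 @ take (cost d2 ?e2 + 1) r2"])
      show "fold (step A) (r0 @ r1 @ take (cost d2 ?e2 + 1) r2) (initial_config A x) =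
          (1, tapes k ?V ?A1 ?J ?e4)"
        by (simp only: fold_append comp_apply 1 2 3)
    qed (use cost lr in \<open>auto simp: rr halted_def halt_state_def\<close>)
    moreover have "output_of (1, tapes k ?V ?A1 ?J ?e4) = F (x, \<rho> x r)"
      using k(3) output_stack_tape[of ?A1 "?e4 1"] arg_cong[OF e4, of rev]
      by (simp add: output_of_def input_anchor_def)
    ultimately show ?thesis by (simp add: halted_def halt_state_def)
  qed
  have halts: "halts_within A (N x) x" for x
    using main by (simp add: halts_within_def)
  show thesis
  proof (rule that[of A])
    have "N x \<le> poly (2 + p1 + q + 7 * pcompose p2 ([:0, 1:] + q) + 2) (length x)" for x
    proof -
      have "t1 x \<le> poly p1 (length x)"
        using c1(3)[of x] by (simp add: t1_def d1_def cost_rename[OF inj_reg_tape] in_enc)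
      then show ?thesis by (simp add: N_def T2_def B_def poly_pcompose)
    qed
    then show "ppt A" unfolding ppt_def using TM halts halts_within_mono by blast
    fix x
    have "result A x = map_pmf (\<lambda>r. output_of (run A r x)) (uniform_bits (N x))"
      by (rule result_eq[OF halts])
    also have "\<dots> = map_pmf (\<lambda>r. F (x, rev (take (B x) (drop (1 + t1 x) r)))) (uniform_bits (N x))"
      by (rule map_pmf_cong) (use main in \<open>auto simp: \<rho>_def\<close>)
    also have "\<dots> = map_pmf (\<lambda>\<rho>. F (x, \<rho>)) (map_pmf rev (map_pmf (take (B x)) (map_pmf (drop (1 + t1 x)) (uniform_bits (N x)))))"
      by (simp add: map_pmf_comp)
    also have "\<dots> = map_pmf (\<lambda>\<rho>. F (x, \<rho>)) (uniform_bits (poly q (length x)))"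
      unfolding N_def map_drop_uniform map_take_uniform map_rev_uniform B_def ..
    finally show "result A x = map_pmf (\<lambda>\<rho>. F (x, \<rho>)) (uniform_bits (poly q (length x)))" .
  qed
qed

section \<open>Averages over bit strings\<close>

definition avg :: "nat \<Rightarrow> (bool list \<Rightarrow> real) \<Rightarrow> real" where
  "avg n \<phi> = (\<Sum>x | length x = n. \<phi> x) / 2 ^ n"

lemma avg_cong: "(\<And>x. length x = n \<Longrightarrow> \<phi> x = \<psi> x) \<Longrightarrow> avg n \<phi> = avg n \<psi>"
  by (simp add: avg_def)

lemma avg_mono: "(\<And>x. length x = n \<Longrightarrow> \<phi> x \<le> \<psi> x) \<Longrightarrow> avg n \<phi> \<le> avg n \<psi>"
  unfolding avg_def by (intro divide_right_mono sum_mono) auto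

lemma avg_const [simp]: "avg n (\<lambda>_. c) = c"
  by (simp add: avg_def)

lemma avg_plus: "avg n (\<lambda>x. \<phi> x + \<psi> x) = avg n \<phi> + avg n \<psi>"
  by (simp add: avg_def sum.distrib add_divide_distrib)

lemma avg_minus: "avg n (\<lambda>x. \<phi> x - \<psi> x) = avg n \<phi> - avg n \<psi>"
  by (simp add: avg_def sum_subtractf diff_divide_distrib)

lemma avg_cmult: "avg n (\<lambda>x. c * \<phi> x) = c * avg n \<phi>"
  by (simp add: avg_def sum_distrib_left)

lemma avg_divide: "avg n (\<lambda>x. \<phi> x / c) = avg n \<phi> / c"
  by (simp add: avg_def sum_divide_distrib[symmetric])

lemma avg_sum: "avg n (\<lambda>x. \<Sum>i\<in>I. \<phi> i x) = (\<Sum>i\<in>I. avg n (\<phi> i))"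
  unfolding avg_def by (subst sum.swap) (simp add: sum_divide_distrib)

lemma avg_nonneg: "(\<And>x. length x = n \<Longrightarrow> 0 \<le> \<phi> x) \<Longrightarrow> 0 \<le> avg n \<phi>"
  using avg_mono[of n "\<lambda>_. 0" \<phi>] by simp

lemma avg_le: "(\<And>x. length x = n \<Longrightarrow> \<phi> x \<le> c) \<Longrightarrow> avg n \<phi> \<le> c"
  using avg_mono[of n \<phi> "\<lambda>_. c"] by simp

lemma avg_swap: "avg m (\<lambda>x. avg n (\<lambda>y. \<phi> x y)) = avg n (\<lambda>y. avg m (\<lambda>x. \<phi> x y))"
  unfolding avg_def sum_divide_distrib[symmetric] by (subst sum.swap) simp

lemma avg_bij:
  assumes "bij_betw h {x. length x = n} {x. length x = n}"
  shows "avg n (\<lambda>x. \<phi> (h x)) = avg n \<phi>"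
  using sum.reindex_bij_betw[OF assms, of \<phi>] by (simp add: avg_def)

lemma avg_add: "avg (m + n) \<phi> = avg m (\<lambda>x. avg n (\<lambda>y. \<phi> (x @ y)))"
proof -
  let ?S = "\<lambda>n. {x :: bool list. length x = n}"
  have "bij_betw (\<lambda>(x, y). x @ y) (?S m \<times> ?S n) (?S (m + n))"
    by (rule bij_betw_byWitness[where f' = "\<lambda>z. (take m z, drop m z)"]) auto
  from sum.reindex_bij_betw[OF this, of \<phi>]
  have "sum \<phi> (?S (m + n)) = (\<Sum>(x, y)\<in>?S m \<times> ?S n. \<phi> (x @ y))" by (simp add: case_prod_unfold)
  also have "\<dots> = (\<Sum>x\<in>?S m. \<Sum>y\<in>?S n. \<phi> (x @ y))" by (simp add: sum.cartesian_product)
  finally show ?thesis by (simp add: avg_def power_add sum_divide_distrib[symmetric] mult.commute)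
qed

lemma avg_of_bool_not: "avg n (\<lambda>x. of_bool (\<not> P x)) = 1 - avg n (\<lambda>x. of_bool (P x))"
proof -
  have "avg n (\<lambda>x. of_bool (\<not> P x)) = avg n (\<lambda>x. 1 - of_bool (P x))" by (rule avg_cong) simp
  then show ?thesis by (simp only: avg_minus avg_const)
qed

lemma avg_0 [simp]: "avg 0 \<phi> = \<phi> []"
  by (simp add: avg_def)

lemma avg_1: "avg 1 \<phi> = (\<phi> [True] + \<phi> [False]) / 2"
proof -
  have "{x :: bool list. length x = 1} = {[True], [False]}"
    by (auto simp: length_Suc_conv)
  then show ?thesis by (simp add: avg_def)
qed

lemma avg_square_le: "(avg n \<phi>)\<^sup>2 \<le> avg n (\<lambda>x. (\<phi> x)\<^sup>2)"
proof -
  have "0 \<le> avg n (\<lambda>x. (\<phi> x - avg n \<phi>)\<^sup>2)" by (rule avg_nonneg) simp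
  also have "\<dots> = avg n (\<lambda>x. (\<phi> x)\<^sup>2 - 2 * avg n \<phi> * \<phi> x + (avg n \<phi>)\<^sup>2)"
    by (rule avg_cong) (simp add: power2_diff algebra_simps)
  also have "\<dots> = avg n (\<lambda>x. (\<phi> x)\<^sup>2) - (avg n \<phi>)\<^sup>2"
    by (simp add: avg_plus avg_minus avg_cmult power2_eq_square)
  finally show ?thesis by simp
qed

section \<open>Inner products and hashing\<close>

lemma length_xor [simp]: "length (xor x y) = min (length x) (length y)"
  by (simp add: xor_def)

lemma xor_simps [simp]:
  "xor [] y = []" "xor x [] = []" "xor (a # x) (b # y) = (a \<noteq> b) # xor x y"
  by (simp_all add: xor_def)

lemma xor_self_cancel: "length x = length y \<Longrightarrow> xor (xor x y) y = x"
  by (induction x y rule: list_induct2) auto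

lemma xor_commute: "xor x y = xor y x"
  by (induction x arbitrary: y; case_tac y) auto

lemma avg_xor:
  assumes "length s = n"
  shows "avg n (\<lambda>x. \<phi> (xor x s)) = avg n \<phi>"
  by (rule avg_bij, rule bij_betw_byWitness[where f' = "\<lambda>x. xor x s"])
    (use assms in \<open>auto simp: xor_self_cancel\<close>)

lemma ip_xor: "length r = length s \<Longrightarrow> ip (xor r s) a = (ip r a \<noteq> ip s a)"
  by (induction r s arbitrary: a rule: list_induct2) (case_tac a; auto)+

definition unit :: "nat \<Rightarrow> nat \<Rightarrow> bool list" where
  "unit n p = map (\<lambda>i. i = p) [0..<n]"

lemma length_unit [simp]: "length (unit n p) = n"
  by (simp add: unit_def)

lemma ip_unit: "p < n \<Longrightarrow> ip (unit n p) a = bit a p"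
proof (induction n arbitrary: p a)
  case (Suc n)
  have Z: "ip (map (\<lambda>i. False) xs) a = False" for xs :: "nat list" and a
  proof (induction xs arbitrary: a)
    case (Cons x xs)
    then show ?case by (cases a) auto
  qed simp
  have u: "unit (Suc n) p = (0 = p) # map (\<lambda>i. Suc i = p) [0..<n]"
  proof -
    have "[0..<Suc n] = 0 # map Suc [0..<n]" by (subst upt_conv_Cons) (simp_all add: map_Suc_upt del: upt_Suc)
    then show ?thesis by (simp only: unit_def list.map map_map comp_def)
  qed
  show ?case
  proof (cases a)
    case (Cons b a')
    show ?thesis
    proof (cases p)
      case 0
      then show ?thesis unfolding u Cons by (simp add: Z bit_nth)
    next
      case (Suc q)
      then have "map (\<lambda>i. Suc i = p) [0..<n] = unit n q" by (simp add: unit_def)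
      then show ?thesis using Suc Suc.IH[of q a'] Suc.prems unfolding u Cons by (simp add: bit_nth)
    qed
  qed (simp add: bit_nth)
qed simp

definition separated :: "nat \<Rightarrow> bool list \<Rightarrow> bool list \<Rightarrow> bool" where
  "separated n a b \<longleftrightarrow> avg n (\<lambda>r. of_bool (ip r a = ip r b)) = 1 / 2"

text \<open>Flipping bit \<open>p\<close> of the row changes exactly one of the two inner products.
  This is an involution on rows, so agreement and disagreement are equally frequent.\<close>

lemma separatedI:
  assumes "p < n" "bit a p \<noteq> bit b p"
  shows "separated n a b"
proof -
  let ?\<phi> = "\<lambda>r. of_bool (ip r a = ip r b) :: real"
  have "avg n ?\<phi> = avg n (\<lambda>r. ?\<phi> (xor r (unit n p)))"
    using avg_xor[of "unit n p" n ?\<phi>] by simp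
  also have "\<dots> = avg n (\<lambda>r. 1 - ?\<phi> r)"
    using assms by (intro avg_cong) (auto simp: ip_xor ip_unit)
  also have "\<dots> = 1 - avg n ?\<phi>" by (simp add: avg_minus)
  finally show ?thesis by (simp add: separated_def)
qed

lemma separated_neq:
  assumes "a \<noteq> b" "length a = length b" "length a \<le> n"
  shows "separated n a b"
proof -
  obtain p where "p < length a" "a ! p \<noteq> b ! p" using assms by (auto simp: list_eq_iff_nth_eq)
  then show ?thesis using assms by (intro separatedI[of p]) (auto simp: bit_nth)
qed

text \<open>Inner products cannot see trailing zeros, so strings of different lengths might agree
  under every row. The appended \<open>True\<close> marks the end; this is why images are hashed as
  \<open>f a @ [True]\<close>.\<close>

lemma separated_snoc:
  assumes "a \<noteq> b" "length a < n" "length b < n"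
  shows "separated n (a @ [True]) (b @ [True])"
proof (cases "length a = length b")
  case True
  then show ?thesis using assms by (intro separated_neq) auto
next
  case False
  then show ?thesis
    using assms by (intro separatedI[of "max (length a) (length b)"])
      (auto simp: bit_nth nth_append max_def)
qed

text \<open>The family of linear hash functions: \<open>R\<close> is a bit matrix with
  \<open>k\<close> rows of width \<open>n\<close>, stored row by row, and the result is its product
  with \<open>y\<close>.\<close>

definition hashes :: "nat \<Rightarrow> nat \<Rightarrow> bool list \<Rightarrow> bool list \<Rightarrow> bool list" where
  "hashes k n R y = map (\<lambda>i. ip (take n (drop (i * n) R)) y) [0..<k]"

lemma length_hashes [simp]: "length (hashes k n R y) = k"
  by (simp add: hashes_def)

lemma hashes_0 [simp]: "hashes 0 n R y = []"
  by (simp add: hashes_def)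

lemma hashes_append:
  assumes "length R = k * n"
  shows "hashes (k + l) n (R @ R') y = hashes k n R y @ hashes l n R' y"
proof -
  have "take n (drop (i * n) (R @ R')) = take n (drop (i * n) R)" if "i < k" for i
  proof -
    have "Suc i * n \<le> k * n" using that by (intro mult_right_mono) auto
    then show ?thesis using assms by simp
  qed
  moreover have "[0..<k + l] = [0..<k] @ map (\<lambda>i. i + k) [0..<l]"
    unfolding map_add_upt using upt_add_eq_append[of 0 k l] by (simp only: le0 add_0 add.commute)
  moreover have "drop ((i + k) * n) (R @ R') = drop (i * n) R'" for i
    using assms by (simp add: add_mult_distrib)
  ultimately show ?thesis by (simp add: hashes_def del: drop_append take_append)
qed

lemma hashes_1: "length r = n \<Longrightarrow> hashes 1 n r y = [ip r y]"
  by (simp add: hashes_def)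

lemma hashes_Suc: "length r = n \<Longrightarrow> hashes (Suc k) n (r @ R) y = ip r y # hashes k n R y"
  using hashes_append[of r 1 n k R y] hashes_1[of r n y] by simp

lemma hash_collision:
  assumes "separated n a b"
  shows "avg (k * n) (\<lambda>R. of_bool (hashes k n R a = hashes k n R b)) = 1 / 2 ^ k"
proof (induction k)
  case (Suc k)
  have "avg (Suc k * n) (\<lambda>R. of_bool (hashes (Suc k) n R a = hashes (Suc k) n R b)) =
      avg n (\<lambda>r. avg (k * n) (\<lambda>R. of_bool (hashes (Suc k) n (r @ R) a = hashes (Suc k) n (r @ R) b)))"
    by (simp add: avg_add)
  also have "\<dots> = avg n (\<lambda>r. avg (k * n) (\<lambda>R. of_bool (ip r a = ip r b) *
      of_bool (hashes k n R a = hashes k n R b)))"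
    by (intro avg_cong) (simp add: hashes_Suc of_bool_conj[symmetric])
  also have "\<dots> = avg n (\<lambda>r. of_bool (ip r a = ip r b) * (1 / 2 ^ k))"
    by (simp add: avg_cmult Suc)
  also have "\<dots> = avg n (\<lambda>r. of_bool (ip r a = ip r b)) / 2 ^ k"
    by (simp add: avg_divide)
  also have "\<dots> = 1 / 2 ^ Suc k" unfolding assms[unfolded separated_def] by simp
  finally show ?case .
qed simp

text \<open>The bias is an average of \<phi> against the deviation of the hash value from uniform.
  By Jensen and Cauchy-Schwarz its square is at most \<open>2 ^ k\<close> times the expected squared
  deviation, which is a collision probability minus \<open>1 / 2 ^ k\<close>; only pairs with equal
  \<open>h\<close> exceed that value. The test also sees \<open>R\<close>, so the hash function may
  be published.\<close>

lemma leftover_hash: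
  fixes S :: "'a set" and h :: "'a \<Rightarrow> bool list" and \<phi> :: "bool list \<Rightarrow> bool list \<Rightarrow> real"
  assumes S: "finite S" "S \<noteq> {}"
    and sep: "\<And>a b. a \<in> S \<Longrightarrow> b \<in> S \<Longrightarrow> h a \<noteq> h b \<Longrightarrow> separated n (h a) (h b)"
    and \<phi>: "\<And>R z. 0 \<le> \<phi> R z" "\<And>R z. \<phi> R z \<le> 1"
  shows "(((\<Sum>a\<in>S. avg (k * n) (\<lambda>R. \<phi> R (hashes k n R (h a)))) / card S -
      avg (k * n) (\<lambda>R. avg k (\<phi> R)))\<^sup>2
    \<le> 2 ^ k * (card {(a, b) \<in> S \<times> S. h a = h b} / (real (card S))\<^sup>2))"
proof -
  let ?s = "real (card S)"
  let ?B = "{z :: bool list. length z = k}"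
  let ?eq = "\<lambda>R a b. of_bool (hashes k n R (h a) = hashes k n R (h b)) :: real"
  define p where "p R z = (\<Sum>a\<in>S. of_bool (hashes k n R (h a) = z)) / ?s" for R z
  define c where "c R z = p R z - 1 / 2 ^ k" for R z
  have s: "?s > 0" using S by (simp add: card_gt_0_iff)
  have sum_of_bool: "(\<Sum>z\<in>?B. of_bool (hashes k n R y = z) * g z) = g (hashes k n R y)" for R y and g :: "bool list \<Rightarrow> real"
  proof -
    have "(\<Sum>z\<in>?B. of_bool (hashes k n R y = z) * g z) =
        (\<Sum>z\<in>?B. if hashes k n R y = z then g z else 0)" by (rule sum.cong) auto
    then show ?thesis by (simp add: sum.delta)
  qed
  have pg: "(\<Sum>z\<in>?B. p R z * g z) = (\<Sum>a\<in>S. g (hashes k n R (h a))) / ?s" for R and g :: "bool list \<Rightarrow> real"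
  proof -
    have "(\<Sum>z\<in>?B. p R z * g z) = (\<Sum>z\<in>?B. \<Sum>a\<in>S. of_bool (hashes k n R (h a) = z) * g z) / ?s"
      by (simp add: p_def sum_distrib_right sum_divide_distrib)
    also have "\<dots> = (\<Sum>a\<in>S. g (hashes k n R (h a))) / ?s"
      by (subst sum.swap) (simp add: sum_of_bool)
    finally show ?thesis .
  qed
  have lhs: "(\<Sum>a\<in>S. avg (k * n) (\<lambda>R. \<phi> R (hashes k n R (h a)))) / ?s -
      avg (k * n) (\<lambda>R. avg k (\<phi> R)) = avg (k * n) (\<lambda>R. \<Sum>z\<in>?B. \<phi> R z * c R z)"
  proof -
    have "(\<Sum>z\<in>?B. \<phi> R z * c R z) = (\<Sum>a\<in>S. \<phi> R (hashes k n R (h a))) / ?s - avg k (\<phi> R)" for R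
      using pg[of R "\<phi> R"]
      by (simp add: c_def avg_def algebra_simps sum_subtractf sum_divide_distrib)
    then show ?thesis by (simp add: avg_minus avg_divide avg_sum)
  qed
  \<comment> \<open>The squared distance from the uniform distribution is the collision probability
    minus that of the uniform one.\<close>
  have sq: "(\<Sum>z\<in>?B. (c R z)\<^sup>2) = (\<Sum>a\<in>S. \<Sum>b\<in>S. ?eq R a b) / ?s\<^sup>2 - 1 / 2 ^ k" for R
  proof -
    have "(\<Sum>z\<in>?B. p R z * p R z) = (\<Sum>a\<in>S. p R (hashes k n R (h a))) / ?s" by (rule pg)
    also have "\<dots> = (\<Sum>a\<in>S. \<Sum>b\<in>S. ?eq R b a) / ?s\<^sup>2"
      by (simp add: p_def sum_divide_distrib[symmetric] power2_eq_square)
    also have "\<dots> = (\<Sum>a\<in>S. \<Sum>b\<in>S. ?eq R a b) / ?s\<^sup>2" by (subst sum.swap) simp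
    finally have 1: "(\<Sum>z\<in>?B. p R z * p R z) = (\<Sum>a\<in>S. \<Sum>b\<in>S. ?eq R a b) / ?s\<^sup>2" .
    have 2: "(\<Sum>z\<in>?B. p R z) = 1" using pg[of R "\<lambda>_. 1"] s by simp
    have "(\<Sum>z\<in>?B. (c R z)\<^sup>2) = (\<Sum>z\<in>?B. p R z * p R z - 2 / 2 ^ k * p R z + 1 / 2 ^ k * (1 / 2 ^ k))"
      by (simp add: c_def power2_eq_square algebra_simps)
    also have "\<dots> = (\<Sum>z\<in>?B. p R z * p R z) - 2 / 2 ^ k * (\<Sum>z\<in>?B. p R z) + 1 / 2 ^ k"
      unfolding sum.distrib sum_subtractf sum_distrib_left by simp
    finally show ?thesis by (simp add: 1 2)
  qed
  have "(avg (k * n) (\<lambda>R. \<Sum>z\<in>?B. \<phi> R z * c R z))\<^sup>2 \<le> avg (k * n) (\<lambda>R. (\<Sum>z\<in>?B. \<phi> R z * c R z)\<^sup>2)"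
    by (rule avg_square_le)
  also have "\<dots> \<le> avg (k * n) (\<lambda>R. 2 ^ k * (\<Sum>z\<in>?B. (c R z)\<^sup>2))"
  proof (rule avg_mono)
    fix R
    have "(\<Sum>z\<in>?B. (\<phi> R z)\<^sup>2) \<le> (\<Sum>z\<in>?B. 1)"
      using \<phi> by (intro sum_mono) (simp add: power_le_one)
    then have "(\<Sum>z\<in>?B. (\<phi> R z)\<^sup>2) \<le> 2 ^ k" by simp
    then show "(\<Sum>z\<in>?B. \<phi> R z * c R z)\<^sup>2 \<le> 2 ^ k * (\<Sum>z\<in>?B. (c R z)\<^sup>2)"
      by (intro order.trans[OF Cauchy_Schwarz_ineq_sum] mult_right_mono sum_nonneg) auto
  qed
  also have "\<dots> = 2 ^ k * (avg (k * n) (\<lambda>R. \<Sum>a\<in>S. \<Sum>b\<in>S. ?eq R a b) / ?s\<^sup>2 - 1 / 2 ^ k)"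
    by (simp add: sq avg_cmult avg_minus avg_divide)
  finally have 1: "(avg (k * n) (\<lambda>R. \<Sum>z\<in>?B. \<phi> R z * c R z))\<^sup>2 \<le>
      2 ^ k * (avg (k * n) (\<lambda>R. \<Sum>a\<in>S. \<Sum>b\<in>S. ?eq R a b) / ?s\<^sup>2 - 1 / 2 ^ k)" .
  have "avg (k * n) (\<lambda>R. \<Sum>a\<in>S. \<Sum>b\<in>S. ?eq R a b) = (\<Sum>a\<in>S. \<Sum>b\<in>S. avg (k * n) (\<lambda>R. ?eq R a b))"
    by (simp add: avg_sum)
  also have "\<dots> \<le> (\<Sum>a\<in>S. \<Sum>b\<in>S. of_bool (h a = h b) + 1 / 2 ^ k)"
  proof (intro sum_mono)
    fix a b assume "a \<in> S" "b \<in> S"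
    then show "avg (k * n) (\<lambda>R. ?eq R a b) \<le> of_bool (h a = h b) + 1 / 2 ^ k"
      using hash_collision[OF sep[of a b], of k] by (cases "h a = h b") auto
  qed
  also have "\<dots> = card {(a, b) \<in> S \<times> S. h a = h b} + ?s\<^sup>2 / 2 ^ k"
  proof -
    have "(\<Sum>a\<in>S. \<Sum>b\<in>S. of_bool (h a = h b) :: real) = (\<Sum>x\<in>S \<times> S. of_bool (h (fst x) = h (snd x)))"
      by (simp add: sum.cartesian_product case_prod_unfold)
    also have "\<dots> = card {(a, b) \<in> S \<times> S. h a = h b}"
    proof -
      have "{(a, b) \<in> S \<times> S. h a = h b} = S \<times> S \<inter> {x. h (fst x) = h (snd x)}" by auto
      then show ?thesis using S(1) by (simp add: of_bool_def sum.If_cases)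
    qed
    finally show ?thesis by (simp add: sum.distrib power2_eq_square)
  qed
  finally have "avg (k * n) (\<lambda>R. \<Sum>a\<in>S. \<Sum>b\<in>S. ?eq R a b) / ?s\<^sup>2 - 1 / 2 ^ k \<le>
      (card {(a, b) \<in> S \<times> S. h a = h b} + ?s\<^sup>2 / 2 ^ k) / ?s\<^sup>2 - 1 / 2 ^ k"
    by (intro diff_right_mono divide_right_mono) auto
  also have "\<dots> = card {(a, b) \<in> S \<times> S. h a = h b} / ?s\<^sup>2"
    using s by (simp add: add_divide_distrib)
  finally show ?thesis
    unfolding lhs by (intro order.trans[OF 1] mult_left_mono) auto
qed

section \<open>List decoding of the Hadamard code\<close>

text \<open>The \<open>2\<^sup>k\<close> strings of \<open>span_list n k \<rho>\<close> form a random affine subspace, given by \<open>k + 1\<close>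
  random strings, and are thus pairwise independent.\<close>

primrec span_list :: "nat \<Rightarrow> nat \<Rightarrow> bool list \<Rightarrow> bool list list" where
  "span_list n 0 \<rho> = [take n \<rho>]"
| "span_list n (Suc k) \<rho> = (let L = span_list n k (drop n \<rho>) in L @ map (xor (take n \<rho>)) L)"

lemma length_span_list [simp]: "length (span_list n k \<rho>) = 2 ^ k"
  by (induction k arbitrary: \<rho>) (auto simp: Let_def)

lemma span_list_length: "length \<rho> = Suc k * n \<Longrightarrow> l \<in> set (span_list n k \<rho>) \<Longrightarrow> length l = n"
proof (induction k arbitrary: \<rho> l)
  case (Suc k)
  have "length (drop n \<rho>) = Suc k * n" using Suc.prems(1) by simp
  note IH = Suc.IH[OF this]
  have "length (take n \<rho>) = n" using Suc.prems(1) by simp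
  with Suc.prems(2) IH show ?case by (auto simp: Let_def)
qed auto

text \<open>An entry \<open>l\<close> is a row with a guess of its inner product in front. Adding
  the unit vector to the row changes the inner product exactly if bit \<open>p\<close> is set, so a
  correct guess and a correct answer of \<open>P\<close> differ exactly if bit \<open>p\<close> is
  set.\<close>

definition vote :: "(bool list \<Rightarrow> bool) \<Rightarrow> nat \<Rightarrow> nat \<Rightarrow> bool list \<Rightarrow> bool" where
  "vote P n p l \<longleftrightarrow> hd l \<noteq> P (xor (tl l) (unit n p))"

definition decode :: "(bool list \<Rightarrow> bool) \<Rightarrow> nat \<Rightarrow> nat \<Rightarrow> bool list list \<Rightarrow> bool list" where
  "decode P n m L = map (\<lambda>p. 2 * length (filter (vote P n p) L) > length L) [0..<m]"

text \<open>All guesses of the bits \<open>ip s a\<close> for the \<open>k + 1\<close> generating strings \<open>s\<close> are correct with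
  probability \<open>2\<^sup>-\<^sup>(\<^sup>k\<^sup>+\<^sup>1\<^sup>)\<close>, and then the guess for every string of the span is correct.\<close>

lemma avg_span_guess:
  assumes "\<And>L. 0 \<le> \<phi> L"
  shows "avg (Suc k * n) (\<lambda>\<rho>. \<phi> (map (\<lambda>r. ip r a # r) (span_list n k \<rho>))) / 2 ^ Suc k
    \<le> avg (Suc k * Suc n) (\<lambda>\<rho>. \<phi> (span_list (Suc n) k \<rho>))"
  using assms
proof (induction k arbitrary: \<phi>)
  case 0
  have "avg (Suc n) (\<lambda>\<rho>. \<phi> (span_list (Suc n) 0 \<rho>)) =
      avg 1 (\<lambda>b. avg n (\<lambda>s. \<phi> (span_list (Suc n) 0 (b @ s))))"
    using avg_add[of 1 n] by simp
  also have "\<dots> = avg n (\<lambda>s. avg 1 (\<lambda>b. \<phi> (span_list (Suc n) 0 (b @ s))))"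
    by (rule avg_swap)
  also have "\<dots> \<ge> avg n (\<lambda>s. \<phi> [ip s a # s] / 2)"
  proof (rule avg_mono)
    fix s :: "bool list" assume "length s = n"
    then show "\<phi> [ip s a # s] / 2 \<le> avg 1 (\<lambda>b. \<phi> (span_list (Suc n) 0 (b @ s)))"
      unfolding avg_1 using 0[of "[True # s]"] 0[of "[False # s]"] by (cases "ip s a") auto
  qed
  also have "avg n (\<lambda>s. \<phi> [ip s a # s] / 2) =
      avg n (\<lambda>\<rho>. \<phi> (map (\<lambda>r. ip r a # r) (span_list n 0 \<rho>))) / 2"
    unfolding avg_divide[symmetric] by (rule avg_cong) simp
  finally show ?case by simp
next
  case (Suc k)
  let ?lab = "map (\<lambda>r. ip r a # r)"
  let ?f = "\<lambda>b s L. \<phi> (L @ map (xor (b # s)) L)"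
  \<comment> \<open>By linearity of the inner product, correct labels of the generating strings
    extend to correct labels of the whole span.\<close>
  have *: "?f (ip s a) s (?lab (span_list n k \<rho>)) = \<phi> (?lab (span_list n (Suc k) (s @ \<rho>)))"
    if s: "length s = n" and \<rho>: "length \<rho> = Suc k * n" for s \<rho>
  proof -
    have "map (xor (ip s a # s)) (?lab (span_list n k \<rho>)) = ?lab (map (xor s) (span_list n k \<rho>))"
      using span_list_length[OF \<rho>] s by (auto simp: ip_xor)
    moreover have "span_list n (Suc k) (s @ \<rho>) = span_list n k \<rho> @ map (xor s) (span_list n k \<rho>)"
      using s by (simp add: Let_def)
    ultimately show ?thesis by (simp only: map_append)
  qed
  have e: "Suc (Suc k) * n = n + Suc k * n" by simp
  have "avg (Suc (Suc k) * n) (\<lambda>\<rho>. \<phi> (?lab (span_list n (Suc k) \<rho>))) =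
      avg n (\<lambda>s. avg (Suc k * n) (\<lambda>\<rho>. \<phi> (?lab (span_list n (Suc k) (s @ \<rho>)))))"
    unfolding e by (rule avg_add)
  also have "\<dots> = avg n (\<lambda>s. avg (Suc k * n) (\<lambda>\<rho>. ?f (ip s a) s (?lab (span_list n k \<rho>))))"
    by (intro avg_cong) (simp only: *)
  finally have "avg (Suc (Suc k) * n) (\<lambda>\<rho>. \<phi> (?lab (span_list n (Suc k) \<rho>))) / 2 ^ Suc (Suc k) =
      avg n (\<lambda>s. avg (Suc k * n) (\<lambda>\<rho>. ?f (ip s a) s (?lab (span_list n k \<rho>))) / 2 ^ Suc k / 2)"
    by (simp add: avg_divide)
  also have "\<dots> \<le> avg n (\<lambda>s. avg (Suc k * Suc n) (\<lambda>\<rho>. ?f (ip s a) s (span_list (Suc n) k \<rho>)) / 2)"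
    using Suc.prems by (intro avg_mono divide_right_mono Suc.IH) auto
  also have "\<dots> \<le> avg n (\<lambda>s. avg 1 (\<lambda>b. avg (Suc k * Suc n) (\<lambda>\<rho>. ?f (hd b) s (span_list (Suc n) k \<rho>))))"
  proof (rule avg_mono)
    fix s :: "bool list"
    let ?g = "\<lambda>b. avg (Suc k * Suc n) (\<lambda>\<rho>. ?f b s (span_list (Suc n) k \<rho>))"
    have "?g b \<ge> 0" for b using Suc.prems by (intro avg_nonneg) auto
    from this[of True] this[of False]
    show "?g (ip s a) / 2 \<le> avg 1 (\<lambda>b. ?g (hd b))"
      unfolding avg_1 by (cases "ip s a") auto
  qed
  also have "\<dots> = avg 1 (\<lambda>b. avg n (\<lambda>s. avg (Suc k * Suc n) (\<lambda>\<rho>. ?f (hd b) s (span_list (Suc n) k \<rho>))))"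
    by (rule avg_swap)
  also have "\<dots> = avg 1 (\<lambda>b. avg n (\<lambda>s. avg (Suc k * Suc n) (\<lambda>\<rho>. \<phi> (span_list (Suc n) (Suc k) ((b @ s) @ \<rho>)))))"
    by (intro avg_cong) (auto simp: Let_def length_Suc_conv)
  also have "\<dots> = avg (1 + n + Suc k * Suc n) (\<lambda>\<rho>. \<phi> (span_list (Suc n) (Suc k) \<rho>))"
    by (simp only: avg_add)
  finally show ?case by (simp add: algebra_simps)
qed

text \<open>Pairwise independence in the form of moments. In each doubling the new half is the old
  one shifted by an independent uniform string, over which \<open>g\<close> averages to zero; so the
  cross term vanishes and the second moment doubles.\<close>

lemma second_moment:
  assumes "avg n g = 0"
  shows "avg (Suc k * n) (\<lambda>\<rho>. (\<Sum>l\<leftarrow>span_list n k \<rho>. g l)\<^sup>2) = 2 ^ k * avg n (\<lambda>r. (g r)\<^sup>2)"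
  using assms
proof (induction k arbitrary: g)
  case 0
  show ?case by simp (rule avg_cong, simp)
next
  case (Suc k)
  let ?V = "\<lambda>g \<rho>. \<Sum>l\<leftarrow>span_list n k \<rho>. g l"
  have V: "(\<Sum>l\<leftarrow>span_list n (Suc k) (s @ \<rho>). g l) = ?V g \<rho> + ?V (\<lambda>l. g (xor s l)) \<rho>"
    if "length s = n" for s \<rho>
    using that by (simp add: Let_def comp_def)
  have sh: "avg n (\<lambda>l. f (xor s l)) = avg n f" if "length s = n" for s and f :: "bool list \<Rightarrow> real"
    using avg_xor[OF that, of f] by (simp add: xor_commute)
  have cross: "avg n (\<lambda>s. ?V g \<rho> * ?V (\<lambda>l. g (xor s l)) \<rho>) = 0" if \<rho>: "length \<rho> = Suc k * n" for \<rho>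
  proof -
    have "avg n (\<lambda>s. ?V (\<lambda>l. g (xor s l)) \<rho>) = (\<Sum>l\<leftarrow>span_list n k \<rho>. avg n (\<lambda>s. g (xor s l)))"
      by (simp add: sum_list_sum_nth avg_sum)
    also have "\<dots> = (\<Sum>l\<leftarrow>span_list n k \<rho>. 0)"
      using Suc.prems span_list_length[OF \<rho>] by (intro arg_cong[of _ _ sum_list] map_cong) (auto simp: avg_xor)
    finally show ?thesis by (simp add: avg_cmult)
  qed
  have e: "Suc (Suc k) * n = n + Suc k * n" by simp
  have "avg (Suc (Suc k) * n) (\<lambda>\<rho>. (\<Sum>l\<leftarrow>span_list n (Suc k) \<rho>. g l)\<^sup>2) =
      avg n (\<lambda>s. avg (Suc k * n) (\<lambda>\<rho>. (\<Sum>l\<leftarrow>span_list n (Suc k) (s @ \<rho>). g l)\<^sup>2))"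
    unfolding e by (rule avg_add)
  also have "\<dots> = avg n (\<lambda>s. avg (Suc k * n) (\<lambda>\<rho>. (?V g \<rho>)\<^sup>2 + (?V (\<lambda>l. g (xor s l)) \<rho>)\<^sup>2 +
      2 * (?V g \<rho> * ?V (\<lambda>l. g (xor s l)) \<rho>)))"
    by (intro avg_cong) (simp add: V power2_sum del: span_list.simps)
  also have "\<dots> = avg n (\<lambda>s. avg (Suc k * n) (\<lambda>\<rho>. (?V g \<rho>)\<^sup>2)) +
      avg n (\<lambda>s. avg (Suc k * n) (\<lambda>\<rho>. (?V (\<lambda>l. g (xor s l)) \<rho>)\<^sup>2)) +
      2 * avg n (\<lambda>s. avg (Suc k * n) (\<lambda>\<rho>. ?V g \<rho> * ?V (\<lambda>l. g (xor s l)) \<rho>))"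
    by (simp only: avg_plus avg_cmult)
  also have "avg n (\<lambda>s. avg (Suc k * n) (\<lambda>\<rho>. ?V g \<rho> * ?V (\<lambda>l. g (xor s l)) \<rho>)) =
      avg (Suc k * n) (\<lambda>\<rho>. avg n (\<lambda>s. ?V g \<rho> * ?V (\<lambda>l. g (xor s l)) \<rho>))"
    by (rule avg_swap)
  also have "\<dots> = avg (Suc k * n) (\<lambda>\<rho>. 0)"
    by (intro avg_cong cross)
  also have "avg n (\<lambda>s. avg (Suc k * n) (\<lambda>\<rho>. (?V (\<lambda>l. g (xor s l)) \<rho>)\<^sup>2)) =
      avg n (\<lambda>s. 2 ^ k * avg n (\<lambda>r. (g r)\<^sup>2))"
  proof (rule avg_cong)
    fix s :: "bool list" assume s: "length s = n"
    have "avg n (\<lambda>l. g (xor s l)) = 0" using sh[OF s, of g] Suc.prems by simp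
    from Suc.IH[OF this]
    show "avg (Suc k * n) (\<lambda>\<rho>. (?V (\<lambda>l. g (xor s l)) \<rho>)\<^sup>2) = 2 ^ k * avg n (\<lambda>r. (g r)\<^sup>2)"
      using sh[OF s, of "\<lambda>r. (g r)\<^sup>2"] by simp
  qed
  finally show ?case using Suc.IH[OF Suc.prems] by simp
qed

text \<open>Chebyshev: with correct labels, a wrong majority means that the number of correct
  answers falls short of its mean by at least \<open>2 ^ k * \<eta>\<close>, whereas a single answer
  has variance at most 1/4.\<close>

lemma decode_wrong_bit:
  assumes agree: "avg n (\<lambda>r. of_bool (P r = ip r a)) \<ge> 1 / 2 + \<eta>" and \<eta>: "\<eta> > 0"
    and p: "p < n"
  shows "avg (Suc k * n) (\<lambda>\<rho>. of_bool ((2 * length (filter (vote P n p)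
      (map (\<lambda>r. ip r a # r) (span_list n k \<rho>))) > 2 ^ k) \<noteq> bit a p)) \<le> 1 / (4 * 2 ^ k * \<eta>\<^sup>2)"
proof -
  let ?M = "2 ^ k :: real"
  define X :: "bool list \<Rightarrow> bool" where "X l \<longleftrightarrow> P (xor l (unit n p)) = ip (xor l (unit n p)) a" for l
  define \<mu> where "\<mu> = avg n (\<lambda>l. of_bool (X l))"
  define g where "g l = of_bool (X l) - \<mu>" for l
  have \<mu>: "\<mu> \<ge> 1 / 2 + \<eta>"
    using agree avg_xor[of "unit n p" n "\<lambda>r. of_bool (P r = ip r a)"] by (simp add: \<mu>_def X_def)
  have g0: "avg n g = 0" unfolding g_def[abs_def] avg_minus by (simp add: \<mu>_def)
  have "avg n (\<lambda>l. (g l)\<^sup>2) = avg n (\<lambda>l. (1 - 2 * \<mu>) * of_bool (X l) + \<mu>\<^sup>2)"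
    by (rule avg_cong) (auto simp: g_def power2_eq_square algebra_simps)
  also have "\<dots> = \<mu> - \<mu>\<^sup>2"
    unfolding avg_plus avg_cmult avg_const \<mu>_def[symmetric] by (simp add: power2_eq_square algebra_simps)
  also have "\<dots> = 1 / 4 - (\<mu> - 1 / 2)\<^sup>2" by (simp add: power2_eq_square algebra_simps)
  finally have g2: "avg n (\<lambda>l. (g l)\<^sup>2) \<le> 1 / 4" by simp
  let ?V = "\<lambda>\<rho>. \<Sum>l\<leftarrow>span_list n k \<rho>. g l"
  let ?wrong = "\<lambda>\<rho>. (2 * length (filter (vote P n p)
      (map (\<lambda>r. ip r a # r) (span_list n k \<rho>))) > 2 ^ k) \<noteq> bit a p"
  have wrong: "of_bool (?wrong \<rho>) \<le> (?V \<rho>)\<^sup>2 / (?M * \<eta>)\<^sup>2" if \<rho>: "length \<rho> = Suc k * n" for \<rho>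
  proof (cases "?wrong \<rho>")
    case True
    let ?L = "span_list n k \<rho>"
    let ?c = "length (filter X ?L)"
    have vote: "vote P n p (ip l a # l) \<longleftrightarrow> (X l \<longleftrightarrow> bit a p)" if "l \<in> set ?L" for l
      using span_list_length[OF \<rho> that] p by (auto simp: vote_def X_def ip_xor ip_unit)
    have "filter (vote P n p) (map (\<lambda>r. ip r a # r) ?L) =
        map (\<lambda>r. ip r a # r) (filter (\<lambda>l. X l \<longleftrightarrow> bit a p) ?L)"
      unfolding filter_map comp_def using vote by (intro arg_cong[of _ _ "map _"] filter_cong) auto
    then have "length (filter (vote P n p) (map (\<lambda>r. ip r a # r) ?L)) =
        length (filter (\<lambda>l. X l \<longleftrightarrow> bit a p) ?L)" by simp
    also have "\<dots> = (if bit a p then ?c else 2 ^ k - ?c)"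
    proof -
      have "length (filter (\<lambda>l. \<not> X l) ?L) = 2 ^ k - ?c"
        using sum_length_filter_compl[of X ?L] by (metis add_diff_cancel_left' length_span_list)
      then show ?thesis by simp
    qed
    \<comment> \<open>For a set bit the counted votes are the correct ones, and a tie is wrong; for
      an unset bit they are the incorrect ones. In both cases at most half of the answers are
      correct.\<close>
    finally have "2 * ?c \<le> 2 ^ k"
      using True by (auto split: if_splits)
    then have c: "2 * real ?c \<le> ?M"
      by (metis (mono_tags) of_nat_le_iff of_nat_mult of_nat_numeral of_nat_power)
    have "?V \<rho> = real ?c - ?M * \<mu>"
    proof -
      have "(\<Sum>l\<leftarrow>L. g l) = real (length (filter X L)) - real (length L) * \<mu>" for L
        by (induction L) (auto simp: g_def algebra_simps)
      from this[of ?L] show ?thesis by simp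
    qed
    then have "?M * \<eta> \<le> - ?V \<rho>"
      using c mult_left_mono[OF \<mu>, of ?M] by (simp add: algebra_simps)
    then have "(?M * \<eta>)\<^sup>2 \<le> (- ?V \<rho>)\<^sup>2" using \<eta> by (intro power_mono) auto
    then show ?thesis using True \<eta> by (simp add: divide_simps)
  qed simp
  have "avg (Suc k * n) (\<lambda>\<rho>. of_bool (?wrong \<rho>)) \<le> avg (Suc k * n) (\<lambda>\<rho>. (?V \<rho>)\<^sup>2 / (?M * \<eta>)\<^sup>2)"
    by (rule avg_mono) (rule wrong)
  also have "\<dots> = ?M * avg n (\<lambda>r. (g r)\<^sup>2) / (?M * \<eta>)\<^sup>2"
    unfolding avg_divide second_moment[OF g0] ..
  also have "\<dots> \<le> ?M * (1 / 4) / (?M * \<eta>)\<^sup>2"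
    using g2 by (intro divide_right_mono mult_left_mono) auto
  also have "\<dots> = 1 / (4 * ?M * \<eta>\<^sup>2)"
    using \<eta> by (simp add: power2_eq_square)
  finally show ?thesis .
qed

text \<open>The condition on \<open>k\<close> makes the union bound over the \<open>m\<close> bits
  at most 1/2 when all labels are correct, and guessing the \<open>k + 1\<close> generating labels
  costs a factor \<open>2 ^ Suc k\<close>.\<close>

theorem Goldreich_Levin:
  assumes agree: "avg n (\<lambda>r. of_bool (P r = ip r a)) \<ge> 1 / 2 + \<eta>" and \<eta>: "\<eta> > 0"
    and m: "length a = m" "m \<le> n" and k: "real m \<le> 2 * 2 ^ k * \<eta>\<^sup>2"
  shows "avg (Suc k * Suc n) (\<lambda>\<rho>. of_bool (decode P n m (span_list (Suc n) k \<rho>) = a)) \<ge> 1 / 2 ^ (k + 2)"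
proof -
  let ?lab = "map (\<lambda>r. ip r a # r)"
  let ?bit = "\<lambda>p \<rho>. 2 * length (filter (vote P n p) (?lab (span_list n k \<rho>))) > 2 ^ k"
  let ?bad = "avg (Suc k * n) (\<lambda>\<rho>. of_bool (decode P n m (?lab (span_list n k \<rho>)) \<noteq> a))"
  have "?bad \<le> avg (Suc k * n) (\<lambda>\<rho>. \<Sum>p<m. of_bool (?bit p \<rho> \<noteq> bit a p))"
  proof (rule avg_mono)
    fix \<rho> :: "bool list"
    show "of_bool (decode P n m (?lab (span_list n k \<rho>)) \<noteq> a) \<le> (\<Sum>p<m. of_bool (?bit p \<rho> \<noteq> bit a p) :: real)"
    proof (cases "decode P n m (?lab (span_list n k \<rho>)) = a")
      case False
      then obtain p where p: "p < m" "?bit p \<rho> \<noteq> bit a p"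
        using m(1) by (auto simp: decode_def list_eq_iff_nth_eq bit_nth)
      then have "(1 :: real) = of_bool (?bit p \<rho> \<noteq> bit a p)" by simp
      also have "\<dots> \<le> (\<Sum>p<m. of_bool (?bit p \<rho> \<noteq> bit a p))"
        using p(1) by (intro member_le_sum) auto
      finally show ?thesis using False by simp
    qed (simp add: sum_nonneg)
  qed
  also have "\<dots> = (\<Sum>p<m. avg (Suc k * n) (\<lambda>\<rho>. of_bool (?bit p \<rho> \<noteq> bit a p)))"
    by (rule avg_sum)
  also have "\<dots> \<le> (\<Sum>p<m. 1 / (4 * 2 ^ k * \<eta>\<^sup>2))"
    using m(2) by (intro sum_mono decode_wrong_bit[OF agree \<eta>]) auto
  also have "\<dots> \<le> 1 / 2"
    using k \<eta> by (simp add: divide_simps ac_simps)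
  finally have "?bad \<le> 1 / 2" .
  moreover have "avg (Suc k * n) (\<lambda>\<rho>. of_bool (decode P n m (?lab (span_list n k \<rho>)) = a)) = 1 - ?bad"
    using avg_of_bool_not[of "Suc k * n" "\<lambda>\<rho>. decode P n m (?lab (span_list n k \<rho>)) = a"] by simp
  ultimately have "1 / 2 \<le> avg (Suc k * n) (\<lambda>\<rho>. of_bool (decode P n m (?lab (span_list n k \<rho>)) = a))"
    by simp
  then have "1 / 2 / 2 ^ Suc k \<le>
      avg (Suc k * n) (\<lambda>\<rho>. of_bool (decode P n m (?lab (span_list n k \<rho>)) = a)) / 2 ^ Suc k"
    by (intro divide_right_mono) auto
  also have "\<dots> \<le> avg (Suc k * Suc n) (\<lambda>\<rho>. of_bool (decode P n m (span_list (Suc n) k \<rho>) = a))"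
    by (rule avg_span_guess) simp
  finally show ?thesis by (simp add: power_add)
qed

section \<open>From distinguishing to inverting\<close>

lemma avg_of_bool_eq: "length h = n \<Longrightarrow> avg n (\<lambda>u. of_bool (u = h)) = 1 / 2 ^ n"
  by (simp add: avg_def of_bool_def sum.If_cases Int_def)

text \<open>The inverter gets \<open>y = f a\<close> and guesses the hash bits \<open>u\<close>, which are those of a preimage
  \<open>a' \<in> S\<close> with probability \<open>2\<^sup>-\<^sup>j\<close>. Since the events that the output is \<open>a'\<close> are disjoint for
  different \<open>a'\<close>, the \<open>2\<^sup>i\<close> preimages of \<open>y\<close> make up for that loss.\<close>

lemma inverter_success:
  fixes S :: "bool list set" and f :: "bool list \<Rightarrow> 'y" and H :: "bool list \<Rightarrow> bool list \<Rightarrow> bool list"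
    and Acc :: "'y \<Rightarrow> bool list \<Rightarrow> bool list \<Rightarrow> bool list \<Rightarrow> bool \<Rightarrow> bool"
  assumes S: "S \<subseteq> {a. length a = m}" "S \<noteq> {}"
    and fib: "\<And>a. a \<in> S \<Longrightarrow> 2 ^ i \<le> card {b. length b = m \<and> f b = f a}"
    and H: "\<And>\<omega> a. length (H \<omega> a) = j"
    and mN: "m \<le> N" and \<delta>: "\<delta> > 0" and k: "real m \<le> 2 * 2 ^ k * (\<delta> / 2)\<^sup>2"
    and gap: "\<delta> \<le> \<bar>(\<Sum>a\<in>S. avg L (\<lambda>\<omega>. avg N (\<lambda>r. of_bool (Acc (f a) (H \<omega> a) \<omega> r (ip r a)) -
      (of_bool (Acc (f a) (H \<omega> a) \<omega> r True) + of_bool (Acc (f a) (H \<omega> a) \<omega> r False)) / 2))) / card S\<bar>"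
  shows "\<exists>\<sigma>. 2 ^ i / 2 ^ m * (card S / 2 ^ j) * (\<delta> / 2) / 2 ^ (k + 2) \<le>
    avg m (\<lambda>a. avg j (\<lambda>u. avg L (\<lambda>\<omega>. avg 1 (\<lambda>c. avg (Suc k * Suc N) (\<lambda>g.
      of_bool (f (decode (\<lambda>r. Acc (f a) u \<omega> r (hd c) = (hd c = \<sigma>)) N m (span_list (Suc N) k g)) = f a))))))"
proof -
  have finS: "finite S" using S(1) finite_bits finite_subset by blast
  let ?s = "real (card S)"
  have s: "?s > 0" using S finS by (simp add: card_gt_0_iff)
  let ?x = "\<lambda>a \<omega> r c. of_bool (Acc (f a) (H \<omega> a) \<omega> r c) :: real"
  let ?d = "\<lambda>a \<omega> r. ?x a \<omega> r (ip r a) - (?x a \<omega> r True + ?x a \<omega> r False) / 2"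
  \<comment> \<open>Yao's predictor: the trial bit \<open>c\<close> is answered if the distinguisher
    accepts and its negation otherwise; \<sigma> exchanges the two if the distinguisher prefers
    random bits.\<close>
  define P where "P \<sigma> y u \<omega> c r \<longleftrightarrow> Acc y u \<omega> r c = (c = \<sigma>)" for \<sigma> y u \<omega> c r
  define agree where "agree \<sigma> a \<omega> c = avg N (\<lambda>r. of_bool (P \<sigma> (f a) (H \<omega> a) \<omega> c r = ip r a))"
    for \<sigma> a \<omega> c
  have agree: "avg 1 (\<lambda>c. agree \<sigma> a \<omega> (hd c)) =
      1 / 2 + (if \<sigma> then 1 else - 1) * avg N (\<lambda>r. ?d a \<omega> r)" for \<sigma> a \<omega>
  proof -
    have "avg 1 (\<lambda>c. agree \<sigma> a \<omega> (hd c)) =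
        avg N (\<lambda>r. avg 1 (\<lambda>c. of_bool (P \<sigma> (f a) (H \<omega> a) \<omega> (hd c) r = ip r a)))"
      unfolding agree_def by (rule avg_swap)
    also have "\<dots> = avg N (\<lambda>r. 1 / 2 + (if \<sigma> then 1 else - 1) * ?d a \<omega> r)"
      by (rule avg_cong) (unfold avg_1, auto simp: P_def of_bool_def field_simps)
    finally show ?thesis by (simp only: avg_plus avg_cmult avg_const)
  qed
  let ?gap = "(\<Sum>a\<in>S. avg L (\<lambda>\<omega>. avg N (\<lambda>r. ?d a \<omega> r))) / ?s"
  define \<sigma> where "\<sigma> \<longleftrightarrow> ?gap \<ge> 0"
  have "1 / 2 + \<delta> \<le> 1 / 2 + (if \<sigma> then 1 else - 1) * ?gap"
    using gap by (auto simp: \<sigma>_def abs_if split: if_splits)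
  also have "\<dots> = (\<Sum>a\<in>S. avg L (\<lambda>\<omega>. avg 1 (\<lambda>c. agree \<sigma> a \<omega> (hd c)))) / ?s"
  proof -
    have "(\<Sum>a\<in>S. avg L (\<lambda>\<omega>. avg 1 (\<lambda>c. agree \<sigma> a \<omega> (hd c)))) =
        ?s * (1 / 2) + (if \<sigma> then 1 else - 1) * (\<Sum>a\<in>S. avg L (\<lambda>\<omega>. avg N (\<lambda>r. ?d a \<omega> r)))"
      by (simp only: agree avg_plus avg_cmult avg_const sum.distrib sum_distrib_left sum_constant)
    then show ?thesis using s by (simp only: add_divide_distrib) simp
  qed
  finally have big: "1 / 2 + \<delta> \<le> (\<Sum>a\<in>S. avg L (\<lambda>\<omega>. avg 1 (\<lambda>c. agree \<sigma> a \<omega> (hd c)))) / ?s" .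
  \<comment> \<open>An average agreement of \<open>1 / 2 + \<delta>\<close> with values at most 1
    forces agreement at least \<open>1 / 2 + \<delta> / 2\<close> on a fraction of at least
    \<open>\<delta> / 2\<close>.\<close>
  define good where "good a \<omega> c \<longleftrightarrow> agree \<sigma> a \<omega> c \<ge> 1 / 2 + \<delta> / 2" for a \<omega> c
  let ?G = "\<lambda>a. avg L (\<lambda>\<omega>. avg 1 (\<lambda>c. of_bool (good a \<omega> (hd c))))"
  have good: "\<delta> / 2 \<le> (\<Sum>a\<in>S. ?G a) / ?s"
  proof -
    have a1: "agree \<sigma> a \<omega> c \<le> 1" for a \<omega> c unfolding agree_def by (rule avg_le) simp
    have pt: "agree \<sigma> a \<omega> c \<le> of_bool (good a \<omega> c) + (1 / 2 + \<delta> / 2)" for a \<omega> c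
      using a1[of a \<omega> c] \<delta> by (cases "good a \<omega> c") (simp_all add: good_def)
    have "(\<Sum>a\<in>S. avg L (\<lambda>\<omega>. avg 1 (\<lambda>c. agree \<sigma> a \<omega> (hd c)))) \<le>
        (\<Sum>a\<in>S. avg L (\<lambda>\<omega>. avg 1 (\<lambda>c. of_bool (good a \<omega> (hd c)) + (1 / 2 + \<delta> / 2))))"
      by (intro sum_mono avg_mono pt)
    also have "\<dots> = (\<Sum>a\<in>S. ?G a) + ?s * (1 / 2 + \<delta> / 2)"
      by (simp only: avg_plus avg_const sum.distrib sum_constant distrib_left)
    finally have "(\<Sum>a\<in>S. avg L (\<lambda>\<omega>. avg 1 (\<lambda>c. agree \<sigma> a \<omega> (hd c)))) / ?s \<le>
        ((\<Sum>a\<in>S. ?G a) + ?s * (1 / 2 + \<delta> / 2)) / ?s"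
      by (rule divide_right_mono) simp
    also have "\<dots> = (\<Sum>a\<in>S. ?G a) / ?s + (1 / 2 + \<delta> / 2)" using s by (simp add: add_divide_distrib)
    finally show ?thesis using big by linarith
  qed
  let ?dec = "\<lambda>y u \<omega> c g. decode (P \<sigma> y u \<omega> (hd c)) N m (span_list (Suc N) k g)"
  let ?AV = "\<lambda>\<phi>. avg j (\<lambda>u. avg L (\<lambda>\<omega>. avg 1 (\<lambda>c. avg (Suc k * Suc N) (\<lambda>g. \<phi> u \<omega> c g))))"
  define E where "E a = ?AV (\<lambda>u \<omega> c g. of_bool (?dec (f a) u \<omega> c g = a))" for a
  have E: "?G a / 2 ^ j / 2 ^ (k + 2) \<le> E a" if a: "a \<in> S" for a
  proof -
    have la: "length a = m" using a S by auto
    have "of_bool (u = H \<omega> a) * of_bool (good a \<omega> (hd c)) * (1 / 2 ^ (k + 2)) \<le>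
        avg (Suc k * Suc N) (\<lambda>g. of_bool (?dec (f a) u \<omega> c g = a))" for u \<omega> c
    proof (cases "u = H \<omega> a \<and> good a \<omega> (hd c)")
      case True
      then have "1 / 2 + \<delta> / 2 \<le> avg N (\<lambda>r. of_bool (P \<sigma> (f a) u \<omega> (hd c) r = ip r a))"
        by (auto simp: good_def agree_def)
      from Goldreich_Levin[OF this _ la mN k] \<delta> True show ?thesis by simp
    next
      case False
      then have "of_bool (u = H \<omega> a) * of_bool (good a \<omega> (hd c)) * (1 / 2 ^ (k + 2)) = (0 :: real)"
        by auto
      also have "\<dots> \<le> avg (Suc k * Suc N) (\<lambda>g. of_bool (?dec (f a) u \<omega> c g = a))"
        by (rule avg_nonneg) simp
      finally show ?thesis .
    qed
    then have "avg j (\<lambda>u. avg L (\<lambda>\<omega>. avg 1 (\<lambda>c. of_bool (u = H \<omega> a) *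
        of_bool (good a \<omega> (hd c)) * (1 / 2 ^ (k + 2))))) \<le> E a"
      unfolding E_def by (intro avg_mono)
    also have "avg j (\<lambda>u. avg L (\<lambda>\<omega>. avg 1 (\<lambda>c. of_bool (u = H \<omega> a) *
        of_bool (good a \<omega> (hd c)) * (1 / 2 ^ (k + 2))))) =
        avg L (\<lambda>\<omega>. avg j (\<lambda>u. avg 1 (\<lambda>c. of_bool (u = H \<omega> a) *
        of_bool (good a \<omega> (hd c)) * (1 / 2 ^ (k + 2)))))"
      by (rule avg_swap)
    also have "\<dots> = avg L (\<lambda>\<omega>. avg 1 (\<lambda>c. of_bool (good a \<omega> (hd c))) * (1 / 2 ^ (k + 2)) *
        avg j (\<lambda>u. of_bool (u = H \<omega> a)))"
    proof (rule avg_cong)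
      fix \<omega> :: "bool list"
      have "avg j (\<lambda>u. avg 1 (\<lambda>c. of_bool (u = H \<omega> a) * of_bool (good a \<omega> (hd c)) * (1 / 2 ^ (k + 2)))) =
          avg j (\<lambda>u. avg 1 (\<lambda>c. of_bool (u = H \<omega> a) * (1 / 2 ^ (k + 2)) * of_bool (good a \<omega> (hd c))))"
        by (simp only: ac_simps)
      also have "\<dots> = avg j (\<lambda>u. (avg 1 (\<lambda>c. of_bool (good a \<omega> (hd c))) * (1 / 2 ^ (k + 2))) * of_bool (u = H \<omega> a))"
        by (rule avg_cong) (simp only: avg_cmult, simp only: ac_simps)
      finally show "avg j (\<lambda>u. avg 1 (\<lambda>c. of_bool (u = H \<omega> a) * of_bool (good a \<omega> (hd c)) * (1 / 2 ^ (k + 2)))) =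
          avg 1 (\<lambda>c. of_bool (good a \<omega> (hd c))) * (1 / 2 ^ (k + 2)) * avg j (\<lambda>u. of_bool (u = H \<omega> a))"
        by (simp only: avg_cmult)
    qed
    also have "\<dots> = avg L (\<lambda>\<omega>. (1 / 2 ^ (k + 2) / 2 ^ j) * avg 1 (\<lambda>c. of_bool (good a \<omega> (hd c))))"
      by (rule avg_cong) (simp add: avg_of_bool_eq[OF H])
    also have "\<dots> = ?G a / 2 ^ j / 2 ^ (k + 2)"
      unfolding avg_cmult by simp
    finally show ?thesis .
  qed
  let ?B = "{a :: bool list. length a = m}"
  have "2 ^ i / 2 ^ m * (card S / 2 ^ j) * (\<delta> / 2) / 2 ^ (k + 2) =
      2 ^ i / 2 ^ m * (?s * (\<delta> / 2)) / 2 ^ j / 2 ^ (k + 2)" by simp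
  also have "\<dots> \<le> 2 ^ i / 2 ^ m * (\<Sum>a\<in>S. ?G a) / 2 ^ j / 2 ^ (k + 2)"
    using good s by (intro divide_right_mono mult_left_mono) (simp_all add: field_simps)
  also have "\<dots> = 2 ^ i / 2 ^ m * (\<Sum>a\<in>S. ?G a / 2 ^ j / 2 ^ (k + 2))"
    by (simp add: sum_divide_distrib[symmetric])
  also have "\<dots> \<le> 2 ^ i / 2 ^ m * (\<Sum>a\<in>S. E a)"
    by (intro mult_left_mono sum_mono E) auto
  also have "\<dots> = (\<Sum>a\<in>S. 2 ^ i * E a) / 2 ^ m"
    by (simp add: sum_distrib_left[symmetric])
  \<comment> \<open>The factor \<open>2 ^ i\<close> becomes the size of the fibre: \<open>a'\<close>
    is a possible answer for every \<open>a\<close> with the same image, and \<open>E a'\<close>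
    depends on the input only through that image. So the sum turns into an average over uniform
    \<open>a\<close> of a sum over the preimages of \<open>f a\<close> in \<open>S\<close>.\<close>
  also have "\<dots> \<le> (\<Sum>a'\<in>S. real (card {b. length b = m \<and> f b = f a'}) * E a') / 2 ^ m"
  proof (intro divide_right_mono sum_mono mult_right_mono)
    fix a assume "a \<in> S"
    from fib[OF this] show "2 ^ i \<le> real (card {b. length b = m \<and> f b = f a})"
      by (metis of_nat_le_iff of_nat_numeral of_nat_power)
    show "0 \<le> E a" unfolding E_def by (intro avg_nonneg) simp
  qed simp
  also have "\<dots> = (\<Sum>a'\<in>S. \<Sum>a\<in>?B. if f a = f a' then E a' else 0) / 2 ^ m"
    by (simp add: sum.If_cases Int_def)
  also have "\<dots> = avg m (\<lambda>a. \<Sum>a'\<in>S. if f a = f a' then E a' else 0)"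
    unfolding avg_def by (subst sum.swap) simp
  also have "\<dots> \<le> avg m (\<lambda>a. ?AV (\<lambda>u \<omega> c g. of_bool (f (?dec (f a) u \<omega> c g) = f a)))"
  proof (rule avg_mono)
    fix a :: "bool list"
    have "(\<Sum>a'\<in>S. if f a = f a' then E a' else 0) =
        (\<Sum>a'\<in>S. ?AV (\<lambda>u \<omega> c g. if f a = f a' then of_bool (?dec (f a) u \<omega> c g = a') else 0))"
      by (intro sum.cong) (auto simp: E_def)
    also have "\<dots> = ?AV (\<lambda>u \<omega> c g. \<Sum>a'\<in>S. if f a = f a' then of_bool (?dec (f a) u \<omega> c g = a') else 0)"
      by (simp only: avg_sum)
    also have "\<dots> \<le> ?AV (\<lambda>u \<omega> c g. of_bool (f (?dec (f a) u \<omega> c g) = f a))"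
    proof (intro avg_mono)
      fix u \<omega> c g :: "bool list"
      let ?z = "?dec (f a) u \<omega> c g"
      have "(\<Sum>a'\<in>S. if f a = f a' then of_bool (?z = a') else 0) =
          (\<Sum>a'\<in>S. if ?z = a' then of_bool (f a = f ?z) else (0 :: real))"
        by (intro sum.cong) auto
      also have "\<dots> \<le> of_bool (f ?z = f a)" using finS by (simp add: sum.delta)
      finally show "(\<Sum>a'\<in>S. if f a = f a' then of_bool (?z = a') else (0 :: real)) \<le> of_bool (f ?z = f a)" .
    qed
    finally show "(\<Sum>a'\<in>S. if f a = f a' then E a' else 0) \<le>
        ?AV (\<lambda>u \<omega> c g. of_bool (f (?dec (f a) u \<omega> c g) = f a))" .
  qed
  finally show ?thesis unfolding P_def by blast
qed

section \<open>The hybrid argument\<close>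

definition gen_bits :: "(bool list \<Rightarrow> bool list) \<Rightarrow> nat \<Rightarrow> nat \<Rightarrow> nat \<Rightarrow> bool list \<Rightarrow> bool list \<Rightarrow> bool list" where
  "gen_bits f n k l R a = hashes k n R (f a @ [True]) @ hashes l n (drop (k * n) R) a"

lemma length_gen_bits [simp]: "length (gen_bits f n k l R a) = k + l"
  by (simp add: gen_bits_def)

lemma hashes_prefix: "length R = k * n \<Longrightarrow> hashes k n (R @ R') y = hashes k n R y"
  using hashes_append[of R k n 0 R' y] by simp

text \<open>The input of the distinguisher in the reduction: the row \<open>r\<close> and the bit \<open>c\<close> are planted at
  the position where two neighbouring hybrids differ.\<close>

definition query :: "nat \<Rightarrow> nat \<Rightarrow> nat \<Rightarrow> nat \<Rightarrow> nat \<Rightarrow> bool list \<Rightarrow> bool list \<Rightarrow> bool list \<Rightarrow> bool list \<Rightarrow> bool \<Rightarrow> bool list" where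
  "query n n1 k j l y u \<omega> r c =
     take n1 \<omega> @ take (k * n) (drop n1 \<omega>) @ take (j * n) (drop (n1 + k * n) \<omega>) @ r @
     take (l * n) (drop (n1 + k * n + j * n) \<omega>) @
     hashes k n (take (k * n) (drop n1 \<omega>)) (y @ [True]) @ u @ [c] @
     take l (drop (n1 + k * n + j * n + l * n) \<omega>)"

definition query_coins :: "nat \<Rightarrow> nat \<Rightarrow> nat \<Rightarrow> nat \<Rightarrow> nat \<Rightarrow> bool list \<Rightarrow> bool list" where
  "query_coins n n1 k j l \<omega> = drop (n1 + k * n + j * n + l * n + l) \<omega>"

text \<open>Here \<open>n\<close> is the width of the hash rows, not the seed length;
  \<open>A w \<rho>\<close> is the verdict on \<open>w\<close> with coins \<rho>, and
  \<open>n1\<close> is the length of the part of the seed that is passed through.\<close>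

locale distinguisher =
  fixes f :: "bool list \<Rightarrow> bool list" and A :: "bool list \<Rightarrow> bool list \<Rightarrow> bool"
    and q n n1 k l m i :: nat and S :: "bool list set"
  assumes S: "S \<subseteq> {a. length a = m}" "S \<noteq> {}"
    and fib: "\<And>a. a \<in> S \<Longrightarrow> 2 ^ i \<le> card {b. length b = m \<and> f b = f a}"
    and fib': "\<And>a. a \<in> S \<Longrightarrow> card {b. length b = m \<and> f b = f a} \<le> 2 ^ Suc i"
    and mn: "m \<le> n" and fn: "\<And>a. length a = m \<Longrightarrow> length (f a) < n"
begin

lemma finS: "finite S"
  using S(1) finite_bits finite_subset by blast

definition \<alpha> :: "bool list \<Rightarrow> real" where
  "\<alpha> w = avg q (\<lambda>\<rho>. of_bool (A w \<rho>))"

lemma \<alpha>: "0 \<le> \<alpha> w" "\<alpha> w \<le> 1"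
  unfolding \<alpha>_def by (auto intro: avg_nonneg avg_le)

definition hybrid1 :: "nat \<Rightarrow> bool list \<Rightarrow> real" where
  "hybrid1 j a = avg n1 (\<lambda>x. avg (k * n) (\<lambda>R1. avg (l * n) (\<lambda>R2. avg (l - j) (\<lambda>z.
     \<alpha> (x @ R1 @ R2 @ hashes k n R1 (f a @ [True]) @ hashes j n R2 a @ z)))))"

definition hybrid :: "nat \<Rightarrow> real" where
  "hybrid j = (\<Sum>a\<in>S. hybrid1 j a) / card S"

definition real_prob :: real where
  "real_prob = (\<Sum>a\<in>S. avg n1 (\<lambda>x. avg ((k + l) * n) (\<lambda>R. \<alpha> (x @ R @ gen_bits f n k l R a)))) / card S"

definition ideal_prob :: real where
  "ideal_prob = avg n1 (\<lambda>x. avg ((k + l) * n) (\<lambda>R. avg (k + l) (\<lambda>z. \<alpha> (x @ R @ z))))"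

lemma hybrid_last: "hybrid l = real_prob"
proof -
  have "avg ((k + l) * n) (\<lambda>R. \<alpha> (x @ R @ gen_bits f n k l R a)) =
      avg (k * n) (\<lambda>R1. avg (l * n) (\<lambda>R2.
        \<alpha> (x @ R1 @ R2 @ hashes k n R1 (f a @ [True]) @ hashes l n R2 a)))" for x a
  proof -
    have "avg ((k + l) * n) (\<lambda>R. \<alpha> (x @ R @ gen_bits f n k l R a)) =
        avg (k * n) (\<lambda>R1. avg (l * n) (\<lambda>R2. \<alpha> (x @ (R1 @ R2) @ gen_bits f n k l (R1 @ R2) a)))"
      unfolding add_mult_distrib by (rule avg_add)
    also have "\<dots> = avg (k * n) (\<lambda>R1. avg (l * n) (\<lambda>R2.
        \<alpha> (x @ R1 @ R2 @ hashes k n R1 (f a @ [True]) @ hashes l n R2 a)))"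
      by (intro avg_cong) (simp add: gen_bits_def hashes_prefix)
    finally show ?thesis .
  qed
  then show ?thesis by (simp add: hybrid_def hybrid1_def real_prob_def)
qed

text \<open>Without image bits the first hybrid is uniform outright. The case is treated separately
  because \<open>k\<close> may be 0 when the fibres are so large that the leftover hash bound says
  nothing.\<close>

lemma hybrid_first_0: "k = 0 \<Longrightarrow> hybrid 0 = ideal_prob"
  unfolding hybrid_def hybrid1_def ideal_prob_def using S finS by (simp add: hashes_def)

text \<open>The leftover hash lemma for the images of \<open>S\<close>: every element of
  \<open>S\<close> shares its image with at most \<open>2 ^ Suc i\<close> elements. All other
  randomness of the hybrid is averaged into the test \<phi>.\<close>

lemma hybrid_first:
  "(hybrid 0 - ideal_prob)\<^sup>2 \<le> 2 ^ k * (2 ^ Suc i / card S)"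
proof -
  define \<phi> where "\<phi> R1 z1 = avg n1 (\<lambda>x. avg (l * n) (\<lambda>R2. avg l (\<lambda>z. \<alpha> (x @ R1 @ R2 @ z1 @ z))))" for R1 z1
  have \<phi>: "0 \<le> \<phi> R z" "\<phi> R z \<le> 1" for R z
    unfolding \<phi>_def by (auto intro!: avg_nonneg avg_le \<alpha>)
  have 1: "hybrid1 0 a = avg (k * n) (\<lambda>R1. \<phi> R1 (hashes k n R1 (f a @ [True])))" for a
    unfolding hybrid1_def \<phi>_def by (subst avg_swap) simp
  have 2: "ideal_prob = avg (k * n) (\<lambda>R1. avg k (\<phi> R1))"
  proof -
    have "ideal_prob = avg n1 (\<lambda>x. avg (k * n) (\<lambda>R1. avg (l * n) (\<lambda>R2. avg k (\<lambda>z1. avg l (\<lambda>z.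
        \<alpha> (x @ R1 @ R2 @ z1 @ z))))))"
      unfolding ideal_prob_def add_mult_distrib avg_add append_assoc ..
    also have "\<dots> = avg (k * n) (\<lambda>R1. avg n1 (\<lambda>x. avg (l * n) (\<lambda>R2. avg k (\<lambda>z1. avg l (\<lambda>z.
        \<alpha> (x @ R1 @ R2 @ z1 @ z))))))"
      by (rule avg_swap)
    also have "\<dots> = avg (k * n) (\<lambda>R1. avg n1 (\<lambda>x. avg k (\<lambda>z1. avg (l * n) (\<lambda>R2. avg l (\<lambda>z.
        \<alpha> (x @ R1 @ R2 @ z1 @ z))))))"
      by (intro avg_cong avg_swap)
    also have "\<dots> = avg (k * n) (\<lambda>R1. avg k (\<lambda>z1. avg n1 (\<lambda>x. avg (l * n) (\<lambda>R2. avg l (\<lambda>z.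
        \<alpha> (x @ R1 @ R2 @ z1 @ z))))))"
      by (intro avg_cong avg_swap)
    finally show ?thesis unfolding \<phi>_def .
  qed
  have "(hybrid 0 - ideal_prob)\<^sup>2 \<le>
      2 ^ k * (card {(a, b) \<in> S \<times> S. f a @ [True] = f b @ [True]} / (real (card S))\<^sup>2)"
    unfolding hybrid_def 1 2
  proof (rule leftover_hash[OF finS S(2)])
    fix a b assume "a \<in> S" "b \<in> S" "f a @ [True] \<noteq> f b @ [True]"
    then show "separated n (f a @ [True]) (f b @ [True])"
      using S(1) fn by (intro separated_snoc) auto
  qed (rule \<phi>)+
  also have "\<dots> \<le> 2 ^ k * (2 ^ Suc i / card S)"
  proof (rule mult_left_mono)
    have "{(a, b) \<in> S \<times> S. f a @ [True] = f b @ [True]} = (SIGMA a:S. {b \<in> S. f b = f a})" by auto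
    then have "card {(a, b) \<in> S \<times> S. f a @ [True] = f b @ [True]} = (\<Sum>a\<in>S. card {b \<in> S. f b = f a})"
      using finS by simp
    also have "\<dots> \<le> (\<Sum>a\<in>S. 2 ^ Suc i)"
    proof (rule sum_mono)
      fix a assume a: "a \<in> S"
      have "card {b \<in> S. f b = f a} \<le> card {b. length b = m \<and> f b = f a}"
        using S(1) by (intro card_mono) (auto intro: finite_subset[OF _ finite_bits[of m]])
      with fib'[OF a] show "card {b \<in> S. f b = f a} \<le> 2 ^ Suc i" by linarith
    qed
    finally have "card {(a, b) \<in> S \<times> S. f a @ [True] = f b @ [True]} \<le> card S * 2 ^ Suc i" by simp
    from of_nat_mono[OF this, where 'a = real]
    have "real (card {(a, b) \<in> S \<times> S. f a @ [True] = f b @ [True]}) \<le> real (card S) * 2 ^ Suc i"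
      by simp
    then have "real (card {(a, b) \<in> S \<times> S. f a @ [True] = f b @ [True]}) / (real (card S))\<^sup>2 \<le>
        real (card S) * 2 ^ Suc i / (real (card S))\<^sup>2" by (rule divide_right_mono) simp
    also have "\<dots> = 2 ^ Suc i / real (card S)" by (simp add: power2_eq_square)
    finally show "real (card {(a, b) \<in> S \<times> S. f a @ [True] = f b @ [True]}) / (real (card S))\<^sup>2 \<le> 2 ^ Suc i / real (card S)" .
  qed simp
  finally show ?thesis .
qed

text \<open>Neighbouring hybrids differ in one bit, which is \<open>ip r a\<close> in one and
  uniform in the other. The averages are reordered so that everything but the row \<open>r\<close>
  becomes the randomness \<omega> of a predictor, as \<open>inverter_success\<close>
  expects.\<close>

lemma hybrid_step:
  assumes "j < l"
  defines "l' \<equiv> l - Suc j"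
  defines "H \<equiv> \<lambda>\<omega>. hashes j n (take (j * n) (drop (n1 + k * n) \<omega>))"
  defines "Acc \<equiv> \<lambda>y u \<omega> r c. A (query n n1 k j l' y u \<omega> r c) (query_coins n n1 k j l' \<omega>)"
  shows "hybrid (Suc j) - hybrid j = (\<Sum>a\<in>S. avg (n1 + (k * n + (j * n + (l' * n + (l' + q)))))
    (\<lambda>\<omega>. avg n (\<lambda>r. of_bool (Acc (f a) (H \<omega> a) \<omega> r (ip r a)) -
      (of_bool (Acc (f a) (H \<omega> a) \<omega> r True) + of_bool (Acc (f a) (H \<omega> a) \<omega> r False)) / 2))) / card S"
proof -
  have l: "l = j + Suc l'" "l - j = 1 + l'" "l - Suc j = l'" using assms by auto
  have ln: "l * n = j * n + (n + l' * n)" by (simp add: l(1) algebra_simps)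
  let ?W = "\<lambda>a x R1 R2 r R3 u c. x @ R1 @ R2 @ r @ R3 @ hashes k n R1 (f a @ [True]) @ hashes j n R2 a @ [c] @ u"
  let ?av = "\<lambda>\<phi>. avg n1 (\<lambda>x. avg (k * n) (\<lambda>R1. avg (j * n) (\<lambda>R2. avg (l' * n) (\<lambda>R3. avg l' (\<lambda>u. avg q (\<lambda>\<rho>. avg n (\<lambda>r.
      \<phi> x R1 R2 r R3 u \<rho>)))))))"
  have sw: "avg n (\<lambda>r. avg (l' * n) (\<lambda>R3. avg l' (\<lambda>u. avg q (\<lambda>\<rho>. \<phi> r R3 u \<rho>)))) =
      avg (l' * n) (\<lambda>R3. avg l' (\<lambda>u. avg q (\<lambda>\<rho>. avg n (\<lambda>r. \<phi> r R3 u \<rho>))))" for \<phi>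
  proof -
    have "avg n (\<lambda>r. avg (l' * n) (\<lambda>R3. avg l' (\<lambda>u. avg q (\<lambda>\<rho>. \<phi> r R3 u \<rho>)))) =
        avg (l' * n) (\<lambda>R3. avg n (\<lambda>r. avg l' (\<lambda>u. avg q (\<lambda>\<rho>. \<phi> r R3 u \<rho>))))" by (rule avg_swap)
    also have "\<dots> = avg (l' * n) (\<lambda>R3. avg l' (\<lambda>u. avg n (\<lambda>r. avg q (\<lambda>\<rho>. \<phi> r R3 u \<rho>))))"
      by (intro avg_cong avg_swap)
    also have "\<dots> = avg (l' * n) (\<lambda>R3. avg l' (\<lambda>u. avg q (\<lambda>\<rho>. avg n (\<lambda>r. \<phi> r R3 u \<rho>))))"
      by (intro avg_cong avg_swap)
    finally show ?thesis .
  qed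
  have h1: "hybrid1 (Suc j) a = ?av (\<lambda>x R1 R2 r R3 u \<rho>. of_bool (A (?W a x R1 R2 r R3 u (ip r a)) \<rho>))" for a
  proof -
    have "hybrid1 (Suc j) a = avg n1 (\<lambda>x. avg (k * n) (\<lambda>R1. avg (j * n) (\<lambda>R2. avg n (\<lambda>r. avg (l' * n) (\<lambda>R3. avg l' (\<lambda>u.
        \<alpha> (x @ R1 @ (R2 @ (r @ R3)) @ hashes k n R1 (f a @ [True]) @ hashes (Suc j) n (R2 @ (r @ R3)) a @ u)))))))"
      unfolding hybrid1_def ln l(3) avg_add ..
    also have "\<dots> = avg n1 (\<lambda>x. avg (k * n) (\<lambda>R1. avg (j * n) (\<lambda>R2. avg n (\<lambda>r. avg (l' * n) (\<lambda>R3. avg l' (\<lambda>u. avg q (\<lambda>\<rho>.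
        of_bool (A (?W a x R1 R2 r R3 u (ip r a)) \<rho>))))))))"
    proof (intro avg_cong)
      fix x R1 R2 r R3 u :: "bool list" assume "length R2 = j * n" "length r = n"
      then have "hashes (Suc j) n (R2 @ (r @ R3)) a = hashes j n R2 a @ [ip r a]"
        using hashes_append[of R2 j n 1 "r @ R3" a] hashes_prefix[of r 1 n R3 a] hashes_1[of r n a]
        by simp
      then show "\<alpha> (x @ R1 @ (R2 @ (r @ R3)) @ hashes k n R1 (f a @ [True]) @ hashes (Suc j) n (R2 @ (r @ R3)) a @ u) =
          avg q (\<lambda>\<rho>. of_bool (A (?W a x R1 R2 r R3 u (ip r a)) \<rho>))"
        by (simp add: \<alpha>_def)
    qed
    also have "\<dots> = ?av (\<lambda>x R1 R2 r R3 u \<rho>. of_bool (A (?W a x R1 R2 r R3 u (ip r a)) \<rho>))"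
      by (simp only: sw)
    finally show ?thesis .
  qed
  have h0: "hybrid1 j a = ?av (\<lambda>x R1 R2 r R3 u \<rho>. (of_bool (A (?W a x R1 R2 r R3 u True) \<rho>) +
      of_bool (A (?W a x R1 R2 r R3 u False) \<rho>)) / 2)" for a
  proof -
    have "hybrid1 j a = avg n1 (\<lambda>x. avg (k * n) (\<lambda>R1. avg (j * n) (\<lambda>R2. avg n (\<lambda>r. avg (l' * n) (\<lambda>R3. avg 1 (\<lambda>c. avg l' (\<lambda>u.
        \<alpha> (x @ R1 @ (R2 @ (r @ R3)) @ hashes k n R1 (f a @ [True]) @ hashes j n (R2 @ (r @ R3)) a @ (c @ u)))))))))"
      unfolding hybrid1_def ln l(2) avg_add ..
    also have "\<dots> = avg n1 (\<lambda>x. avg (k * n) (\<lambda>R1. avg (j * n) (\<lambda>R2. avg n (\<lambda>r. avg (l' * n) (\<lambda>R3. avg l' (\<lambda>u. avg q (\<lambda>\<rho>.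
        (of_bool (A (?W a x R1 R2 r R3 u True) \<rho>) + of_bool (A (?W a x R1 R2 r R3 u False) \<rho>)) / 2)))))))"
    proof (intro avg_cong)
      fix x R1 R2 r R3 :: "bool list" assume "length R2 = j * n" "length r = n"
      then have "hashes j n (R2 @ (r @ R3)) a = hashes j n R2 a" by (simp add: hashes_prefix)
      then have "avg 1 (\<lambda>c. avg l' (\<lambda>u.
        \<alpha> (x @ R1 @ (R2 @ (r @ R3)) @ hashes k n R1 (f a @ [True]) @ hashes j n (R2 @ (r @ R3)) a @ (c @ u)))) =
        (avg l' (\<lambda>u. \<alpha> (?W a x R1 R2 r R3 u True)) + avg l' (\<lambda>u. \<alpha> (?W a x R1 R2 r R3 u False))) / 2"
        unfolding avg_1 by simp
      also have "\<dots> = avg l' (\<lambda>u. avg q (\<lambda>\<rho>.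
        (of_bool (A (?W a x R1 R2 r R3 u True) \<rho>) + of_bool (A (?W a x R1 R2 r R3 u False) \<rho>)) / 2))"
        by (simp only: avg_plus avg_divide \<alpha>_def)
      finally show "avg 1 (\<lambda>c. avg l' (\<lambda>u.
        \<alpha> (x @ R1 @ (R2 @ (r @ R3)) @ hashes k n R1 (f a @ [True]) @ hashes j n (R2 @ (r @ R3)) a @ (c @ u)))) =
        avg l' (\<lambda>u. avg q (\<lambda>\<rho>.
        (of_bool (A (?W a x R1 R2 r R3 u True) \<rho>) + of_bool (A (?W a x R1 R2 r R3 u False) \<rho>)) / 2))" .
    qed
    also have "\<dots> = ?av (\<lambda>x R1 R2 r R3 u \<rho>. (of_bool (A (?W a x R1 R2 r R3 u True) \<rho>) +
      of_bool (A (?W a x R1 R2 r R3 u False) \<rho>)) / 2)"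
      by (simp only: sw)
    finally show ?thesis .
  qed
  have "avg (n1 + (k * n + (j * n + (l' * n + (l' + q)))))
    (\<lambda>\<omega>. avg n (\<lambda>r. of_bool (Acc (f a) (H \<omega> a) \<omega> r (ip r a)) -
      (of_bool (Acc (f a) (H \<omega> a) \<omega> r True) + of_bool (Acc (f a) (H \<omega> a) \<omega> r False)) / 2)) =
    hybrid1 (Suc j) a - hybrid1 j a" for a
  proof -
    have "avg (n1 + (k * n + (j * n + (l' * n + (l' + q)))))
      (\<lambda>\<omega>. avg n (\<lambda>r. of_bool (Acc (f a) (H \<omega> a) \<omega> r (ip r a)) -
        (of_bool (Acc (f a) (H \<omega> a) \<omega> r True) + of_bool (Acc (f a) (H \<omega> a) \<omega> r False)) / 2)) =
      ?av (\<lambda>x R1 R2 r R3 u \<rho>. of_bool (A (?W a x R1 R2 r R3 u (ip r a)) \<rho>) -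
        (of_bool (A (?W a x R1 R2 r R3 u True) \<rho>) + of_bool (A (?W a x R1 R2 r R3 u False) \<rho>)) / 2)"
      unfolding avg_add
    proof (intro avg_cong)
      fix x R1 R2 R3 u \<rho> r :: "bool list"
      assume len: "length x = n1" "length R1 = k * n" "length R2 = j * n" "length R3 = l' * n"
        "length u = l'" "length \<rho> = q" "length r = n"
      let ?\<omega> = "x @ R1 @ R2 @ R3 @ u @ \<rho>"
      have "Acc (f a) (H ?\<omega> a) ?\<omega> r c = A (?W a x R1 R2 r R3 u c) \<rho>" for c
        unfolding Acc_def H_def query_def query_coins_def using len by simp
      then show "of_bool (Acc (f a) (H ?\<omega> a) ?\<omega> r (ip r a)) -
        (of_bool (Acc (f a) (H ?\<omega> a) ?\<omega> r True) + of_bool (Acc (f a) (H ?\<omega> a) ?\<omega> r False)) / 2 =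
        of_bool (A (?W a x R1 R2 r R3 u (ip r a)) \<rho>) -
        (of_bool (A (?W a x R1 R2 r R3 u True) \<rho>) + of_bool (A (?W a x R1 R2 r R3 u False) \<rho>)) / (2 :: real)"
        by simp
    qed
    also have "\<dots> = hybrid1 (Suc j) a - hybrid1 j a"
      unfolding h1 h0 by (simp only: avg_minus)
    finally show ?thesis .
  qed
  then show ?thesis
    by (simp add: hybrid_def sum_subtractf diff_divide_distrib)
qed

text \<open>Half of \<epsilon> pays for replacing the image bits by uniform ones. The other half is
  spread over \<open>l\<close> steps, so some step keeps a gap of
  \<open>\<epsilon> / (2 * real l)\<close>; the further halving is the loss in
  \<open>inverter_success\<close>.\<close>

theorem distinguish_invert:
  assumes \<epsilon>: "\<epsilon> > 0" "\<epsilon> \<le> \<bar>real_prob - ideal_prob\<bar>"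
    and k: "k = 0 \<or> 2 ^ k * (2 ^ Suc i / card S) \<le> (\<epsilon> / 2)\<^sup>2"
    and \<kappa>: "real m \<le> 2 * 2 ^ \<kappa> * (\<epsilon> / (2 * real l) / 2)\<^sup>2"
  shows "\<exists>j<l. \<exists>\<sigma>. 2 ^ i / 2 ^ m * (card S / 2 ^ j) * (\<epsilon> / (2 * real l) / 2) / 2 ^ (\<kappa> + 2) \<le>
    avg m (\<lambda>a. avg j (\<lambda>u. avg (n1 + (k * n + (j * n + ((l - Suc j) * n + ((l - Suc j) + q))))) (\<lambda>\<omega>.
      avg 1 (\<lambda>c. avg (Suc \<kappa> * Suc n) (\<lambda>g.
      of_bool (f (decode (\<lambda>r. A (query n n1 k j (l - Suc j) (f a) u \<omega> r (hd c))
          (query_coins n n1 k j (l - Suc j) \<omega>) = (hd c = \<sigma>)) n m (span_list (Suc n) \<kappa> g)) = f a))))))"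
proof -
  have "\<bar>hybrid 0 - ideal_prob\<bar> \<le> \<epsilon> / 2"
    using k
  proof
    assume "k = 0"
    then show ?thesis using hybrid_first_0 \<epsilon>(1) by simp
  next
    assume "2 ^ k * (2 ^ Suc i / card S) \<le> (\<epsilon> / 2)\<^sup>2"
    from order.trans[OF hybrid_first this] show ?thesis
      using \<epsilon>(1) by (simp add: abs_le_square_iff[symmetric])
  qed
  then have gap: "\<epsilon> / 2 \<le> \<bar>hybrid l - hybrid 0\<bar>" using \<epsilon> hybrid_last by linarith
  have l: "l > 0" using gap \<epsilon>(1) by (cases l) auto
  have "\<exists>j<l. \<epsilon> / (2 * real l) \<le> \<bar>hybrid (Suc j) - hybrid j\<bar>"
  proof (rule ccontr)
    assume "\<not> ?thesis"
    then have "\<And>j. j < l \<Longrightarrow> \<bar>hybrid (Suc j) - hybrid j\<bar> < \<epsilon> / (2 * real l)" by force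
    then have "(\<Sum>j<l. \<bar>hybrid (Suc j) - hybrid j\<bar>) < (\<Sum>j<l. \<epsilon> / (2 * real l))"
      using l by (intro sum_strict_mono) auto
    also have "\<dots> = \<epsilon> / 2" using l by simp
    finally have "(\<Sum>j<l. \<bar>hybrid (Suc j) - hybrid j\<bar>) < \<epsilon> / 2" .
    moreover have "\<bar>hybrid l - hybrid 0\<bar> \<le> (\<Sum>j<l. \<bar>hybrid (Suc j) - hybrid j\<bar>)"
      unfolding sum_lessThan_telescope[symmetric] by (rule sum_abs)
    ultimately show False using gap by linarith
  qed
  then obtain j where j: "j < l" "\<epsilon> / (2 * real l) \<le> \<bar>hybrid (Suc j) - hybrid j\<bar>" by blast
  have "\<epsilon> / (2 * real l) > 0" using \<epsilon>(1) l by simp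
  note inv = inverter_success[where f = f and i = i and j = j and L = "n1 + (k * n + (j * n + ((l - Suc j) * n + ((l - Suc j) + q))))"
      and H = "\<lambda>\<omega>. hashes j n (take (j * n) (drop (n1 + k * n) \<omega>))"
      and Acc = "\<lambda>y u \<omega> r c. A (query n n1 k j (l - Suc j) y u \<omega> r c) (query_coins n n1 k j (l - Suc j) \<omega>)",
      OF S fib length_hashes mn this \<kappa>]
  show ?thesis
    by (rule exI[of _ j], rule conjI[OF j(1)], rule inv) (use j(2) hybrid_step[OF j(1)] in simp_all)
qed

end

section \<open>Entropy\<close>

text \<open>Jensen's inequality for the logarithm: Shannon entropy is at least collision
  entropy.\<close>

lemma log_le_collision:
  fixes p :: "'a \<Rightarrow> real"
  assumes "finite Z" "Z \<noteq> {}" "\<And>z. z \<in> Z \<Longrightarrow> p z > 0" "(\<Sum>z\<in>Z. p z) = 1"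
  shows "(\<Sum>z\<in>Z. p z * log 2 (p z)) \<le> log 2 (\<Sum>z\<in>Z. (p z)\<^sup>2)"
proof -
  have "- log 2 (\<Sum>z\<in>Z. p z *\<^sub>R p z) \<le> (\<Sum>z\<in>Z. p z * - log 2 (p z))"
    using assms by (intro convex_on_sum[OF _ _ minus_log_convex]) (auto intro: less_imp_le)
  then show ?thesis by (simp add: sum_negf power2_eq_square)
qed

text \<open>Entropy is bounded through collisions: if a seed collides with \<open>K\<close> seeds on
  average, itself included, then at most \<open>log 2 K\<close> bits are lost.\<close>

lemma entropy_map_uniform:
  fixes G :: "'a \<Rightarrow> 'b::countable" and K :: real
  assumes E: "finite E" "E \<noteq> {}"
    and K: "real (card {(x, y) \<in> E \<times> E. G x = G y}) \<le> K * card E"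
  shows "log 2 (card E) - log 2 K \<le> shannon_entropy (map_pmf G (pmf_of_set E))"
proof -
  let ?P = "map_pmf G (pmf_of_set E)"
  let ?e = "real (card E)"
  let ?Z = "G ` E"
  have e: "?e > 0" using E by (simp add: card_gt_0_iff)
  have Z: "set_pmf ?P = ?Z" using E by simp
  have p: "pmf ?P z = card {x \<in> E. G x = z} / ?e" for z
    using E by (simp add: pmf_map measure_pmf_of_set vimage_def Int_def conj_commute)
  have H: "shannon_entropy ?P = - (\<Sum>z\<in>?Z. pmf ?P z * log 2 (pmf ?P z))"
    using shannon_entropy_eq_sum[of ?P] E by simp
  have pos: "pmf ?P z > 0" if "z \<in> ?Z" for z
    using that Z by (metis pmf_positive)
  have "(\<Sum>z\<in>?Z. pmf ?P z) = 1"
    using sum_pmf_eq_1[of ?Z ?P] E Z by simp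
  with pos have 1: "(\<Sum>z\<in>?Z. pmf ?P z * log 2 (pmf ?P z)) \<le> log 2 (\<Sum>z\<in>?Z. (pmf ?P z)\<^sup>2)"
    using E by (intro log_le_collision) auto
  have "{(x, y) \<in> E \<times> E. G x = G y} = (SIGMA x:E. {y \<in> E. G y = G x})" by auto
  then have "real (card {(x, y) \<in> E \<times> E. G x = G y}) = (\<Sum>x\<in>E. real (card {y \<in> E. G y = G x}))"
    using E by simp
  also have "\<dots> = (\<Sum>z\<in>?Z. \<Sum>x | x \<in> E \<and> G x = z. real (card {y \<in> E. G y = G x}))"
    using sum.image_gen[OF E(1), of _ G] by blast
  also have "\<dots> = (\<Sum>z\<in>?Z. ?e\<^sup>2 * (pmf ?P z)\<^sup>2)"
    using e by (intro sum.cong) (simp_all add: p power2_eq_square)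
  also have "\<dots> = ?e\<^sup>2 * (\<Sum>z\<in>?Z. (pmf ?P z)\<^sup>2)" by (simp add: sum_distrib_left)
  finally have "?e * (\<Sum>z\<in>?Z. (pmf ?P z)\<^sup>2) \<le> K"
    using K e by (simp add: power2_eq_square)
  then have c: "(\<Sum>z\<in>?Z. (pmf ?P z)\<^sup>2) \<le> K / ?e" using e by (simp add: field_simps)
  have s: "0 < (\<Sum>z\<in>?Z. (pmf ?P z)\<^sup>2)"
    using pos E by (intro sum_pos zero_less_power) auto
  then have "log 2 (\<Sum>z\<in>?Z. (pmf ?P z)\<^sup>2) \<le> log 2 (K / ?e)" using c by simp
  also have "\<dots> = log 2 K - log 2 ?e"
  proof -
    have "K / ?e > 0" using s c by linarith
    then have "K > 0" using e by (simp add: zero_less_divide_iff)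
    then show ?thesis using e by (simp add: log_divide)
  qed
  finally show ?thesis using 1 H by linarith
qed

context distinguisher
begin

text \<open>Three kinds of pairs. Equal strings always collide. Different preimages of one image
  collide with probability \<open>1 / 2 ^ l\<close>, and there are at most \<open>2 ^ Suc i\<close>
  partners for each string. Different images collide with probability
  \<open>1 / 2 ^ (k + l)\<close>, with at most \<open>2 ^ m\<close> partners. Per string this is at
  most 1 + 2 + 1.\<close>

lemma collision_bound:
  assumes "i \<le> l" "m \<le> k + l"
  shows "(\<Sum>a\<in>S. \<Sum>b\<in>S. avg ((k + l) * n) (\<lambda>R. of_bool (gen_bits f n k l R a = gen_bits f n k l R b)))
    \<le> 4 * real (card S)"
proof -
  let ?s = "real (card S)"
  have pair: "avg ((k + l) * n) (\<lambda>R. of_bool (gen_bits f n k l R a = gen_bits f n k l R b)) \<le>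
      of_bool (a = b) + of_bool (f b = f a) / 2 ^ l + 1 / 2 ^ (k + l)"
    if ab: "a \<in> S" "b \<in> S" for a b
  proof (cases "a = b")
    case True
    have "avg ((k + l) * n) (\<lambda>R. of_bool (gen_bits f n k l R a = gen_bits f n k l R b)) \<le> 1"
      by (rule avg_le) simp
    then show ?thesis using True by (simp add: add_increasing2)
  next
    case False
    let ?h1 = "\<lambda>R. of_bool (hashes k n R (f a @ [True]) = hashes k n R (f b @ [True])) :: real"
    let ?h2 = "\<lambda>R. of_bool (hashes l n R a = hashes l n R b) :: real"
    have "avg ((k + l) * n) (\<lambda>R. of_bool (gen_bits f n k l R a = gen_bits f n k l R b)) =
        avg (k * n) (\<lambda>R1. avg (l * n) (\<lambda>R2. of_bool (gen_bits f n k l (R1 @ R2) a = gen_bits f n k l (R1 @ R2) b)))"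
      unfolding add_mult_distrib by (rule avg_add)
    also have "\<dots> = avg (k * n) (\<lambda>R1. avg (l * n) (\<lambda>R2. ?h1 R1 * ?h2 R2))"
      by (intro avg_cong) (auto simp: gen_bits_def hashes_prefix)
    also have "\<dots> = avg (k * n) (\<lambda>R1. avg (l * n) ?h2 * ?h1 R1)"
      by (rule avg_cong) (simp only: avg_cmult, rule mult.commute)
    also have "\<dots> = avg (l * n) ?h2 * avg (k * n) ?h1" by (rule avg_cmult)
    also have "avg (l * n) ?h2 = 1 / 2 ^ l"
      using False ab S(1) mn by (intro hash_collision separated_neq) auto
    finally have 1: "avg ((k + l) * n) (\<lambda>R. of_bool (gen_bits f n k l R a = gen_bits f n k l R b)) =
        1 / 2 ^ l * avg (k * n) ?h1" .
    show ?thesis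
    proof (cases "f b = f a")
      case True
      then show ?thesis unfolding 1 using False by simp
    next
      case neq: False
      have "avg (k * n) ?h1 = 1 / 2 ^ k"
        using neq ab S(1) fn by (intro hash_collision separated_snoc) auto
      then show ?thesis unfolding 1 using False neq by (simp add: power_add mult.commute)
    qed
  qed
  have fibS: "(\<Sum>b\<in>S. of_bool (f b = f a) :: real) \<le> 2 ^ Suc i" if a: "a \<in> S" for a
  proof -
    have "(\<Sum>b\<in>S. of_bool (f b = f a) :: real) = real (card {b \<in> S. f b = f a})"
      using finS by (simp add: of_bool_def sum.If_cases Int_def)
    also have "card {b \<in> S. f b = f a} \<le> card {b. length b = m \<and> f b = f a}"
      using S(1) by (intro card_mono) (auto intro: finite_subset[OF _ finite_bits[of m]])
    also note fib'[OF a]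
    finally show ?thesis by simp
  qed
  have "card S \<le> 2 ^ m" using card_mono[OF finite_bits S(1)] by simp
  then have "?s \<le> real (2 ^ m)" by (simp only: of_nat_le_iff)
  also have "real (2 ^ m) \<le> 2 ^ (k + l)" using assms(2) by (simp add: power_increasing)
  finally have s2: "?s / 2 ^ (k + l) \<le> 1" by simp
  have "(2 :: real) ^ i \<le> 2 ^ l" using assms(1) by (simp add: power_increasing)
  then have i2: "2 ^ Suc i / (2 ^ l :: real) \<le> 2" by (simp add: divide_simps)
  have "(\<Sum>a\<in>S. \<Sum>b\<in>S. avg ((k + l) * n) (\<lambda>R. of_bool (gen_bits f n k l R a = gen_bits f n k l R b)))
      \<le> (\<Sum>a\<in>S. \<Sum>b\<in>S. of_bool (a = b) + of_bool (f b = f a) / 2 ^ l + 1 / 2 ^ (k + l))"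
    by (intro sum_mono pair)
  also have "\<dots> = (\<Sum>a\<in>S. 1 + (\<Sum>b\<in>S. of_bool (f b = f a)) / 2 ^ l + ?s / 2 ^ (k + l))"
  proof (rule sum.cong)
    fix a assume a: "a \<in> S"
    have "(\<Sum>b\<in>S. of_bool (a = b) :: real) = 1"
      using finS a by (simp add: of_bool_def sum.delta)
    then show "(\<Sum>b\<in>S. of_bool (a = b) + of_bool (f b = f a) / 2 ^ l + 1 / 2 ^ (k + l)) =
      1 + (\<Sum>b\<in>S. of_bool (f b = f a)) / 2 ^ l + ?s / 2 ^ (k + l)"
      by (simp add: sum.distrib sum_divide_distrib)
  qed simp
  also have "\<dots> \<le> (\<Sum>a\<in>S. 4)"
  proof (rule sum_mono)
    fix a assume "a \<in> S"
    then have "(\<Sum>b\<in>S. of_bool (f b = f a) :: real) / 2 ^ l \<le> 2 ^ Suc i / 2 ^ l"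
      by (intro divide_right_mono fibS) auto
    then show "1 + (\<Sum>b\<in>S. of_bool (f b = f a)) / 2 ^ l + ?s / 2 ^ (k + l) \<le> (4 :: real)"
      using s2 i2 by linarith
  qed
  finally show ?thesis by simp
qed

end

definition seeds :: "nat \<Rightarrow> bool list \<Rightarrow> bool list set \<Rightarrow> bool list set" where
  "seeds n w S = (\<lambda>(p, a). p @ w @ a) ` ({p. length p = n} \<times> S)"

lemma sum_seeds:
  fixes \<phi> :: "bool list \<Rightarrow> real"
  shows "(\<Sum>x\<in>seeds n w S. \<phi> x) = (\<Sum>a\<in>S. 2 ^ n * avg n (\<lambda>p. \<phi> (p @ w @ a)))"
proof -
  have "inj_on (\<lambda>(p, a). p @ w @ a) ({p. length p = n} \<times> S)"
    by (auto simp: inj_on_def)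
  then have "(\<Sum>x\<in>seeds n w S. \<phi> x) = (\<Sum>(p, a)\<in>{p. length p = n} \<times> S. \<phi> (p @ w @ a))"
    unfolding seeds_def by (simp add: sum.reindex case_prod_unfold)
  also have "\<dots> = (\<Sum>p | length p = n. \<Sum>a\<in>S. \<phi> (p @ w @ a))"
    by (simp add: sum.cartesian_product)
  also have "\<dots> = (\<Sum>a\<in>S. \<Sum>p | length p = n. \<phi> (p @ w @ a))" by (rule sum.swap)
  finally show ?thesis by (simp add: avg_def)
qed

lemma card_seeds: "finite S \<Longrightarrow> card (seeds n w S) = 2 ^ n * card S"
proof -
  assume "finite S"
  have "inj_on (\<lambda>(p, a). p @ w @ a) ({p. length p = n} \<times> S)"
    by (auto simp: inj_on_def)
  then show ?thesis by (simp add: seeds_def card_image card_cartesian_product)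
qed

lemma finite_seeds: "finite S \<Longrightarrow> finite (seeds n w S)"
  by (simp add: seeds_def)

context distinguisher
begin

text \<open>As \<open>x\<close> and \<open>R\<close> are part of the output, two seeds can only
  collide if they agree there, and then the hash bits must collide. The average of 4 collisions per
  seed costs 2 bits.\<close>

lemma entropy_bound:
  assumes "i \<le> l" "m \<le> k + l"
    and G: "\<And>x R a. length x = n1 \<Longrightarrow> length R = (k + l) * n \<Longrightarrow> a \<in> S \<Longrightarrow>
      G (x @ R @ w @ a) = x @ R @ gen_bits f n k l R a"
  shows "log 2 (2 ^ (n1 + (k + l) * n) * real (card S)) - 2 \<le>
    shannon_entropy (map_pmf G (pmf_of_set (seeds (n1 + (k + l) * n) w S)))"
proof -
  let ?N = "n1 + (k + l) * n"
  let ?E = "seeds ?N w S"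
  have E: "finite ?E" "?E \<noteq> {}"
    using finite_seeds[OF finS] S(2) by (auto simp: seeds_def)
  have G': "G (p @ w @ a) = p @ gen_bits f n k l (drop n1 p) a" if "length p = ?N" "a \<in> S" for p a
  proof -
    have "take n1 p @ drop n1 p @ z = p @ z" for z by (metis append_assoc append_take_drop_id)
    then show ?thesis using G[of "take n1 p" "drop n1 p" a] that by (simp only:) simp
  qed
  have "{(x, y) \<in> ?E \<times> ?E. G x = G y} = (SIGMA x:?E. {y \<in> ?E. G x = G y})" by auto
  then have "real (card {(x, y) \<in> ?E \<times> ?E. G x = G y}) = (\<Sum>x\<in>?E. real (card {y \<in> ?E. G x = G y}))"
    using E by simp
  also have "\<dots> = (\<Sum>x\<in>?E. \<Sum>y\<in>?E. of_bool (G x = G y))"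
    using E by (simp add: of_bool_def sum.If_cases Int_def)
  also have "\<dots> = (\<Sum>a\<in>S. 2 ^ ?N * avg ?N (\<lambda>p. \<Sum>b\<in>S. 2 ^ ?N * avg ?N (\<lambda>p'.
      of_bool (G (p @ w @ a) = G (p' @ w @ b)))))"
    by (simp only: sum_seeds)
  also have "\<dots> = (\<Sum>a\<in>S. 2 ^ ?N * (\<Sum>b\<in>S. avg ?N (\<lambda>p.
      of_bool (gen_bits f n k l (drop n1 p) a = gen_bits f n k l (drop n1 p) b))))"
  proof (intro sum.cong arg_cong[of _ _ "\<lambda>x. 2 ^ ?N * x"] refl)
    fix a assume a: "a \<in> S"
    have "2 ^ ?N * avg ?N (\<lambda>p'. of_bool (G (p @ w @ a) = G (p' @ w @ b))) =
        of_bool (gen_bits f n k l (drop n1 p) a = gen_bits f n k l (drop n1 p) b)"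
      if p: "length p = ?N" and b: "b \<in> S" for p b
    proof -
      have "avg ?N (\<lambda>p'. of_bool (G (p @ w @ a) = G (p' @ w @ b))) =
          avg ?N (\<lambda>p'. of_bool (gen_bits f n k l (drop n1 p) a = gen_bits f n k l (drop n1 p) b) * of_bool (p' = p))"
        using p a b by (intro avg_cong) (auto simp: G')
      also have "\<dots> = of_bool (gen_bits f n k l (drop n1 p) a = gen_bits f n k l (drop n1 p) b) / 2 ^ ?N"
        unfolding avg_cmult avg_of_bool_eq[OF p] by simp
      finally show ?thesis by simp
    qed
    then have "avg ?N (\<lambda>p. \<Sum>b\<in>S. 2 ^ ?N * avg ?N (\<lambda>p'. of_bool (G (p @ w @ a) = G (p' @ w @ b)))) =
        avg ?N (\<lambda>p. \<Sum>b\<in>S. of_bool (gen_bits f n k l (drop n1 p) a = gen_bits f n k l (drop n1 p) b))"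
      by (intro avg_cong sum.cong) auto
    then show "avg ?N (\<lambda>p. \<Sum>b\<in>S. 2 ^ ?N * avg ?N (\<lambda>p'. of_bool (G (p @ w @ a) = G (p' @ w @ b)))) =
        (\<Sum>b\<in>S. avg ?N (\<lambda>p. of_bool (gen_bits f n k l (drop n1 p) a = gen_bits f n k l (drop n1 p) b)))"
      by (simp only: avg_sum)
  qed
  also have "\<dots> = 2 ^ ?N * (\<Sum>a\<in>S. \<Sum>b\<in>S. avg ?N (\<lambda>p.
      of_bool (gen_bits f n k l (drop n1 p) a = gen_bits f n k l (drop n1 p) b)))"
    by (simp only: sum_distrib_left)
  also have "(\<lambda>a b. avg ?N (\<lambda>p. of_bool (gen_bits f n k l (drop n1 p) a = gen_bits f n k l (drop n1 p) b))) =
      (\<lambda>a b. avg ((k + l) * n) (\<lambda>R. of_bool (gen_bits f n k l R a = gen_bits f n k l R b)))"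
    (is "?l = ?r")
  proof (intro ext)
    fix a b
    have "?l a b = avg n1 (\<lambda>x. avg ((k + l) * n) (\<lambda>R. of_bool (gen_bits f n k l (drop n1 (x @ R)) a =
        gen_bits f n k l (drop n1 (x @ R)) b)))"
      by (rule avg_add)
    also have "\<dots> = avg n1 (\<lambda>x. ?r a b)" by (rule avg_cong) simp
    finally show "?l a b = ?r a b" by simp
  qed
  finally have "real (card {(x, y) \<in> ?E \<times> ?E. G x = G y}) = 2 ^ ?N * (\<Sum>a\<in>S. \<Sum>b\<in>S.
      avg ((k + l) * n) (\<lambda>R. of_bool (gen_bits f n k l R a = gen_bits f n k l R b)))" .
  also have "\<dots> \<le> 2 ^ ?N * (4 * real (card S))"
    using collision_bound[OF assms(1,2)] by (intro mult_left_mono) auto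
  also have "\<dots> = 4 * real (card ?E)" using card_seeds[OF finS, of ?N w] by simp
  finally have "log 2 (card ?E) - log 2 4 \<le> shannon_entropy (map_pmf G (pmf_of_set ?E))"
    by (intro entropy_map_uniform E)
  moreover have "log 2 (4 :: real) = 2" using log_of_power_eq[of 4 2 2] by simp
  ultimately show ?thesis using card_seeds[OF finS, of ?N w] by simp
qed

end

section \<open>The inverter\<close>

lemma FP_at_snd:
  assumes "FP f"
  shows "FP (\<lambda>p :: 'c::ctx \<times> 'a::ctx. f (snd p))"
  by (rule FP_comp[OF FP_snd[OF FP_id] assms])

lemma FPN_at_snd:
  assumes "FPN f"
  shows "FPN (\<lambda>p :: 'c::ctx \<times> 'a::ctx. f (snd p))"
  using FP_at_snd[OF assms[unfolded FPN_def]] by (simp add: FPN_def)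

lemma FPP_at_snd:
  assumes "FPP f"
  shows "FPP (\<lambda>p :: 'c::ctx \<times> 'a::ctx. f (snd p))"
  using FP_at_snd[OF assms[unfolded FPP_def]] by (simp add: FPP_def)

lemma map_concat: "map h [0..<n] = concat (map (\<lambda>i. [h i :: bool]) [0..<n])"
  by (induction n) auto

lemma FP_hashes [fp]:
  assumes "FPN k" "FPN n" "FP R" "FP y"
  shows "FP (\<lambda>x. hashes (k x) (n x) (R x) (y x))"
  unfolding hashes_def map_concat
  by (intro fp assms assms(1,2)[THEN FPN_at_snd] assms(3,4)[THEN FP_at_snd])

lemma FP_unit [fp]:
  assumes "FPN n" "FPN p"
  shows "FP (\<lambda>x. unit (n x) (p x))"
  unfolding unit_def map_concat by (intro fp assms assms[THEN FPN_at_snd])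

lemma FP_query [fp]:
  assumes "FPN n" "FPN n1" "FPN k" "FPN j" "FPN l" "FP y" "FP u" "FP \<omega>" "FP r" "FPP c"
  shows "FP (\<lambda>x. query (n x) (n1 x) (k x) (j x) (l x) (y x) (u x) (\<omega> x) (r x) (c x))"
  unfolding query_def by (intro fp assms)

lemma FP_query_coins [fp]:
  assumes "FPN n" "FPN n1" "FPN k" "FPN j" "FPN l" "FP \<omega>"
  shows "FP (\<lambda>x. query_coins (n x) (n1 x) (k x) (j x) (l x) (\<omega> x))"
  unfolding query_coins_def by (intro fp assms)

definition accepts :: "machine \<Rightarrow> nat \<Rightarrow> bool list \<Rightarrow> bool list \<Rightarrow> bool" where
  "accepts D n w \<rho> \<longleftrightarrow> output_of (run D \<rho> (with_unary n w)) = [True]"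

lemma FPP_accepts [fp]:
  assumes "turing_machine D" "FPN n" "FP w" "FP \<rho>"
  shows "FPP (\<lambda>x. accepts D (n x) (w x) (\<rho> x))"
proof -
  have "FP (\<lambda>x. (with_unary (n x) (w x), \<rho> x))"
    unfolding with_unary_def by (intro fp assms)
  from FP_comp[OF this FP_run[OF assms(1)]]
  have "FP (\<lambda>x. output_of (run D (\<rho> x) (with_unary (n x) (w x))))" by simp
  then show ?thesis unfolding accepts_def by (intro fp)
qed

text \<open>The affine subspace of \<open>span_list\<close>, flattened, by repeated doubling. The bound \<open>b\<close> on the
  number of its elements keeps the computation polynomial.\<close>

type_synonym span_state = "(bool list \<times> bool list) \<times> (bool list \<times> (bool list \<times> bool list))"

definition span_step :: "span_state \<Rightarrow> span_state" where
  "span_step s = (let L = fst (fst s); c = snd (fst s); h = fst (snd s);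
       b = fst (snd (snd s)); w = length (snd (snd (snd s))) in
     if length c < length b then
       ((L @ concat (map (\<lambda>J. xor (drop (length h - w) h) (take w (drop (J * w) L))) [0..<length c]), c @ c),
        (take (length h - w) h, snd (snd s)))
     else s)"

text \<open>The base point is the last block of \<open>g\<close>, where the recursion of
  \<open>span_list\<close> ends; the other blocks are then consumed from back to front.\<close>

definition span_init :: "nat \<Rightarrow> nat \<Rightarrow> nat \<Rightarrow> bool list \<Rightarrow> span_state" where
  "span_init w k b g = ((drop (k * w) g, [True]),
     (take (k * w) g, (replicate b True, replicate w True)))"

lemma FP_span_step: "FP span_step"
  unfolding span_step_def Let_def by (intro fp)

text \<open>The guard stops the doubling once \<open>c\<close> has reached the length of
  \<open>b\<close>. This gives the size bound on all intermediate states that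
  \<open>FP_funpow\<close> demands.\<close>

lemma span_step_bounds:
  "length (snd (fst ((span_step ^^ t) s))) \<le> max (length (snd (fst s))) (2 * length (fst (snd (snd s))))"
  "snd (snd ((span_step ^^ t) s)) = snd (snd s)"
  "length (fst (snd ((span_step ^^ t) s))) \<le> length (fst (snd s))"
  by (induction t) (auto simp: span_step_def Let_def)

lemma span_step_length:
  "length (fst (fst ((span_step ^^ t) s))) \<le>
     length (fst (fst s)) + t * (2 * length (fst (snd (snd s))) + length (snd (fst s))) *
       length (snd (snd (snd s)))"
proof (induction t)
  case (Suc t)
  let ?s = "(span_step ^^ t) s"
  let ?w = "length (snd (snd (snd s)))"
  have "length (concat (map (\<lambda>J. xor (drop (length h - ?w) h) (take ?w (drop (J * ?w) L))) [0..<c])) \<le> c * ?w" for h L c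
    by (induction c) auto
  from this[of "fst (snd ?s)" "fst (fst ?s)" "length (snd (fst ?s))"]
  have "length (fst (fst (span_step ?s))) \<le> length (fst (fst ?s)) + length (snd (fst ?s)) * ?w"
    by (auto simp: span_step_def Let_def span_step_bounds(2))
  also have "length (snd (fst ?s)) \<le> 2 * length (fst (snd (snd s))) + length (snd (fst s))"
    using span_step_bounds(1)[of t s] by auto
  finally show ?case using Suc by (simp add: add_mult_distrib mult.assoc)
qed simp

definition span_flat :: "nat \<Rightarrow> nat \<Rightarrow> nat \<Rightarrow> bool list \<Rightarrow> bool list \<times> bool list" where
  "span_flat w k b g = fst ((span_step ^^ k) (span_init w k b g))"

lemma FP_span_flat [fp]:
  assumes "FPN w" "FPN k" "FPN b" "FP g"
  shows "FP (\<lambda>x. span_flat (w x) (k x) (b x) (g x))"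
proof -
  obtain pw pk pb pg :: "nat poly" where p: "\<And>x. w x \<le> poly pw (blen x)" "\<And>x. k x \<le> poly pk (blen x)"
    "\<And>x. b x \<le> poly pb (blen x)" "\<And>x. length (g x) \<le> poly pg (blen x)"
  proof -
    obtain pw pk pb pg where "\<forall>x. blen (replicate (w x) True) \<le> poly pw (blen x)"
      "\<forall>x. blen (replicate (k x) True) \<le> poly pk (blen x)"
      "\<forall>x. blen (replicate (b x) True) \<le> poly pb (blen x)" "\<forall>x. blen (g x) \<le> poly pg (blen x)"
      using FP_blen[OF assms(1)[unfolded FPN_def]] FP_blen[OF assms(2)[unfolded FPN_def]]
        FP_blen[OF assms(3)[unfolded FPN_def]] FP_blen[OF assms(4)] by blast
    then show thesis by (intro that[of pw pk pb pg]) auto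
  qed
  have "FP (\<lambda>x. (span_step ^^ length (replicate (k x) True)) (span_init (w x) (k x) (b x) (g x)))"
  proof (rule FP_funpow[OF FP_span_step, where q = "pg + pk * (2 * pb + 1) * pw + (1 + 2 * pb) + pg + pb + pw"])
    fix x t assume "t \<le> length (replicate (k x) True)"
    then have t: "t \<le> poly pk (blen x)" using p(2)[of x] by simp
    let ?s = "span_init (w x) (k x) (b x) (g x)"
    let ?n = "blen x"
    have b: "blen s = length (fst (fst s)) + length (snd (fst s)) + (length (fst (snd s)) +
      (length (fst (snd (snd s))) + length (snd (snd (snd s)))))" for s :: span_state
      by (cases s) (auto simp: blen_prod_def)
    have 1: "length (fst (fst ((span_step ^^ t) ?s))) \<le> poly pg ?n + poly pk ?n * (2 * poly pb ?n + 1) * poly pw ?n"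
    proof -
      have "length (fst (fst ((span_step ^^ t) ?s))) \<le> length (g x) + t * (2 * b x + 1) * w x"
        using span_step_length[of t ?s] by (simp add: span_init_def)
      also have "\<dots> \<le> poly pg ?n + poly pk ?n * (2 * poly pb ?n + 1) * poly pw ?n"
        using p[of x] t by (intro add_mono mult_mono) auto
      finally show ?thesis .
    qed
    have 2: "length (snd (fst ((span_step ^^ t) ?s))) \<le> 1 + 2 * poly pb ?n"
      using span_step_bounds(1)[of t ?s] p(3)[of x] by (simp add: span_init_def max_def split: if_splits)
    have 3: "length (fst (snd ((span_step ^^ t) ?s))) \<le> poly pg ?n"
      using span_step_bounds(3)[of t ?s] p(4)[of x] by (simp add: span_init_def)
    have 4: "length (fst (snd (snd ((span_step ^^ t) ?s)))) \<le> poly pb ?n"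
      "length (snd (snd (snd ((span_step ^^ t) ?s)))) \<le> poly pw ?n"
      using span_step_bounds(2)[of t ?s] p(1,3)[of x] by (simp_all add: span_init_def)
    show "blen ((span_step ^^ t) ?s) \<le> poly (pg + pk * (2 * pb + 1) * pw + (1 + 2 * pb) + pg + pb + pw) ?n"
      using 1 2 3 4 by (simp add: b)
  next
    show "FP (\<lambda>x. replicate (k x) True)" by (intro fp assms)
    show "FP (\<lambda>x. span_init (w x) (k x) (b x) (g x))"
      unfolding span_init_def by (intro fp assms)
  qed
  from FP_fst[OF this] show ?thesis by (simp add: span_flat_def)
qed

text \<open>The bound on \<open>b\<close> says that the guard of \<open>span_step\<close> never
  stops the first \<open>k\<close> doublings.\<close>

lemma span_flat:
  assumes g: "length g = Suc k * w" and b: "\<And>t. t < k \<Longrightarrow> 2 ^ t < b"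
  shows "fst (span_flat w k b g) = concat (span_list w k g)" "length (snd (span_flat w k b g)) = 2 ^ k"
proof -
  have "\<exists>c. (span_step ^^ t) (span_init w k b g) = ((concat (span_list w t (drop ((k - t) * w) g)), c),
      (take ((k - t) * w) g, (replicate b True, replicate w True))) \<and> length c = 2 ^ t" if "t \<le> k" for t
    using that
  proof (induction t)
    case 0
    then show ?case using g by (simp add: span_init_def)
  next
    case (Suc t)
    then obtain c where c: "(span_step ^^ t) (span_init w k b g) =
        ((concat (span_list w t (drop ((k - t) * w) g)), c),
          (take ((k - t) * w) g, (replicate b True, replicate w True)))" "length c = 2 ^ t"
      by auto
    let ?L = "span_list w t (drop ((k - t) * w) g)"
    have kt: "k - t = Suc (k - Suc t)" using Suc.prems by simp
    have le: "(k - t) * w \<le> length g" using g by (simp add: trans_le_add2)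
    have lh: "length (take ((k - t) * w) g) = (k - t) * w" using le by simp
    have sub: "(k - t) * w - w = (k - Suc t) * w" unfolding kt by simp
    have blk: "drop ((k - Suc t) * w) (take ((k - t) * w) g) = take w (drop ((k - Suc t) * w) g)"
      unfolding drop_take by (simp add: kt)
    have "length (drop ((k - t) * w) g) = Suc t * w"
      using g Suc.prems by (simp add: diff_mult_distrib add_mult_distrib)
    then have wid: "length l = w" if "l \<in> set ?L" for l using span_list_length that by blast
    have ent: "take w (drop (J * w) (concat L)) = L ! J" if "J < length L" "\<And>l. l \<in> set L \<Longrightarrow> length l = w" for J L
      using that
    proof (induction L arbitrary: J)
      case (Cons l L)
      then show ?case by (cases J) auto
    qed simp
    have blocks: "map (\<lambda>J. xor (take w (drop ((k - Suc t) * w) g)) (take w (drop (J * w) (concat ?L)))) [0..<2 ^ t] =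
        map (xor (take w (drop ((k - Suc t) * w) g))) ?L"
      by (rule nth_equalityI) (auto simp: ent[OF _ wid])
    have rest: "drop w (drop ((k - Suc t) * w) g) = drop ((k - t) * w) g" by (simp add: kt)
    have short: "take ((k - Suc t) * w) (take ((k - t) * w) g) = take ((k - Suc t) * w) g"
      by (simp add: min_def kt)
    have cb: "(2::nat) ^ t < b" using b[of t] Suc.prems by simp
    have "span_step ((concat ?L, c), (take ((k - t) * w) g, (replicate b True, replicate w True))) =
      ((concat (span_list w (Suc t) (drop ((k - Suc t) * w) g)), c @ c),
        (take ((k - Suc t) * w) g, (replicate b True, replicate w True)))"
      unfolding span_step_def Let_def fst_conv snd_conv length_replicate lh blk sub c(2) if_P[OF cb] short blocks
      by (simp only: span_list.simps Let_def rest concat_append)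
    then show ?case using c by (intro exI[of _ "c @ c"]) simp
  qed
  from this[of k] obtain c where "(span_step ^^ k) (span_init w k b g) = ((concat (span_list w k g), c),
      ([], (replicate b True, replicate w True)))" "length c = 2 ^ k" by auto
  then show "fst (span_flat w k b g) = concat (span_list w k g)"
    "length (snd (span_flat w k b g)) = 2 ^ k" by (simp_all add: span_flat_def)
qed

definition vote_at :: "machine \<Rightarrow> nat \<Rightarrow> nat \<Rightarrow> nat \<Rightarrow> nat \<Rightarrow> nat \<Rightarrow> nat \<Rightarrow> bool list \<Rightarrow> bool list \<Rightarrow>
    bool list \<Rightarrow> bool \<Rightarrow> bool \<Rightarrow> bool list \<Rightarrow> nat \<Rightarrow> nat \<Rightarrow> bool" where
  "vote_at D n N n1 k j l y u \<omega> c \<sigma> L p J \<longleftrightarrow>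
     bit L (J * Suc N) \<noteq>
       (accepts D n (query N n1 k j l y u \<omega> (xor (take N (drop (Suc (J * Suc N)) L)) (unit N p)) c)
         (query_coins N n1 k j l \<omega>) = (c = \<sigma>))"

lemma FPP_vote_at [fp]:
  assumes "turing_machine D" "FPN n" "FPN N" "FPN n1" "FPN k" "FPN j" "FPN l" "FP y" "FP u" "FP \<omega>"
    "FPP c" "FPP \<sigma>" "FP L" "FPN p" "FPN J"
  shows "FPP (\<lambda>x. vote_at D (n x) (N x) (n1 x) (k x) (j x) (l x) (y x) (u x) (\<omega> x) (c x) (\<sigma> x) (L x) (p x) (J x))"
  unfolding vote_at_def by (intro fp assms)

definition tally :: "machine \<Rightarrow> nat \<Rightarrow> nat \<Rightarrow> nat \<Rightarrow> nat \<Rightarrow> nat \<Rightarrow> nat \<Rightarrow> nat \<Rightarrow> bool list \<Rightarrow> bool list \<Rightarrow>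
    bool list \<Rightarrow> bool \<Rightarrow> bool \<Rightarrow> bool list \<Rightarrow> nat \<Rightarrow> bool list" where
  "tally D m n N n1 k j l y u \<omega> c \<sigma> L M =
     map (\<lambda>p. M < 2 * card {J. J < M \<and> vote_at D n N n1 k j l y u \<omega> c \<sigma> L p J}) [0..<m]"

lemma FP_tally [fp]:
  assumes "turing_machine D" "FPN m" "FPN n" "FPN N" "FPN n1" "FPN k" "FPN j" "FPN l" "FP y" "FP u" "FP \<omega>"
    "FPP c" "FPP \<sigma>" "FP L" "FPN M"
  shows "FP (\<lambda>x. tally D (m x) (n x) (N x) (n1 x) (k x) (j x) (l x) (y x) (u x) (\<omega> x) (c x) (\<sigma> x) (L x) (M x))"
  unfolding tally_def map_concat
  by (intro fp assms assms(2-8,15)[THEN FPN_at_snd, THEN FPN_at_snd] assms(2-8,15)[THEN FPN_at_snd]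
      assms(9-11,14)[THEN FP_at_snd, THEN FP_at_snd] assms(12,13)[THEN FPP_at_snd, THEN FPP_at_snd])

lemma tally_eq_decode:
  assumes "\<And>l. l \<in> set Ls \<Longrightarrow> length l = Suc N"
  shows "tally D m n N n1 k j l y u \<omega> c \<sigma> (concat Ls) (length Ls) =
    decode (\<lambda>r. accepts D n (query N n1 k j l y u \<omega> r c) (query_coins N n1 k j l \<omega>) = (c = \<sigma>)) N m Ls"
proof -
  have ent: "take (Suc N) (drop (J * Suc N) (concat Ls)) = Ls ! J" if "J < length Ls" for J
    using that assms
  proof (induction Ls arbitrary: J)
    case (Cons l L)
    then show ?case by (cases J) auto
  qed simp
  have "vote_at D n N n1 k j l y u \<omega> c \<sigma> (concat Ls) p J =
      vote (\<lambda>r. accepts D n (query N n1 k j l y u \<omega> r c) (query_coins N n1 k j l \<omega>) = (c = \<sigma>)) N p (Ls ! J)"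
    if J: "J < length Ls" for p J
  proof -
    have len: "length (Ls ! J) = Suc N" using assms J by simp
    then obtain b r where br: "drop (J * Suc N) (concat Ls) = b # r" "Ls ! J = b # take N r"
      using ent[OF J] by (cases "drop (J * Suc N) (concat Ls)") auto
    have "bit (concat Ls) (J * Suc N) = b" using br(1) unfolding bit_def by simp
    moreover have "drop (Suc (J * Suc N)) (concat Ls) = r"
      using br(1) unfolding drop_Suc tl_drop[symmetric] by simp
    ultimately show ?thesis unfolding vote_at_def vote_def br(2) by simp
  qed
  then show ?thesis
    unfolding tally_def decode_def length_filter_conv_card by (simp cong: conj_cong)
qed

text \<open>The coins are cut into \<open>j\<close> guessed hash bits, the trial bit of the
  predictor, the generating strings of the span with their guessed labels, and the randomness
  \<omega> of the planted query.\<close>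

definition guess :: "machine \<Rightarrow> nat \<Rightarrow> nat \<Rightarrow> nat \<Rightarrow> nat \<Rightarrow> nat \<Rightarrow> nat \<Rightarrow> nat \<Rightarrow> nat \<Rightarrow> nat \<Rightarrow> bool \<Rightarrow>
    bool list \<Rightarrow> bool list \<Rightarrow> bool list" where
  "guess D m n N n1 k j l \<kappa> b \<sigma> y \<rho> =
     tally D m n N n1 k j l y (take j \<rho>) (drop (Suc j + Suc \<kappa> * Suc N) \<rho>) (bit \<rho> j) \<sigma>
       (fst (span_flat (Suc N) \<kappa> b (take (Suc \<kappa> * Suc N) (drop (Suc j) \<rho>))))
       (length (snd (span_flat (Suc N) \<kappa> b (take (Suc \<kappa> * Suc N) (drop (Suc j) \<rho>)))))"

lemma length_guess: "length (guess D m n N n1 k j l \<kappa> b \<sigma> y \<rho>) = m"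
  by (simp add: guess_def tally_def)

lemma FP_guess [fp]:
  assumes "turing_machine D" "FPN m" "FPN n" "FPN N" "FPN n1" "FPN k" "FPN j" "FPN l" "FPN \<kappa>" "FPN b"
    "FPP \<sigma>" "FP y" "FP \<rho>"
  shows "FP (\<lambda>x. guess D (m x) (n x) (N x) (n1 x) (k x) (j x) (l x) (\<kappa> x) (b x) (\<sigma> x) (y x) (\<rho> x))"
  unfolding guess_def by (intro fp assms)

lemma guess_eq_decode:
  assumes "length u = j" "length c = 1" "length g = Suc \<kappa> * Suc N" "2 ^ \<kappa> < b"
  shows "guess D m n N n1 k j l \<kappa> b \<sigma> y (u @ c @ g @ \<omega>) =
    decode (\<lambda>r. accepts D n (query N n1 k j l y u \<omega> r (hd c)) (query_coins N n1 k j l \<omega>) = (hd c = \<sigma>)) N m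
      (span_list (Suc N) \<kappa> g)"
proof -
  let ?\<rho> = "u @ c @ g @ \<omega>"
  obtain c0 where c: "c = [c0]" using assms(2) by (auto simp: length_Suc_conv)
  have parts: "take j ?\<rho> = u" "bit ?\<rho> j = hd c" "take (Suc \<kappa> * Suc N) (drop (Suc j) ?\<rho>) = g"
    "drop (Suc j + Suc \<kappa> * Suc N) ?\<rho> = \<omega>"
    using assms(1,3) by (simp_all add: c bit_def)
  have "(2::nat) ^ t < b" if "t < \<kappa>" for t
    using power_increasing[of t \<kappa> "2::nat"] that assms(4) by linarith
  note flat = span_flat[OF assms(3) this]
  have "length (snd (span_flat (Suc N) \<kappa> b g)) = length (span_list (Suc N) \<kappa> g)"
    using flat(2) by simp
  then show ?thesis
    unfolding guess_def parts using flat(1)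
    by (simp only:) (rule tally_eq_decode[OF span_list_length[OF assms(3)]])
qed

definition digit :: "nat \<Rightarrow> nat \<Rightarrow> nat \<Rightarrow> nat" where
  "digit b e t = t div b ^ e - t div b ^ Suc e * b"

lemma digit: "digit b e t = t div b ^ e mod b"
  by (simp add: digit_def minus_div_mult_eq_mod[symmetric] div_mult2_eq[symmetric] mult.commute)

lemma FPN_digit [fp]:
  assumes "FPN b" "FPN t"
  shows "FPN (\<lambda>x. digit (b x) e (t x))"
proof -
  have "FPN (\<lambda>x. b x ^ e)" for e
    by (induction e) (auto intro: fp assms)
  then show ?thesis unfolding digit_def by (intro fp assms)
qed

text \<open>Digits in base \<open>b\<close> let a single loop over \<open>t < b ^ r\<close> replace
  \<open>r\<close> nested loops over parameters below \<open>b\<close>.\<close>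

lemma ex_digits:
  assumes "\<And>e. e < r \<Longrightarrow> d e < b"
  shows "\<exists>t<b ^ r. \<forall>e<r. digit b e t = d e"
  using assms
proof (induction r arbitrary: d)
  case (Suc r)
  from Suc.IH[of "\<lambda>e. d (Suc e)"] Suc.prems obtain t
    where t: "t < b ^ r" "\<And>e. e < r \<Longrightarrow> digit b e t = d (Suc e)" by auto
  have d0: "d 0 < b" using Suc.prems by simp
  have "t * b + d 0 < (t + 1) * b" using d0 by simp
  also have "\<dots> \<le> b ^ r * b" using t(1) by (intro mult_right_mono) auto
  finally have "t * b + d 0 < b ^ Suc r" by (simp add: mult.commute)
  moreover have "digit b e (t * b + d 0) = d e" if "e < Suc r" for e
  proof (cases e)
    case (Suc e')
    have "(t * b + d 0) div b ^ Suc e' = (t * b + d 0) div b div b ^ e'"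
      by (simp add: div_mult2_eq)
    also have "(t * b + d 0) div b = t" using d0 by simp
    finally show ?thesis using t(2)[of e'] that Suc by (simp add: digit)
  qed (use d0 in \<open>simp add: digit\<close>)
  ultimately show ?case by blast
qed simp

text \<open>Rejected candidates are empty and accepted ones have length \<open>m\<close>, so the
  first \<open>m\<close> bits of the concatenation are the first accepted candidate.\<close>

lemma take_concat_good:
  assumes "\<And>z. z \<in> set zs \<Longrightarrow> z = [] \<or> length z = m \<and> Q z" "z \<in> set zs" "z \<noteq> []"
  shows "Q (take m (concat zs))"
  using assms
proof (induction zs)
  case (Cons a zs)
  show ?case
  proof (cases "a = []")
    case True
    with Cons show ?thesis by auto
  next
    case False
    then show ?thesis using Cons.prems(1)[of a] by auto
  qed
qed simp

text \<open>The number of leading ones, which recovers the security parameter from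
  \<open>with_unary\<close>.\<close>

definition ones :: "bool list \<Rightarrow> nat" where
  "ones x = card {i. i < length x \<and> (\<forall>i'<Suc i. bit x i')}"

lemma FPN_ones [fp]:
  assumes "FP x"
  shows "FPN (\<lambda>y. ones (x y))"
  unfolding ones_def
  by (intro fp FPP_All assms assms[THEN FP_at_snd] assms[THEN FP_at_snd, THEN FP_at_snd])

lemma ones_with_unary: "ones (with_unary m y) = m"
proof -
  have "{i. i < length (with_unary m y) \<and> (\<forall>i'<Suc i. bit (with_unary m y) i')} = {..<m}"
  proof (intro equalityI subsetI)
    fix i assume "i \<in> {i. i < length (with_unary m y) \<and> (\<forall>i'<Suc i. bit (with_unary m y) i')}"
    then have "m < Suc i \<longrightarrow> bit (with_unary m y) m" by auto
    then show "i \<in> {..<m}" by (auto simp: bit_nth with_unary_def nth_append not_less_eq)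
  qed (auto simp: bit_nth with_unary_def nth_append)
  then show ?thesis by (simp add: ones_def)
qed

lemma FP_poly_time_computable:
  assumes "poly_time_computable f"
  shows "FP f"
proof -
  obtain M and p :: "nat poly" where M: "computes_in_time M f (poly p)"
    using assms by (auto simp: poly_time_computable_def)
  then have tm: "turing_machine M" by (simp add: computes_in_time_def)
  have "FP (\<lambda>x :: bool list. (x, replicate (poly p (length x)) True))" by (intro fp)
  from FP_comp[OF this FP_run[OF tm]]
  have "FP (\<lambda>x. output_of (run M (replicate (poly p (length x)) True) x))" by simp
  moreover have "output_of (run M (replicate (poly p (length x)) True) x) = f x" for x
    using M by (auto simp: computes_in_time_def)
  ultimately show ?thesis by simp
qed

text \<open>The number \<open>t\<close> encodes all parameters that the inverter does not know.
  Testing the result with \<open>f\<close> makes wrong parameters harmless.\<close>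

definition candidate :: "(bool list \<Rightarrow> bool list) \<Rightarrow> machine \<Rightarrow> nat \<Rightarrow> nat \<Rightarrow> nat \<Rightarrow> bool list \<Rightarrow> bool list \<Rightarrow>
    nat \<Rightarrow> bool list" where
  "candidate f D m N b y \<rho> t =
     (let z = guess D m (digit b 0 t) N (digit b 1 t) (digit b 2 t) (digit b 3 t) (digit b 4 t)
            (digit b 5 t) b (0 < digit b 6 t) y \<rho>
      in if f z = y then z else [])"

lemma FP_candidate [fp]:
  assumes "FP f" "turing_machine D" "FPN m" "FPN N" "FPN b" "FP y" "FP \<rho>" "FPN t"
  shows "FP (\<lambda>x. candidate f D (m x) (N x) (b x) (y x) (\<rho> x) (t x))"
proof -
  have "FP (\<lambda>x. guess D (m x) (digit (b x) 0 (t x)) (N x) (digit (b x) 1 (t x)) (digit (b x) 2 (t x))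
      (digit (b x) 3 (t x)) (digit (b x) 4 (t x)) (digit (b x) 5 (t x)) (b x) (0 < digit (b x) 6 (t x)) (y x) (\<rho> x))"
    by (intro fp assms)
  note g = this FP_comp[OF this assms(1)]
  show ?thesis unfolding candidate_def Let_def by (intro fp g assms)
qed

definition search :: "(bool list \<Rightarrow> bool list) \<Rightarrow> machine \<Rightarrow> nat \<Rightarrow> nat \<Rightarrow> nat \<Rightarrow> bool list \<Rightarrow> bool list \<Rightarrow> bool list" where
  "search f D m N b y \<rho> = take m (concat (map (\<lambda>t. candidate f D m N b y \<rho> t) [0..<b ^ 7]))"

lemma FP_search:
  assumes "FP f" "turing_machine D" "FPN m" "FPN N" "FPN b" "FP y" "FP \<rho>"
  shows "FP (\<lambda>x. search f D (m x) (N x) (b x) (y x) (\<rho> x))"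
proof -
  have "FPN (\<lambda>x. b x ^ e)" for e
    by (induction e) (auto intro: fp assms)
  then show ?thesis
    unfolding search_def
    by (intro fp assms assms(3-5)[THEN FPN_at_snd] assms(6,7)[THEN FP_at_snd])
qed

lemma search_success:
  assumes "f (guess D m n N n1 k j l \<kappa> b \<sigma> y \<rho>) = y" "m > 0"
    "n < b" "n1 < b" "k < b" "j < b" "l < b" "\<kappa> < b" "1 < b"
  shows "f (search f D m N b y \<rho>) = y"
proof -
  let ?d = "(!) [n, n1, k, j, l, \<kappa>, of_bool \<sigma>]"
  have "\<exists>t<b ^ 7. \<forall>e<7. digit b e t = ?d e"
    by (rule ex_digits) (use assms(3-) in \<open>auto simp: nth_Cons' of_bool_def\<close>)
  then obtain t where t: "t < b ^ 7" "\<And>e. e < 7 \<Longrightarrow> digit b e t = ?d e" by auto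
  have "digit b 0 t = n" "digit b 1 t = n1" "digit b 2 t = k" "digit b 3 t = j" "digit b 4 t = l"
    "digit b 5 t = \<kappa>" "digit b 6 t = of_bool \<sigma>"
    using t(2)[of 0] t(2)[of 1] t(2)[of 2] t(2)[of 3] t(2)[of 4] t(2)[of 5] t(2)[of 6] by simp_all
  then have "candidate f D m N b y \<rho> t = guess D m n N n1 k j l \<kappa> b \<sigma> y \<rho>"
    using assms(1) by (simp add: candidate_def Let_def)
  then have "candidate f D m N b y \<rho> t \<noteq> []" using length_guess assms(2) by (metis length_greater_0_conv)
  moreover have "candidate f D m N b y \<rho> t \<in> set (map (candidate f D m N b y \<rho>) [0..<b ^ 7])"
    using t(1) unfolding set_map set_upt by (intro imageI) simp
  moreover have "z = [] \<or> length z = m \<and> f z = y"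
    if "z \<in> set (map (candidate f D m N b y \<rho>) [0..<b ^ 7])" for z
    using that unfolding set_map by (auto simp: candidate_def Let_def length_guess)
  ultimately show ?thesis
    unfolding search_def by (intro take_concat_good[where Q = "\<lambda>z. f z = y"]) blast+
qed

lemma avg_take: "avg (m + n) (\<lambda>x. \<phi> (take m x)) = avg m \<phi>"
proof -
  have "avg (m + n) (\<lambda>x. \<phi> (take m x)) = avg m (\<lambda>x. avg n (\<lambda>y. \<phi> x))"
    unfolding avg_add by (intro avg_cong) simp
  then show ?thesis by simp
qed

lemma pmf_map_uniform: "pmf (map_pmf P (uniform_bits n)) True = avg n (\<lambda>x. of_bool (P x))"
proof -
  have "pmf (map_pmf P (uniform_bits n)) True = card ({x. length x = n} \<inter> {x. P x}) / card {x :: bool list. length x = n}"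
    unfolding pmf_map uniform_bits_def
    by (subst measure_pmf_of_set) (auto simp: vimage_def ex_bits)
  then show ?thesis by (simp add: avg_def card_bits of_bool_def sum.If_cases finite_bits)
qed

lemma pmf_bind_uniform: "pmf (bind_pmf (uniform_bits n) K) b = avg n (\<lambda>x. pmf (K x) b)"
  unfolding pmf_bind by (simp add: uniform_bits_def integral_pmf_of_set avg_def card_bits finite_bits ex_bits)

text \<open>Whichever parameters the analysis picks, the search includes them and uses the same
  coins for them. So it succeeds at least whenever the single guess with these parameters
  does.\<close>

theorem inverter:
  fixes P b q :: "nat poly"
  assumes f: "poly_time_computable f" and D: "turing_machine D"
  obtains A where "ppt A"
    "\<And>m n n1 k j l \<kappa> \<sigma>. m > 0 \<Longrightarrow> n < poly b m \<Longrightarrow> n1 < poly b m \<Longrightarrow> k < poly b m \<Longrightarrow> j < poly b m \<Longrightarrow>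
       l < poly b m \<Longrightarrow> \<kappa> < poly b m \<Longrightarrow> 1 < poly b m \<Longrightarrow>
       avg m (\<lambda>a. avg (poly q m) (\<lambda>\<rho>. of_bool (f (guess D m n (poly P m) n1 k j l \<kappa> (poly b m) \<sigma> (f a) \<rho>) = f a)))
         \<le> inversion_prob f A m"
proof -
  define F where "F = (\<lambda>p :: bool list \<times> bool list. search f D (ones (fst p)) (poly P (ones (fst p)))
    (poly b (ones (fst p))) (drop (Suc (ones (fst p))) (fst p)) (take (poly q (ones (fst p))) (snd p)))"
  have "FP F" unfolding F_def by (intro FP_search fp FP_poly_time_computable f D)
  then obtain A where A: "ppt A"
    "\<And>x. result A x = map_pmf (\<lambda>\<rho>. F (x, \<rho>)) (uniform_bits (poly q (length x)))"
    by (rule FP_ppt[where q = q]) blast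
  have inv: "inversion_prob f A m = avg m (\<lambda>a. avg (poly q m) (\<lambda>\<rho>.
      of_bool (f (search f D m (poly P m) (poly b m) (f a) \<rho>) = f a)))" for m
  proof -
    have "inversion_prob f A m = avg m (\<lambda>a. pmf (map_pmf (\<lambda>x'. f x' = f a) (result A (with_unary m (f a)))) True)"
      unfolding inversion_prob_def pmf_bind_uniform by (simp only: map_pmf_def)
    also have "\<dots> = avg m (\<lambda>a. avg (poly q m) (\<lambda>\<rho>.
      of_bool (f (search f D m (poly P m) (poly b m) (f a) \<rho>) = f a)))"
    proof (rule avg_cong)
      fix a :: "bool list"
      let ?x = "with_unary m (f a)"
      \<comment> \<open>The number of coins drawn is a polynomial in the length of the whole input,
        of which \<open>m\<close> is only a part; a prefix of them is used.\<close>
      have "poly q m \<le> poly q (length ?x)" by (rule poly_nat_mono) (simp add: with_unary_def)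
      then obtain r where r: "poly q (length ?x) = poly q m + r" using le_Suc_ex by blast
      have "drop (Suc m) ?x = f a" by (simp add: with_unary_def)
      then have "pmf (map_pmf (\<lambda>x'. f x' = f a) (result A ?x)) True = avg (poly q m + r) (\<lambda>\<rho>.
        of_bool (f (search f D m (poly P m) (poly b m) (f a) (take (poly q m) \<rho>)) = f a))"
        by (simp add: A(2) map_pmf_comp pmf_map_uniform F_def ones_with_unary r)
      then show "pmf (map_pmf (\<lambda>x'. f x' = f a) (result A ?x)) True = avg (poly q m) (\<lambda>\<rho>.
        of_bool (f (search f D m (poly P m) (poly b m) (f a) \<rho>) = f a))"
        by (simp only: avg_take[where \<phi> = "\<lambda>\<rho>. of_bool (f (search f D m (poly P m) (poly b m) (f a) \<rho>) = f a)"])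
    qed
    finally show ?thesis .
  qed
  show thesis
  proof (rule that[OF A(1)])
    fix m n n1 k j l \<kappa> \<sigma>
    assume "m > 0" "n < poly b m" "n1 < poly b m" "k < poly b m" "j < poly b m"
      "l < poly b m" "\<kappa> < poly b m" "1 < poly b m"
    then show "avg m (\<lambda>a. avg (poly q m) (\<lambda>\<rho>. of_bool (f (guess D m n (poly P m) n1 k j l \<kappa> (poly b m) \<sigma> (f a) \<rho>) = f a)))
         \<le> inversion_prob f A m"
      unfolding inv by (intro avg_mono) (auto simp: of_bool_def dest: search_success)
  qed
qed

section \<open>The generator\<close>

definition binary :: "bool list \<Rightarrow> nat" where
  "binary w = fold (\<lambda>b v. 2 * v + of_bool b) w 0"

lemma ex_binary: "v < 2 ^ k \<Longrightarrow> \<exists>w. length w = k \<and> binary w = v"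
proof (induction k arbitrary: v)
  case (Suc k)
  from Suc.IH[of "v div 2"] less_mult_imp_div_less[of v "2 ^ k" 2] Suc.prems obtain w where w: "length w = k" "binary w = v div 2" by auto
  have "binary (w @ [odd v]) = v" using w(2) by (simp add: binary_def)
  with w(1) show ?case by (intro exI[of _ "w @ [odd v]"]) simp
qed (simp add: binary_def)

text \<open>The value of a binary string can be exponential in its length, so in unary only its
  minimum with a given bound is available. Truncating after every doubling is correct because values
  at or above the bound stay there.\<close>

lemma FPN_min_binary [fp]:
  assumes "FPN b" "FP w"
  shows "FPN (\<lambda>x. min (b x) (binary (w x)))"
proof -
  define F where "F = (\<lambda>p :: bool list \<times> bool list \<times> bool list. (tl (fst p),
    (take (length (snd (snd p))) (fst (snd p) @ fst (snd p) @
      (case fst p of [] \<Rightarrow> [] | x # _ \<Rightarrow> if x then [True] else [])), snd (snd p))))"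
  have F: "FP F" unfolding F_def by (intro fp FP_case_list)
  have Fk: "(F ^^ k) (w, ([] :: bool list, replicate b True)) =
      (drop k w, (replicate (min b (binary (take k w))) True, replicate b True))" if "k \<le> length w" for k w b
    using that
  proof (induction k)
    case (Suc k)
    then obtain y ys where d: "drop k w = y # ys" by (cases "drop k w") auto
    have t: "take (Suc k) w = take k w @ [y]"
      using Suc.prems nth_via_drop[OF d] by (simp add: take_Suc_conv_app_nth)
    have tl: "drop (Suc k) w = ys" using d by (metis drop_Suc list.sel(3) tl_drop)
    have "binary (take (Suc k) w) = 2 * binary (take k w) + of_bool y" by (simp add: t binary_def)
    then show ?case
      using Suc by (auto simp: F_def d tl replicate_add[symmetric] min_def replicate_app_Cons_same
          simp flip: replicate_Suc)
  qed (simp add: binary_def)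
  have "FP (\<lambda>x. (F ^^ length (w x)) (w x, ([] :: bool list, replicate (b x) True)))"
  proof -
    obtain pw where pw: "\<And>x. length (w x) \<le> poly pw (blen x)" using FP_blen[OF assms(2)] by auto
    obtain pb where pb: "\<And>x. b x \<le> poly pb (blen x)"
      using FP_blen[OF assms(1)[unfolded FPN_def]] by auto
    show ?thesis
    proof (rule FP_funpow[OF F assms(2), where q = "pw + pb + pb"])
      show "FP (\<lambda>x. (w x, ([] :: bool list, replicate (b x) True)))" by (intro fp assms)
      fix x k assume "k \<le> length (w x)"
      then show "blen ((F ^^ k) (w x, ([] :: bool list, replicate (b x) True))) \<le> poly (pw + pb + pb) (blen x)"
        using pw[of x] pb[of x] by (simp add: Fk)
    qed
  qed
  from FP_fst[OF FP_snd[OF this]] show ?thesis by (simp add: Fk FPN_def)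
qed

lemma FP_gen_bits [fp]:
  assumes "FP f" "FPN n" "FPN k" "FPN l" "FP R" "FP a"
  shows "FP (\<lambda>x. gen_bits f (n x) (k x) (l x) (R x) (a x))"
  unfolding gen_bits_def by (intro fp assms FP_comp[OF assms(6,1)])

text \<open>The seed block consists of the hash functions \<open>R\<close>, a guess \<open>w\<close> for the logarithm of the
  number of preimages of \<open>f a\<close>, and \<open>a\<close>.\<close>

definition width :: "nat \<Rightarrow> nat \<Rightarrow> nat \<Rightarrow> nat" where
  "width K s m = m + s div K + 1"

definition hash_len :: "nat poly \<Rightarrow> nat \<Rightarrow> nat \<Rightarrow> nat \<Rightarrow> nat" where
  "hash_len P K s m = poly P m * (width K s m + s)"

text \<open>The loss \<open>5 * s + 8\<close> is what leftover hashing needs. With t = 2^s, the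
  class \<open>S\<close> has at least 2^m / (2 t) elements, so the squared error is at most 4 t /
  (256 t^5) = (1 / (8 t^2))^2, and 1 / (4 t^2) is at most 1 / n^2. The cap \<open>2 * m\<close>
  serves the unary computation and does not affect values up to \<open>m\<close>.\<close>

definition image_bits :: "nat \<Rightarrow> nat \<Rightarrow> bool list \<Rightarrow> nat" where
  "image_bits s m w = m - min (2 * m) (binary w) - (5 * s + 8)"

definition block :: "(bool list \<Rightarrow> bool list) \<Rightarrow> nat poly \<Rightarrow> nat \<Rightarrow> nat \<Rightarrow> nat \<Rightarrow> bool list \<Rightarrow> bool list" where
  "block f P K s m y =
     (let q = hash_len P K s m; k = image_bits s m (take (s div K + 1) (drop q y))
      in gen_bits f (poly P m) k (width K s m + s - k) (take q y) (drop (q + (s div K + 1)) y))"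

text \<open>Only the last \<open>width K s m\<close> bits are replaced, so the hash rows remain in
  the output. The minimum gives the right output length even for seeds too short to hold a
  block.\<close>

definition generator :: "(bool list \<Rightarrow> bool list) \<Rightarrow> nat poly \<Rightarrow> nat \<Rightarrow> nat \<Rightarrow> bool list \<Rightarrow> bool list" where
  "generator f P K s x =
     (let m = 2 ^ (s div K); n = length x; c = min n (width K s m) in
        take (n - c) x @ take (c + s) (block f P K s m (drop (n - (width K s m + hash_len P K s m)) x)))"

lemma length_block: "length (block f P K s m y) = width K s m + s"
proof -
  have "image_bits s m w \<le> width K s m + s" for w by (simp add: image_bits_def width_def)
  then show ?thesis by (simp add: block_def Let_def)
qed

lemma length_generator: "length (generator f P K s x) = length x + s"
  by (simp add: generator_def Let_def length_block)

lemma FPN_width [fp]: "FPN K \<Longrightarrow> FPN s \<Longrightarrow> FPN m \<Longrightarrow> FPN (\<lambda>x. width (K x) (s x) (m x))"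
  unfolding width_def by (intro fp)

lemma FPN_hash_len [fp]: "FPN K \<Longrightarrow> FPN s \<Longrightarrow> FPN m \<Longrightarrow> FPN (\<lambda>x. hash_len P (K x) (s x) (m x))"
  unfolding hash_len_def by (intro fp)

lemma FP_block:
  assumes "FP f" "FPN K" "FPN s" "FPN m" "FP y"
  shows "FP (\<lambda>x. block f P (K x) (s x) (m x) (y x))"
  unfolding block_def Let_def image_bits_def by (intro fp assms)

section \<open>The program of the generator\<close>

definition transfer :: "nat \<Rightarrow> (bool \<Rightarrow> bool) \<Rightarrow> com" where
  "transfer u h = For 7 (Case u Skip (Pop u ;; Push 8 (h True)) (Pop u ;; Push 8 (h False)))"

lemma transfer:
  assumes "u \<noteq> 7" "u \<noteq> 8"
  shows "exec (transfer u h) e = e(7 := [], u := drop (length (e 7)) (e u),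
      8 := rev (map h (take (length (e 7)) (e u))) @ e 8)" (is "_ = ?G e")
    and "cost (transfer u h) e \<le> 8 * length (e 7) + 1"
proof -
  let ?c = "Case u Skip (Pop u ;; Push 8 (h True)) (Pop u ;; Push 8 (h False))"
  have "exec (For 7 ?c) e = ?G e \<and> cost (For 7 ?c) e \<le> 8 * length (e 7) + 1"
  proof (induction "e 7" arbitrary: e)
    case Nil
    then show ?case by (auto simp: fun_upd_idem simp flip: Nil)
  next
    case (Cons x xs)
    let ?e = "pop 7 (exec ?c e)"
    have "7 \<notin> writes ?c" using assms by auto
    note * = exec_For_Cons[of _ _ e x xs, OF this Cons(2)[symmetric]]
    have c: "cost ?c e \<le> 5" by (auto split: list.splits)
    have e: "?e = (case e u of [] \<Rightarrow> e(7 := xs) | y # ys \<Rightarrow> e(7 := xs, u := ys, 8 := h y # e 8))"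
      using assms by (auto simp: pop_def fun_eq_iff simp flip: Cons(2) split: list.splits)
    have "xs = ?e 7" unfolding e using assms by (auto split: list.splits)
    note IH = Cons(1)[of ?e, OF this]
    have l: "length (?e 7) = length xs" using \<open>xs = ?e 7\<close> by simp
    have "?G ?e = ?G e"
      using assms unfolding e by (cases "e u") (auto simp: fun_eq_iff simp flip: Cons(2))
    then have "exec (For 7 ?c) e = ?G e" using IH *(1) by (simp only:)
    moreover have "cost (For 7 ?c) e \<le> 8 * length (e 7) + 1"
      using IH *(2) c l unfolding Cons(2)[symmetric] by simp
    ultimately show ?case by blast
  qed
  then show "exec (transfer u h) e = ?G e" "cost (transfer u h) e \<le> 8 * length (e 7) + 1"
    by (simp_all add: transfer_def del: exec.simps cost.simps)
qed

text \<open>The part of the program that runs after the input has been read: tapes 1 and 3 hold the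
  input in reverse, register \<open>7 + i\<close> of the loop program is the \<open>i\<close>-th register of a context, and the
  first of them holds the stretch in unary.\<close>

definition state :: "bool list \<Rightarrow> bool list \<Rightarrow> 'a::ctx \<Rightarrow> env \<Rightarrow> bool" where
  "state u w g e \<longleftrightarrow> e 1 = u \<and> e 3 = w \<and> (\<forall>i. e (7 + i) = enc g i)"

lemma state_rename:
  assumes "state u w g e" "exec c (enc g) = enc g'"
  shows "state u w g' (exec (rename ((+) 7) c) e)" "cost (rename ((+) 7) c) e = cost c (enc g)"
proof -
  have inj: "inj ((+) (7 :: nat))" by simp
  have e: "(\<lambda>i. e (7 + i)) = enc g" using assms(1) by (auto simp: state_def)
  show "cost (rename ((+) 7) c) e = cost c (enc g)"
    unfolding cost_rename[OF inj] e by (rule refl)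
  have "exec (rename ((+) 7) c) e (7 + i) = enc g' i" for i
    using fun_cong[OF exec_rename[OF inj, of c e], of i] unfolding e assms(2) .
  moreover have "exec (rename ((+) 7) c) e v = e v" if "v < 7" for v
    using that by (intro exec_rename_other) auto
  ultimately show "state u w g' (exec (rename ((+) 7) c) e)" using assms(1) by (simp add: state_def)
qed

lemma state_FP:
  assumes "implements c p F" "state u w g e"
  shows "state u w (F g) (exec (rename ((+) 7) c) e)" "cost (rename ((+) 7) c) e \<le> poly p (blen g)"
  using state_rename[OF assms(2) implementsD(2)[OF assms(1)]] implementsD(3)[OF assms(1), of g] by auto

lemma enc_triple:
  "enc (a :: bool list, (b :: bool list, x)) i =
     (if i = 0 then a else if i = 1 then b else enc ([] :: bool list, ([] :: bool list, x)) i)"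
  by (auto simp: enc_Pair merge_def enc_bits elim!: oddE)

lemma state_transfer:
  assumes "state u w (a :: bool list, (b :: bool list, x)) e"
  shows "state u (drop (length a) w) ([] :: bool list, (rev (map h (take (length a) w)) @ b, x)) (exec (transfer 3 h) e)"
    "state (drop (length a) u) w ([] :: bool list, (rev (map h (take (length a) u)) @ b, x)) (exec (transfer 1 h) e)"
    "cost (transfer 3 h) e \<le> 8 * length a + 1" "cost (transfer 1 h) e \<le> 8 * length a + 1"
proof -
  have i: "e (7 + i) = enc (a, (b, x)) i" for i using assms by (simp add: state_def)
  have "e 1 = u" "e 3 = w" using assms unfolding state_def by blast+
  moreover have "e 7 = a" "e 8 = b" using i[of 0] i[of 1] unfolding enc_triple[of a] by simp_all
  ultimately have e: "e (Suc 0) = u" "e 1 = u" "e 3 = w" "e 7 = a" "e 8 = b" by simp_all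
  have 78: "(7 + i = 7) = (i = 0)" "(7 + i = 8) = (i = 1)" for i :: nat by auto
  show "state u (drop (length a) w) ([] :: bool list, (rev (map h (take (length a) w)) @ b, x)) (exec (transfer 3 h) e)"
    unfolding state_def by (subst enc_triple) (use i in \<open>auto simp: transfer e 78 enc_triple[of a]\<close>)
  show "state (drop (length a) u) w ([] :: bool list, (rev (map h (take (length a) u)) @ b, x)) (exec (transfer 1 h) e)"
    unfolding state_def by (subst enc_triple) (use i in \<open>auto simp: transfer e 78 enc_triple[of a]\<close>)
  show "cost (transfer 3 h) e \<le> 8 * length a + 1" "cost (transfer 1 h) e \<le> 8 * length a + 1"
    using transfer(2)[of 3 h e] transfer(2)[of 1 h e] e by auto
qed

primrec pushes :: "nat \<Rightarrow> com" where
  "pushes 0 = Skip"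
| "pushes (Suc n) = Push 8 True ;; pushes n"

lemma pushes:
  "exec (pushes n) e = e(8 := replicate n True @ e 8)" "cost (pushes n) e = 2 * n"
  "wf_com (pushes n)" "regs (pushes n) \<subseteq> {8}"
proof -
  show "exec (pushes n) e = e(8 := replicate n True @ e 8)"
    by (induction n arbitrary: e) (auto simp: replicate_app_Cons_same fun_upd_def cong: if_cong)
  show "cost (pushes n) e = 2 * n"
    by (induction n arbitrary: e) auto
  show "wf_com (pushes n)" "regs (pushes n) \<subseteq> {8}"
    by (induction n) auto
qed

text \<open>The polynomial must not depend on \<open>K\<close>, which is chosen after it; therefore the program
  first writes down \<open>K\<close> and treats it as an input.\<close>

theorem generator_program:
  assumes f: "FP f"
  obtains p :: "nat poly" where "\<And>K. K > 0 \<Longrightarrow> \<exists>c. wf_com c \<and> regs c \<subseteq> {1, 3} \<union> {7..} \<and>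
    (\<forall>x s e. state (rev x) (rev x) (replicate s True) e \<longrightarrow>
      exec c e 1 = rev (generator f P K s x) \<and> cost c e \<le> 2 * K + poly p (2 ^ (s div K) + K))"
proof -
  define FA where "FA = (\<lambda>p :: bool list \<times> bool list. (replicate (length (fst p) div length (snd p)) True, (p, [True])))"
  define FM where "FM = (\<lambda>p :: (bool list \<times> bool list) \<times> bool list. (fst p, snd p @ snd p))"
  define FB where "FB = (\<lambda>p :: bool list \<times> ((bool list \<times> bool list) \<times> bool list).
    (replicate (width (length (snd (fst (snd p)))) (length (fst (fst (snd p)))) (length (snd (snd p))) +
      hash_len P (length (snd (fst (snd p)))) (length (fst (fst (snd p)))) (length (snd (snd p)))) True, ([] :: bool list, snd p)))"
  define FC where "FC = (\<lambda>p :: bool list \<times> (bool list \<times> ((bool list \<times> bool list) \<times> bool list)).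
    (replicate (width (length (snd (fst (snd (snd p))))) (length (fst (fst (snd (snd p))))) (length (snd (snd (snd p))))) True,
      ([] :: bool list, snd p)))"
  define FD where "FD = (\<lambda>p :: bool list \<times> (bool list \<times> (bool list \<times> ((bool list \<times> bool list) \<times> bool list))).
    take (length (fst (snd p)) + length (fst (fst (snd (snd (snd p))))))
      (block f P (length (snd (fst (snd (snd (snd p)))))) (length (fst (fst (snd (snd (snd p)))))) (length (snd (snd (snd (snd p)))))
        (fst (snd (snd p)))))"
  have "FP FA" "FP FM" "FP FB" "FP FC" "FP FD"
    unfolding FA_def FM_def FB_def FC_def FD_def by (intro fp f FP_block)+
  then obtain cA pA cM pM cB pB cC pC cD pD where impl: "implements cA pA FA" "implements cM pM FM"
    "implements cB pB FB" "implements cC pC FC" "implements cD pD FD"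
    by (auto simp: FP_def)
  define cL where "cL = For 0 (rename odd' cM)"
  let ?r = "rename ((+) 7)"
  \<comment> \<open>Only the end of the input is touched: the block is popped from the copy on tape
    3 and the bits to be replaced from tape 1, while the rest of tape 1 stays in place as output.
    Replacing popped bits by \<open>True\<close> counts how many there were, which yields the
    minimum for short inputs.\<close>
  define c where "c K = pushes K ;; ?r cA ;; ?r cL ;; ?r cB ;; transfer 3 id ;; ?r cC ;; transfer 1 (\<lambda>_. True) ;; ?r cD ;; shift_to 7 1" for K
  \<comment> \<open>A polynomial in \<open>m + K\<close> that dominates
    \<open>s + K + 2 * m\<close>, since \<open>s < K * Suc m\<close>.\<close>
  define lin :: "nat poly" where "lin = [:0, 3, 1:]"
  define p where "p = pcompose pA lin + ([:0, 1:] * (pcompose pM lin + 2) + 1) + pcompose pB lin +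
      (8 * pcompose pB lin + 1) + pcompose pC (pcompose pB lin + lin) + (8 * pcompose pB lin + 1) +
      pcompose pD (2 * pcompose pB lin + lin) + (6 * pcompose pD (2 * pcompose pB lin + lin) + 1)"
  have main: "exec (c K) e 1 = rev (generator f P K s x) \<and> cost (c K) e \<le> 2 * K + poly p (2 ^ (s div K) + K)"
    if st: "state (rev x) (rev x) (replicate s True) e" and K: "K > 0" for x s e K
  proof -
    let ?e = "s div K"
    let ?m = "2 ^ ?e :: nat"
    let ?u = "?m + K"
    let ?w = "width K s ?m"
    let ?q = "?w + hash_len P K s ?m"
    let ?n = "length x"
    let ?SK = "(replicate s True, replicate K True)"
    let ?M = "replicate ?m True"
    have em: "?e < ?m" by (rule less_exp)
    then have eu: "?e \<le> ?u" by linarith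
    have "s < K * Suc ?e" using K by (simp add: dividend_less_times_div)
    also have "\<dots> \<le> K * Suc ?m" using em by (intro mult_left_mono) auto
    finally have sB: "s + K + 2 * ?m \<le> poly lin ?u"
      by (simp add: lin_def algebra_simps)
    define e0 where "e0 = exec (pushes K) e"
    define e1 where "e1 = exec (?r cA) e0"
    define e2 where "e2 = exec (?r cL) e1"
    define e3 where "e3 = exec (?r cB) e2"
    define e4 where "e4 = exec (transfer 3 id) e3"
    define e5 where "e5 = exec (?r cC) e4"
    define e6 where "e6 = exec (transfer 1 (\<lambda>_. True)) e5"
    define e7 where "e7 = exec (?r cD) e6"
    define SD where "SD = drop (?n - ?q) x"
    define z where "z = take (min ?n ?w + s) (block f P K s ?m SD)"
    have mono: "poly p' i \<le> poly p' j" if "i \<le> j" for p' :: "nat poly" and i j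
      using that by (rule poly_nat_mono)
    have s0: "state (rev x) (rev x) ?SK e0"
    proof -
      have e: "e 1 = rev x" "e 3 = rev x" "e (7 + i) = enc (replicate s True) i" for i
        using st unfolding state_def by blast+
      have "e 8 = []" using e(3)[of 1] by (simp add: enc_bits)
      moreover have "(7 + i = 8) = (i = 1)" for i :: nat by auto
      ultimately show ?thesis
        using e unfolding state_def e0_def pushes by (auto simp: enc_Pair merge_def enc_bits elim!: oddE)
    qed
    have s1: "state (rev x) (rev x) (replicate ?e True, (?SK, [True])) e1"
      and k1: "cost (?r cA) e0 \<le> poly pA (poly lin ?u)"
      using state_FP[OF impl(1) s0] mono[of "s + K" "poly lin ?u" pA] sB by (auto simp: FA_def e1_def)
    have Mk: "(FM ^^ k) (S, [True]) = (S, replicate (2 ^ k) True)" for k S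
      by (induction k) (auto simp: FM_def replicate_add[symmetric] mult_2)
    have x2: "exec cL (enc (replicate ?e True, (?SK, [True]))) = enc ([] :: bool list, (?SK, ?M))"
      unfolding cL_def exec_For_funpow(1)[OF impl(2)] by (simp add: Mk)
    have s2: "state (rev x) (rev x) ([] :: bool list, (?SK, ?M)) e2"
      using state_rename(1)[OF s1 x2] by (simp add: e2_def)
    have "cost cL (enc (replicate ?e True, (?SK, [True]))) \<le>
        length (replicate ?e True) * (poly pM (poly lin ?u) + 2) + 1"
      unfolding cL_def
    proof (rule exec_For_funpow(2)[OF impl(2)])
      fix k assume "k < length (replicate ?e True)"
      then have k: "k \<le> ?e" by simp
      have "(2::nat) ^ k \<le> ?m" by (intro power_increasing k) auto
      then have "s + K + 2 ^ k \<le> poly lin ?u" using sB by linarith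
      then show "blen ((FM ^^ k) (?SK, [True])) \<le> poly lin ?u" by (simp add: Mk)
    qed
    also have "\<dots> \<le> ?u * (poly pM (poly lin ?u) + 2) + 1"
      using eu by (intro add_mono mult_mono) simp_all
    finally have k2: "cost (?r cL) e1 \<le> ?u * (poly pM (poly lin ?u) + 2) + 1"
      unfolding state_rename(2)[OF s1 x2] .
    have FB: "FB ([], (?SK, ?M)) = (replicate ?q True, ([], (?SK, ?M)))" by (simp add: FB_def)
    have s3: "state (rev x) (rev x) (replicate ?q True, ([] :: bool list, (?SK, ?M))) e3"
      and k3: "cost (?r cB) e2 \<le> poly pB (poly lin ?u)"
      using state_FP[OF impl(3) s2] mono[of "s + K + ?m" "poly lin ?u" pB] sB by (auto simp: FB e3_def)
    have qB: "?q + s + K + ?m \<le> poly pB (poly lin ?u)"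
      using implementsD(4)[OF impl(3), of "([], (?SK, ?M))"]
        mono[of "s + K + ?m" "poly lin ?u" pB] sB unfolding FB by simp
    have SD: "rev (take ?q (rev x)) = SD" by (simp add: SD_def rev_take)
    have s4: "state (rev x) (drop ?q (rev x)) ([] :: bool list, (SD, (?SK, ?M))) e4"
      and k4: "cost (transfer 3 id) e3 \<le> 8 * poly pB (poly lin ?u) + 1"
      using state_transfer(1,3)[OF s3, of id] qB by (auto simp: e4_def SD)
    have lSD: "length SD \<le> poly pB (poly lin ?u)" using qB by (simp add: SD_def)
    have FC: "FC ([], (SD, (?SK, ?M))) = (replicate ?w True, ([], (SD, (?SK, ?M))))" by (simp add: FC_def)
    have s5: "state (rev x) (drop ?q (rev x)) (replicate ?w True, ([] :: bool list, (SD, (?SK, ?M)))) e5"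
      and k5: "cost (?r cC) e4 \<le> poly pC (poly pB (poly lin ?u) + poly lin ?u)"
      using state_FP[OF impl(4) s4] mono[of "length SD + (s + K + ?m)" "poly pB (poly lin ?u) + poly lin ?u" pC] sB lSD
      by (auto simp: FC e5_def)
    have s6: "state (drop ?w (rev x)) (drop ?q (rev x))
        ([] :: bool list, (replicate (min ?n ?w) True, (SD, (?SK, ?M)))) e6"
      and k6: "cost (transfer 1 (\<lambda>_. True)) e5 \<le> 8 * poly pB (poly lin ?u) + 1"
      using state_transfer(2,4)[OF s5, of "\<lambda>_. True"] qB
      by (auto simp: e6_def map_replicate_const)
    have FD: "FD ([], (replicate (min ?n ?w) True, (SD, (?SK, ?M)))) = z"
      by (simp add: FD_def z_def)
    have bl: "blen ([] :: bool list, (replicate (min ?n ?w) True, (SD, (?SK, ?M)))) \<le>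
        2 * poly pB (poly lin ?u) + poly lin ?u"
      using lSD qB sB by simp
    have s7: "state (drop ?w (rev x)) (drop ?q (rev x)) z e7"
      and k7: "cost (?r cD) e6 \<le> poly pD (2 * poly pB (poly lin ?u) + poly lin ?u)"
      and lz: "length z \<le> poly pD (2 * poly pB (poly lin ?u) + poly lin ?u)"
      using state_FP[OF impl(5) s6] mono[OF bl, of pD]
        implementsD(4)[OF impl(5), of "([], (replicate (min ?n ?w) True, (SD, (?SK, ?M))))"]
      unfolding FD by (auto simp: e7_def)
    have "e7 1 = drop ?w (rev x)" "e7 (7 + 0) = enc z 0" using s7 unfolding state_def by blast+
    then have e7: "e7 1 = drop ?w (rev x)" "e7 (Suc 0) = drop ?w (rev x)" "e7 7 = z"
      by (simp_all add: enc_bits)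
    have "exec (c K) e 1 = rev z @ drop ?w (rev x)"
      unfolding c_def exec.simps e0_def[symmetric] e1_def[symmetric] e2_def[symmetric] e3_def[symmetric] e4_def[symmetric]
        e5_def[symmetric] e6_def[symmetric] e7_def[symmetric]
      by (simp add: shift_to e7)
    also have "drop ?w (rev x) = rev (take (?n - min ?n ?w) x)"
      by (auto simp: drop_rev min_def)
    also have "rev z @ rev (take (?n - min ?n ?w) x) = rev (generator f P K s x)"
      by (simp add: generator_def Let_def z_def SD_def)
    finally have 1: "exec (c K) e 1 = rev (generator f P K s x)" .
    have k8: "cost (shift_to 7 1) e7 \<le> 6 * poly pD (2 * poly pB (poly lin ?u) + poly lin ?u) + 1"
      using shift_to(2)[of 7 1 e7] lz e7 by simp
    have "cost (c K) e = 2 * K + (cost (?r cA) e0 + (cost (?r cL) e1 + (cost (?r cB) e2 + (cost (transfer 3 id) e3 +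
        (cost (?r cC) e4 + (cost (transfer 1 (\<lambda>_. True)) e5 + (cost (?r cD) e6 + cost (shift_to 7 1) e7)))))))"
      unfolding c_def cost.simps e0_def[symmetric] e1_def[symmetric] e2_def[symmetric] e3_def[symmetric] e4_def[symmetric]
        e5_def[symmetric] e6_def[symmetric] e7_def[symmetric] pushes(2) by (rule refl)
    also have "\<dots> \<le> 2 * K + poly p ?u"
      using k1 k2 k3 k4 k5 k6 k7 k8 by (simp add: p_def poly_pcompose)
    finally show ?thesis using 1 by blast
  qed
  show thesis
  proof (rule that[of p])
    fix K :: nat assume K: "K > 0"
    have odd: "odd' v = 0 \<longleftrightarrow> False" for v by (simp add: odd'_def)
    have "wf_com (c K)"
      using impl[THEN implementsD(1)] by (auto simp: odd c_def cL_def inj_odd' transfer_def shift_to_def pushes)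
    moreover have "regs (c K) \<subseteq> {1, 3} \<union> {7..}"
      using pushes(4)[of K] by (auto simp: c_def transfer_def shift_to_def)
    ultimately show "\<exists>c. wf_com c \<and> regs c \<subseteq> {1, 3} \<union> {7..} \<and>
      (\<forall>x s e. state (rev x) (rev x) (replicate s True) e \<longrightarrow>
        exec c e 1 = rev (generator f P K s x) \<and> cost c e \<le> 2 * K + poly p (2 ^ (s div K) + K))"
      using main[OF _ K] by blast
  qed
qed

section \<open>Rate-1 efficiency\<close>

text \<open>Stacks while they grow by one element per step: the head scans the blank above the stack.\<close>

definition pushed :: "nat \<Rightarrow> (nat \<Rightarrow> int) \<Rightarrow> bool list \<Rightarrow> tape" where
  "pushed v A xs = (fst (stack_tape v A xs), snd (stack_tape v A xs) - sgn_tape v)"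

lemma act_pushed: "act (Some b, push_move v) (pushed v A xs) = pushed v A (b # xs)"
  using sgn_tape_cases[of v]
  by (auto simp: pushed_def stack_tape_eq push_move_def sgn_tape_def fun_eq_iff cell_Cons algebra_simps)

lemma act_settle: "act (read_tape (pushed v A xs), pop_move v) (pushed v A xs) = stack_tape v A xs"
  by (auto simp: pushed_def stack_tape_eq pop_move_def sgn_tape_def)

lemma act_Stay: "act (read_tape T, Stay) T = T"
  by (cases T) simp

lemma map2_act_fun:
  "map2 act (map Z [0..<k]) (map T [0..<k]) = map (\<lambda>v. act (Z v) (T v)) [0..<k]"
  by (rule nth_equalityI) auto

definition walk :: "nat \<Rightarrow> nat \<Rightarrow> nat \<Rightarrow> move \<Rightarrow> instr" where
  "walk a u o' mv = (\<lambda>_ ss. if ss ! u = None then (a + 1, keep ss)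
     else (a, (keep ss)[u := (None, pop_move u), o' := (ss ! o', mv)]))"

lemma reaches_walk:
  assumes "loaded M a [walk a u o' mv]" "a \<ge> 2" "u < k" "o' < k" "u \<in> V" "o' \<notin> V"
  shows "reaches M (length (e u) + 1) (a, tapes k V A J e)
    (a + 1, tapes k V A (J(o' := (fst (J o'), snd (J o') + int (length (e u)) * offset mv))) (e(u := [])))"
proof (induction "e u" arbitrary: e J)
  case Nil
  have "map read_tape (tapes k V A J e) ! u = None" using Nil assms(3,5) by (simp add: read_stack flip: Nil)
  then have "reaches M 1 (a, tapes k V A J e) (a + 1, tapes k V A J e)"
    by (intro step_keep[OF assms(1,2)]) (simp add: walk_def)
  moreover have "e(u := []) = e" using Nil by auto
  moreover have "J(o' := (fst (J o'), snd (J o'))) = J" by simp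
  ultimately show ?case by (simp flip: Nil)
next
  case (Cons b xs)
  let ?ts = "tapes k V A J e"
  let ?J = "J(o' := (fst (J o'), snd (J o') + offset mv))"
  let ?e = "e(u := xs)"
  have eu: "e u = b # xs" using Cons by simp
  have uo: "u \<noteq> o'" using assms by auto
  have 1: "reaches M 1 (a, ?ts) (a, tapes k V A ?J ?e)"
  proof (rule reaches_1)
    fix c
    have "map read_tape ?ts ! u \<noteq> None" using eu assms(3,5) by (simp add: read_stack)
    then have "step M c (a, ?ts) =
        (a, map2 act ((keep (map read_tape ?ts))[u := (None, pop_move u), o' := (map read_tape ?ts ! o', mv)]) ?ts)"
      using assms by (subst step_instr[of M c a]) (auto simp: loaded_Cons halt_state_def walk_def)
    also have "\<dots> = (a, ?ts[u := act (None, pop_move u) (?ts ! u), o' := act (map read_tape ?ts ! o', mv) (?ts ! o')])"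
      using assms uo by (subst act_keep_update2) auto
    also have "\<dots> = (a, tapes k V A ?J ?e)"
    proof -
      have "act (read_tape (J o'), mv) (J o') = (fst (J o'), snd (J o') + offset mv)" by (cases "J o'") simp
      then show ?thesis
        using assms uo act_pop[of "e u" u A] eu
        by (auto simp: tapes_def nth_list_update intro!: nth_equalityI)
    qed
    finally show "step M c (a, ?ts) = (a, tapes k V A ?J ?e)" .
  qed
  have "xs = ?e u" by simp
  note 2 = Cons(1)[of ?e ?J, OF this]
  show ?case
    using reaches_trans[OF 1 2] by (simp add: eu algebra_simps)
qed

definition scan :: "nat \<Rightarrow> nat \<Rightarrow> nat \<Rightarrow> instr" where
  "scan a v o' = (\<lambda>_ ss. if ss ! o' = None then (a + 1, (keep ss)[v := (ss ! v, MoveRight)])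
     else (a, (keep ss)[v := (Some True, MoveLeft), o' := (ss ! o', MoveRight)]))"

lemma reaches_scan:
  assumes "loaded M a [scan a v o']" "a \<ge> 2" "v < k" "o' < k" "v \<in> V" "o' \<notin> V" "v \<noteq> 1"
    "J o' = (g, p)" "\<And>i. i < s \<Longrightarrow> g (p + int i) \<noteq> None" "g (p + int s) = None"
  shows "reaches M (s + 1) (a, (tapes k V A J e)[v := pushed v A (e v)])
    (a + 1, tapes k V A (J(o' := (g, p + int s))) (e(v := replicate s True @ e v)))"
  using assms(8-10)
proof (induction s arbitrary: e J p)
  case 0
  let ?T = "tapes k V A J e"
  let ?ts = "?T[v := pushed v A (e v)]"
  have vo: "v \<noteq> o'" using assms by auto
  have "reaches M 1 (a, ?ts) (a + 1, ?T)"
  proof (rule reaches_1)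
    fix b
    have "map read_tape ?ts ! o' = None" using 0 assms vo by simp
    then have "step M b (a, ?ts) = (a + 1, map2 act ((keep (map read_tape ?ts))[v := (map read_tape ?ts ! v, MoveRight)]) ?ts)"
      using assms by (subst step_instr[of M b a]) (auto simp: loaded_Cons halt_state_def scan_def)
    also have "\<dots> = (a + 1, ?ts[v := act (map read_tape ?ts ! v, MoveRight) (?ts ! v)])"
      using assms by (subst act_keep_update) auto
    also have "\<dots> = (a + 1, ?T)"
      using assms act_settle[of v A "e v"]
      by (auto simp: pop_move_def nth_list_update tapes_def intro!: nth_equalityI)
    finally show "step M b (a, ?ts) = (a + 1, ?T)" .
  qed
  moreover have "J(o' := (g, p)) = J" using 0 by auto
  ultimately show ?case by simp
next
  case (Suc s)
  let ?ts = "(tapes k V A J e)[v := pushed v A (e v)]"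
  let ?J = "J(o' := (g, p + 1))"
  let ?e = "e(v := True # e v)"
  let ?us = "(tapes k V A ?J ?e)[v := pushed v A (?e v)]"
  have vo: "v \<noteq> o'" using assms by auto
  have 1: "reaches M 1 (a, ?ts) (a, ?us)"
  proof (rule reaches_1)
    fix b
    have "map read_tape ?ts ! o' \<noteq> None" using Suc(3)[of 0] Suc(2) assms vo by simp
    then have "step M b (a, ?ts) = (a, map2 act ((keep (map read_tape ?ts))[v := (Some True, MoveLeft),
        o' := (map read_tape ?ts ! o', MoveRight)]) ?ts)"
      using assms by (subst step_instr[of M b a]) (auto simp: loaded_Cons halt_state_def scan_def)
    also have "\<dots> = (a, ?ts[v := act (Some True, MoveLeft) (?ts ! v), o' := act (map read_tape ?ts ! o', MoveRight) (?ts ! o')])"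
      using assms vo by (subst act_keep_update2) auto
    also have "\<dots> = (a, ?us)"
      using assms act_pushed[of True v A "e v"] Suc(2) vo
      by (auto simp: push_move_def nth_list_update tapes_def intro!: nth_equalityI)
    finally show "step M b (a, ?ts) = (a, ?us)" .
  qed
  have "reaches M (s + 1) (a, ?us) (a + 1, tapes k V A (?J(o' := (g, p + 1 + int s))) (?e(v := replicate s True @ ?e v)))"
  proof (rule Suc.IH)
    show "g (p + 1 + int i) \<noteq> None" if "i < s" for i
      using Suc(3)[of "Suc i"] that by (simp add: add.assoc)
    show "g (p + 1 + int s) = None" using Suc(4) by (simp add: add.assoc)
  qed simp
  from reaches_trans[OF 1 this] show ?case
    by (simp add: add.assoc replicate_app_Cons_same fun_upd_def cong: if_cong)
qed

text \<open>The machine \<open>M\<close> runs on tape 0 and on the tapes from \<open>b0\<close> on. Tape 2 marks the cells of tape 0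
  that have been visited, so that on its first visit a cell can be copied to the tapes 1 and 3.
  The stacks 4, 5, 6 count the steps in which the head of the output tape of \<open>M\<close> does not move right,
  those in which it moves left, and those without a copy: they tell how far the head of the output
  tape is from cell \<open>length x\<close>.\<close>

definition sim_act :: "nat \<Rightarrow> (symbol \<times> move) list \<Rightarrow> symbol list \<Rightarrow> nat \<Rightarrow> symbol \<times> move" where
  "sim_act b0 as ss v =
     (let copied = (ss ! 2 = None \<and> ss ! 0 \<noteq> None); keep1 = (ss ! v, Stay) in
      if v = 0 then as ! 0
      else if v = 1 then (if copied then (ss ! 0, push_move 1) else keep1)
      else if v = 2 then (Some True, snd (as ! 0))
      else if v = 3 then (if copied then (ss ! 0, push_move 3) else keep1)
      else if v = 4 then (if snd (as ! 1) = MoveRight then keep1 else (Some True, push_move 4))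
      else if v = 5 then (if snd (as ! 1) = MoveLeft then (Some True, push_move 5) else keep1)
      else if v = 6 then (if copied then keep1 else (Some True, push_move 6))
      else if v < b0 then keep1
      else as ! (v - b0 + 1))"

text \<open>State \<open>q\<close> of \<open>M\<close> has the address \<open>3 + q\<close>. The
  guard keeps the instruction inside the machine for symbol lists of a wrong length, on which
  \<open>M\<close> is unconstrained.\<close>

definition sim :: "machine \<Rightarrow> nat \<Rightarrow> nat \<Rightarrow> instr" where
  "sim M b0 q = (\<lambda>_ ss. let r = transition M False q (ss ! 0 # drop b0 ss) in
     (if fst r < num_states M then 3 + fst r else 0, map (sim_act b0 (snd r) ss) [0..<length ss]))"

text \<open>Chosen so that all heads start on cell 0: the tapes 1 and 3 to 7 start as stacks in
  growth, whose heads scan the cell above the top, and those from 8 on as stacks at rest.\<close>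

definition anchor :: "nat \<Rightarrow> int" where
  "anchor v = (if v = 1 then - 1 else if v < 8 then 1 else 0)"

text \<open>Cells in the visited interval have the current content \<open>g\<close>, all others
  still that of the input \<open>x\<close>; this describes tape 0 for several inputs at
  once.\<close>

definition overlay :: "int \<Rightarrow> int \<Rightarrow> (int \<Rightarrow> symbol) \<Rightarrow> bool list \<Rightarrow> int \<Rightarrow> symbol" where
  "overlay lo hi g x = (\<lambda>i. if lo \<le> i \<and> i < hi then g i else cell x i)"

text \<open>The clause about \<open>x'\<close> says that the run so far is the same for every input
  that agrees with \<open>x\<close> below \<open>hi\<close>. The head of the output tape has made
  \<open>t - d1\<close> moves to the right and \<open>d2\<close> to the left, which gives its
  position and bounds the cells written so far.\<close>

definition tracks :: "machine \<Rightarrow> nat \<Rightarrow> bool list \<Rightarrow> nat \<Rightarrow> config \<Rightarrow> (nat \<Rightarrow> tape) \<Rightarrow>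
    int \<Rightarrow> int \<Rightarrow> nat \<Rightarrow> nat \<Rightarrow> nat \<Rightarrow> bool" where
  "tracks M b0 x t c T lo hi d1 d2 dr \<longleftrightarrow>
     (fst c < num_states M \<and> length (snd c) = num_tapes M) \<and>
     (lo \<le> 0 \<and> 0 \<le> hi \<and> lo - 1 \<le> snd (snd c ! 0) \<and> snd (snd c ! 0) \<le> hi) \<and>
     (\<forall>x'. (\<forall>i<hi. cell x' i = cell x i) \<longrightarrow> run M (replicate t False) x' =
        (fst c, (snd c)[0 := (overlay lo hi (fst (snd c ! 0)) x', snd (snd c ! 0))])) \<and>
     (T 0 = snd c ! 0 \<and> (\<forall>v. b0 \<le> v \<longrightarrow> v < b0 + num_tapes M - 1 \<longrightarrow> T v = snd c ! (v - b0 + 1))) \<and>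
     (T 2 = ((\<lambda>i. if lo \<le> i \<and> i < hi then Some True else None), snd (snd c ! 0)) \<and>
      T 1 = pushed 1 anchor (rev (take (nat hi) x)) \<and> T 3 = pushed 3 anchor (rev (take (nat hi) x))) \<and>
     (T 4 = pushed 4 anchor (replicate d1 True) \<and> T 5 = pushed 5 anchor (replicate d2 True) \<and>
      T 6 = pushed 6 anchor (replicate dr True) \<and> T 7 = pushed 7 anchor [] \<and>
      (\<forall>v. 8 \<le> v \<longrightarrow> v < b0 \<longrightarrow> T v = stack_tape v anchor [])) \<and>
     t = length (take (nat hi) x) + dr \<and>
     (snd (snd c ! 1) = int t - int d1 - int d2 \<and> (d2 \<le> d1 \<and> d1 \<le> t) \<and>
      (\<forall>i. fst (snd c ! 1) i \<noteq> None \<longrightarrow> i \<le> int t - int d1))"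

lemma step_run: "run M (replicate (Suc t) False) x = step M False (run M (replicate t False) x)"
proof -
  have "replicate (Suc t) False = replicate t False @ [False]" by (simp add: replicate_append_same)
  then show ?thesis by (simp add: run_append)
qed

lemma overlay_extend:
  fixes lo hi p i :: int
  assumes "lo \<le> hi" "lo - 1 \<le> p" "p \<le> hi"
    and "lo' = (if p = lo - 1 then p else lo)" "hi' = (if p = hi then p + 1 else hi)"
  shows "(lo' \<le> i \<and> i < hi') \<longleftrightarrow> (lo \<le> i \<and> i < hi) \<or> i = p"
  using assms by (auto split: if_splits)

lemma tracks_step:
  assumes tr: "tracks M b0 x t c T lo hi d1 d2 dr" and tm: "turing_machine M" and b0: "b0 \<ge> 8"
    and nh: "\<not> halted c" and x: "run M (replicate t False) x = c" and k: "k = b0 + num_tapes M - 1"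
    and l: "loaded A (3 + fst c) [sim M b0 (fst c)]"
  shows "\<exists>T' lo' hi' d1' d2' dr'. tracks M b0 x (Suc t) (step M False c) T' lo' hi' d1' d2' dr' \<and>
    reaches A 1 (3 + fst c, map T [0..<k]) (3 + fst (step M False c), map T' [0..<k])"
proof -
  obtain q ts where c: "c = (q, ts)" by (cases c)
  have nt: "num_tapes M \<ge> 2" using tm by (simp add: turing_machine_def)
  note tr = tr[unfolded tracks_def c fst_conv snd_conv]
  have q: "q < num_states M" and lts: "length ts = num_tapes M" using tr by auto
  obtain g p where t0: "ts ! 0 = (g, p)" by (cases "ts ! 0")
  obtain h r where t1: "ts ! 1 = (h, r)" by (cases "ts ! 1")
  note tr = tr[unfolded t0 t1 fst_conv snd_conv]
  have lh: "lo \<le> 0" "0 \<le> hi" "lo - 1 \<le> p" "p \<le> hi" using tr by blast+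
  have agree: "run M (replicate t False) x' = (q, ts[0 := (overlay lo hi g x', p)])"
    if "\<forall>i<hi. cell x' i = cell x i" for x' using tr that by blast
  have T: "T 0 = (g, p)" "\<And>v. b0 \<le> v \<Longrightarrow> v < b0 + num_tapes M - 1 \<Longrightarrow> T v = ts ! (v - b0 + 1)"
    "T 2 = ((\<lambda>i. if lo \<le> i \<and> i < hi then Some True else None), p)"
    "T 1 = pushed 1 anchor (rev (take (nat hi) x))" "T 3 = pushed 3 anchor (rev (take (nat hi) x))"
    "T 4 = pushed 4 anchor (replicate d1 True)" "T 5 = pushed 5 anchor (replicate d2 True)"
    "T 6 = pushed 6 anchor (replicate dr True)" "T 7 = pushed 7 anchor []"
    "\<And>v. 8 \<le> v \<Longrightarrow> v < b0 \<Longrightarrow> T v = stack_tape v anchor []"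
    using tr by blast+
  have cnt: "t = length (take (nat hi) x) + dr" "r = int t - int d1 - int d2" "d2 \<le> d1" "d1 \<le> t"
    "\<And>i. h i \<noteq> None \<Longrightarrow> i \<le> int t - int d1" using tr by blast+
  define rs where "rs = map read_tape ts"
  define q' where "q' = fst (transition M False q rs)"
  define as where "as = snd (transition M False q rs)"
  have lrs: "length rs = num_tapes M" by (simp add: rs_def lts)
  have q': "q' < num_states M" and las: "length as = num_tapes M"
    using tm q lrs by (auto simp: turing_machine_def q'_def as_def)
  have qn: "q \<noteq> halt_state" using nh by (simp add: c halted_def)
  have stepM: "step M False (q, us) = (q', map2 act as us)" if "map read_tape us = rs" for us
    using qn that by (simp add: step_def halted_def q'_def as_def case_prod_beta)
  have stepc: "step M False c = (q', map2 act as ts)" unfolding c by (rule stepM) (simp add: rs_def)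
  obtain s0 m0 where a0: "as ! 0 = (s0, m0)" by (cases "as ! 0")
  obtain s1 m1 where a1: "as ! 1 = (s1, m1)" by (cases "as ! 1")
  define lo' where "lo' = (if p = lo - 1 then p else lo)"
  define hi' where "hi' = (if p = hi then p + 1 else hi)"
  note ext = overlay_extend[OF _ lh(3,4) lo'_def hi'_def]
  have ext: "(lo' \<le> i \<and> i < hi') \<longleftrightarrow> (lo \<le> i \<and> i < hi) \<or> i = p" for i by (rule ext) (use lh in simp)
  define new where "new \<longleftrightarrow> \<not> (lo \<le> p \<and> p < hi)"
  \<comment> \<open>The clause about \<open>x'\<close>, taken for \<open>x\<close> itself, shows
    that an unvisited cell still has its initial content.\<close>
  have g: "g p = cell x p" if new
  proof -
    have "ts ! 0 = (overlay lo hi g x, p)"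
      using agree[of x] x nt lts by (metis c length_greater_0_conv list_update_id nth_list_update_eq prod.inject
        order_less_le_trans zero_less_numeral)
    then have "g = overlay lo hi g x" using t0 by simp
    then have "g p = overlay lo hi g x p" by (rule fun_cong)
    also have "\<dots> = cell x p" using that by (auto simp: overlay_def new_def)
    finally show ?thesis .
  qed
  define copied where "copied \<longleftrightarrow> new \<and> g p \<noteq> None"
  \<comment> \<open>A cell visited for the first time lies left of the input, is the next input
    cell, or lies right of the input. In the outer cases it is blank and nothing is copied.\<close>
  have hi': "take (nat hi') x = (if copied then take (nat hi) x @ [the (g p)] else take (nat hi) x)"
  proof (cases "p = hi")
    case True
    then have n: new by (simp add: new_def)
    show ?thesis
    proof (cases "hi < int (length x)")
      case True
      then have "g p = Some (x ! nat hi)" using g[OF n] \<open>p = hi\<close> lh by (simp add: cell_def)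
      moreover have "nat hi' = Suc (nat hi)" using \<open>p = hi\<close> lh by (simp add: hi'_def)
      ultimately show ?thesis using n True lh by (simp add: copied_def take_Suc_conv_app_nth)
    next
      case False
      then have "g p = None" using g[OF n] \<open>p = hi\<close> lh by (simp add: cell_def)
      moreover have "length x \<le> nat hi'" "length x \<le> nat hi"
        using False lh \<open>p = hi\<close> by (auto simp: hi'_def)
      ultimately show ?thesis by (simp add: copied_def)
    qed
  next
    case False
    then have "copied \<Longrightarrow> p < 0" using lh by (auto simp: copied_def new_def)
    then have "\<not> copied" using g by (auto simp: copied_def cell_def)
    then show ?thesis using False by (simp add: hi'_def)
  qed
  define d1' where "d1' = (if m1 = MoveRight then d1 else Suc d1)"
  define d2' where "d2' = (if m1 = MoveLeft then Suc d2 else d2)"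
  define dr' where "dr' = (if copied then dr else Suc dr)"
  define ss where "ss = map read_tape (map T [0..<k])"
  define T' where "T' = (\<lambda>v. act (sim_act b0 as ss v) (T v))"
  have k8: "k \<ge> 9" "k = b0 + num_tapes M - 1" using k b0 nt by auto
  have lss: "length ss = k" by (simp add: ss_def)
  have ssv: "ss ! v = read_tape (T v)" if "v < k" for v using that by (simp add: ss_def)
  have sym: "ss ! 0 # drop b0 ss = rs"
  proof (rule nth_equalityI)
    show "length (ss ! 0 # drop b0 ss) = length rs" using lss lrs k8 nt by simp
    fix i assume "i < length (ss ! 0 # drop b0 ss)"
    then have i: "i \<le> k - b0" using lss by simp
    show "(ss ! 0 # drop b0 ss) ! i = rs ! i"
    proof (cases i)
      case 0
      then show ?thesis using ssv[of 0] k8 T(1) t0 lts nt by (simp add: rs_def)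
    next
      case (Suc j)
      then have "b0 + j < k" using i by simp
      then show ?thesis using Suc ssv[of "b0 + j"] T(2)[of "b0 + j"] k8 lts lss by (simp add: rs_def)
    qed
  qed
  have reach: "reaches A 1 (3 + q, map T [0..<k]) (3 + q', map T' [0..<k])"
  proof (rule reaches_1)
    fix b
    have tA: "transition A b (3 + q) = sim M b0 q b" using l by (simp add: loaded_Cons c)
    have "sim M b0 q b ss = (3 + q', map (sim_act b0 as ss) [0..<k])"
      using q' by (simp add: sim_def Let_def sym q'_def[symmetric] as_def[symmetric] lss)
    then have "step A b (3 + q, map T [0..<k]) = (3 + q', map2 act (map (sim_act b0 as ss) [0..<k]) (map T [0..<k]))"
      using step_instr[OF tA, of "map T [0..<k]"] unfolding ss_def[symmetric] by (simp add: halt_state_def)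
    then show "step A b (3 + q, map T [0..<k]) = (3 + q', map T' [0..<k])"
      by (simp add: map2_act_fun T'_def)
  qed
  have ss: "ss ! 0 = g p" "(ss ! 2 = None) = new"
    using ssv[of 0] ssv[of 2] k8 T(1,3) by (auto simp: new_def)
  have cp: "(ss ! 2 = None \<and> ss ! 0 \<noteq> None) = copied" by (simp add: ss copied_def)
  have keep: "act (ss ! v, Stay) (T v) = T v" if "v < k" for v
    unfolding ssv[OF that] by (rule act_Stay)
  have T'b: "T' v = map2 act as ts ! (v - b0 + 1)" if "b0 \<le> v" "v < b0 + num_tapes M - 1" for v
    using that b0 T(2)[OF that] las lts by (simp add: T'_def sim_act_def Let_def)
  have T'0: "T' 0 = map2 act as ts ! 0"
    using T(1) t0 las lts nt by (simp add: T'_def sim_act_def Let_def)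
  have n0: "map2 act as ts ! 0 = (g(p := s0), p + offset m0)" using las lts nt a0 t0 by simp
  have n1: "map2 act as ts ! 1 = (h(r := s1), r + offset m1)" using las lts nt a1 t1 by simp
  have copy: "act (ss ! 0, push_move v) (pushed v anchor (rev (take (nat hi) x))) =
      pushed v anchor (rev (take (nat hi') x))" if copied for v
  proof -
    have "ss ! 0 = Some (the (g p))" using that by (auto simp: ss copied_def)
    then show ?thesis using that by (simp add: act_pushed hi')
  qed
  have T'v: "T' 1 = pushed 1 anchor (rev (take (nat hi') x))" "T' 3 = pushed 3 anchor (rev (take (nat hi') x))"
    "T' 4 = pushed 4 anchor (replicate d1' True)" "T' 5 = pushed 5 anchor (replicate d2' True)"
    "T' 6 = pushed 6 anchor (replicate dr' True)" "T' 7 = pushed 7 anchor []"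
    using keep[of 1] keep[of 3] keep[of 4] keep[of 5] keep[of 6] keep[of 7] k8 b0 T copy[of 1] copy[of 3]
    unfolding T'_def sim_act_def Let_def cp a1 d1'_def d2'_def dr'_def
    by (auto simp: hi' act_pushed)
  have T'2: "T' 2 = ((\<lambda>i. if lo' \<le> i \<and> i < hi' then Some True else None), p + offset m0)"
    unfolding ext using T(3) a0 by (auto simp: T'_def sim_act_def Let_def fun_eq_iff)
  have T'r: "T' v = stack_tape v anchor []" if "8 \<le> v" "v < b0" for v
    using T(10)[OF that] keep[of v] that k8 nt unfolding T'_def sim_act_def by (simp add: Let_def)
  have off: "offset m0 \<in> {-1, 0, 1}" by (cases m0) auto
  have agree': "run M (replicate (Suc t) False) x' =
      (q', (map2 act as ts)[0 := (overlay lo' hi' (g(p := s0)) x', p + offset m0)])"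
    if x': "\<forall>i<hi'. cell x' i = cell x i" for x'
  proof -
    have "\<forall>i<hi. cell x' i = cell x i" using x' by (auto simp: hi'_def)
    note ag = agree[OF this]
    have "overlay lo hi g x' p = g p"
    proof (cases new)
      case True
      then have "p = hi \<or> p < 0" using lh by (auto simp: new_def)
      then have "cell x' p = cell x p" using x' by (auto simp: hi'_def cell_negative)
      then show ?thesis using g[OF True] True by (simp add: overlay_def new_def)
    qed (simp add: overlay_def new_def)
    then have "map read_tape (ts[0 := (overlay lo hi g x', p)]) = rs"
      using t0 lts nt by (auto simp: rs_def nth_list_update intro!: nth_equalityI)
    then have "run M (replicate (Suc t) False) x' = (q', map2 act as (ts[0 := (overlay lo hi g x', p)]))"
      unfolding step_run ag by (rule stepM)
    also have "map2 act as (ts[0 := (overlay lo hi g x', p)]) =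
        (map2 act as ts)[0 := act (as ! 0) (overlay lo hi g x', p)]"
      using las lts nt by (auto simp: nth_list_update intro!: nth_equalityI)
    also have "act (as ! 0) (overlay lo hi g x', p) = (overlay lo' hi' (g(p := s0)) x', p + offset m0)"
      unfolding overlay_def ext a0 by (auto simp: fun_eq_iff)
    finally show ?thesis .
  qed
  have "tracks M b0 x (Suc t) (q', map2 act as ts) T' lo' hi' d1' d2' dr'"
    unfolding tracks_def fst_conv snd_conv n0 n1
  proof (intro conjI allI impI)
    show "T' 0 = (g(p := s0), p + offset m0)" using T'0 n0 by simp
    show "Suc t = length (take (nat hi') x) + dr'" using cnt(1) by (auto simp: hi' dr'_def)
    show "r + offset m1 = int (Suc t) - int d1' - int d2'"
      using cnt(2) by (cases m1) (auto simp: d1'_def d2'_def)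
    show "d2' \<le> d1'" "d1' \<le> Suc t" using cnt(3,4) by (auto simp: d1'_def d2'_def)
    fix i assume "(h(r := s1)) i \<noteq> None"
    then have "i \<le> int t - int d1" using cnt(2) cnt(5)[of i] by (cases "i = r") auto
    then show "i \<le> int (Suc t) - int d1'" by (auto simp: d1'_def)
  qed (use q' las lts lh off T'b T'2 T'v T'r agree' in \<open>auto simp: lo'_def hi'_def\<close>)
  then show ?thesis using reach unfolding stepc[unfolded c] c fst_conv by blast
qed

lemma deterministic_code: "i \<in> set (code c a) \<Longrightarrow> i True = i False"
  by (induction c arbitrary: a) (auto simp: Let_def goto_def pop_to_def)

lemma deterministic_prog_machine:
  assumes "\<And>i. i \<in> set is \<Longrightarrow> i True = i False"
  shows "deterministic (prog_machine k is)"
  using assms by (auto simp: deterministic_def prog_machine_def fun_eq_iff)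

lemma reaches_run:
  assumes "reaches M t (initial_config M x) c" "halted c" "t \<le> length r"
  shows "run M r x = c"
proof (rule halted_reaches_run[of M "take t r"])
  show "fold (step M) (take t r) (initial_config M x) = c"
    using assms(1,3) by (simp add: reaches_def)
qed (use assms in auto)

definition settle :: "nat \<Rightarrow> instr" where
  "settle a = (\<lambda>_ ss. (a, map (\<lambda>v. (ss ! v, if v \<in> {1, 3, 4, 5, 6} then pop_move v else Stay)) [0..<length ss]))"

definition start_tapes :: "bool list \<Rightarrow> nat \<Rightarrow> tape" where
  "start_tapes x v = (if v = 0 then input_tape x else blank_tape)"

text \<open>Undoes the left move of the start step on tape 1, because the simulation starts with all
  heads on cell 0.\<close>

lemma reaches_bump:
  assumes "loaded (prog_machine k is) 2 [\<lambda>_ ss. (3, (keep ss)[1 := (ss ! 1, MoveRight)])]" "k \<ge> 2"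
  shows "reaches (prog_machine k is) 2 (initial_config (prog_machine k is) x) (3, map (start_tapes x) [0..<k])"
proof -
  let ?A = "prog_machine k is"
  let ?ts = "tapes k {..<k} (input_anchor x) (\<lambda>_. blank_tape) (input_env x)"
  have "reaches ?A 1 (2, ?ts) (3, map (start_tapes x) [0..<k])"
  proof (rule reaches_1)
    fix b
    have "step ?A b (2, ?ts) = (3, map2 act ((keep (map read_tape ?ts))[1 := (map read_tape ?ts ! 1, MoveRight)]) ?ts)"
      using assms(1) by (subst step_instr[of ?A b 2]) (auto simp: loaded_Cons halt_state_def)
    also have "\<dots> = (3, ?ts[1 := act (map read_tape ?ts ! 1, MoveRight) (?ts ! 1)])"
      using assms(2) by (subst act_keep_update) auto
    also have "?ts[1 := act (map read_tape ?ts ! 1, MoveRight) (?ts ! 1)] = map (start_tapes x) [0..<k]"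
    proof (rule nth_equalityI)
      fix v assume "v < length (?ts[1 := act (map read_tape ?ts ! 1, MoveRight) (?ts ! 1)])"
      then have v: "v < k" by simp
      show "?ts[1 := act (map read_tape ?ts ! 1, MoveRight) (?ts ! 1)] ! v = map (start_tapes x) [0..<k] ! v"
      proof (cases "v = 1")
        case True
        have "act (read_tape (stack_tape 1 (input_anchor x) []), MoveRight) (stack_tape 1 (input_anchor x) []) = blank_tape"
          by (auto simp: stack_tape_eq input_anchor_def blank_tape_def sgn_tape_def cell_def fun_eq_iff)
        then show ?thesis using True v by (simp add: input_env_def start_tapes_def)
      qed (use v input_stack_tape[of v x] in \<open>simp add: start_tapes_def\<close>)
    qed simp
    finally show "step ?A b (2, ?ts) = (3, map (start_tapes x) [0..<k])" .
  qed
  from reaches_trans[OF reaches_start[OF assms(2)] this] show ?thesis by (simp add: numeral_2_eq_2)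
qed

lemma tracks_start:
  assumes "turing_machine M" "b0 \<ge> 8"
  shows "tracks M b0 x 0 (initial_config M x) (start_tapes x) 0 0 0 0 0"
proof -
  have nt: "num_tapes M \<ge> 2" using assms(1) by (simp add: turing_machine_def)
  have ov: "(overlay 0 0 g x', 0) = input_tape x'" for g x'
    by (auto simp: overlay_def input_tape_def cell_def fun_eq_iff)
  have st: "stack_tape v anchor [] = ((\<lambda>_. None), anchor v)" for v
    by (auto simp: stack_tape_eq cell_def)
  have sn: "snd (input_tape x) = 0" by (simp add: input_tape_def)
  have "(replicate (num_tapes M - 1) blank_tape) ! 0 = blank_tape" using nt by simp
  then show ?thesis
    unfolding tracks_def
    using assms nt
    by (auto simp: initial_config_def turing_machine_def run_def ov sn pushed_def st start_tapes_def
        anchor_def sgn_tape_def blank_tape_def fun_eq_iff)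
qed

lemma reaches_settle:
  assumes "loaded A a' [settle a]" "a' \<ge> 2" "V = {1, 3, 4, 5, 6} \<union> {8..<b0}"
    "T 1 = pushed 1 anchor xs" "T 3 = pushed 3 anchor xs" "T 4 = pushed 4 anchor (replicate d1 True)"
    "T 5 = pushed 5 anchor (replicate d2 True)" "T 6 = pushed 6 anchor (replicate dr True)"
    "\<And>v. 8 \<le> v \<Longrightarrow> v < b0 \<Longrightarrow> T v = stack_tape v anchor []"
    "e = (\<lambda>v. if v = 1 \<or> v = 3 then xs else if v = 4 then replicate d1 True
       else if v = 5 then replicate d2 True else if v = 6 then replicate dr True else [])"
  shows "reaches A 1 (a', map T [0..<k]) (a, tapes k V anchor T e)"
proof (rule reaches_1)
  fix b
  let ?Z = "\<lambda>v. (read_tape (T v), if v \<in> {1, 3, 4, 5, 6} then pop_move v else Stay)"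
  have t: "transition A b a' = settle a b" using assms(1) by (simp add: loaded_Cons)
  have "settle a b (map read_tape (map T [0..<k])) = (a, map ?Z [0..<k])"
    by (auto simp: settle_def)
  then have "step A b (a', map T [0..<k]) = (a, map2 act (map ?Z [0..<k]) (map T [0..<k]))"
    using step_instr[OF t, of "map T [0..<k]"] assms(2) by (simp add: halt_state_def)
  also have "\<dots> = (a, map (\<lambda>v. act (?Z v) (T v)) [0..<k])" unfolding map2_act_fun ..
  also have "map (\<lambda>v. act (?Z v) (T v)) [0..<k] = tapes k V anchor T e"
    unfolding tapes_def
  proof (rule map_cong[OF refl])
    fix v
    show "act (?Z v) (T v) = (if v \<in> V then stack_tape v anchor (e v) else T v)"
      using assms(4-9) by (auto simp: assms(3,10) act_settle act_Stay)
  qed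
  finally show "step A b (a', map T [0..<k]) = (a, tapes k V anchor T e)" .
qed

lemma halted_run_eq:
  assumes "halted (run M (replicate t False) x)" "halted (run M (replicate t' False) x)"
  shows "run M (replicate t False) x = run M (replicate t' False) x"
  using assms
proof (induction t t' rule: linorder_wlog)
  case (le t t')
  then have "replicate t' False = replicate t False @ replicate (t' - t) False"
    by (simp add: replicate_add[symmetric])
  then show ?case using run_halted[OF le(2), of "replicate (t' - t) False"] by simp
qed simp

text \<open>The run of \<open>M\<close> may use the whole budget of about \<open>n\<close> steps, so
  copying the input has to share these steps. Afterwards the head of the output tape of
  \<open>M\<close> is brought to cell \<open>n\<close>, and scanning to the first blank yields
  \<open>s n\<close> in unary. The summand \<open>4 * T n\<close> pays for the steps of
  \<open>M\<close> beyond \<open>n\<close> and for unwinding the three counters.\<close>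

theorem piggyback:
  assumes L: "computes_in_time M L (\<lambda>n. n + T n)"
    and len: "\<And>x. length (L x) = length x + s (length x)"
    and mono: "\<And>n n'. n < n' \<Longrightarrow> n + s n < n' + s n'"
    and c: "wf_com c" "regs c \<subseteq> {1, 3} \<union> {7..}"
    and prog: "\<And>x e. state (rev x) (rev x) (replicate (s (length x)) True) e \<Longrightarrow>
      exec c e 1 = rev (G x) \<and> cost c e \<le> C (length x)"
  shows "\<exists>A. computes_in_time A G (\<lambda>n. n + (4 * T n + s n + C n + 20))"
proof -
  define ns where "ns = num_states M"
  define b0 where "b0 = Suc (Max (insert 8 (regs c)))"
  define k where "k = b0 + num_tapes M - 1"
  have tm: "turing_machine M" and detM: "deterministic M" using L by (auto simp: computes_in_time_def)
  have nt: "num_tapes M \<ge> 2" and ns: "ns \<ge> 2"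
    using tm by (auto simp: turing_machine_def ns_def start_state_def halt_state_def)
  have b0: "b0 \<ge> 9" "regs c \<subseteq> {..<b0}" by (auto simp: b0_def less_Suc_eq_le)
  have k: "k \<ge> 2" "b0 < k" using b0 nt by (auto simp: k_def)
  define a where "a = 3 + ns"
  \<comment> \<open>The halt state 1 of \<open>M\<close> is replaced by \<open>settle a\<close>,
    from which control passes on to the measuring of the output.\<close>
  define prg where "prg = [\<lambda>_ ss. (3, (keep ss)[1 := (ss ! 1, MoveRight)])] @
    map (\<lambda>q. if q = 1 then settle a else sim M b0 q) [0..<ns] @
    [walk a 4 b0 MoveRight, walk (a + 1) 5 b0 MoveRight, walk (a + 2) 6 b0 MoveLeft, scan (a + 3) 7 b0] @
    code c (a + 4) @ [goto 1]"
  define A where "A = prog_machine k prg"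
  have lp: "2 + length prg = a + 5 + csize c" by (simp add: prg_def a_def)
  have "instrs_ok (2 + length prg) prg"
    unfolding lp unfolding prg_def instrs_ok_simps
    by (intro conjI instrs_ok_code)
      (auto simp: instrs_ok_def sim_def settle_def walk_def scan_def Let_def a_def ns_def)
  then have tmA: "turing_machine A"
    unfolding A_def using k by (intro turing_prog_machine) (auto simp: prg_def)
  have "i True = i False" if "i \<in> set prg" for i
    using that deterministic_code[of i c "a + 4"]
    by (auto simp: prg_def sim_def settle_def walk_def scan_def goto_def)
  then have detA: "deterministic A" unfolding A_def by (rule deterministic_prog_machine)
  have ld: "loaded A 2 prg" unfolding A_def by (rule loaded_prog_machine)
  have l: "loaded A 2 [\<lambda>_ ss. (3, (keep ss)[1 := (ss ! 1, MoveRight)])]"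
    "loaded A 3 (map (\<lambda>q. if q = 1 then settle a else sim M b0 q) [0..<ns])"
    "loaded A a [walk a 4 b0 MoveRight]" "loaded A (a + 1) [walk (a + 1) 5 b0 MoveRight]"
    "loaded A (a + 2) [walk (a + 2) 6 b0 MoveLeft]" "loaded A (a + 3) [scan (a + 3) 7 b0]"
    "loaded A (a + 4) (code c (a + 4))" "loaded A (a + 4 + csize c) [goto 1]"
    using ld unfolding prg_def loaded_append
    by (simp_all add: loaded_Cons loaded_def[of _ _ "[]"] a_def ac_simps numeral_eq_Suc)
  have lq: "loaded A (3 + q) [if q = 1 then settle a else sim M b0 q]" if "q < ns" for q
    using l(2) that unfolding loaded_def by (auto dest: spec[of _ q])
  have main: "halted (run A r x) \<and> output_of (run A r x) = G x"
    if r: "length r = length x + (4 * T (length x) + s (length x) + C (length x) + 20)" for x r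
  proof -
    let ?n = "length x"
    let ?c = "\<lambda>t. run M (replicate t False) x"
    have fin: "halted (?c (?n + T ?n))" "output_of (?c (?n + T ?n)) = L x"
      using L by (auto simp: computes_in_time_def)
    define \<tau> where "\<tau> = (LEAST t. halted (?c t))"
    have \<tau>: "halted (?c \<tau>)" "\<tau> \<le> ?n + T ?n" "\<And>t. t < \<tau> \<Longrightarrow> \<not> halted (?c t)"
      unfolding \<tau>_def using fin(1) by (auto intro: LeastI Least_le dest: not_less_Least)
    have "\<exists>T' lo hi d1 d2 dr. tracks M b0 x t (?c t) T' lo hi d1 d2 dr \<and>
        reaches A t (3, map (start_tapes x) [0..<k]) (3 + fst (?c t), map T' [0..<k])" if "t \<le> \<tau>" for t
      using that
    proof (induction t)
      case 0
      have "tracks M b0 x 0 (?c 0) (start_tapes x) 0 0 0 0 0"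
        using tracks_start[OF tm, of b0 x] b0 by (simp add: run_def)
      moreover have "fst (?c 0) = 0" by (simp add: run_def initial_config_def start_state_def)
      ultimately show ?case by fastforce
    next
      case (Suc t)
      then obtain T' lo hi d1 d2 dr where IH: "tracks M b0 x t (?c t) T' lo hi d1 d2 dr"
        "reaches A t (3, map (start_tapes x) [0..<k]) (3 + fst (?c t), map T' [0..<k])" by auto
      have nh: "\<not> halted (?c t)" using \<tau>(3) Suc.prems by simp
      have "fst (?c t) < ns" using IH(1) unfolding tracks_def ns_def by blast
      moreover have "fst (?c t) \<noteq> 1" using nh by (simp add: halted_def halt_state_def)
      ultimately have "loaded A (3 + fst (?c t)) [sim M b0 (fst (?c t))]" using lq[of "fst (?c t)"] by simp
      from tracks_step[OF IH(1) tm _ nh refl k_def this] b0(1)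
      obtain T'' lo' hi' d1' d2' dr' where "tracks M b0 x (Suc t) (step M False (?c t)) T'' lo' hi' d1' d2' dr'"
        "reaches A 1 (3 + fst (?c t), map T' [0..<k]) (3 + fst (step M False (?c t)), map T'' [0..<k])" by auto
      with reaches_trans[OF IH(2)] show ?case unfolding step_run[symmetric] Suc_eq_plus1 by blast
    qed
    from this[OF order_refl] obtain T' lo hi d1 d2 dr where tr: "tracks M b0 x \<tau> (?c \<tau>) T' lo hi d1 d2 dr"
      and r1: "reaches A \<tau> (3, map (start_tapes x) [0..<k]) (3 + fst (?c \<tau>), map T' [0..<k])" by blast
    obtain ts where ts: "?c \<tau> = (1, ts)" using \<tau>(1) by (cases "?c \<tau>") (auto simp: halted_def halt_state_def)
    obtain h p where hp: "ts ! 1 = (h, p)" by (cases "ts ! 1")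
    note tr = tr[unfolded tracks_def ts fst_conv snd_conv hp]
    have agree: "run M (replicate \<tau> False) x' = (1, ts[0 := (overlay lo hi (fst (ts ! 0)) x', snd (ts ! 0))])"
      if "\<forall>i<hi. cell x' i = cell x i" for x' using tr that by blast
    have T': "T' 1 = pushed 1 anchor (rev (take (nat hi) x))" "T' 3 = pushed 3 anchor (rev (take (nat hi) x))"
      "T' 4 = pushed 4 anchor (replicate d1 True)" "T' 5 = pushed 5 anchor (replicate d2 True)"
      "T' 6 = pushed 6 anchor (replicate dr True)" "T' 7 = pushed 7 anchor []"
      "\<And>v. 8 \<le> v \<Longrightarrow> v < b0 \<Longrightarrow> T' v = stack_tape v anchor []" using tr by blast+
    have cnt: "\<tau> = length (take (nat hi) x) + dr" "p = int \<tau> - int d1 - int d2" "d2 \<le> d1" "d1 \<le> \<tau>"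
      "\<And>i. h i \<noteq> None \<Longrightarrow> i \<le> int \<tau> - int d1" using tr by blast+
    have hi0: "0 \<le> hi" using tr by blast
    have To: "T' b0 = (h, p)"
    proof -
      have "b0 < b0 + num_tapes M - 1" using nt by simp
      then have "T' b0 = ts ! (b0 - b0 + 1)" using tr by blast
      then show ?thesis using hp by simp
    qed
    have out: "output_of (?c t) = L x" if "halted (?c t)" for t
      using halted_run_eq[OF that fin(1)] fin(2) by simp
    \<comment> \<open>Otherwise \<open>M\<close> would run on the visited prefix \<open>x'\<close>
      just as on \<open>x\<close>, and both would have the same output, although the output length
      strictly increases with the input length.\<close>
    have hi: "?n \<le> nat hi"
    proof (rule ccontr)
      assume "\<not> ?n \<le> nat hi"
      define x' where "x' = take (nat hi) x"
      have lx: "length x' < ?n" using \<open>\<not> ?n \<le> nat hi\<close> by (simp add: x'_def)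
      have "\<forall>i<hi. cell x' i = cell x i" using \<open>\<not> ?n \<le> nat hi\<close> by (auto simp: x'_def cell_def)
      note ag = agree[OF this]
      have "halted (run M (replicate \<tau> False) x')" unfolding ag by (simp add: halted_def halt_state_def)
      moreover have f': "halted (run M (replicate (length x' + T (length x')) False) x')"
        "output_of (run M (replicate (length x' + T (length x')) False) x') = L x'"
        using L by (auto simp: computes_in_time_def)
      ultimately have "output_of (run M (replicate \<tau> False) x') = L x'"
        using halted_run_eq[of M \<tau> x' "length x' + T (length x')"] by simp
      then have "L x' = L x" using out[OF \<tau>(1)] unfolding ag ts by (simp add: output_of_def)
      then show False using len[of x] len[of x'] mono[OF lx] by simp
    qed
    have L': "tape_content (h, p) = L x" using out[OF \<tau>(1)] unfolding ts output_of_def snd_conv hp .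
    have least: "(LEAST i. h (int i) = None) = ?n + s ?n"
      using arg_cong[OF L', of length] len[of x] by (simp add: tape_content_def)
    have "h (int (Suc \<tau>)) = None" using cnt(5)[of "int (Suc \<tau>)"] by fastforce
    from LeastI[of "\<lambda>i. h (int i) = None", OF this] have h1: "h (int (?n + s ?n)) = None" unfolding least .
    have h2: "h (int i) \<noteq> None" if "i < ?n + s ?n" for i
      using not_less_Least[of i "\<lambda>i. h (int i) = None"] that unfolding least by simp
    have \<tau>n: "\<tau> = ?n + dr" using cnt(1) hi by simp
    \<comment> \<open>The last output cell can only have been reached by moves to the right, so at
      most \<open>T ?n + 1\<close> steps were anything else.\<close>
    have d1: "d1 \<le> T ?n + 1"
    proof (cases "?n + s ?n")
      case 0
      then show ?thesis using cnt(4) \<tau>(2) by simp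
    next
      case (Suc j)
      then have "int j \<le> int \<tau> - int d1" using cnt(5)[of "int j"] h2[of j] by simp
      then show ?thesis using Suc \<tau>(2) by simp
    qed
    have xs: "take (nat hi) x = x" using hi by simp
    define V where "V = {1, 3, 4, 5, 6} \<union> {8..<b0}"
    define V' where "V' = insert 7 V"
    define e where "e = (\<lambda>v::nat. if v = 1 \<or> v = 3 then rev x else if v = 4 then replicate d1 True
       else if v = 5 then replicate d2 True else if v = 6 then replicate dr True else [])"
    define e1 where "e1 = e(4 := [])"
    define e2 where "e2 = e1(5 := [])"
    define e3 where "e3 = e2(6 := [])"
    \<comment> \<open>Going right \<open>d1 + d2\<close> times leads the head to cell \<tau>, which
      is \<open>?n + dr\<close>; going left \<open>dr\<close> times then leads to cell
      \<open>?n\<close>.\<close>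
    define J1 where "J1 = T'(b0 := (h, p + int d1))"
    define J2 where "J2 = T'(b0 := (h, p + int d1 + int d2))"
    define J3 where "J3 = T'(b0 := (h, int ?n))"
    define J4 where "J4 = T'(b0 := (h, int ?n + int (s ?n)))"
    define e4 where "e4 = e3(7 := replicate (s ?n) True)"
    have Vb: "b0 \<notin> V" "b0 \<notin> V'" using b0 by (auto simp: V_def V'_def)
    have k4: "4 < k" "5 < k" "6 < k" "7 < k" using k b0 by auto
    have r2: "reaches A 1 (4, map T' [0..<k]) (a, tapes k V anchor T' e)"
    proof (rule reaches_settle[of A 4 a V b0 T' "rev x" d1 d2 dr])
      show "loaded A 4 [settle a]" using lq[of 1] ns by simp
    qed (use T' xs V_def e_def in auto)
    have "reaches A (length (e 4) + 1) (a, tapes k V anchor T' e) (a + 1, tapes k V anchor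
        (T'(b0 := (fst (T' b0), snd (T' b0) + int (length (e 4)) * offset MoveRight))) (e(4 := [])))"
      by (rule reaches_walk) (use l(3) a_def k4 k Vb V_def in auto)
    then have r3: "reaches A (d1 + 1) (a, tapes k V anchor T' e) (a + 1, tapes k V anchor J1 e1)"
      by (simp add: e_def[of ] e1_def J1_def To)
    have "reaches A (length (e1 5) + 1) (a + 1, tapes k V anchor J1 e1) (a + 1 + 1, tapes k V anchor
        (J1(b0 := (fst (J1 b0), snd (J1 b0) + int (length (e1 5)) * offset MoveRight))) (e1(5 := [])))"
      by (rule reaches_walk) (use l(4) a_def k4 k Vb V_def in auto)
    moreover have "length (e1 5) = d2" by (simp add: e1_def e_def)
    ultimately have r4: "reaches A (d2 + 1) (a + 1, tapes k V anchor J1 e1) (a + 2, tapes k V anchor J2 e2)"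
      by (simp add: e2_def J1_def J2_def numeral_2_eq_2)
    have "reaches A (length (e2 6) + 1) (a + 2, tapes k V anchor J2 e2) (a + 2 + 1, tapes k V anchor
        (J2(b0 := (fst (J2 b0), snd (J2 b0) + int (length (e2 6)) * offset MoveLeft))) (e2(6 := [])))"
      by (rule reaches_walk) (use l(5) a_def k4 k Vb V_def in auto)
    moreover have "length (e2 6) = dr" by (simp add: e2_def e1_def e_def)
    moreover have "p + int d1 + int d2 - int dr = int ?n" using cnt(2) \<tau>n by simp
    ultimately have r5: "reaches A (dr + 1) (a + 2, tapes k V anchor J2 e2) (a + 3, tapes k V anchor J3 e3)"
      by (simp add: e3_def J2_def J3_def numeral_3_eq_3)
    have e37: "e3 7 = []" by (simp add: e3_def e2_def e1_def e_def)
    have "tapes k V anchor J3 e3 = (tapes k V' anchor J3 e3)[7 := pushed 7 anchor (e3 7)]"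
    proof (rule nth_equalityI)
      fix v assume v: "v < length (tapes k V anchor J3 e3)"
      have "J3 7 = pushed 7 anchor []" using T'(6) b0 by (simp add: J3_def)
      then show "tapes k V anchor J3 e3 ! v = (tapes k V' anchor J3 e3)[7 := pushed 7 anchor (e3 7)] ! v"
        using v k4(4) by (cases "v = 7") (auto simp: V'_def V_def e37)
    qed simp
    moreover have "reaches A (s ?n + 1) (a + 3, (tapes k V' anchor J3 e3)[7 := pushed 7 anchor (e3 7)])
      (a + 3 + 1, tapes k V' anchor (J3(b0 := (h, int ?n + int (s ?n)))) (e3(7 := replicate (s ?n) True @ e3 7)))"
    proof (rule reaches_scan)
      show "J3 b0 = (h, int ?n)" by (simp add: J3_def)
      show "h (int ?n + int i) \<noteq> None" if "i < s ?n" for i using h2[of "?n + i"] that by simp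
      show "h (int ?n + int (s ?n)) = None" using h1 by simp
    qed (use l(6) a_def k4 k Vb V'_def in auto)
    ultimately have r6: "reaches A (s ?n + 1) (a + 3, tapes k V anchor J3 e3) (a + 4, tapes k V' anchor J4 e4)"
      by (simp only: e4_def J3_def J4_def e37 append_Nil2 fun_upd_upd add.assoc numeral_plus_one semiring_norm)
    have V'k: "V' \<subseteq> {..<k}" using k b0 by (auto simp: V'_def V_def)
    have rc: "regs c \<subseteq> V'"
    proof
      fix v assume "v \<in> regs c"
      then have "v \<in> {1, 3} \<union> {7..}" "v < b0" using c(2) b0(2) by auto
      then show "v \<in> V'" by (auto simp: V'_def V_def)
    qed
    have r7: "reaches A (cost c e4) (a + 4, tapes k V' anchor J4 e4) (a + 4 + csize c, tapes k V' anchor J4 (exec c e4))"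
      by (rule reaches_code[OF l(7) c(1) rc V'k]) (simp add: a_def)
    have r8: "reaches A 1 (a + 4 + csize c, tapes k V' anchor J4 (exec c e4)) (1, tapes k V' anchor J4 (exec c e4))"
      by (rule step_goto[OF l(8)]) (simp add: a_def)
    have "state (rev x) (rev x) (replicate (s ?n) True) e4"
      by (auto simp: state_def e4_def e3_def e2_def e1_def e_def enc_bits)
    note pr = prog[OF this]
    have r0: "reaches A 2 (initial_config A x) (3, map (start_tapes x) [0..<k])"
      unfolding A_def by (rule reaches_bump[OF l(1)[unfolded A_def] k(1)])
    have "reaches A (2 + (\<tau> + (1 + ((d1 + 1) + ((d2 + 1) + ((dr + 1) + ((s ?n + 1) + (cost c e4 + 1))))))))
        (initial_config A x) (1, tapes k V' anchor J4 (exec c e4))"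
      using reaches_trans[OF r0 reaches_trans[OF r1[unfolded ts fst_conv] reaches_trans[of A 1 "(3 + 1, map T' [0..<k])", OF _
        reaches_trans[OF r3 reaches_trans[OF r4 reaches_trans[OF r5 reaches_trans[OF r6 reaches_trans[OF r7 r8]]]]]]]] r2
      by (simp add: numeral_eq_Suc)
    from reaches_run[OF this, of r] have "run A r x = (1, tapes k V' anchor J4 (exec c e4))"
      using r pr d1 cnt(3) \<tau>(2) \<tau>n by (simp add: halted_def halt_state_def)
    moreover have "output_of (1, tapes k V' anchor J4 (exec c e4)) = G x"
      using k output_stack_tape[of anchor "exec c e4 1"] pr
      by (simp add: output_of_def V'_def V_def anchor_def)
    ultimately show ?thesis by (simp add: halted_def halt_state_def)
  qed
  show ?thesis
    unfolding computes_in_time_def using tmA detA main by blast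
qed

lemma computes_in_time_mono:
  assumes "computes_in_time M f T" "\<And>n. T n \<le> T' n"
  shows "computes_in_time M f T'"
proof -
  have "halted (run M r x) \<and> output_of (run M r x) = f x" if r: "length r = T' (length x)" for x r
  proof -
    have "length (take (T (length x)) r) = T (length x)" using r assms(2)[of "length x"] by simp
    then have "halted (run M (take (T (length x)) r) x)" "output_of (run M (take (T (length x)) r) x) = f x"
      using assms(1) by (auto simp: computes_in_time_def)
    then show ?thesis using run_halted[of M "take (T (length x)) r" x "drop (T (length x)) r"] by simp
  qed
  then show ?thesis using assms(1) by (simp add: computes_in_time_def)
qed

lemma rate1_efficient_poly_time:
  assumes "rate1_efficient f"
  shows "poly_time_computable f"
proof -
  obtain M \<epsilon> and T :: "nat \<Rightarrow> nat" where M: "\<epsilon> < 1" "(\<lambda>n. real (T n)) \<in> O(\<lambda>n. real n powr \<epsilon>)"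
    "computes_in_time M f (\<lambda>n. n + T n)" using assms by (auto simp: rate1_efficient_def)
  from M(2) obtain c where "c > 0" and "\<forall>\<^sub>F n in sequentially. norm (real (T n)) \<le> c * norm (real n powr \<epsilon>)"
    by (elim landau_o.bigE)
  then obtain N where N: "\<And>n. n \<ge> N \<Longrightarrow> real (T n) \<le> c * real n powr \<epsilon>"
    by (auto simp: eventually_sequentially)
  \<comment> \<open>The asymptotic bound holds from \<open>N\<close> on; the finitely many earlier
    times are absorbed by \<open>d\<close>.\<close>
  define c' d where "c' = nat \<lceil>c\<rceil>" and "d = (\<Sum>n\<le>N. T n)"
  have "T n \<le> c' * n + d" for n
  proof (cases "n \<le> N")
    case True
    then have "T n \<le> d" unfolding d_def by (intro member_le_sum) auto
    then show ?thesis by simp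
  next
    case False
    then have "real n powr \<epsilon> \<le> real n powr 1" using M(1) by (intro powr_mono) auto
    then have "real (T n) \<le> c * real n" using N[of n] False \<open>c > 0\<close>
      by (smt (verit) mult_left_mono nat_le_linear of_nat_0_le_iff powr_one)
    also have "\<dots> \<le> real c' * real n" unfolding c'_def by (intro mult_right_mono) (auto simp: real_nat_ceiling_ge)
    finally have "T n \<le> c' * n" unfolding of_nat_mult[symmetric] of_nat_le_iff .
    then show ?thesis by simp
  qed
  then have "computes_in_time M f (poly [:d, 1 + c':])"
    by (intro computes_in_time_mono[OF M(3)]) (simp add: algebra_simps add_mono)
  then show ?thesis by (auto simp: poly_time_computable_def)
qed

lemma poly_nat_bound:
  fixes p :: "nat poly"
  shows "\<exists>c d. \<forall>u\<ge>1. poly p u \<le> c * u ^ d"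
proof (induction p)
  case (pCons a p)
  then obtain c d where cd: "\<And>u. u \<ge> 1 \<Longrightarrow> poly p u \<le> c * u ^ d" by auto
  have "poly (pCons a p) u \<le> (a + c) * u ^ Suc d" if "u \<ge> 1" for u
  proof -
    have "a * 1 \<le> a * u ^ Suc d" using that by (intro mult_left_mono) auto
    moreover have "u * poly p u \<le> u * (c * u ^ d)" using cd[OF that] by (rule mult_left_mono) simp
    ultimately have "a * 1 + u * poly p u \<le> a * u ^ Suc d + u * (c * u ^ d)" by (rule add_mono)
    then show ?thesis by (simp add: algebra_simps)
  qed
  then show ?case by blast
qed auto

section \<open>Growth of the stretch and of powers of two derived from it\<close>

definition stretch :: "real \<Rightarrow> nat \<Rightarrow> nat" where
  "stretch \<gamma> n = nat \<lfloor>\<gamma> * log 2 (real n)\<rfloor>"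

lemma stretched_length: "stretched_length \<gamma> n = n + stretch \<gamma> n"
  by (simp add: stretched_length_def stretch_def)

lemma stretch_mono:
  assumes "\<gamma> > 0" "m \<le> n"
  shows "stretch \<gamma> m \<le> stretch \<gamma> n"
proof (cases "m = 0")
  case True
  then show ?thesis by (simp add: stretch_def log_def)
next
  case False
  then have "log 2 (real m) \<le> log 2 (real n)" using assms by simp
  then show ?thesis unfolding stretch_def using assms(1) by (intro nat_mono floor_mono mult_left_mono) auto
qed

lemma stretch_le:
  assumes "\<gamma> > 0" "n \<ge> 1"
  shows "real (stretch \<gamma> n) \<le> \<gamma> * log 2 (real n)"
proof -
  have "0 \<le> \<gamma> * log 2 (real n)" using assms by simp
  then show ?thesis unfolding stretch_def by (simp add: of_nat_nat)
qed

lemma pow_stretch_div: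
  assumes "\<gamma> > 0" "n \<ge> 1" "K > 0"
  shows "2 ^ (stretch \<gamma> n div K) \<le> real n powr (\<gamma> / K)"
proof -
  have "real (stretch \<gamma> n div K) \<le> real (stretch \<gamma> n) / K"
    by (rule of_nat_div_le_of_nat)
  also have "\<dots> \<le> (\<gamma> * log 2 (real n)) / K"
    using stretch_le[OF assms(1,2)] assms(3) by (intro divide_right_mono) auto
  finally have "2 powr real (stretch \<gamma> n div K) \<le> 2 powr (log 2 (real n) * (\<gamma> / K))"
    by (intro powr_mono) (auto simp: field_simps)
  also have "\<dots> = (2 powr log 2 (real n)) powr (\<gamma> / K)" by (rule powr_powr[symmetric])
  also have "2 powr log 2 (real n) = real n" using assms(2) by simp
  finally show ?thesis by (simp add: powr_realpow)
qed

lemma bigo_powr_mono: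
  assumes "f \<in> O(\<lambda>n. real n powr a)" "a \<le> b"
  shows "f \<in> O(\<lambda>n. real n powr b)"
proof (rule landau_o.big_trans[OF assms(1)])
  show "(\<lambda>n. real n powr a) \<in> O(\<lambda>n. real n powr b)"
  proof (rule landau_o.bigI[of 1])
    show "\<forall>\<^sub>F n in sequentially. norm (real n powr a) \<le> 1 * norm (real n powr b)"
      using eventually_ge_at_top[of 1]
      by eventually_elim (use assms(2) in \<open>auto intro!: powr_mono\<close>)
  qed simp
qed

text \<open>Since \<open>2 ^ (stretch \<gamma> n div K)\<close> is at most \<open>n\<close> to the
  power \<gamma> / K, any \<open>K\<close> of at least 2 \<gamma> d brings a polynomial of degree
  \<open>d\<close> below a multiple of the square root of \<open>n\<close>.\<close>

lemma poly_stretch_bigo: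
  fixes p :: "nat poly"
  assumes "\<gamma> > 0"
  obtains K0 :: nat where "K0 > 0"
    "\<And>K. K \<ge> K0 \<Longrightarrow> (\<lambda>n. real (poly p (2 ^ (stretch \<gamma> n div K) + K))) \<in> O(\<lambda>n. real n powr (1 / 2))"
proof -
  obtain c d where cd: "\<And>u. u \<ge> 1 \<Longrightarrow> poly p u \<le> c * u ^ d" using poly_nat_bound by blast
  show thesis
  proof (rule that[of "Suc (nat \<lceil>2 * \<gamma> * d\<rceil>)"])
    fix K :: nat assume K: "K \<ge> Suc (nat \<lceil>2 * \<gamma> * d\<rceil>)"
    then have K0: "K > 0" by simp
    have "2 * \<gamma> * d \<le> real K" using K by linarith
    then have half: "\<gamma> / K * d \<le> 1 / 2" using K0 by (simp add: field_simps)
    show "(\<lambda>n. real (poly p (2 ^ (stretch \<gamma> n div K) + K))) \<in> O(\<lambda>n. real n powr (1 / 2))"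
    proof (rule bigoI[of _ "real c * (1 + real K) ^ d"])
      show "\<forall>\<^sub>F n in sequentially. norm (real (poly p (2 ^ (stretch \<gamma> n div K) + K))) \<le>
        real c * (1 + real K) ^ d * norm (real n powr (1 / 2))"
        using eventually_ge_at_top[of 1]
      proof eventually_elim
        case (elim n)
        let ?m = "2 ^ (stretch \<gamma> n div K) :: nat"
        have m: "real ?m \<le> real n powr (\<gamma> / K)" using pow_stretch_div[OF assms elim K0] by simp
        have "real (poly p (?m + K)) \<le> real (c * (?m + K) ^ d)" by (rule of_nat_mono, rule cd, rule order_trans[OF one_le_power[of 2 "stretch \<gamma> n div K"]]) simp_all
        also have "\<dots> = real c * (real ?m + real K) ^ d" by simp
        also have "\<dots> \<le> real c * ((1 + real K) * real n powr (\<gamma> / K)) ^ d"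
        proof (intro mult_left_mono power_mono)
          have "1 \<le> real n powr (\<gamma> / K)" using elim assms by (intro ge_one_powr_ge_zero) auto
          then have "real K * 1 \<le> real K * real n powr (\<gamma> / K)" by (intro mult_left_mono) auto
          then show "real ?m + real K \<le> (1 + real K) * real n powr (\<gamma> / K)" using m by (simp add: algebra_simps)
        qed auto
        also have "\<dots> = real c * (1 + real K) ^ d * real n powr (\<gamma> / K * d)"
        proof -
          have "(real n powr (\<gamma> / K)) ^ d = (real n powr (\<gamma> / K)) powr real d"
            using elim by (intro powr_realpow[symmetric]) simp
          then show ?thesis by (simp add: power_mult_distrib powr_powr)
        qed
        also have "\<dots> \<le> real c * (1 + real K) ^ d * real n powr (1 / 2)"
          using half elim by (intro mult_left_mono powr_mono) auto
        finally show ?case by simp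
      qed
    qed
  qed simp
qed

text \<open>The polynomial of \<open>generator_program\<close> is obtained before \<open>K\<close>,
  so \<open>K\<close> can be chosen large for its degree. The exponent is the maximum of 1/2 and
  that of the machine for the stretch.\<close>

theorem rate1_generator:
  assumes f: "FP f" and \<gamma>: "\<gamma> > 0" and adm: "admissible_stretch \<gamma>"
  obtains K0 :: nat where "K0 > 0"
    "\<And>K. K \<ge> K0 \<Longrightarrow> rate1_efficient (\<lambda>x. generator f P K (stretch \<gamma> (length x)) x)"
proof -
  obtain L where "rate1_efficient L" and L: "\<And>x. length (L x) = stretched_length \<gamma> (length x)"
    using adm by (auto simp: admissible_stretch_def)
  then obtain M \<epsilon> and T :: "nat \<Rightarrow> nat" where M: "\<epsilon> < 1" "(\<lambda>n. real (T n)) \<in> O(\<lambda>n. real n powr \<epsilon>)"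
    "computes_in_time M L (\<lambda>n. n + T n)" by (auto simp: rate1_efficient_def)
  obtain p where p: "\<And>K. K > 0 \<Longrightarrow> \<exists>c. wf_com c \<and> regs c \<subseteq> {1, 3} \<union> {7..} \<and>
    (\<forall>x s e. state (rev x) (rev x) (replicate s True) e \<longrightarrow>
      exec c e 1 = rev (generator f P K s x) \<and> cost c e \<le> 2 * K + poly p (2 ^ (s div K) + K))"
    using generator_program[OF f, of P] by blast
  obtain K0 where K0: "K0 > 0"
    "\<And>K. K \<ge> K0 \<Longrightarrow> (\<lambda>n. real (poly p (2 ^ (stretch \<gamma> n div K) + K))) \<in> O(\<lambda>n. real n powr (1 / 2))"
    using poly_stretch_bigo[OF \<gamma>, of p] by blast
  show thesis
  proof (rule that[OF K0(1)])
    fix K assume K: "K \<ge> K0"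
    then have Kp: "K > 0" using K0(1) by simp
    define C where "C n = 2 * K + poly p (2 ^ (stretch \<gamma> n div K) + K)" for n
    obtain c where c: "wf_com c" "regs c \<subseteq> {1, 3} \<union> {7..}"
      "\<And>x s e. state (rev x) (rev x) (replicate s True) e \<Longrightarrow>
        exec c e 1 = rev (generator f P K s x) \<and> cost c e \<le> 2 * K + poly p (2 ^ (s div K) + K)"
      using p[OF Kp] by blast
    have "\<exists>A. computes_in_time A (\<lambda>x. generator f P K (stretch \<gamma> (length x)) x)
        (\<lambda>n. n + (4 * T n + stretch \<gamma> n + C n + 20))"
    proof (rule piggyback[OF M(3) _ _ c(1,2)])
      show "length (L x) = length x + stretch \<gamma> (length x)" for x by (simp add: L stretched_length)
      show "n + stretch \<gamma> n < n' + stretch \<gamma> n'" if "n < n'" for n n'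
        using stretch_mono[OF \<gamma>, of n n'] that by simp
      show "exec c e 1 = rev (generator f P K (stretch \<gamma> (length x)) x) \<and> cost c e \<le> C (length x)"
        if "state (rev x) (rev x) (replicate (stretch \<gamma> (length x)) True) e" for x e
        using c(3)[OF that] by (simp add: C_def)
    qed
    then obtain A where A: "computes_in_time A (\<lambda>x. generator f P K (stretch \<gamma> (length x)) x)
        (\<lambda>n. n + (4 * T n + stretch \<gamma> n + C n + 20))" by blast
    define \<epsilon>' where "\<epsilon>' = max \<epsilon> (1 / 2)"
    have e: "\<epsilon> \<le> \<epsilon>'" "1 / 2 \<le> \<epsilon>'" "0 \<le> \<epsilon>'" "\<epsilon>' < 1" using M(1) by (auto simp: \<epsilon>'_def)
    have T: "(\<lambda>n. 4 * real (T n)) \<in> O(\<lambda>n. real n powr \<epsilon>')"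
      using bigo_powr_mono[OF M(2) e(1)] by simp
    have const: "(\<lambda>n. x) \<in> O(\<lambda>n. real n powr \<epsilon>')" for x :: real
      by (rule bigo_powr_mono[OF _ e(3)])
        (rule bigoI[of _ "\<bar>x\<bar>"], use eventually_gt_at_top[of 0] in eventually_elim, auto)
    have "(\<lambda>n. real (stretch \<gamma> n)) \<in> O(\<lambda>n. real n powr (1 / 2))"
    proof (rule bigoI[of _ "\<gamma> * 2 / ln 2"])
      show "\<forall>\<^sub>F n in sequentially. norm (real (stretch \<gamma> n)) \<le> \<gamma> * 2 / ln 2 * norm (real n powr (1 / 2))"
        using eventually_ge_at_top[of 1]
      proof eventually_elim
        case (elim n)
        have "\<gamma> * log 2 (real n) = \<gamma> / ln 2 * ln (real n)" by (simp add: log_def)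
        also have "\<dots> \<le> \<gamma> / ln 2 * (real n powr (1 / 2) / (1 / 2))"
          using elim \<gamma> by (intro mult_left_mono ln_powr_bound) auto
        finally show ?case using stretch_le[OF \<gamma> elim] by (simp add: mult_ac)
      qed
    qed
    note s = bigo_powr_mono[OF this e(2)] and C = bigo_powr_mono[OF K0(2)[OF K] e(2)]
    have "(\<lambda>n. 4 * real (T n) + real (stretch \<gamma> n) + (2 * real K + real (poly p (2 ^ (stretch \<gamma> n div K) + K))) + 20)
        \<in> O(\<lambda>n. real n powr \<epsilon>')"
      by (intro sum_in_bigo T s C const)
    then have "(\<lambda>n. real (4 * T n + stretch \<gamma> n + C n + 20)) \<in> O(\<lambda>n. real n powr \<epsilon>')"
      by (simp add: C_def)
    then show "rate1_efficient (\<lambda>x. generator f P K (stretch \<gamma> (length x)) x)"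
      unfolding rate1_efficient_def using A e(4)
      by (intro exI[of _ A] exI[of _ \<epsilon>'] exI[of _ "\<lambda>n. 4 * T n + stretch \<gamma> n + C n + 20"] conjI)
  qed
qed

section \<open>Security and entropy\<close>

lemma cond_uniform_bits:
  assumes "E \<subseteq> {x. length x = n}" "E \<noteq> {}"
  shows "cond_pmf (uniform_bits n) E = pmf_of_set E"
proof (rule pmf_eqI)
  fix x
  have fin: "finite E" using assms(1) finite_bits finite_subset by blast
  have ne: "set_pmf (uniform_bits n) \<inter> E \<noteq> {}" using assms by auto
  have "card ({x. length x = n} \<inter> E) = card E" using assms(1) by (simp add: Int_absorb1)
  then have m: "measure (measure_pmf (uniform_bits n)) E = real (card E) / 2 ^ n"
    unfolding uniform_bits_def by (subst measure_pmf_of_set) (auto simp: ex_bits)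
  have "pmf (uniform_bits n) x = (if length x = n then 1 / 2 ^ n else 0)"
    unfolding uniform_bits_def by (subst pmf_of_set) (auto simp: ex_bits indicator_def)
  then show "pmf (cond_pmf (uniform_bits n) E) x = pmf (pmf_of_set E) x"
    unfolding pmf_cond[OF ne] m using assms fin by (auto simp: indicator_def card_gt_0_iff)
qed

lemma accept_prob_uniform:
  assumes "finite E" "E \<noteq> {}" "\<And>y. halts_within D q (with_unary n y)"
  shows "accept_prob D n (map_pmf G (pmf_of_set E)) =
    (\<Sum>x\<in>E. avg q (\<lambda>\<rho>. of_bool (accepts D n (G x) \<rho>))) / card E"
proof -
  have 1: "pmf (result D (with_unary n y)) [True] = avg q (\<lambda>\<rho>. of_bool (accepts D n y \<rho>))" for y
  proof -
    have "pmf (result D (with_unary n y)) [True] =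
        pmf (map_pmf (\<lambda>\<rho>. accepts D n y \<rho>) (uniform_bits q)) True"
      unfolding result_eq[OF assms(3)] pmf_map by (auto simp: accepts_def vimage_def)
    then show ?thesis by (simp only: pmf_map_uniform)
  qed
  have "accept_prob D n (map_pmf G (pmf_of_set E)) = pmf (bind_pmf (pmf_of_set E) (\<lambda>x. result D (with_unary n (G x)))) [True]"
    by (simp add: accept_prob_def bind_map_pmf)
  also have "\<dots> = (\<Sum>x\<in>E. pmf (result D (with_unary n (G x))) [True]) / card E"
    unfolding pmf_bind using assms by (simp add: integral_pmf_of_set)
  finally show ?thesis unfolding 1 .
qed

text \<open>Pigeonhole: fibre sizes lie between 1 and \<open>2 ^ m\<close>, so \<open>m + 1\<close>
  dyadic classes cover all strings and one of them has density at least
  \<open>1 / (m + 1)\<close>.\<close>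

lemma ex_fiber_class:
  fixes f :: "bool list \<Rightarrow> bool list"
  defines "fiber \<equiv> \<lambda>m a. card {b. length b = m \<and> f b = f a}"
  shows "\<exists>i\<le>m. 2 ^ m \<le> (m + 1) * card {a. length a = m \<and> 2 ^ i \<le> fiber m a \<and> fiber m a \<le> 2 ^ Suc i}"
proof (rule ccontr)
  let ?S = "\<lambda>i. {a. length a = m \<and> 2 ^ i \<le> fiber m a \<and> fiber m a \<le> 2 ^ Suc i}"
  assume "\<not> ?thesis"
  then have less: "(m + 1) * card (?S i) < 2 ^ m" if "i \<le> m" for i using that by force
  have "{a. length a = m} \<subseteq> (\<Union>i\<le>m. ?S i)"
  proof
    fix a :: "bool list" assume "a \<in> {a. length a = m}"
    then have a: "length a = m" by simp
    have fin: "finite {b. length b = m \<and> f b = f a}" by (rule finite_subset[OF _ finite_bits[of m]]) auto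
    have "a \<in> {b. length b = m \<and> f b = f a}" using a by simp
    then have "1 \<le> fiber m a" unfolding fiber_def using fin by (metis One_nat_def Suc_leI card_gt_0_iff empty_iff)
    then obtain i where i: "2 ^ i \<le> fiber m a" "fiber m a < 2 ^ (i + 1)"
      using ex_power_ivl1[of 2 "fiber m a"] by auto
    have "fiber m a \<le> card {b :: bool list. length b = m}"
      unfolding fiber_def by (rule card_mono) auto
    then have "fiber m a \<le> 2 ^ m" by simp
    then have "(2::nat) ^ i \<le> 2 ^ m" using i(1) order_trans by blast
    then have "i \<le> m" by simp
    then show "a \<in> (\<Union>i\<le>m. ?S i)" using i a by auto
  qed
  then have "card {a :: bool list. length a = m} \<le> card (\<Union>i\<le>m. ?S i)"
    by (intro card_mono) (auto intro: finite_subset[OF _ finite_bits[of m]])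
  also have "\<dots> \<le> (\<Sum>i\<le>m. card (?S i))" by (rule card_UN_le) simp
  finally have "(2::nat) ^ m \<le> (\<Sum>i\<le>m. card (?S i))" by simp
  then have "(m + 1) * 2 ^ m \<le> (\<Sum>i\<le>m. (m + 1) * card (?S i))"
    unfolding sum_distrib_left[symmetric] by (rule mult_left_mono) simp
  also have "\<dots> < (\<Sum>i\<le>m. 2 ^ m)" using less by (intro sum_strict_mono) auto
  finally show False by simp
qed

text \<open>The event of the seeds whose bits \<open>w\<close> give the logarithm \<open>i\<close> of the number of preimages of
  \<open>f a\<close>, where \<open>i\<close> is a most frequent value.\<close>

locale event =
  fixes f :: "bool list \<Rightarrow> bool list" and P :: "nat poly" and K s n m i k l n1 :: nat
    and w :: "bool list" and S :: "bool list set"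
  assumes m: "m = 2 ^ (s div K)" and K: "K > 0"
    and P: "m \<le> poly P m" "\<And>a. length a = m \<Longrightarrow> length (f a) < poly P m"
    and S: "S = {a. length a = m \<and> 2 ^ i \<le> card {b. length b = m \<and> f b = f a} \<and>
      card {b. length b = m \<and> f b = f a} \<le> 2 ^ Suc i}"
    and S_large: "2 ^ m \<le> (m + 1) * card S"
    and i: "i \<le> m" and w: "length w = s div K + 1" "binary w = i"
    and kl: "k = image_bits s m w" "l = width K s m + s - k"
    and n: "n = n1 + hash_len P K s m + width K s m"
begin

lemma event_bounds:
  shows "k + l = width K s m + s" "i \<le> l" "m \<le> k + l" "k = m - i - (5 * s + 8)" "m \<ge> 1"
    "l \<le> i + (5 * s + 8) + (s div K + 1) + s" "hash_len P K s m = (k + l) * poly P m"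
    "n = n1 + (k + l) * poly P m + length w + m" "l > 0"
proof -
  show m1: "m \<ge> 1" by (simp add: m)
  then have "min (2 * m) i = i" using i by simp
  then show k: "k = m - i - (5 * s + 8)" by (simp add: kl(1) image_bits_def w(2))
  show kl': "k + l = width K s m + s" unfolding kl(2) by (simp add: k width_def)
  then show "hash_len P K s m = (k + l) * poly P m" by (simp add: hash_len_def)
  then show "n = n1 + (k + l) * poly P m + length w + m" using n w(1) by (simp add: width_def)
  show "i \<le> l" "m \<le> k + l" "l \<le> i + (5 * s + 8) + (s div K + 1) + s" "l > 0"
    using k kl' i m1 by (auto simp: width_def)
qed

lemma S_nonempty: "S \<noteq> {}" and finite_S: "finite S"
proof -
  have "card S \<noteq> 0" using S_large by (metis mult_0_right not_le zero_less_numeral zero_less_power)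
  then show "S \<noteq> {}" by auto
  show "finite S" unfolding S by (rule finite_subset[OF _ finite_bits[of m]]) auto
qed

lemma distinguisher: "distinguisher f (poly P m) m i S"
proof
  show "S \<subseteq> {a. length a = m}" "S \<noteq> {}" using S_nonempty by (auto simp: S)
qed (use P S in auto)

lemma generator_eq:
  assumes "length x = n1" "length R = (k + l) * poly P m" "a \<in> S"
  shows "generator f P K s (x @ R @ w @ a) = x @ R @ gen_bits f (poly P m) k l R a"
proof -
  have a: "length a = m" using assms(3) by (simp add: S)
  let ?x = "x @ R @ w @ a"
  have wm: "width K s m = length w + m" by (simp add: width_def w(1))
  have len: "length ?x = n1 + (k + l) * poly P m + (length w + m)" using assms a by simp
  have d: "drop (length ?x - (width K s m + hash_len P K s m)) ?x = R @ w @ a"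
    using assms(1) event_bounds(7) unfolding len wm by simp
  have t: "take (length ?x - min (length ?x) (width K s m)) ?x = x @ R"
    using assms(1,2) unfolding len wm by simp
  have b: "block f P K s m (R @ w @ a) = gen_bits f (poly P m) k l R a"
    using assms(2) kl w(1) by (simp add: block_def Let_def event_bounds(7))
  have "min (length ?x) (width K s m) = width K s m" unfolding len wm by simp
  then show ?thesis
    unfolding generator_def Let_def m[symmetric] d t b
    using event_bounds(1) by simp
qed

definition event_set :: "bool list set" where
  "event_set = seeds (n1 + (k + l) * poly P m) w S"

lemma event_set: "event_set \<subseteq> {x. length x = n}" "event_set \<noteq> {}" "finite event_set"
proof -
  show "event_set \<subseteq> {x. length x = n}"
    using event_bounds(8) unfolding event_set_def seeds_def by (auto simp: S)
  show "finite event_set" unfolding event_set_def by (rule finite_seeds[OF finite_S])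
  have "card event_set \<noteq> 0"
    unfolding event_set_def card_seeds[OF finite_S] using S_nonempty finite_S by simp
  then show "event_set \<noteq> {}" by auto
qed

end

lemma ex_event:
  assumes "m = 2 ^ (s div K)" "K > 0" "\<And>m. m \<le> poly P m" "\<And>a. length (f a) < poly P (length a)"
    and "hash_len P K s m + width K s m \<le> n"
  shows "\<exists>i k l n1 w S. event f P K s n m i k l n1 w S"
proof -
  obtain i where i: "i \<le> m" "2 ^ m \<le> (m + 1) * card {a. length a = m \<and>
      2 ^ i \<le> card {b. length b = m \<and> f b = f a} \<and> card {b. length b = m \<and> f b = f a} \<le> 2 ^ Suc i}"
    using ex_fiber_class by blast
  \<comment> \<open>\<open>w\<close> has one bit more than the exponent of \<open>m\<close> because
    \<open>i\<close> may be equal to \<open>m\<close>.\<close>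
  have "m < 2 ^ (s div K + 1)" unfolding assms(1) by simp
  then have "i < 2 ^ (s div K + 1)" using i(1) by simp
  then obtain w where "length w = s div K + 1" "binary w = i" using ex_binary by blast
  moreover have "n = n - (hash_len P K s m + width K s m) + hash_len P K s m + width K s m"
    using assms(5) by simp
  moreover have f': "length a = m \<Longrightarrow> length (f a) < poly P m" for a using assms(4)[of a] by simp
  ultimately have "event f P K s n m i (image_bits s m w) (width K s m + s - image_bits s m w)
     (n - (hash_len P K s m + width K s m)) w {a. length a = m \<and>
      2 ^ i \<le> card {b. length b = m \<and> f b = f a} \<and> card {b. length b = m \<and> f b = f a} \<le> 2 ^ Suc i}"
    using i assms(1-3,5) f' by unfold_locales auto
  then show ?thesis by blast
qed

context event
begin

abbreviation "N \<equiv> poly P m"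

lemma accept_prob_real:
  assumes "\<And>y. halts_within D q (with_unary n y)"
  shows "accept_prob D n (map_pmf (generator f P K s) (pmf_of_set event_set)) =
    distinguisher.real_prob f (accepts D n) q N n1 k l S"
proof -
  interpret distinguisher f "accepts D n" q N n1 k l m i S by (rule distinguisher)
  let ?N = "n1 + (k + l) * N"
  have "accept_prob D n (map_pmf (generator f P K s) (pmf_of_set event_set)) =
      (\<Sum>x\<in>event_set. \<alpha> (generator f P K s x)) / card event_set"
    using accept_prob_uniform[OF event_set(3,2) assms] by (simp add: \<alpha>_def)
  also have "(\<Sum>x\<in>event_set. \<alpha> (generator f P K s x)) =
      (\<Sum>a\<in>S. 2 ^ ?N * avg n1 (\<lambda>x. avg ((k + l) * N) (\<lambda>R. \<alpha> (x @ R @ gen_bits f N k l R a))))"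
    unfolding event_set_def sum_seeds avg_add
    by (intro sum.cong refl arg_cong2[where f = "(*)"] avg_cong) (simp add: generator_eq)
  also have "\<dots> / card event_set = real_prob"
    unfolding event_set_def card_seeds[OF finite_S] sum_distrib_left[symmetric] real_prob_def by simp
  finally show ?thesis .
qed

lemma accept_prob_ideal:
  assumes "\<And>y. halts_within D q (with_unary n y)"
  shows "accept_prob D n (uniform_bits (n + s)) = distinguisher.ideal_prob (accepts D n) q N n1 k l"
proof -
  interpret distinguisher f "accepts D n" q N n1 k l m i S by (rule distinguisher)
  have ns: "n + s = n1 + ((k + l) * N + (k + l))" using n event_bounds(1,7) by simp
  have "accept_prob D n (map_pmf (\<lambda>x. x) (pmf_of_set {x. length x = n + s})) =
      (\<Sum>x | length x = n + s. \<alpha> x) / card {x :: bool list. length x = n + s}"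
    using accept_prob_uniform[of "{x. length x = n + s}" D q n "\<lambda>x. x"] assms ex_bits by (simp add: \<alpha>_def)
  also have "\<dots> = avg (n + s) \<alpha>" by (simp add: avg_def)
  also have "\<dots> = ideal_prob" unfolding ns avg_add ideal_prob_def ..
  finally show ?thesis by (simp add: uniform_bits_def)
qed

lemma card_S_ge: "2 ^ m / (real m + 1) \<le> real (card S)"
proof -
  have "real (2 ^ m) \<le> real ((m + 1) * card S)" using S_large by (simp only: of_nat_le_iff)
  then show ?thesis by (simp add: field_simps)
qed

lemma m_less: "real m + 1 \<le> 2 ^ (s div K + 1)"
proof -
  have "m + 1 \<le> 2 ^ (s div K + 1)" using event_bounds(5) by (simp add: m)
  then have "real (m + 1) \<le> real (2 ^ (s div K + 1))" by (simp only: of_nat_le_iff)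
  then show ?thesis by simp
qed

text \<open>Fixing \<open>w\<close> costs \<open>s div K + 1\<close> bits, restricting
  \<open>a\<close> to \<open>S\<close> costs at most as many because its density is at least
  \<open>1 / (m + 1)\<close>, and collisions cost 2.\<close>

lemma entropy_event:
  "real n - 2 * real (s div K) - 4 \<le> shannon_entropy (map_pmf (generator f P K s) (pmf_of_set event_set))"
proof -
  interpret distinguisher f "\<lambda>_ _. True" 0 N n1 k l m i S by (rule distinguisher)
  let ?N = "n1 + (k + l) * N"
  have "0 < real (card S)" using S_nonempty finite_S by (simp add: card_gt_0_iff)
  moreover have "2 ^ ?N * (2 ^ m / 2 ^ (s div K + 1)) \<le> 2 ^ ?N * real (card S)"
    using card_S_ge m_less by (intro mult_left_mono order.trans[OF divide_left_mono card_S_ge]) auto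
  ultimately have "log 2 (2 ^ ?N * (2 ^ m / 2 ^ (s div K + 1))) \<le> log 2 (2 ^ ?N * real (card S))"
    by (subst log_le_cancel_iff) auto
  moreover have "log 2 (2 ^ ?N * (2 ^ m / 2 ^ (s div K + 1))) = real ?N + real m - real (s div K + 1)"
    by (simp add: log_mult log_divide log_nat_power del: power_Suc power_add)
  moreover have "log 2 (2 ^ ?N * real (card S)) - 2 \<le>
      shannon_entropy (map_pmf (generator f P K s) (pmf_of_set event_set))"
    unfolding event_set_def by (rule entropy_bound) (use event_bounds generator_eq in auto)
  moreover have "real n = real ?N + real (s div K + 1) + real m"
    using event_bounds(8) w(1) by simp
  ultimately show ?thesis by simp
qed

text \<open>The surplus \<open>X\<close> adjusts the number of coins to a polynomial in
  \<open>m\<close>. It ends up behind the coins of the distinguisher, which has halted by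
  then.\<close>

lemma avg_guess:
  assumes D: "\<And>y. halts_within D q (with_unary n y)" and b: "2 ^ \<kappa> < b" and j: "j < l"
  shows "avg (j + (1 + (Suc \<kappa> * Suc N + ((n1 + (k * N + (j * N + ((l - Suc j) * N + ((l - Suc j) + q))))) + X))))
      (\<lambda>\<rho>. of_bool (f (guess D m n N n1 k j (l - Suc j) \<kappa> b \<sigma> (f a) \<rho>) = f a)) =
    avg j (\<lambda>u. avg (n1 + (k * N + (j * N + ((l - Suc j) * N + ((l - Suc j) + q))))) (\<lambda>\<omega>.
      avg 1 (\<lambda>c. avg (Suc \<kappa> * Suc N) (\<lambda>g.
      of_bool (f (decode (\<lambda>r. accepts D n (query N n1 k j (l - Suc j) (f a) u \<omega> r (hd c))
          (query_coins N n1 k j (l - Suc j) \<omega>) = (hd c = \<sigma>)) N m (span_list (Suc N) \<kappa> g)) = f a)))))"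
    (is "avg (j + (1 + (?g + (?W + X)))) ?L = avg j (\<lambda>u. avg ?W (\<lambda>\<omega>. avg 1 (\<lambda>c. avg ?g (?R u \<omega> c))))")
proof -
  let ?l = "l - Suc j"
  have acc: "accepts D n y (\<rho> @ z) = accepts D n y \<rho>" if "length \<rho> = q" for y \<rho> z
  proof -
    have "halted (run D \<rho> (with_unary n y))" using D that by (simp add: halts_within_def)
    then show ?thesis by (simp add: accepts_def run_halted)
  qed
  have eq: "?L (u @ c @ g @ \<omega> @ z) = ?R u \<omega> c g" if "length u = j" "length c = 1" "length g = ?g" "length \<omega> = ?W"
    for u c g \<omega> z
  proof -
    have "query N n1 k j ?l (f a) u (\<omega> @ z) r (hd c) = query N n1 k j ?l (f a) u \<omega> r (hd c)" for r
      using that(4) by (simp add: query_def)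
    moreover have "query_coins N n1 k j ?l (\<omega> @ z) = query_coins N n1 k j ?l \<omega> @ z"
      using that(4) by (simp add: query_coins_def)
    moreover have "length (query_coins N n1 k j ?l \<omega>) = q"
      using that(4) by (simp add: query_coins_def)
    ultimately show ?thesis
      unfolding guess_eq_decode[OF that(1-3) b] by (simp add: acc)
  qed
  have "avg (j + (1 + (?g + (?W + X)))) ?L = avg j (\<lambda>u. avg 1 (\<lambda>c. avg ?g (\<lambda>g. avg ?W (\<lambda>\<omega>. avg X (\<lambda>z. ?L (u @ c @ g @ \<omega> @ z))))))"
    unfolding avg_add ..
  also have "\<dots> = avg j (\<lambda>u. avg 1 (\<lambda>c. avg ?g (\<lambda>g. avg ?W (\<lambda>\<omega>. avg X (\<lambda>z. ?R u \<omega> c g)))))"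
    by (intro avg_cong eq)
  also have "\<dots> = avg j (\<lambda>u. avg 1 (\<lambda>c. avg ?g (\<lambda>g. avg ?W (\<lambda>\<omega>. ?R u \<omega> c g))))"
    by (simp only: avg_const)
  also have "\<dots> = avg j (\<lambda>u. avg 1 (\<lambda>c. avg ?W (\<lambda>\<omega>. avg ?g (\<lambda>g. ?R u \<omega> c g))))"
    by (intro avg_cong avg_swap)
  also have "\<dots> = avg j (\<lambda>u. avg ?W (\<lambda>\<omega>. avg 1 (\<lambda>c. avg ?g (\<lambda>g. ?R u \<omega> c g))))"
    by (intro avg_cong avg_swap)
  finally show ?thesis .
qed

end

context event
begin

lemma sizes:
  "m \<le> 2 ^ s" "s div K + 1 \<le> m" "l \<le> 3 * 2 ^ s" "(2::real) ^ (s div K + 1) \<le> 2 * 2 ^ s"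
proof -
  have "s div K \<le> s" by simp
  then show m': "m \<le> 2 ^ s" unfolding m by (intro power_increasing) auto
  show e': "s div K + 1 \<le> m" unfolding m Suc_eq_plus1[symmetric] by (rule Suc_leI[OF less_exp])
  have "s < 2 ^ s" by (rule less_exp)
  moreover have "l \<le> m + s div K + 1 + s" using event_bounds(1) by (simp add: width_def)
  ultimately show "l \<le> 3 * 2 ^ s" using m' e' by linarith
  have "(2::real) ^ (s div K) \<le> 2 ^ s" by (intro power_increasing) auto
  then show "(2::real) ^ (s div K + 1) \<le> 2 * 2 ^ s" by simp
qed

text \<open>With t = 2^s, the bounds n \<le> 2 t and l \<le> 3 t give \<epsilon> \<ge> 1 / (4 t^2)
  and \<delta> \<ge> 1 / (48 t^3). Then \<kappa> = 7 s + 11 is large enough, as 2^12 t^7 / (48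
  t^3)^2 \<ge> t \<ge> m. The success probability is at least 1 / (1024 t^8) * 1 / (48 t^3) / (2^13
  t^7); rounding 48 up to 64 gives 2^29 t^18 in the denominator.\<close>

lemma event_invert:
  assumes D: "\<And>y. halts_within D q (with_unary n y)" and n2: "n \<le> 2 * 2 ^ s" "n > 0"
    and gap: "1 / (real n)\<^sup>2 \<le> \<bar>accept_prob D n (map_pmf (generator f P K s) (pmf_of_set event_set)) -
      accept_prob D n (uniform_bits (n + s))\<bar>"
  shows "\<exists>j<l. \<exists>\<sigma>. 1 / 2 ^ (18 * s + 29) \<le>
    avg m (\<lambda>a. avg j (\<lambda>u. avg (n1 + (k * N + (j * N + ((l - Suc j) * N + ((l - Suc j) + q))))) (\<lambda>\<omega>.
      avg 1 (\<lambda>c. avg (Suc (7 * s + 11) * Suc N) (\<lambda>g.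
      of_bool (f (decode (\<lambda>r. accepts D n (query N n1 k j (l - Suc j) (f a) u \<omega> r (hd c))
          (query_coins N n1 k j (l - Suc j) \<omega>) = (hd c = \<sigma>)) N m (span_list (Suc N) (7 * s + 11) g)) = f a))))))"
proof -
  interpret distinguisher f "accepts D n" q N n1 k l m i S by (rule distinguisher)
  define t where "t = (2::real) ^ s"
  define \<epsilon> where "\<epsilon> = 1 / (real n)\<^sup>2"
  have t: "1 \<le> t" by (simp add: t_def)
  have nt: "real n \<le> 2 * t"
    using n2(1) unfolding t_def by (metis of_nat_le_iff of_nat_mult of_nat_numeral of_nat_power)
  have mt: "real m \<le> t"
    using sizes(1) unfolding t_def by (metis of_nat_le_iff of_nat_numeral of_nat_power)
  have lt: "real l \<le> 3 * t"
    using sizes(3) unfolding t_def by (metis of_nat_le_iff of_nat_mult of_nat_numeral of_nat_power)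
  have pw: "(2::real) ^ (a * s + c) = 2 ^ c * t ^ a" for a c
    by (simp add: t_def power_add power_mult[symmetric] mult.commute)
  have n0: "0 < real n" and l0: "0 < real l" using n2(2) event_bounds(9) by auto
  have \<epsilon>: "0 < \<epsilon>" "1 / (4 * t\<^sup>2) \<le> \<epsilon>"
  proof -
    show "0 < \<epsilon>" using n0 by (simp add: \<epsilon>_def)
    have "(real n)\<^sup>2 \<le> (2 * t)\<^sup>2" using nt by (intro power_mono) auto
    then show "1 / (4 * t\<^sup>2) \<le> \<epsilon>" unfolding \<epsilon>_def using n0 t by (intro divide_left_mono) (auto simp: power_mult_distrib)
  qed
  have S1: "2 ^ m / (2 * t) \<le> real (card S)"
  proof -
    have "2 ^ m / (2 * t) \<le> 2 ^ m / (real m + 1)" using mt t by (intro divide_left_mono) auto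
    also note card_S_ge
    finally show ?thesis .
  qed
  have S0: "0 < real (card S)" using S_nonempty finite_S by (simp add: card_gt_0_iff)
  have k: "k = 0 \<or> 2 ^ k * (2 ^ Suc i / card S) \<le> (\<epsilon> / 2)\<^sup>2"
  proof (cases "k = 0")
    case False
    then have "m = k + i + (5 * s + 8)" using event_bounds(4) by simp
    then have pm: "(2::real) ^ m = 2 ^ k * 2 ^ i * (256 * t ^ 5)"
      using pw[of 5 8] by (simp add: power_add)
    have "2 ^ k * (2 ^ Suc i / card S) \<le> 2 ^ k * (2 ^ Suc i / (2 ^ m / (2 * t)))"
      using S1 S0 t by (intro mult_left_mono divide_left_mono mult_pos_pos divide_pos_pos) auto
    also have "\<dots> = (4 * t) / (256 * t ^ 5)"
      unfolding pm using t by (simp add: field_simps)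
    also have "\<dots> = (1 / (4 * t\<^sup>2) / 2)\<^sup>2"
      using t by (simp add: field_simps power2_eq_square eval_nat_numeral)
    also have "\<dots> \<le> (\<epsilon> / 2)\<^sup>2"
      using \<epsilon> by (intro power_mono divide_right_mono) auto
    finally show ?thesis by simp
  qed simp
  define \<delta> where "\<delta> = \<epsilon> / (2 * real l) / 2"
  have \<delta>: "1 / (48 * t ^ 3) \<le> \<delta>" "0 < \<delta>"
  proof -
    show "0 < \<delta>" using \<epsilon>(1) l0 by (simp add: \<delta>_def)
    have "1 / (48 * t ^ 3) = 1 / (4 * t\<^sup>2) / (4 * (3 * t))"
      by (simp add: power2_eq_square eval_nat_numeral)
    also have "\<dots> \<le> \<epsilon> / (4 * real l)"
      using \<epsilon> lt l0 t by (intro frac_le) auto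
    finally show "1 / (48 * t ^ 3) \<le> \<delta>" by (simp add: \<delta>_def)
  qed
  have \<kappa>: "real m \<le> 2 * 2 ^ (7 * s + 11) * \<delta>\<^sup>2"
  proof -
    have "real m \<le> 4096 * t ^ 7 * (1 / (48 * t ^ 3))\<^sup>2"
      using mt t by (simp add: field_simps power2_eq_square eval_nat_numeral)
    also have "\<dots> \<le> 4096 * t ^ 7 * \<delta>\<^sup>2"
      using \<delta> t by (intro mult_left_mono power_mono) auto
    finally show ?thesis using pw[of 7 11] by simp
  qed
  have gap': "\<epsilon> \<le> \<bar>real_prob - ideal_prob\<bar>"
    using gap unfolding accept_prob_real[OF D] accept_prob_ideal[OF D] \<epsilon>_def .
  obtain j \<sigma> where j: "j < l" and lb: "2 ^ i / 2 ^ m * (card S / 2 ^ j) * \<delta> / 2 ^ (7 * s + 11 + 2) \<le>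
    avg m (\<lambda>a. avg j (\<lambda>u. avg (n1 + (k * N + (j * N + ((l - Suc j) * N + ((l - Suc j) + q))))) (\<lambda>\<omega>.
      avg 1 (\<lambda>c. avg (Suc (7 * s + 11) * Suc N) (\<lambda>g.
      of_bool (f (decode (\<lambda>r. accepts D n (query N n1 k j (l - Suc j) (f a) u \<omega> r (hd c))
          (query_coins N n1 k j (l - Suc j) \<omega>) = (hd c = \<sigma>)) N m (span_list (Suc N) (7 * s + 11) g)) = f a))))))"
    using distinguish_invert[OF \<epsilon>(1) gap' k \<kappa>[unfolded \<delta>_def]] unfolding \<delta>_def by blast
  have "1 / 2 ^ (18 * s + 29) \<le> 2 ^ i / 2 ^ m * (card S / 2 ^ j) * \<delta> / 2 ^ (7 * s + 11 + 2)"
  proof -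
    \<comment> \<open>The balance of the reduction: guessing costs \<open>2 ^ j\<close>, but
      \<open>l\<close> exceeds \<open>i\<close> by \<open>O(s)\<close> only, so the
      \<open>2 ^ i\<close> preimages make up for it up to a polynomial factor.\<close>
    have "(2::real) ^ j \<le> 2 ^ (i + (6 * s + 8) + (s div K + 1))"
      using j event_bounds(6) by (intro power_increasing) auto
    also have "\<dots> = 2 ^ i * (256 * t ^ 6) * 2 ^ (s div K + 1)"
      using pw[of 6 8] by (simp add: power_add)
    also have "\<dots> \<le> 2 ^ i * (256 * t ^ 6) * (2 * t)"
      using sizes(4) t unfolding t_def[symmetric] by (intro mult_left_mono) auto
    finally have j2: "(2::real) ^ j \<le> 2 ^ i * (512 * t ^ 7)" by (simp add: eval_nat_numeral mult_ac)
    have "1 / (1024 * t ^ 8) = 2 ^ i / 2 ^ m * ((2 ^ m / (2 * t)) / (2 ^ i * (512 * t ^ 7)))"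
      using t by (simp add: field_simps eval_nat_numeral)
    also have "\<dots> \<le> 2 ^ i / 2 ^ m * (card S / 2 ^ j)"
      using S1 j2 t by (intro mult_left_mono frac_le) auto
    finally have 1: "1 / (1024 * t ^ 8) \<le> 2 ^ i / 2 ^ m * (card S / 2 ^ j)" .
    have "1 / 2 ^ (18 * s + 29) = 1 / (1024 * t ^ 8) * (1 / (64 * t ^ 3)) / (8192 * t ^ 7)"
      unfolding pw by (simp add: power_add[symmetric] mult_ac)
    also have "\<dots> \<le> 1 / (1024 * t ^ 8) * (1 / (48 * t ^ 3)) / (8192 * t ^ 7)"
      using t by (intro divide_right_mono mult_left_mono divide_left_mono) auto
    also have "\<dots> \<le> 2 ^ i / 2 ^ m * (card S / 2 ^ j) * \<delta> / (8192 * t ^ 7)"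
      using 1 \<delta> t by (intro divide_right_mono mult_mono) auto
    finally have lb': "1 / 2 ^ (18 * s + 29) \<le> 2 ^ i / 2 ^ m * (card S / 2 ^ j) * \<delta> / (8192 * t ^ 7)" .
    have "7 * s + 11 + 2 = 7 * s + 13" by simp
    then have "(2::real) ^ (7 * s + 11 + 2) = 8192 * t ^ 7" using pw[of 7 13] by (simp only:) simp
    with lb' show ?thesis by (simp only:)
  qed
  with lb show ?thesis using j by (intro exI[of _ j] conjI exI[of _ \<sigma>]) linarith+
qed

end

text \<open>Here \<open>\<gamma> > 1\<close> enters: \<open>n\<close> is bounded by a multiple of
  \<open>2 ^ s\<close>, so that all losses can be measured in powers of \<open>2 ^ s\<close> and
  thereby of \<open>m\<close>.\<close>

lemma less_two_pow_stretch:
  assumes "\<gamma> > 1" "n \<ge> 1"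
  shows "n < 2 * 2 ^ stretch \<gamma> n"
proof -
  have l0: "0 \<le> log 2 (real n)" using assms(2) by simp
  have "1 * log 2 (real n) \<le> \<gamma> * log 2 (real n)" using assms(1) l0 by (intro mult_right_mono) auto
  also have "\<dots> < real (stretch \<gamma> n) + 1"
    unfolding stretch_def using assms(1) l0 by (simp add: of_nat_nat)
  finally have "log 2 (real n) < real (stretch \<gamma> n + 1)" by simp
  then have "real n < 2 powr real (stretch \<gamma> n + 1)" using assms(2) by (simp add: log_less_iff)
  then have "real n < real (2 * 2 ^ stretch \<gamma> n)" by (simp add: powr_realpow powr_add)
  then show ?thesis by (simp only: of_nat_less_iff)
qed

lemma pow_stretch_div_unbounded:
  fixes B :: nat
  assumes "\<gamma> > 1" "K > 0"
  shows "\<exists>n0. \<forall>n\<ge>n0. B \<le> 2 ^ (stretch \<gamma> n div K)"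
proof (intro exI[of _ "2 * 2 ^ (K * B)"] allI impI)
  fix n :: nat assume n: "2 * 2 ^ (K * B) \<le> n"
  have "1 \<le> n" using n one_le_power[of "2::nat" "K * B"] by linarith
  from less_two_pow_stretch[OF assms(1) this] n have "(2::nat) ^ (K * B) < 2 ^ stretch \<gamma> n" by linarith
  then have "K * B \<le> stretch \<gamma> n" by simp
  then have "B \<le> stretch \<gamma> n div K" using assms(2) by (simp add: less_eq_div_iff_mult_less_eq mult.commute)
  also have "\<dots> \<le> 2 ^ (stretch \<gamma> n div K)" by (rule less_imp_le, rule less_exp)
  finally show "B \<le> 2 ^ (stretch \<gamma> n div K)" .
qed

lemma two_pow_le:
  assumes "K > 0"
  shows "2 ^ s \<le> (2 * 2 ^ (s div K) :: nat) ^ K"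
proof -
  have "s \<le> (s div K + 1) * K"
    using dividend_less_times_div[OF assms, of s] by (simp add: mult.commute)
  then have "(2::nat) ^ s \<le> 2 ^ ((s div K + 1) * K)" by (intro power_increasing) auto
  also have "\<dots> = (2 * 2 ^ (s div K)) ^ K" by (subst power_mult) simp
  finally show ?thesis .
qed

text \<open>As for the running time: the block length is bounded by a polynomial in
  \<open>m + K\<close>, hence by a multiple of the square root of \<open>n\<close> for large
  \<open>K\<close>.\<close>

lemma block_size_bound:
  assumes "\<gamma> > 0"
  obtains K0 :: nat where "K0 > 0" "\<And>K. K \<ge> K0 \<Longrightarrow> \<forall>\<^sub>F n in sequentially.
    hash_len P K (stretch \<gamma> n) (2 ^ (stretch \<gamma> n div K)) + width K (stretch \<gamma> n) (2 ^ (stretch \<gamma> n div K)) \<le> n"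
proof -
  define p where "p = P * ([:0, 2:] + [:0, 1, 1:]) + [:0, 2:]"
  obtain K0 where K0: "K0 > 0"
    "\<And>K. K \<ge> K0 \<Longrightarrow> (\<lambda>n. real (poly p (2 ^ (stretch \<gamma> n div K) + K))) \<in> O(\<lambda>n. real n powr (1 / 2))"
    using poly_stretch_bigo[OF assms, of p] by blast
  show thesis
  proof (rule that[OF K0(1)])
    fix K assume K: "K \<ge> K0"
    then have Kp: "K > 0" using K0(1) by simp
    from K0(2)[OF K] obtain c where c: "c > 0" "\<forall>\<^sub>F n in sequentially.
        norm (real (poly p (2 ^ (stretch \<gamma> n div K) + K))) \<le> c * norm (real n powr (1 / 2))"
      by (elim landau_o.bigE)
    show "\<forall>\<^sub>F n in sequentially.
      hash_len P K (stretch \<gamma> n) (2 ^ (stretch \<gamma> n div K)) + width K (stretch \<gamma> n) (2 ^ (stretch \<gamma> n div K)) \<le> n"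
      using c(2) eventually_ge_at_top[of "nat \<lceil>c\<^sup>2\<rceil>"]
    proof eventually_elim
      case (elim n)
      let ?s = "stretch \<gamma> n"
      define m where "m = (2::nat) ^ (?s div K)"
      let ?m = m
      let ?u = "?m + K"
      have e: "Suc (?s div K) \<le> ?m" unfolding m_def by (rule Suc_leI[OF less_exp])
      have w: "width K ?s ?m \<le> 2 * ?u" using e unfolding width_def by simp
      have "?s < K * Suc (?s div K)" using Kp by (simp add: dividend_less_times_div)
      also have "\<dots> \<le> ?u * Suc ?u" using e by (intro mult_mono) simp_all
      finally have s: "?s \<le> ?u + ?u * ?u" by simp
      have "hash_len P K ?s ?m + width K ?s ?m \<le> poly P ?u * (2 * ?u + (?u + ?u * ?u)) + 2 * ?u"
        unfolding hash_len_def by (intro add_mono mult_mono poly_nat_mono w s) auto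
      also have "\<dots> = poly p ?u" by (simp add: p_def algebra_simps)
      finally have "real (hash_len P K ?s ?m + width K ?s ?m) \<le> real (poly p ?u)" by (rule of_nat_mono)
      also have "\<dots> \<le> c * sqrt (real n)" using elim(1) by (simp add: powr_half_sqrt m_def)
      also have "\<dots> \<le> sqrt (real n) * sqrt (real n)"
      proof (rule mult_right_mono)
        have "c\<^sup>2 \<le> real n" using elim(2) by linarith
        then show "c \<le> sqrt (real n)" using c(1) by (simp add: real_le_rsqrt)
      qed simp
      also have "\<dots> = real n" by simp
      finally show ?case by (simp only: of_nat_le_iff m_def)
    qed
  qed
qed

text \<open>All parameters of the inverter are polynomial in \<open>m = 2\<^sup>s\<^sup>/\<^sup>K\<close>, because \<open>2\<^sup>s \<le> (2 m)\<^sup>K\<close>.\<close>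

lemma inversion_bound:
  assumes f: "poly_time_computable f" and D: "turing_machine D" and \<gamma>: "\<gamma> > 1" and K: "K > 0"
    and pD: "\<And>n y. halts_within D (poly pD n) (with_unary n y)"
  obtains A where "ppt A"
    "\<And>n i k l n1 w S. event f P K (stretch \<gamma> n) n (2 ^ (stretch \<gamma> n div K)) i k l n1 w S \<Longrightarrow>
      1 / (real n)\<^sup>2 \<le> \<bar>accept_prob D n (map_pmf (generator f P K (stretch \<gamma> n))
          (pmf_of_set (event.event_set P (2 ^ (stretch \<gamma> n div K)) k l n1 w S))) -
        accept_prob D n (uniform_bits (n + stretch \<gamma> n))\<bar> \<Longrightarrow> n > 0 \<Longrightarrow>
      1 / 2 ^ (18 * stretch \<gamma> n + 29) \<le> inversion_prob f A (2 ^ (stretch \<gamma> n div K))"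
proof -
  \<comment> \<open>Since \<open>2 ^ s\<close> is at most \<open>(2 * m) ^ K\<close>, this exceeds
    \<open>2 ^ (7 * s + 11)\<close>, the size of the span, and with it every parameter that has to
    be found by search.\<close>
  define b :: "nat poly" where "b = [:2 ^ 12:] * ([:0, 2:] ^ K) ^ 7"
  define Q where "Q = b + (1 + ((b + 1) * (P + 1) + ((b + (b * P + (b * P + (b * P + (b + pcompose pD b))))))))"
  obtain A where A: "ppt A"
    "\<And>m n n1 k j l \<kappa> \<sigma>. m > 0 \<Longrightarrow> n < poly b m \<Longrightarrow> n1 < poly b m \<Longrightarrow> k < poly b m \<Longrightarrow> j < poly b m \<Longrightarrow>
       l < poly b m \<Longrightarrow> \<kappa> < poly b m \<Longrightarrow> 1 < poly b m \<Longrightarrow>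
       avg m (\<lambda>a. avg (poly Q m) (\<lambda>\<rho>. of_bool (f (guess D m n (poly P m) n1 k j l \<kappa> (poly b m) \<sigma> (f a) \<rho>) = f a)))
         \<le> inversion_prob f A m"
    using inverter[OF f D, of b Q P] by blast
  show thesis
  proof (rule that[OF A(1)])
    fix n i k l n1 w S
    let ?s = "stretch \<gamma> n"
    define m where "m = (2::nat) ^ (?s div K)"
    let ?N = "poly P m"
    let ?b = "poly b m"
    assume "event f P K ?s n (2 ^ (?s div K)) i k l n1 w S"
      and gap: "1 / (real n)\<^sup>2 \<le> \<bar>accept_prob D n (map_pmf (generator f P K ?s)
          (pmf_of_set (event.event_set P (2 ^ (?s div K)) k l n1 w S))) - accept_prob D n (uniform_bits (n + ?s))\<bar>"
      and n0: "n > 0"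
    then interpret event f P K ?s n m i k l n1 w S by (simp add: m_def)
    have n2: "n \<le> 2 * 2 ^ ?s" using less_two_pow_stretch[OF \<gamma>, of n] n0 by simp
    obtain j \<sigma> where j: "j < l" and lb: "1 / 2 ^ (18 * ?s + 29) \<le>
      avg m (\<lambda>a. avg j (\<lambda>u. avg (n1 + (k * ?N + (j * ?N + ((l - Suc j) * ?N + ((l - Suc j) + poly pD n))))) (\<lambda>\<omega>.
        avg 1 (\<lambda>c. avg (Suc (7 * ?s + 11) * Suc ?N) (\<lambda>g.
        of_bool (f (decode (\<lambda>r. accepts D n (query ?N n1 k j (l - Suc j) (f a) u \<omega> r (hd c))
            (query_coins ?N n1 k j (l - Suc j) \<omega>) = (hd c = \<sigma>)) ?N m (span_list (Suc ?N) (7 * ?s + 11) g)) = f a))))))"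
      using event_invert[OF pD n2 n0 gap[folded m_def]] by blast
    have "(2::nat) ^ (7 * ?s + 11) < 2 ^ 12 * (2 ^ ?s) ^ 7"
      by (simp add: power_add power_mult[symmetric] mult.commute)
    also have "\<dots> \<le> 2 ^ 12 * ((2 * m) ^ K) ^ 7"
      unfolding m_def by (intro mult_left_mono power_mono two_pow_le K) auto
    also have "\<dots> = ?b" by (simp add: b_def poly_power mult.commute)
    finally have \<kappa>: "2 ^ (7 * ?s + 11) < ?b" .
    have s2: "(2::nat) ^ (?s + 11) \<le> 2 ^ (7 * ?s + 11)" by (intro power_increasing) auto
    from order.strict_trans1[OF s2 \<kappa>] have s1: "2048 * 2 ^ ?s < ?b" by (simp add: power_add mult.commute)
    have one: "(1::nat) \<le> 2 ^ ?s" by simp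
    have small: "n < ?b" "n1 < ?b" "k < ?b" "l < ?b" "1 < ?b"
      using s1 one n2 n sizes(1,3) event_bounds(4) by linarith+
    then have small': "j < ?b" "l - Suc j < ?b" using j by linarith+
    have \<kappa>': "7 * ?s + 11 < ?b" using \<kappa> less_exp[of "7 * ?s + 11"] by (rule order.strict_trans[rotated])
    have m0: "m > 0" using event_bounds(5) by simp
    let ?W = "n1 + (k * ?N + (j * ?N + ((l - Suc j) * ?N + ((l - Suc j) + poly pD n))))"
    have "?W \<le> ?b + (?b * ?N + (?b * ?N + (?b * ?N + (?b + poly pD ?b))))"
      using small small' by (intro add_mono mult_right_mono poly_nat_mono) auto
    moreover have "Suc (7 * ?s + 11) * Suc ?N \<le> (?b + 1) * (?N + 1)" using \<kappa>' by (intro mult_mono) auto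
    ultimately have "j + (1 + (Suc (7 * ?s + 11) * Suc ?N + ?W)) \<le> poly Q m"
      using small'(1) by (simp only: Q_def poly_add poly_mult poly_1 poly_pcompose)
    then obtain X where "poly Q m = j + (1 + (Suc (7 * ?s + 11) * Suc ?N + ?W)) + X" using le_Suc_ex by blast
    then have X: "poly Q m = j + (1 + (Suc (7 * ?s + 11) * Suc ?N + (?W + X)))" by simp
    have "1 / 2 ^ (18 * ?s + 29) \<le> avg m (\<lambda>a. avg (poly Q m) (\<lambda>\<rho>.
        of_bool (f (guess D m n ?N n1 k j (l - Suc j) (7 * ?s + 11) ?b \<sigma> (f a) \<rho>) = f a)))"
      using lb unfolding X avg_guess[OF pD \<kappa> j] .
    also have "\<dots> \<le> inversion_prob f A m"
      by (rule A(2)) (use small small' \<kappa>' m0 in auto)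
    finally show "1 / 2 ^ (18 * ?s + 29) \<le> inversion_prob f A (2 ^ (?s div K))" by (simp add: m_def)
  qed
qed

theorem theorem5p8:
  assumes "\<exists>f. one_way_function f"
  shows "\<forall>\<gamma>::real. \<gamma> > 1 \<longrightarrow> admissible_stretch \<gamma> \<longrightarrow>
           (\<exists>G. rate1_efficient G \<and> cond_secure_ep_prg (\<lambda>n. 1 / (real n)\<^sup>2) \<gamma> G)"
proof (intro allI impI)
  fix \<gamma> :: real assume \<gamma>: "\<gamma> > 1" and adm: "admissible_stretch \<gamma>"
  then have \<gamma>0: "\<gamma> > 0" by simp
  obtain f where f: "poly_time_computable f" and ow: "\<And>A. ppt A \<Longrightarrow> negligible (inversion_prob f A)"
    using assms by (auto simp: one_way_function_def)
  have FPf: "FP f" using f by (rule FP_poly_time_computable)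
  obtain pf :: "nat poly" where pf: "\<And>a. length (f a) \<le> poly pf (length a)"
    using FP_blen[OF FPf] by auto
  define P where "P = pf + [:1, 1:]"
  have P: "m \<le> poly P m" "length (f a) < poly P (length a)" for m a
    using pf[of a] by (simp_all add: P_def)
  obtain K0 where K0: "K0 > 0"
    "\<And>K. K \<ge> K0 \<Longrightarrow> rate1_efficient (\<lambda>x. generator f P K (stretch \<gamma> (length x)) x)"
    using rate1_generator[OF FPf \<gamma>0 adm, of P] by blast
  obtain K1 where K1: "\<And>K. K \<ge> K1 \<Longrightarrow> \<forall>\<^sub>F n in sequentially.
    hash_len P K (stretch \<gamma> n) (2 ^ (stretch \<gamma> n div K)) + width K (stretch \<gamma> n) (2 ^ (stretch \<gamma> n div K)) \<le> n"
    using block_size_bound[OF \<gamma>0, of P] by blast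
  define K where "K = max K0 K1"
  have K: "K > 0" using K0(1) by (simp add: K_def)
  define s where "s = stretch \<gamma>"
  define m where "m n = (2::nat) ^ (s n div K)" for n
  define G where "G = (\<lambda>x. generator f P K (s (length x)) x)"
  have rate: "rate1_efficient G" using K0(2)[of K] by (simp add: K_def G_def s_def)
  define fits where "fits n \<longleftrightarrow> hash_len P K (s n) (m n) + width K (s n) (m n) \<le> n" for n
  have fits: "\<forall>\<^sub>F n in sequentially. fits n" using K1[of K] by (simp add: K_def fits_def s_def m_def)
  \<comment> \<open>Events have to be nonempty for every \<open>n\<close>; where no block fits into
    the seed, the whole space is taken.\<close>
  have "\<exists>E. if fits n then \<exists>i k l n1 w S. event f P K (s n) n (m n) i k l n1 w S \<and>
      E = event.event_set P (m n) k l n1 w S else E = {x. length x = n}" for n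
  proof (cases "fits n")
    case True
    with ex_event[OF m_def K P, of n n] show ?thesis by (auto simp: fits_def)
  qed simp
  then obtain E where E: "\<And>n. if fits n then \<exists>i k l n1 w S. event f P K (s n) n (m n) i k l n1 w S \<and>
      E n = event.event_set P (m n) k l n1 w S else E n = {x. length x = n}" by metis
  have En: "E n \<subseteq> {x. length x = n} \<and> E n \<noteq> {}" for n
  proof (cases "fits n")
    case True
    with E[of n] obtain i k l n1 w S where "event f P K (s n) n (m n) i k l n1 w S"
      "E n = event.event_set P (m n) k l n1 w S" by auto
    then show ?thesis using event.event_set(1,2) by metis
  next
    case False
    with E[of n] show ?thesis by (auto simp: ex_bits)
  qed
  have out: "cond_output G E n = map_pmf (generator f P K (s n)) (pmf_of_set (E n))" for n
  proof -
    have "finite (E n)" using En[of n] finite_bits finite_subset by blast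
    then have "set_pmf (pmf_of_set (E n)) = E n" using En by simp
    then have "map_pmf G (pmf_of_set (E n)) = map_pmf (generator f P K (s n)) (pmf_of_set (E n))"
      using En[of n] by (intro map_pmf_cong) (auto simp: G_def)
    then show ?thesis using cond_uniform_bits[of "E n" n] En by (simp add: cond_output_def)
  qed
  have ind: "indistinguishable (\<lambda>n. 1 / (real n)\<^sup>2) (cond_output G E) (\<lambda>n. uniform_bits (stretched_length \<gamma> n))"
    unfolding indistinguishable_def
  proof (intro allI impI)
    fix D assume "ppt_in_first_input D"
    then obtain pD :: "nat poly" where D: "turing_machine D" "\<And>n y. halts_within D (poly pD n) (with_unary n y)"
      by (auto simp: ppt_in_first_input_def)
    obtain A where A: "ppt A"
      "\<And>n i k l n1 w S. event f P K (s n) n (m n) i k l n1 w S \<Longrightarrow>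
        1 / (real n)\<^sup>2 \<le> \<bar>accept_prob D n (map_pmf (generator f P K (s n))
            (pmf_of_set (event.event_set P (m n) k l n1 w S))) - accept_prob D n (uniform_bits (n + s n))\<bar> \<Longrightarrow>
        n > 0 \<Longrightarrow> 1 / 2 ^ (18 * s n + 29) \<le> inversion_prob f A (m n)"
      using inversion_bound[OF f D(1) \<gamma> K D(2), of P] unfolding s_def[symmetric] m_def by blast
    \<comment> \<open>For \<open>m \<ge> 2\<close>,
      \<open>2 ^ s \<le> (2 * m) ^ K \<le> (m * m) ^ K\<close>, so \<open>2 ^ (18 * s + 29)\<close>
      is at most \<open>m\<close> to the power \<open>36 * K + 29\<close>.\<close>
    define c where "c = 36 * K + 29"
    have "\<forall>\<^sub>F m in sequentially. \<bar>inversion_prob f A m\<bar> < 1 / real m ^ c"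
      using ow[OF A(1)] by (simp add: negligible_def)
    then obtain M where M: "\<And>m. m \<ge> M \<Longrightarrow> \<bar>inversion_prob f A m\<bar> < 1 / real m ^ c"
      by (auto simp: eventually_sequentially)
    \<comment> \<open>Negligibility is a statement about large \<open>m\<close>; it applies for all
      large \<open>n\<close> because \<open>m n\<close> tends to infinity.\<close>
    obtain n0 where n0: "\<And>n. n \<ge> n0 \<Longrightarrow> max M 2 \<le> m n"
      using pow_stretch_div_unbounded[OF \<gamma> K, of "max M 2"] by (auto simp: m_def s_def)
    obtain n1 where n1: "\<And>n. n \<ge> n1 \<Longrightarrow> fits n" using fits by (auto simp: eventually_sequentially)
    show "\<exists>n0. \<forall>n\<ge>n0. \<bar>accept_prob D n (cond_output G E n) -
        accept_prob D n (uniform_bits (stretched_length \<gamma> n))\<bar> < 1 / (real n)\<^sup>2"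
    proof (intro exI allI impI)
      fix n assume n: "max (max n0 n1) 1 \<le> n"
      show "\<bar>accept_prob D n (cond_output G E n) -
        accept_prob D n (uniform_bits (stretched_length \<gamma> n))\<bar> < 1 / (real n)\<^sup>2"
      proof (rule ccontr)
        assume "\<not> ?thesis"
        then have gap: "1 / (real n)\<^sup>2 \<le> \<bar>accept_prob D n (map_pmf (generator f P K (s n)) (pmf_of_set (E n))) -
            accept_prob D n (uniform_bits (n + s n))\<bar>"
          by (simp add: out stretched_length s_def)
        obtain i k l n1 w S where ev: "event f P K (s n) n (m n) i k l n1 w S"
          "E n = event.event_set P (m n) k l n1 w S"
          using E[of n] n1[of n] n by auto
        have lb: "1 / 2 ^ (18 * s n + 29) \<le> inversion_prob f A (m n)"
          by (rule A(2)[OF ev(1) gap[unfolded ev(2)]]) (use n in simp)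
        have mn: "M \<le> m n" "2 \<le> m n" using n0[of n] n by auto
        have "(2::nat) ^ s n \<le> (2 * m n) ^ K" unfolding m_def by (rule two_pow_le[OF K])
        also have "\<dots> \<le> (m n * m n) ^ K" using mn(2) by (intro power_mono mult_right_mono) auto
        finally have "(2 ^ s n) ^ 18 * 2 ^ 29 \<le> ((m n * m n) ^ K) ^ 18 * m n ^ 29"
          using mn(2) by (intro mult_mono power_mono) auto
        also have "\<dots> = m n ^ c"
          by (simp add: c_def power_add power_mult[symmetric] power2_eq_square[symmetric] mult.commute)
        finally have "(2::nat) ^ (18 * s n + 29) \<le> m n ^ c"
          by (simp add: power_add power_mult[symmetric] mult.commute)
        then have "real (2 ^ (18 * s n + 29)) \<le> real (m n ^ c)" by (simp only: of_nat_le_iff)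
        then have "1 / real (m n) ^ c \<le> 1 / 2 ^ (18 * s n + 29)"
          by (intro divide_left_mono) (use mn(2) in auto)
        then show False using lb M[OF mn(1)] by linarith
      qed
    qed
  qed
  \<comment> \<open>The loss \<open>2 * (s div K) + 4\<close> is at most
    \<open>(2 * \<gamma> + 4) * log 2 n\<close>, because the logarithm is at least 1 from
    \<open>n = 2\<close> on.\<close>
  have entropy: "\<forall>\<^sub>F n in sequentially.
      shannon_entropy (cond_output G E n) \<ge> real n - (2 * \<gamma> + 4) * log 2 (real n)"
    using fits eventually_ge_at_top[of 2]
  proof eventually_elim
    case (elim n)
    obtain i k l n1 w S where ev: "event f P K (s n) n (m n) i k l n1 w S"
      "E n = event.event_set P (m n) k l n1 w S"
      using E[of n] elim(1) by auto
    interpret event f P K "s n" n "m n" i k l n1 w S by (rule ev(1))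
    have "real (s n div K) \<le> real (s n)" by simp
    also have "\<dots> \<le> \<gamma> * log 2 (real n)" unfolding s_def using stretch_le[OF \<gamma>0] elim(2) by simp
    finally have e: "real (s n div K) \<le> \<gamma> * log 2 (real n)" .
    have "1 \<le> log 2 (real n)" using elim(2) by (simp add: le_log_iff)
    then have "real n - (2 * \<gamma> + 4) * log 2 (real n) \<le> real n - 2 * real (s n div K) - 4"
      using e by (simp add: algebra_simps)
    also have "\<dots> \<le> shannon_entropy (cond_output G E n)"
      unfolding out ev(2) by (rule entropy_event)
    finally show ?case .
  qed
  have "length (G x) = stretched_length \<gamma> (length x)" for x
    by (simp add: G_def length_generator stretched_length s_def)
  then show "\<exists>G. rate1_efficient G \<and> cond_secure_ep_prg (\<lambda>n. 1 / (real n)\<^sup>2) \<gamma> G"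
    unfolding cond_secure_ep_prg_def
    using rate rate1_efficient_poly_time[OF rate] En ind entropy by blast
qed

end
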